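(* For all $k,h,\lambda\in\mathbb C$ with $k\neq-2$ and $\lambda\ne0$, there is an isomorphism of $\widehat{sl(2)}$-modules $$Wh_{\widehat{sl(2)}}(\lambda,0,k,h+k/4)\cong L^{Vir}(d_k,h)\otimes\Pi_\lambda .$$
   Context: For $(\lambda,\mu)\in\mathbb C^2$, $\widetilde{Wh}_{\widehat{sl(2)}}(\lambda,\mu,k)$ is the universal $\widehat{sl(2)}$-module of level $k$ generated by a vector $w_{\lambda,\mu,k}$ (Whittaker vector) with $e(n)w_{\lambda,\mu,k}=\delta_{n,0}\lambda w_{\lambda,\mu,k}$ for $n\ge0$ and $f(m)w_{\lambda,\mu,k}=\delta_{m,1}\mu w_{\lambda,\mu,k}$ for $m\ge1$. For $a\in\mathbb C$, $M_{\widehat{sl(2)}}(\lambda,0,k,a)=\widetilde{Wh}_{\widehat{sl(2)}}(\lambda,0,k)/U(\widehat{sl(2)}).(L_{sug}(0)-a)w_{\lambda,0,k}$, where $L_{sug}(0)$ is the Sugawara operator, and $Wh_{\widehat{sl(2)}}(\lambda,0,k,a)$ is the simple quotient of $M_{\widehat{sl(2)}}(\lambda,0,k,a)$. $d_k=1-6\frac{(k+1)^2}{k+2}$; $L^{Vir}(d_k,h)$ is the irreducible highest weight Virasoro module of central charge $d_k$ and highest weight $h$; $V^{Vir}(d_k,0)$ is the universal Virasoro vertex algebra with conformal vector $\omega$. Let $\langle c,c\rangle=\langle d,d\rangle=0$, $\langle c,d\rangle=2$; $M(1)$ is the Heisenberg vertex algebra generated by $c(z),d(z)$, as a vector space $\mathbb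 C[c(-n),d(-n)\mid n\ge1]$, with $[a(m),b(n)]=m\langle a,b\rangle\delta_{m+n,0}$; $\Pi(0)=M(1)\otimes\mathbb C[\mathbb Zc]$ is the lattice-type vertex algebra. Put $\mu=\frac d2+\frac k4c$, $\nu=\frac d2-\frac k4c$ (as lattice elements). The universal affine vertex algebra $V^k(sl(2))$ (hence $\widehat{sl(2)}$) acts on $V^{Vir}(d_k,0)\otimes\Pi(0)$-modules via the homomorphism $e\mapsto e^c$, $h\mapsto2\mu(-1)\mathbf 1$, $f\mapsto[(k+2)\omega-\nu(-1)^2-(k+1)\nu(-2)]e^{-c}$. For $\lambda\ne0$, $\Pi_\lambda$ is the $\Pi(0)$-module $U_\lambda\otimes M(1)$, where $U_\lambda=\mathbb C[d]v_1$ is the module, free of rank one over $\mathbb C[d]$, for the associative algebra generated by $d$, $e^{nc}$ ($n\in\mathbb Z$) with relations $[d,e^{nc}]=2ne^{nc}$, $e^{nc}e^{mc}=e^{(n+m)c}$, $e^0=1$, determined by $e^{nc}v_1=\lambda^nv_1$. On $\Pi_\lambda$: $c(0)=-\mathrm{Id}$, $d(0)$ acts as $d$ on $U_\lambda$, $c(n),d(n)$ ($n\neq0$) act on $M(1)$ as usual, and $Y(e^{nc},z)=e^{nc}\exp\big(n\sum_{j\ge1}\frac{c(-j)}jz^j\big)\exp\big(-n\sum_{j\ge1}\frac{c(j)}jz^{-j}\big)z^{n c(0)}$. *)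

theory Defs
  imports
    "HOL-Algebra.Module"
    "HOL-Algebra.AbelCoset"
    "HOL-Library.Poly_Mapping"
    "HOL-Computational_Algebra.Polynomial"
    Complex_Main
begin

hide_const (open) Polynomial.smult Poly_Mapping.degree

section \<open>Complex vector spaces, quotients and tensor products\<close>

definition complex_ring :: "complex ring" where
  "complex_ring = \<lparr>carrier = UNIV, monoid.mult = (*), one = 1, zero = 0, add = (+)\<rparr>"

text \<open>The record type of modules extends that of rings; the fields for a product and a unit are
  irrelevant for a module and are left \<open>undefined\<close> below.\<close>

definition free_space :: "'b set \<Rightarrow> (complex, 'b \<Rightarrow>\<^sub>0 complex) module" where
  "free_space B = \<lparr>carrier = {p. Poly_Mapping.keys p \<subseteq> B}, monoid.mult = undefined, one = undefined,
     zero = 0, add = (+), smult = (\<lambda>a. Poly_Mapping.map ((*) a))\<rparr>"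

text \<open>The linear extension of a map between bases.\<close>

definition push :: "('a \<Rightarrow> 'b) \<Rightarrow> ('a \<Rightarrow>\<^sub>0 complex) \<Rightarrow> ('b \<Rightarrow>\<^sub>0 complex)" where
  "push g p = (\<Sum>x\<in>Poly_Mapping.keys p. Poly_Mapping.single (g x) (Poly_Mapping.lookup p x))"

definition lin_span :: "(complex, 'v, 'm) module_scheme \<Rightarrow> 'v set \<Rightarrow> 'v set" where
  "lin_span V S = \<Inter>{N. submodule N complex_ring V \<and> S \<subseteq> N}"

definition quot_space ::
    "(complex, 'v, 'm) module_scheme \<Rightarrow> 'v set \<Rightarrow> (complex, 'v set) module" where
  "quot_space V N = \<lparr>carrier = a_rcosets\<^bsub>V\<^esub> N, monoid.mult = undefined, one = undefined,
     zero = N, add = set_add V, smult = (\<lambda>a X. \<Union>x\<in>X. N +>\<^bsub>V\<^esub> (a \<odot>\<^bsub>V\<^esub> x))\<rparr>"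

text \<open>The tensor product \<open>V \<otimes> W\<close> over the complex numbers is the free vector space on the
  pairs \<open>(v, w)\<close> modulo the relations of bilinearity.\<close>

definition bilinear_relations ::
    "(complex, 'v, 'm) module_scheme \<Rightarrow> (complex, 'w, 'n) module_scheme
      \<Rightarrow> ('v \<times> 'w \<Rightarrow>\<^sub>0 complex) set" where
  "bilinear_relations V W =
     {Poly_Mapping.single (v \<oplus>\<^bsub>V\<^esub> v', w) 1 - Poly_Mapping.single (v, w) 1
        - Poly_Mapping.single (v', w) 1 | v v' w.
          v \<in> carrier V \<and> v' \<in> carrier V \<and> w \<in> carrier W}
     \<union> {Poly_Mapping.single (v, w \<oplus>\<^bsub>W\<^esub> w') 1 - Poly_Mapping.single (v, w) 1
        - Poly_Mapping.single (v, w') 1 | v w w'.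
          v \<in> carrier V \<and> w \<in> carrier W \<and> w' \<in> carrier W}
     \<union> {Poly_Mapping.single (a \<odot>\<^bsub>V\<^esub> v, w) 1 - Poly_Mapping.single (v, w) a | a v w.
          v \<in> carrier V \<and> w \<in> carrier W}
     \<union> {Poly_Mapping.single (v, a \<odot>\<^bsub>W\<^esub> w) 1 - Poly_Mapping.single (v, w) a | a v w.
          v \<in> carrier V \<and> w \<in> carrier W}"

definition tensor_null ::
    "(complex, 'v, 'm) module_scheme \<Rightarrow> (complex, 'w, 'n) module_scheme
      \<Rightarrow> ('v \<times> 'w \<Rightarrow>\<^sub>0 complex) set" where
  "tensor_null V W = lin_span (free_space (carrier V \<times> carrier W)) (bilinear_relations V W)"

definition tensor_space ::
    "(complex, 'v, 'm) module_scheme \<Rightarrow> (complex, 'w, 'n) module_scheme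
      \<Rightarrow> (complex, ('v \<times> 'w \<Rightarrow>\<^sub>0 complex) set) module" where
  "tensor_space V W = quot_space (free_space (carrier V \<times> carrier W)) (tensor_null V W)"

text \<open>The operator \<open>\<phi> \<otimes> \<psi>\<close> on \<open>V \<otimes> W\<close>, for linear operators \<open>\<phi>\<close> and \<open>\<psi>\<close>.\<close>

definition tensor_map ::
    "(complex, 'v, 'm) module_scheme \<Rightarrow> (complex, 'w, 'n) module_scheme
      \<Rightarrow> ('v \<Rightarrow> 'v) \<Rightarrow> ('w \<Rightarrow> 'w)
      \<Rightarrow> ('v \<times> 'w \<Rightarrow>\<^sub>0 complex) set \<Rightarrow> ('v \<times> 'w \<Rightarrow>\<^sub>0 complex) set" where
  "tensor_map V W \<phi> \<psi> X =
     (\<Union>p\<in>X. tensor_null V W +>\<^bsub>free_space (carrier V \<times> carrier W)\<^esub> push (map_prod \<phi> \<psi>) p)"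

section \<open>Modules over a Lie algebra with a given basis\<close>

text \<open>A complex Lie algebra with basis \<open>'g\<close> is given by the brackets of its basis elements. A
  representation is a vector space together with the operators by which basis elements act.\<close>

type_synonym 'g bracket = "'g \<Rightarrow> 'g \<Rightarrow> ('g \<Rightarrow>\<^sub>0 complex)"

record ('g, 'v) rep = "(complex, 'v) module" +
  act :: "'g \<Rightarrow> 'v \<Rightarrow> 'v"

locale lie_module = Module.module complex_ring M
  for br :: "'g bracket" and M :: "('g, 'v) rep" +
  assumes act_closed: "v \<in> carrier M \<Longrightarrow> act M x v \<in> carrier M"
    and act_add: "\<lbrakk>v \<in> carrier M; w \<in> carrier M\<rbrakk>
      \<Longrightarrow> act M x (v \<oplus>\<^bsub>M\<^esub> w) = act M x v \<oplus>\<^bsub>M\<^esub> act M x w"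
    and act_smult: "v \<in> carrier M \<Longrightarrow> act M x (a \<odot>\<^bsub>M\<^esub> v) = a \<odot>\<^bsub>M\<^esub> act M x v"
    and act_bracket: "v \<in> carrier M \<Longrightarrow>
      act M x (act M y v) \<ominus>\<^bsub>M\<^esub> act M y (act M x v)
        = (\<Oplus>\<^bsub>M\<^esub>z\<in>Poly_Mapping.keys (br x y). Poly_Mapping.lookup (br x y) z \<odot>\<^bsub>M\<^esub> act M z v)"

definition lie_isomorphic :: "'g bracket \<Rightarrow> ('g, 'v) rep \<Rightarrow> ('g, 'w) rep \<Rightarrow> bool" where
  "lie_isomorphic br M N \<longleftrightarrow> lie_module br M \<and> lie_module br N \<and>
     (\<exists>\<phi> \<in> iso (add_monoid M) (add_monoid N).
        (\<forall>a. \<forall>v\<in>carrier M. \<phi> (a \<odot>\<^bsub>M\<^esub> v) = a \<odot>\<^bsub>N\<^esub> \<phi> v) \<and>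
        (\<forall>x. \<forall>v\<in>carrier M. \<phi> (act M x v) = act N x (\<phi> v)))"

definition subrep :: "'v set \<Rightarrow> ('g, 'v) rep \<Rightarrow> bool" where
  "subrep N M \<longleftrightarrow> submodule N complex_ring M \<and> (\<forall>x. \<forall>v\<in>N. act M x v \<in> N)"

definition gen_subrep :: "('g, 'v) rep \<Rightarrow> 'v set \<Rightarrow> 'v set" where
  "gen_subrep M S = \<Inter>{N. subrep N M \<and> S \<subseteq> N}"

definition quot_rep :: "('g, 'v) rep \<Rightarrow> 'v set \<Rightarrow> ('g, 'v set) rep" where
  "quot_rep M N = Module.module.extend (quot_space M N)
     \<lparr>act = (\<lambda>x X. \<Union>v\<in>X. N +>\<^bsub>M\<^esub> act M x v)\<rparr>"

definition maximal_subrep :: "'v set \<Rightarrow> ('g, 'v) rep \<Rightarrow> bool" where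
  "maximal_subrep N M \<longleftrightarrow> subrep N M \<and> N \<noteq> carrier M \<and>
     (\<forall>N'. subrep N' M \<and> N \<subseteq> N' \<and> N' \<noteq> carrier M \<longrightarrow> N' = N)"

text \<open>Only meaningful for modules that have exactly one maximal proper submodule.\<close>

definition simple_quotient :: "('g, 'v) rep \<Rightarrow> ('g, 'v set) rep" where
  "simple_quotient M = quot_rep M (THE N. maximal_subrep N M)"

text \<open>The tensor algebra, with basis the words in \<open>'g\<close>, as a left module over itself.\<close>

definition tensor_algebra :: "('g, 'g list \<Rightarrow>\<^sub>0 complex) rep" where
  "tensor_algebra = Module.module.extend (free_space UNIV) \<lparr>act = (\<lambda>x. push ((#) x))\<rparr>"

text \<open>The elements \<open>(x y - y x - [x, y]) u\<close> for words \<open>u\<close>; the left ideal they generate is the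
  two-sided ideal that defines the universal enveloping algebra.\<close>

definition enveloping_relations :: "'g bracket \<Rightarrow> ('g list \<Rightarrow>\<^sub>0 complex) set" where
  "enveloping_relations br =
     {Poly_Mapping.single (x # y # u) 1 - Poly_Mapping.single (y # x # u) 1
        - push (\<lambda>z. z # u) (br x y) | x y u. True}"

text \<open>The universal module generated by a vector that is annihilated by \<open>S\<close>: the quotient of the
  universal enveloping algebra by the left ideal generated by \<open>S\<close>.\<close>

definition cyclic_null :: "'g bracket \<Rightarrow> ('g list \<Rightarrow>\<^sub>0 complex) set \<Rightarrow> ('g list \<Rightarrow>\<^sub>0 complex) set" where
  "cyclic_null br S = gen_subrep tensor_algebra (enveloping_relations br \<union> S)"

definition universal_cyclic ::
    "'g bracket \<Rightarrow> ('g list \<Rightarrow>\<^sub>0 complex) set \<Rightarrow> ('g, ('g list \<Rightarrow>\<^sub>0 complex) set) rep" where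
  "universal_cyclic br S = quot_rep tensor_algebra (cyclic_null br S)"

definition cyclic_vector ::
    "'g bracket \<Rightarrow> ('g list \<Rightarrow>\<^sub>0 complex) set \<Rightarrow> ('g list \<Rightarrow>\<^sub>0 complex) set" where
  "cyclic_vector br S = cyclic_null br S +>\<^bsub>tensor_algebra\<^esub> Poly_Mapping.single [] 1"

text \<open>The element \<open>x - a\<close> of the enveloping algebra.\<close>

definition eigen_relation :: "'g \<Rightarrow> complex \<Rightarrow> ('g list \<Rightarrow>\<^sub>0 complex)" where
  "eigen_relation x a = Poly_Mapping.single [x] 1 - Poly_Mapping.single [] a"

section \<open>Fields\<close>

text \<open>A field \<open>a(z) = (\<Sum>n. a\<^sub>n z\<^bsup>-n-1\<^esup>)\<close> is given by its modes \<open>n \<mapsto> a\<^sub>n\<close>.\<close>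

type_synonym 'v field_modes = "int \<Rightarrow> 'v \<Rightarrow> 'v"

definition field_add ::
    "('a, 'v, 'm) module_scheme \<Rightarrow> 'v field_modes \<Rightarrow> 'v field_modes \<Rightarrow> 'v field_modes" where
  "field_add M a b = (\<lambda>n v. a n v \<oplus>\<^bsub>M\<^esub> b n v)"

definition field_scale ::
    "('a, 'v, 'm) module_scheme \<Rightarrow> 'a \<Rightarrow> 'v field_modes \<Rightarrow> 'v field_modes" where
  "field_scale M s a = (\<lambda>n v. s \<odot>\<^bsub>M\<^esub> a n v)"

text \<open>The \<open>r\<close>-th product of fields, so that \<open>Y(a\<^sub>(\<^sub>r\<^sub>) b, z) = Y(a, z)\<^sub>(\<^sub>r\<^sub>) Y(b, z)\<close> in any module over a
  vertex algebra (the iterate formula, a special case of the Borcherds identity):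
  \<open>(a\<^sub>(\<^sub>r\<^sub>) b)\<^sub>n = (\<Sum>i\<ge>0. (-1)^i (r choose i) (a\<^bsub>r-i\<^esub> b\<^bsub>n+i\<^esub> - (-1)^r b\<^bsub>r+n-i\<^esub> a\<^sub>i))\<close>.
  On each vector only finitely many summands are nonzero. The product with \<open>r = -1\<close> is the
  normally ordered product.\<close>

definition nth_product ::
    "(complex, 'v, 'm) module_scheme \<Rightarrow> int \<Rightarrow> 'v field_modes \<Rightarrow> 'v field_modes \<Rightarrow> 'v field_modes" where
  "nth_product M r a b = (\<lambda>n v.
     let t = (\<lambda>i::nat. ((- 1) ^ i * (of_int r gchoose i)) \<odot>\<^bsub>M\<^esub>
               (a (r - int i) (b (n + int i) v)
                 \<ominus>\<^bsub>M\<^esub> ((- 1) powi r) \<odot>\<^bsub>M\<^esub> b (r + n - int i) (a (int i) v)))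
     in \<Oplus>\<^bsub>M\<^esub>i\<in>{i. t i \<noteq> \<zero>\<^bsub>M\<^esub>}. t i)"

section \<open>The affine Lie algebra of \<open>sl(2)\<close> and its Whittaker modules\<close>

datatype affine_sl2 = E int | F int | H int | K

text \<open>\<open>[x(m), y(n)] = [x, y](m + n) + m \<delta>\<^bsub>m+n,0\<^esub> (x, y) K\<close> with the trace form \<open>(e, f) = 1\<close>,
  \<open>(h, h) = 2\<close>.\<close>

fun affine_bracket :: "affine_sl2 bracket" where
  "affine_bracket (E m) (F n) = Poly_Mapping.single (H (m + n)) 1
     + Poly_Mapping.single K (if m + n = 0 then of_int m else 0)"
| "affine_bracket (F m) (E n) = - Poly_Mapping.single (H (m + n)) 1
     + Poly_Mapping.single K (if m + n = 0 then of_int m else 0)"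
| "affine_bracket (H m) (E n) = Poly_Mapping.single (E (m + n)) 2"
| "affine_bracket (E m) (H n) = Poly_Mapping.single (E (m + n)) (- 2)"
| "affine_bracket (H m) (F n) = Poly_Mapping.single (F (m + n)) (- 2)"
| "affine_bracket (F m) (H n) = Poly_Mapping.single (F (m + n)) 2"
| "affine_bracket (H m) (H n) = Poly_Mapping.single K (if m + n = 0 then 2 * of_int m else 0)"
| "affine_bracket _ _ = 0"

definition whittaker_relations ::
    "complex \<Rightarrow> complex \<Rightarrow> complex \<Rightarrow> (affine_sl2 list \<Rightarrow>\<^sub>0 complex) set" where
  "whittaker_relations lam mu k =
     {eigen_relation (E n) (if n = 0 then lam else 0) | n. n \<ge> 0}
     \<union> {eigen_relation (F m) (if m = 1 then mu else 0) | m. m \<ge> 1}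
     \<union> {eigen_relation K k}"

definition universal_whittaker ::
    "complex \<Rightarrow> complex \<Rightarrow> complex \<Rightarrow> (affine_sl2, (affine_sl2 list \<Rightarrow>\<^sub>0 complex) set) rep" where
  "universal_whittaker lam mu k = universal_cyclic affine_bracket (whittaker_relations lam mu k)"

definition whittaker_vector ::
    "complex \<Rightarrow> complex \<Rightarrow> complex \<Rightarrow> (affine_sl2 list \<Rightarrow>\<^sub>0 complex) set" where
  "whittaker_vector lam mu k = cyclic_vector affine_bracket (whittaker_relations lam mu k)"

text \<open>The field of the Sugawara vector
  \<open>(e(-1) f(-1) 1 + f(-1) e(-1) 1 + h(-1)\<^sup>2 1 / 2) / (2 (k + 2))\<close>, and \<open>L\<^sub>s\<^sub>u\<^sub>g(n)\<close>, its mode of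
  index \<open>n + 1\<close>.\<close>

definition sugawara_field :: "complex \<Rightarrow> (affine_sl2, 'v) rep \<Rightarrow> 'v field_modes" where
  "sugawara_field k M =
     (let e = (\<lambda>n. act M (E n)); f = (\<lambda>n. act M (F n)); h = (\<lambda>n. act M (H n))
      in field_scale M (1 / (2 * (k + 2)))
           (field_add M (field_add M (nth_product M (-1) e f) (nth_product M (-1) f e))
              (field_scale M (1 / 2) (nth_product M (-1) h h))))"

definition L_sug :: "complex \<Rightarrow> (affine_sl2, 'v) rep \<Rightarrow> 'v field_modes" where
  "L_sug k M n = sugawara_field k M (n + 1)"

text \<open>\<open>M(\<lambda>, 0, k, a)\<close> and its simple quotient \<open>Wh(\<lambda>, 0, k, a)\<close>.\<close>

definition whittaker_M ::
    "complex \<Rightarrow> complex \<Rightarrow> complex \<Rightarrow> (affine_sl2, (affine_sl2 list \<Rightarrow>\<^sub>0 complex) set set) rep" where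
  "whittaker_M lam k a =
     (let W = universal_whittaker lam 0 k; w = whittaker_vector lam 0 k
      in quot_rep W (gen_subrep W {L_sug k W 0 w \<ominus>\<^bsub>W\<^esub> a \<odot>\<^bsub>W\<^esub> w}))"

definition whittaker_Wh ::
    "complex \<Rightarrow> complex \<Rightarrow> complex \<Rightarrow> (affine_sl2, (affine_sl2 list \<Rightarrow>\<^sub>0 complex) set set set) rep" where
  "whittaker_Wh lam k a = simple_quotient (whittaker_M lam k a)"

section \<open>The irreducible highest weight modules of the Virasoro algebra\<close>

datatype virasoro = L int | C

fun virasoro_bracket :: "virasoro bracket" where
  "virasoro_bracket (L m) (L n) = Poly_Mapping.single (L (m + n)) (of_int (m - n))
     + Poly_Mapping.single C (if m + n = 0 then of_int (m ^ 3 - m) / 12 else 0)"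
| "virasoro_bracket _ _ = 0"

definition virasoro_Verma ::
    "complex \<Rightarrow> complex \<Rightarrow> (virasoro, (virasoro list \<Rightarrow>\<^sub>0 complex) set) rep" where
  "virasoro_Verma cc hw = universal_cyclic virasoro_bracket
     ({eigen_relation (L n) (if n = 0 then hw else 0) | n. n \<ge> 0} \<union> {eigen_relation C cc})"

definition virasoro_irreducible ::
    "complex \<Rightarrow> complex \<Rightarrow> (virasoro, (virasoro list \<Rightarrow>\<^sub>0 complex) set set) rep" where
  "virasoro_irreducible cc hw = simple_quotient (virasoro_Verma cc hw)"

definition d_level :: "complex \<Rightarrow> complex" where
  "d_level k = 1 - 6 * (k + 1)\<^sup>2 / (k + 2)"

section \<open>The module \<open>\<Pi>\<^sub>\<lambda>\<close>\<close>

text \<open>\<open>cneg j\<close> stands for \<open>c(-(j+1))\<close> and \<open>dneg j\<close> for \<open>d(-(j+1))\<close>. The module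
  \<open>U\<^sub>\<lambda> \<otimes> M(1)\<close>, with \<open>U\<^sub>\<lambda> = \<complex>[d] v\<^sub>1\<close> free of rank one, is the space of polynomials in these
  variables with coefficients in \<open>\<complex>[d]\<close>; a polynomial \<open>p(d)\<close> stands for the vector \<open>p(d) v\<^sub>1\<close>.\<close>

datatype heis_var = cneg nat | dneg nat

type_synonym Pi_vec = "(heis_var \<Rightarrow>\<^sub>0 nat) \<Rightarrow>\<^sub>0 complex poly"

definition Pi_scale :: "complex \<Rightarrow> Pi_vec \<Rightarrow> Pi_vec" where
  "Pi_scale a = Poly_Mapping.map (Polynomial.smult a)"

definition Pi_space :: "(complex, Pi_vec) module" where
  "Pi_space = \<lparr>carrier = UNIV, monoid.mult = undefined, one = undefined,
     zero = 0, add = (+), smult = Pi_scale\<rparr>"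

definition heis_mult :: "heis_var \<Rightarrow> Pi_vec \<Rightarrow> Pi_vec" where
  "heis_mult x p = Poly_Mapping.single (Poly_Mapping.single x 1) 1 * p"

definition heis_deriv :: "heis_var \<Rightarrow> Pi_vec \<Rightarrow> Pi_vec" where
  "heis_deriv x p = (\<Sum>m\<in>Poly_Mapping.keys p. Poly_Mapping.single (m - Poly_Mapping.single x 1)
     (of_nat (Poly_Mapping.lookup m x) * Poly_Mapping.lookup p m))"

text \<open>For \<open>n > 0\<close>, \<open>[c(n), d(-n)] = [d(n), c(-n)] = 2 n\<close>, as \<open>\<langle>c, d\<rangle> = 2\<close>.\<close>

definition Pi_c :: "Pi_vec field_modes" where
  "Pi_c n p = (if n < 0 then heis_mult (cneg (nat (- n - 1))) p
     else if n = 0 then - p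
     else Pi_scale (2 * of_int n) (heis_deriv (dneg (nat (n - 1))) p))"

definition Pi_d :: "Pi_vec field_modes" where
  "Pi_d n p = (if n < 0 then heis_mult (dneg (nat (- n - 1))) p
     else if n = 0 then Poly_Mapping.map ((*) [:0, 1:]) p
     else Pi_scale (2 * of_int n) (heis_deriv (cneg (nat (n - 1))) p))"

text \<open>Since \<open>e\<^bsup>nc\<^esup> d = (d - 2n) e\<^bsup>nc\<^esup>\<close> and \<open>e\<^bsup>nc\<^esup> v\<^sub>1 = \<lambda>\<^sup>n v\<^sub>1\<close>, the element \<open>e\<^bsup>nc\<^esup>\<close> maps
  \<open>p(d) v\<^sub>1\<close> to \<open>\<lambda>\<^sup>n p(d - 2n) v\<^sub>1\<close>.\<close>

definition Pi_shift :: "complex \<Rightarrow> int \<Rightarrow> Pi_vec \<Rightarrow> Pi_vec" where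
  "Pi_shift lam n = Poly_Mapping.map
     (\<lambda>p. Polynomial.smult (lam powi n) (pcompose p [:- 2 * of_int n, 1:]))"

text \<open>The coefficient of \<open>z\<^sup>i\<close> in \<open>exp (\<Sum>j\<ge>1. a\<^sub>j z\<^sup>j)\<close>, that is, the sum of
  \<open>a\<^bsub>j1\<^esub> \<dots> a\<^bsub>jr\<^esub> / r!\<close> over all \<open>r\<close> and all positive \<open>j1, \<dots>, jr\<close> with sum \<open>i\<close>.\<close>

definition exp_coeff :: "(nat \<Rightarrow> Pi_vec \<Rightarrow> Pi_vec) \<Rightarrow> nat \<Rightarrow> Pi_vec \<Rightarrow> Pi_vec" where
  "exp_coeff a i p = (\<Sum>js | sum_list js = i \<and> 0 \<notin> set js.
     Pi_scale (1 / fact (length js)) (foldr a js p))"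

text \<open>The modes of
  \<open>Y(e\<^bsup>nc\<^esup>, z) = e\<^bsup>nc\<^esup> exp (n \<Sum>j\<ge>1. c(-j)/j z\<^sup>j) exp (-n \<Sum>j\<ge>1. c(j)/j z\<^bsup>-j\<^esup>) z\<^bsup>n c(0)\<^esup>\<close>. As
  \<open>c(0) = -Id\<close>, the last factor is \<open>z\<^bsup>-n\<^esup>\<close>; so if \<open>i\<close> and \<open>l\<close> are the degrees taken from the two
  exponentials, the mode of index \<open>m\<close> collects the terms with \<open>i - l - n = -m - 1\<close>.\<close>

definition Pi_exp :: "complex \<Rightarrow> int \<Rightarrow> Pi_vec field_modes" where
  "Pi_exp lam n m p = Sum_any (\<lambda>l::nat. let i = int l + n - m - 1 in
     if i < 0 then 0
     else Pi_shift lam n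
       (exp_coeff (\<lambda>j. Pi_scale (of_int n / of_nat j) \<circ> Pi_c (- int j)) (nat i)
         (exp_coeff (\<lambda>j. Pi_scale (- of_int n / of_nat j) \<circ> Pi_c (int j)) l p)))"

section \<open>The action of the affine Lie algebra on \<open>L \<otimes> \<Pi>\<^sub>\<lambda>\<close>\<close>

text \<open>For a Virasoro module \<open>V\<close> of central charge \<open>d\<^sub>k\<close>, regarded as a module over the universal
  Virasoro vertex algebra, \<open>V \<otimes> \<Pi>\<^sub>\<lambda>\<close> is acted on by the fields of \<open>\<omega>\<close>, \<open>c\<close>, \<open>d\<close> and \<open>e\<^bsup>nc\<^esup>\<close>, and
  \<open>e\<close>, \<open>h\<close>, \<open>f\<close> act by the fields of \<open>e\<^sup>c\<close>, \<open>2 \<mu>(-1) 1\<close> and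
  \<open>((k+2) \<omega> - \<nu>(-1)\<^sup>2 - (k+1) \<nu>(-2)) e\<^bsup>-c\<^esup>\<close>, where \<open>\<mu> = d/2 + k/4 c\<close> and \<open>\<nu> = d/2 - k/4 c\<close>.
  Note that \<open>\<omega>\<^sub>n = L(n-1)\<close>.\<close>

definition affine_tensor ::
    "complex \<Rightarrow> complex \<Rightarrow> (virasoro, 'v) rep \<Rightarrow> (affine_sl2, ('v \<times> Pi_vec \<Rightarrow>\<^sub>0 complex) set) rep" where
  "affine_tensor k lam V =
     (let T = tensor_space V Pi_space;
          pi = (\<lambda>a n. tensor_map V Pi_space id (a n));
          omega = (\<lambda>n. tensor_map V Pi_space (act V (L (n - 1))) id);
          c = pi Pi_c;
          d = pi Pi_d;
          mu = field_add T (field_scale T (1 / 2) d) (field_scale T (k / 4) c);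
          nu = field_add T (field_scale T (1 / 2) d) (field_scale T (- k / 4) c);
          emc = pi (Pi_exp lam (- 1));
          e = pi (Pi_exp lam 1);
          h = field_scale T 2 mu;
          f = field_add T (field_scale T (k + 2) (nth_product T (- 1) omega emc))
               (field_add T
                 (field_scale T (- 1) (nth_product T (- 1) nu (nth_product T (- 1) nu emc)))
                 (field_scale T (- (k + 1)) (nth_product T (- 2) nu emc)))
      in Module.module.extend T
           \<lparr>act = (\<lambda>x. case x of E n \<Rightarrow> e n | F n \<Rightarrow> f n | H n \<Rightarrow> h n | K \<Rightarrow> smult T k)\<rparr>)"

end

theory Submission imports Defs
begin

text \<open>Let \<open>I\<close> be the left ideal of relations defining \<open>M(\<lambda>, 0, k, a)\<close> as a quotient of the tensor algebra. On that module
  \<open>L\<^sub>s\<^sub>u\<^sub>g(0)\<close> acts on a word of degree \<open>d\<close> as the scalar \<open>a + d\<close>, so all left ideals above \<open>I\<close> are graded. The degree zero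
  part is spanned by the vectors \<open>p(h(0)) w\<close>, on which \<open>e(0)\<close> acts by \<open>\<lambda>\<close> times a shift of the polynomial \<open>p\<close>; as
  \<open>e(0) - \<lambda>\<close> lowers the degree of \<open>p\<close>, each of these vectors that is nonzero generates \<open>w\<close>. Hence the proper left ideals above \<open>I\<close> have a largest
  member, which defines \<open>Wh(\<lambda>, 0, k, a)\<close>.

  In \<open>L(d\<^sub>k, h) \<otimes> \<Pi>\<^sub>\<lambda>\<close> the vector \<open>v\<^sub>h \<otimes> v\<^sub>1\<close> is a Whittaker vector on which \<open>L\<^sub>s\<^sub>u\<^sub>g(0)\<close> acts as \<open>h + k/4\<close>. This module is simple: an
  element of lowest degree in a nonzero submodule is killed by \<open>e(n)\<close> and \<open>h(n)\<close> for \<open>n > 0\<close>, so it involves only \<open>\<complex>[d] v\<^sub>1\<close>;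
  \<open>e(0) - \<lambda>\<close> reduces it to \<open>v \<otimes> v\<^sub>1\<close>; the modes of \<open>e\<close> and \<open>h\<close> produce all of \<open>v \<otimes> \<Pi>\<^sub>\<lambda>\<close>, and the modes of \<open>f\<close> give back those of
  \<open>\<omega>\<close>. So the left ideal that annihilates \<open>v\<^sub>h \<otimes> v\<^sub>1\<close> is maximal and contains \<open>I\<close>; it is therefore the largest one.\<close>

text \<open>That the stated operators satisfy the affine relations is itself a large part of the
  proof, and the work lies in [f(m), f(n)]. After the Virasoro bracket has been used, this
  commutator splits into the parts carrying a mode L(s) and the part carrying none. Each part is an
  identity between operators on \<open>Pi_vec\<close>, settled by its behaviour under e and h
  together with a single vacuum expectation. For the part without a mode this is a cubic polynomial
  in m, and the central charge d_k is exactly what makes it cancel.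

  Infinite sums are the obstacle throughout. Modes of fields are controlled by the weight grading of
  \<open>Pi_vec\<close>, which leaves finitely many terms on each vector. L_sug(0) on the abstract
  module is tested against linear functionals that vanish on the ideal; the shift from k to k + 2
  then arises from displacing the cut of the normal ordering.

  The Virasoro modules are treated by the same locale \<open>graded_cyclic\<close>; that their Verma
  modules are nonzero is seen on an explicit Fock space of arbitrary central charge and weight. The
  constant k/4 is what the \<open>Pi_vec\<close> factor contributes to the eigenvalue of L_sug(0)
  (\<open>casimir_1\<close>).\<close>

abbreviation (input) single :: "'a \<Rightarrow> 'b \<Rightarrow> 'a \<Rightarrow>\<^sub>0 'b::zero" where "single \<equiv> Poly_Mapping.single"
abbreviation (input) lookup :: "('a \<Rightarrow>\<^sub>0 'b::zero) \<Rightarrow> 'a \<Rightarrow> 'b" where "lookup \<equiv> Poly_Mapping.lookup"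
abbreviation (input) keys :: "('a \<Rightarrow>\<^sub>0 'b::zero) \<Rightarrow> 'a set" where "keys \<equiv> Poly_Mapping.keys"

section \<open>Polynomials and free vector spaces\<close>

text \<open>A polynomial invariant under the shift takes one value at the infinitely many points x -
  2n. This turns invariance under e(0) into constancy in d or h(0).\<close>

lemma poly_periodic_const:
  fixes q :: "complex poly"
  assumes "pcompose q [:- 2, 1:] = q"
  shows "q = [:poly q x:]"
proof -
  have step: "poly q (y - 2) = poly q y" for y
    using arg_cong [OF assms, of "\<lambda>p. poly p y"] by (simp add: poly_pcompose)
  have n: "poly q (x - 2 * of_nat n) = poly q x" for n
  proof (induction n)
    case (Suc n)
    have "x - 2 * of_nat (Suc n) = (x - 2 * of_nat n) - 2" by (simp add: algebra_simps)
    then show ?case using step [of "x - 2 * of_nat n"] Suc by (simp only:)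
  qed simp
  have "inj (\<lambda>n::nat. x - 2 * of_nat n)" by (auto simp: inj_def)
  then have "infinite (range (\<lambda>n::nat. x - 2 * of_nat n))"
    using finite_imageD by blast
  moreover have "range (\<lambda>n::nat. x - 2 * of_nat n) \<subseteq> {y. poly (q - [:poly q x:]) y = 0}"
    using n by auto
  ultimately have "q - [:poly q x:] = 0"
    using poly_roots_finite finite_subset by blast
  then show ?thesis by simp
qed

text \<open>The substitution t + a keeps the leading coefficient, which therefore cancels. With a =
  -2 this is the drop of degree under e(0) - lambda.\<close>

lemma degree_shift_diff:
  fixes q' :: "complex poly"
  assumes "degree q' > 0"
  shows "degree (pcompose q' [:a, 1:] - q') < degree q'"
proof -
  let ?d = "pcompose q' [:a, 1:] - q'"
  have deg: "degree (pcompose q' [:a, 1:]) = degree q'" by (simp add: degree_pcompose)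
  have "coeff ?d (degree q') = 0"
    using lead_coeff_comp [of "[:a, 1:]" q'] deg by simp
  moreover have "degree ?d \<le> degree q'" using degree_diff_le_max [of "pcompose q' [:a, 1:]" q'] deg by simp
  ultimately show ?thesis
    by (metis assms degree_0 leading_coeff_0_iff nat_less_le)
qed

lemma poly_mapping_sum_single: "(\<Sum>x\<in>keys p. single x (lookup p x)) = p"
proof (rule poly_mapping_eqI)
  fix y
  have "lookup (\<Sum>x\<in>keys p. single x (lookup p x)) y
     = (\<Sum>x\<in>keys p. if x = y then lookup p x else 0)"
    by (simp add: lookup_sum lookup_single when_def)
  also have "\<dots> = lookup p y"
    by (simp add: sum.delta' in_keys_iff)
  finally show "lookup (\<Sum>x\<in>keys p. single x (lookup p x)) y = lookup p y" .
qed

lemma poly_mapping_single_induct [case_names zero single add]: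
  fixes p :: "'a \<Rightarrow>\<^sub>0 'b::comm_monoid_add"
  assumes "P 0" and "\<And>x a. P (single x a)" and "\<And>p q. P p \<Longrightarrow> P q \<Longrightarrow> P (p + q)"
  shows "P p"
proof -
  have "finite A \<Longrightarrow> P (\<Sum>x\<in>A. single x (f x))" for A and f :: "'a \<Rightarrow> 'b"
    by (induction A rule: finite_induct) (use assms in auto)
  from this [of "keys p" "lookup p"] show ?thesis
    by (simp add: poly_mapping_sum_single)
qed

abbreviation lin where "lin \<equiv> Vector_Spaces.linear"

lemma lin_add: "lin s t f \<Longrightarrow> f (x + y) = f x + f y"
  and lin_scale: "lin s t f \<Longrightarrow> f (s a x) = t a (f x)"
  and lin_zero: "lin s t f \<Longrightarrow> f 0 = 0"
  and lin_diff: "lin s t f \<Longrightarrow> f (x - y) = f x - f y"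
  and lin_minus: "lin s t f \<Longrightarrow> f (- x) = - f x"
  and lin_sum: "lin s t f \<Longrightarrow> f (sum g A) = (\<Sum>x\<in>A. f (g x))"
proof -
  assume "lin s t f"
  then interpret Vector_Spaces.linear s t f .
  show "f (x + y) = f x + f y" "f (s a x) = t a (f x)" "f 0 = 0" "f (x - y) = f x - f y"
    "f (- x) = - f x" "f (sum g A) = (\<Sum>x\<in>A. f (g x))"
    by (simp_all add: add scale zero diff neg sum)
qed

abbreviation fscale :: "complex \<Rightarrow> ('a \<Rightarrow>\<^sub>0 complex) \<Rightarrow> ('a \<Rightarrow>\<^sub>0 complex)" where
  "fscale a \<equiv> Poly_Mapping.map ((*) a)"

lemma lookup_map: "f 0 = 0 \<Longrightarrow> lookup (Poly_Mapping.map f p) x = f (lookup p x)"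
  by (transfer) (auto simp: when_def)

interpretation free: vector_space "fscale :: complex \<Rightarrow> ('a \<Rightarrow>\<^sub>0 complex) \<Rightarrow> _"
  by unfold_locales (auto intro!: poly_mapping_eqI simp: lookup_map lookup_add algebra_simps)

interpretation Pi: vector_space Pi_scale
  by unfold_locales
    (auto intro!: poly_mapping_eqI simp: Pi_scale_def lookup_map lookup_add smult_add_right smult_add_left)

lemma lookup_Pi_scale: "lookup (Pi_scale a p) m = Polynomial.smult a (lookup p m)"
  by (simp add: Pi_scale_def lookup_map)

lemma Pi_scale_single [simp]: "Pi_scale a (single m q) = single m (Polynomial.smult a q)"
  by (simp add: Pi_scale_def)

abbreviation plin :: "(Pi_vec \<Rightarrow> Pi_vec) \<Rightarrow> bool" where "plin \<equiv> lin Pi_scale Pi_scale"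

lemma plinI: "(\<And>p q. A (p + q) = A p + A q) \<Longrightarrow> (\<And>a p. A (Pi_scale a p) = Pi_scale a (A p)) \<Longrightarrow> plin A"
  by unfold_locales auto

text \<open>With the two sides of an operator identity as \<open>f\<close> and \<open>g\<close>,
  only monomials \<open>single m q\<close> are left to check.\<close>

lemma additive_eqI:
  fixes p :: "'a \<Rightarrow>\<^sub>0 'b::comm_monoid_add" and f :: "_ \<Rightarrow> 'c::ab_group_add"
  assumes "\<And>p q. f (p + q) = f p + f q" "\<And>p q. g (p + q) = g p + g q"
    and "\<And>x a. f (single x a) = g (single x a)"
  shows "f p = g p"
proof (induction p rule: poly_mapping_single_induct)
  case zero
  then show ?case using assms(1) [of 0 0] assms(2) [of 0 0] by simp
qed (use assms in auto)

section \<open>The Heisenberg algebra on \<open>\<Pi>\<^sub>\<lambda>\<close>\<close>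

definition mon :: "heis_var \<Rightarrow> heis_var \<Rightarrow>\<^sub>0 nat" where "mon x = single x 1"

lemma lookup_mon: "lookup (mon x) y = (if x = y then 1 else 0)"
  by (simp add: mon_def lookup_single when_def)

lemma mon_diff_add: "lookup m x \<noteq> 0 \<Longrightarrow> m - mon x + mon x = m"
  by (rule poly_mapping_eqI) (auto simp: lookup_add lookup_minus lookup_mon)

lemma mon_diff_diff: "m - mon x - mon y = m - mon y - mon x"
  by (rule poly_mapping_eqI) (simp add: lookup_minus)

lemma mon_diff_add_swap: "x \<noteq> y \<Longrightarrow> m + mon y - mon x = m - mon x + mon y"
  by (rule poly_mapping_eqI) (auto simp add: lookup_add lookup_minus lookup_mon)

lemma heis_mult_single: "heis_mult x (single m q) = single (m + mon x) q"
  by (simp add: heis_mult_def mult_single add.commute mon_def)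

lemma lookup_heis_deriv: "lookup (heis_deriv x p) m
   = of_nat (Suc (lookup m x)) * lookup p (m + mon x)"
proof -
  have "lookup (heis_deriv x p) m
    = (\<Sum>m'\<in>keys p. (if m' - mon x = m then (of_nat (lookup m' x) * lookup p m') else 0))"
    by (simp add: heis_deriv_def lookup_sum lookup_single when_def mon_def)
  also have "\<dots> = (\<Sum>m'\<in>keys p. (if m' = m + mon x then (of_nat (Suc (lookup m x)) * lookup p m') else 0))"
  proof (rule sum.cong)
    fix m'
    \<comment> \<open>If \<open>x\<close> does not occur in \<open>m'\<close>, truncated subtraction
      gives \<open>m' - mon x = m'\<close>, but the factor \<open>lookup m' x\<close> is then
      zero.\<close>
    show "(if m' - mon x = m then of_nat (lookup m' x) * lookup p m' else 0)
      = (if m' = m + mon x then of_nat (Suc (lookup m x)) * lookup p m' else 0)"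
      using mon_diff_add [of m' x] by (cases "lookup m' x = 0") (auto simp: lookup_add lookup_mon)
  qed simp
  also have "\<dots> = of_nat (Suc (lookup m x)) * lookup p (m + mon x)"
    by (simp add: sum.delta in_keys_iff del: of_nat_Suc)
  finally show ?thesis .
qed

lemma heis_deriv_single: "heis_deriv x (single m q)
  = single (m - mon x) (of_nat (lookup m x) * q)"
  by (cases "q = 0") (simp_all add: heis_deriv_def mon_def)

lemma heis_mult_add: "heis_mult x (p + q) = heis_mult x p + heis_mult x q"
  by (simp add: heis_mult_def distrib_left)

lemma heis_deriv_add: "heis_deriv x (p + q) = heis_deriv x p + heis_deriv x q"
  by (auto intro!: poly_mapping_eqI simp: lookup_heis_deriv lookup_add distrib_left simp del: of_nat_Suc)

lemma plin_heis_mult: "plin (heis_mult x)"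
proof (rule plinI)
  show "heis_mult x (Pi_scale a p) = Pi_scale a (heis_mult x p)" for a p
    by (rule additive_eqI [of "\<lambda>p. heis_mult x (Pi_scale a p)"])
      (simp_all add: Pi.scale_right_distrib heis_mult_add heis_mult_single)
qed (rule heis_mult_add)

lemma plin_heis_deriv: "plin (heis_deriv x)"
  by (rule plinI) (auto intro!: poly_mapping_eqI simp: heis_deriv_add lookup_heis_deriv lookup_Pi_scale simp del: of_nat_Suc)

lemma heis_deriv_commute: "heis_deriv x (heis_deriv y p) = heis_deriv y (heis_deriv x p)"
  by (rule additive_eqI [of "\<lambda>p. heis_deriv x (heis_deriv y p)" "\<lambda>p. heis_deriv y (heis_deriv x p)"])
    (auto simp: heis_deriv_add heis_deriv_single mon_diff_diff lookup_minus lookup_mon mult.left_commute)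

lemma heis_mult_commute: "heis_mult x (heis_mult y p) = heis_mult y (heis_mult x p)"
  by (simp add: heis_mult_def ac_simps)

lemma heis_deriv_mult: "heis_deriv x (heis_mult y p) = heis_mult y (heis_deriv x p) + (if x = y then p else 0)"
proof (rule additive_eqI [of "\<lambda>p. heis_deriv x (heis_mult y p)" "\<lambda>p. heis_mult y (heis_deriv x p) + (if x = y then p else 0)"])
  fix m q
  show "heis_deriv x (heis_mult y (single m q)) = heis_mult y (heis_deriv x (single m q))
    + (if x = y then (single m q) else 0)"
  proof (cases "x = y")
    case True
    then show ?thesis
      using mon_diff_add [of m x]
      by (cases "lookup m x = 0")
        (simp_all add: heis_deriv_single heis_mult_single lookup_add lookup_mon distrib_right lin_zero [OF plin_heis_mult] add.commute flip: single_add)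
  next
    case False
    then show ?thesis
      by (simp add: heis_deriv_single heis_mult_single lookup_add lookup_mon mon_diff_add_swap)
  qed
qed (auto simp: heis_deriv_add heis_mult_add)

lemma Pi_d_0: "Pi_d 0 p = single 0 [:0, 1:] * p"
  by (simp only: Pi_d_def mult_map_scale_conv_mult) simp

lemma Pi_d_0_single [simp]: "Pi_d 0 (single m q) = single m ([:0, 1:] * q)"
  by (simp add: Pi_d_def)

lemma lookup_Pi_d_0: "lookup (Pi_d 0 p) m = [:0, 1:] * lookup p m"
  by (simp add: Pi_d_def lookup_map)

lemma plin_Pi_d_0: "plin (Pi_d 0)"
  by (rule plinI) (auto intro!: poly_mapping_eqI simp: lookup_Pi_d_0 lookup_add lookup_Pi_scale distrib_left smult_add_right)

lemma Pi_c_simps: "n < 0 \<Longrightarrow> Pi_c n = heis_mult (cneg (nat (- n - 1)))"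
  "Pi_c 0 = uminus"
  "n > 0 \<Longrightarrow> Pi_c n = (\<lambda>p. Pi_scale (2 * of_int n) (heis_deriv (dneg (nat (n - 1))) p))"
  by (auto simp: Pi_c_def fun_eq_iff)

lemma Pi_d_simps: "n < 0 \<Longrightarrow> Pi_d n = heis_mult (dneg (nat (- n - 1)))"
  "n > 0 \<Longrightarrow> Pi_d n = (\<lambda>p. Pi_scale (2 * of_int n) (heis_deriv (cneg (nat (n - 1))) p))"
  by (auto simp: Pi_d_def fun_eq_iff)

lemma plin_scaled: "plin A \<Longrightarrow> plin (\<lambda>p. Pi_scale a (A p))"
  by (rule plinI) (simp_all add: lin_add lin_scale Pi.scale_right_distrib mult.commute)

lemma plin_add: "plin A \<Longrightarrow> plin B \<Longrightarrow> plin (\<lambda>p. A p + B p)"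
  by (rule plinI) (simp_all add: lin_add lin_scale Pi.scale_right_distrib)

lemma plin_minus: "plin A \<Longrightarrow> plin (\<lambda>p. - A p)"
  by (rule plinI) (simp_all add: lin_add lin_scale)

lemma plin_diff: "plin A \<Longrightarrow> plin B \<Longrightarrow> plin (\<lambda>p. A p - B p)"
  by (rule plinI) (simp_all add: lin_add lin_scale Pi.scale_right_diff_distrib)

lemma plin_comp: "plin A \<Longrightarrow> plin B \<Longrightarrow> plin (\<lambda>p. A (B p))"
  by (rule plinI) (simp_all add: lin_add lin_scale)

lemma plin_ident: "plin (\<lambda>p. p)" and plin_zero: "plin (\<lambda>p. 0)"
  by (rule plinI; simp)+

lemma plin_c: "plin (Pi_c n)"
  by (cases n "0::int" rule: linorder_cases)
    (auto simp: Pi_c_simps plin_heis_mult intro: plin_scaled plin_heis_deriv plin_minus [OF plin_ident])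

lemma plin_d: "plin (Pi_d n)"
  by (cases n "0::int" rule: linorder_cases)
    (auto simp: Pi_d_simps plin_heis_mult plin_Pi_d_0 intro: plin_scaled plin_heis_deriv)

lemma heis_deriv_Pi_d_0: "heis_deriv x (Pi_d 0 p) = Pi_d 0 (heis_deriv x p)"
  by (rule additive_eqI [of "\<lambda>p. heis_deriv x (Pi_d 0 p)" "\<lambda>p. Pi_d 0 (heis_deriv x p)"])
    (simp_all add: heis_deriv_add lin_add [OF plin_Pi_d_0] heis_deriv_single)

lemma heis_mult_Pi_d_0: "heis_mult x (Pi_d 0 p) = Pi_d 0 (heis_mult x p)"
  by (simp add: Pi_d_0 heis_mult_def ac_simps)

lemmas heis_scale_simps = heis_deriv_mult heis_deriv_Pi_d_0 heis_mult_Pi_d_0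
  lin_scale [OF plin_heis_mult] lin_scale [OF plin_heis_deriv] lin_scale [OF plin_Pi_d_0]
  lin_minus [OF plin_heis_mult] lin_minus [OF plin_heis_deriv] lin_minus [OF plin_Pi_d_0]
  Pi.scale_right_distrib Pi.scale_left_commute

lemma Pi_c_commute: "Pi_c m (Pi_c n p) = Pi_c n (Pi_c m p)"
  apply (cases m "0::int" rule: linorder_cases; cases n "0::int" rule: linorder_cases)
          apply (simp_all only: Pi_c_simps Pi_d_simps)
          apply (simp_all add: heis_scale_simps nat_eq_iff eq_neg_iff_add_eq_0 del: Pi.scale_scale)
   apply (rule heis_mult_commute)
  apply (metis Pi.scale_left_commute heis_deriv_commute)
  done

lemma Pi_d_commute: "Pi_d m (Pi_d n p) = Pi_d n (Pi_d m p)"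
  apply (cases m "0::int" rule: linorder_cases; cases n "0::int" rule: linorder_cases)
          apply (simp_all only: Pi_c_simps Pi_d_simps)
          apply (simp_all add: heis_scale_simps nat_eq_iff eq_neg_iff_add_eq_0 del: Pi.scale_scale)
   apply (rule heis_mult_commute)
  apply (metis Pi.scale_left_commute heis_deriv_commute)
  done

text \<open>Split by the signs of \<open>m\<close> and \<open>n\<close>: only a derivative against
  multiplication by the same variable fails to commute, and the variables match exactly when
  \<open>m + n = 0\<close>.\<close>

lemma Pi_c_Pi_d: "Pi_c m (Pi_d n p) = Pi_d n (Pi_c m p) + (if m + n = 0 then Pi_scale (2 * of_int m) p else 0)"
  apply (cases m "0::int" rule: linorder_cases; cases n "0::int" rule: linorder_cases)
          apply (simp_all only: Pi_c_simps Pi_d_simps)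
          apply (simp_all add: heis_scale_simps nat_eq_iff eq_neg_iff_add_eq_0 del: Pi.scale_scale)
    apply (rule heis_mult_commute)
   apply (simp add: add.commute del: of_int_add flip: Pi.scale_left_distrib distrib_left of_int_add)
  apply (rule heis_deriv_commute)
  done

subsection \<open>Weights\<close>

fun var_index :: "heis_var \<Rightarrow> nat" where
  "var_index (cneg j) = Suc j"
| "var_index (dneg j) = Suc j"

text \<open>The energy grading, in which c(-n) and d(-n) have weight n; the variables are numbered
  from 0, hence the \<open>Suc\<close> in \<open>var_index\<close>.\<close>

definition wt :: "(heis_var \<Rightarrow>\<^sub>0 nat) \<Rightarrow> nat" where
  "wt m = (\<Sum>x\<in>keys m. lookup m x * var_index x)"

lemma wt_add: "wt (m + n) = wt m + wt n"
  unfolding wt_def by (rule setsum_keys_plus_distrib) (auto simp: distrib_right)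

lemma wt_mon [simp]: "wt (mon x) = var_index x"
  by (simp add: wt_def mon_def)

lemma wt_0 [simp]: "wt 0 = 0"
  by (simp add: wt_def)

lemma wt_eq_0_iff: "wt m = 0 \<longleftrightarrow> m = 0"
proof -
  have "var_index x \<noteq> 0" for x by (cases x) simp_all
  moreover have "wt m = 0 \<longleftrightarrow> (\<forall>x\<in>keys m. lookup m x * var_index x = 0)"
    by (simp only: wt_def sum_eq_0_iff finite_keys)
  ultimately have "wt m = 0 \<longleftrightarrow> keys m = {}"
    by (metis all_not_in_conv in_keys_iff mult_eq_0_iff)
  then show ?thesis by simp
qed

text \<open>The degree is an integer so that operators may formally lower it below 0, where only the
  zero vector is left (\<open>hom_negative\<close>).\<close>

definition hom :: "int \<Rightarrow> Pi_vec \<Rightarrow> bool" where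
  "hom r p \<longleftrightarrow> (\<forall>m\<in>keys p. int (wt m) = r)"

definition bnd :: "int \<Rightarrow> Pi_vec \<Rightarrow> bool" where
  "bnd r p \<longleftrightarrow> (\<forall>m\<in>keys p. int (wt m) \<le> r)"

lemma hom_zero [simp]: "hom r 0" and bnd_zero [simp]: "bnd r 0"
  by (simp_all add: hom_def bnd_def)

lemma hom_add: "hom r p \<Longrightarrow> hom r q \<Longrightarrow> hom r (p + q)"
  and bnd_add: "bnd r p \<Longrightarrow> bnd r q \<Longrightarrow> bnd r (p + q)"
  using keys_add [of p q] by (auto simp: hom_def bnd_def)

lemma hom_minus [simp]: "hom r (- p) = hom r p"
  by (simp add: hom_def)

lemma hom_diff: "hom r p \<Longrightarrow> hom r q \<Longrightarrow> hom r (p - q)"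
  using hom_add [of r p "- q"] by simp

lemma hom_scale: "hom r p \<Longrightarrow> hom r (Pi_scale a p)"
  by (auto simp: hom_def in_keys_iff lookup_Pi_scale)

lemma hom_sum: "(\<And>x. x \<in> A \<Longrightarrow> hom r (f x)) \<Longrightarrow> hom r (sum f A)"
  by (induction A rule: infinite_finite_induct) (auto intro: hom_add)

lemma hom_Sum_any: "(\<And>x. hom r (f x)) \<Longrightarrow> hom r (Sum_any f)"
  by (simp add: Sum_any.expand_set hom_sum)

lemma bnd_sum: "(\<And>x. x \<in> A \<Longrightarrow> bnd r (f x)) \<Longrightarrow> bnd r (sum f A)"
  by (induction A rule: infinite_finite_induct) (auto intro: bnd_add)

lemma hom_single: "hom (int (wt m)) (single m q)"
  by (simp add: hom_def)

lemma hom_1: "hom 0 1"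
  using hom_single [of 0 1] by simp

lemma bnd_mono: "bnd r p \<Longrightarrow> r \<le> s \<Longrightarrow> bnd s p"
  by (force simp: bnd_def)

lemma bnd_negative: "bnd r p \<Longrightarrow> r < 0 \<Longrightarrow> p = 0"
  by (force simp: bnd_def simp flip: keys_eq_empty)

lemma hom_imp_bnd: "hom r p \<Longrightarrow> bnd r p"
  by (auto simp: hom_def bnd_def)

lemma hom_negative: "hom r p \<Longrightarrow> r < 0 \<Longrightarrow> p = 0"
  using bnd_negative hom_imp_bnd by blast

lemma bnd_exists: "\<exists>r. bnd r p"
proof -
  have "bnd (Max (insert 0 ((\<lambda>m. int (wt m)) ` keys p))) p"
    by (simp add: bnd_def)
  then show ?thesis ..
qed

lemma hom_lookup_0: "hom r p \<Longrightarrow> r \<noteq> 0 \<Longrightarrow> lookup p 0 = 0"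
  by (force simp: hom_def in_keys_iff)

lemma hom_0_eq: "hom 0 p \<Longrightarrow> p = single 0 (lookup p 0)"
  by (rule poly_mapping_eqI) (auto simp: hom_def wt_eq_0_iff lookup_single when_def in_keys_iff)

definition graded :: "int \<Rightarrow> (Pi_vec \<Rightarrow> Pi_vec) \<Rightarrow> bool" where
  "graded s A \<longleftrightarrow> plin A \<and> (\<forall>r p. hom r p \<longrightarrow> hom (r + s) (A p))"

lemma graded_lin: "graded s A \<Longrightarrow> plin A"
  and graded_hom: "graded s A \<Longrightarrow> hom r p \<Longrightarrow> hom (r + s) (A p)"
  by (auto simp: graded_def)

lemma gradedI:
  assumes "plin A" and "\<And>m q. hom (int (wt m) + s) (A (single m q))"
  shows "graded s A"
  unfolding graded_def
proof (intro conjI allI impI)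
  fix r p assume "hom r p"
  have "A p = (\<Sum>m\<in>keys p. A (single m (lookup p m)))"
    by (simp add: poly_mapping_sum_single flip: lin_sum [OF assms(1)])
  also have "hom (r + s) \<dots>"
    using assms(2) \<open>hom r p\<close> by (auto simp: hom_def intro!: hom_sum [unfolded hom_def])
  finally show "hom (r + s) (A p)" .
qed (rule assms)

lemma graded_bnd:
  assumes "graded s A" and "bnd r p" shows "bnd (r + s) (A p)"
proof -
  have "A p = (\<Sum>m\<in>keys p. A (single m (lookup p m)))"
    by (simp add: poly_mapping_sum_single flip: lin_sum [OF graded_lin [OF assms(1)]])
  also have "bnd (r + s) \<dots>"
  proof (rule bnd_sum)
    fix m assume "m \<in> keys p"
    then have "int (wt m) + s \<le> r + s"
      using assms(2) by (simp add: bnd_def)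
    then show "bnd (r + s) (A (single m (lookup p m)))"
      by (rule bnd_mono [OF hom_imp_bnd [OF graded_hom [OF assms(1) hom_single]]])
  qed
  finally show ?thesis .
qed

lemma graded_comp: "graded s A \<Longrightarrow> graded t B \<Longrightarrow> u = s + t \<Longrightarrow> graded u (\<lambda>p. A (B p))"
  by (auto simp: graded_def plin_comp ac_simps) (metis add.assoc add.commute)

lemma graded_add: "graded s A \<Longrightarrow> graded s B \<Longrightarrow> graded s (\<lambda>p. A p + B p)"
  and graded_diff: "graded s A \<Longrightarrow> graded s B \<Longrightarrow> graded s (\<lambda>p. A p - B p)"
  and graded_minus: "graded s A \<Longrightarrow> graded s (\<lambda>p. - A p)"
  and graded_scale: "graded s A \<Longrightarrow> graded s (\<lambda>p. Pi_scale a (A p))"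
  and graded_zero: "graded s (\<lambda>p. 0)"
  by (auto simp: graded_def plin_add plin_diff plin_minus plin_scaled plin_zero hom_add hom_diff hom_scale)

lemma graded_ident: "graded 0 (\<lambda>p. p)"
  by (simp add: graded_def plin_ident)

lemma graded_heis_mult: "graded (int (var_index x)) (heis_mult x)"
  using hom_single by (intro gradedI plin_heis_mult) (simp add: heis_mult_single hom_def wt_add)

lemma graded_heis_deriv: "graded (- int (var_index x)) (heis_deriv x)"
proof (intro gradedI plin_heis_deriv)
  fix m q
  show "hom (int (wt m) + - int (var_index x)) (heis_deriv x (single m q))"
  proof (cases "lookup m x = 0")
    case False
    then have "wt m = wt (m - mon x) + var_index x"
      using mon_diff_add [of m x] wt_add [of "m - mon x" "mon x"] by simp
    then show ?thesis by (simp add: heis_deriv_single hom_def)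
  qed (simp add: heis_deriv_single)
qed

text \<open>This grading makes infinite sums of modes harmless: a vector of bounded weight is killed
  by all modes of large index.\<close>

definition fld :: "int \<Rightarrow> Pi_vec field_modes \<Rightarrow> bool" where
  "fld s a \<longleftrightarrow> (\<forall>n. graded (s - n) (a n))"

lemma fldD: "fld s a \<Longrightarrow> graded (s - n) (a n)" and fld_lin: "fld s a \<Longrightarrow> plin (a n)"
  by (auto simp: fld_def graded_def)

lemma fld_c: "fld 0 Pi_c"
  unfolding fld_def
proof
  fix n :: int
  show "graded (0 - n) (Pi_c n)"
    using graded_heis_mult [of "cneg (nat (- n - 1))"] graded_scale [OF graded_heis_deriv [of "dneg (nat (n - 1))"], of "2 * of_int n"]
    by (cases n "0::int" rule: linorder_cases)
      (auto simp: Pi_c_simps intro: graded_minus [OF graded_ident])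
qed

lemma fld_d: "fld 0 Pi_d"
  unfolding fld_def
proof
  fix n :: int
  show "graded (0 - n) (Pi_d n)"
    using graded_heis_mult [of "dneg (nat (- n - 1))"] graded_scale [OF graded_heis_deriv [of "cneg (nat (n - 1))"], of "2 * of_int n"]
    by (cases n "0::int" rule: linorder_cases)
      (auto simp: Pi_d_simps intro!: gradedI plin_Pi_d_0 hom_single)
qed

lemma fld_add: "fld s a \<Longrightarrow> fld s b \<Longrightarrow> fld s (\<lambda>n p. a n p + b n p)"
  and fld_diff: "fld s a \<Longrightarrow> fld s b \<Longrightarrow> fld s (\<lambda>n p. a n p - b n p)"
  and fld_minus: "fld s a \<Longrightarrow> fld s (\<lambda>n p. - a n p)"
  and fld_scale: "fld s a \<Longrightarrow> fld s (\<lambda>n p. Pi_scale x (a n p))"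
  by (auto simp: fld_def intro: graded_add graded_diff graded_minus graded_scale)

lemma fld_shift: "fld s a \<Longrightarrow> fld (s - m) (\<lambda>n. a (m + n))"
  by (auto simp: fld_def) (metis diff_diff_eq)

section \<open>Normally ordered sums\<close>

lemma lin_Sum_any:
  assumes "lin s t A" and "finite {j. f j \<noteq> 0}"
  shows "A (Sum_any f) = Sum_any (\<lambda>j. A (f j))"
proof -
  have "{j. A (f j) \<noteq> 0} \<subseteq> {j. f j \<noteq> 0}"
    using lin_zero [OF assms(1)] by auto
  then show ?thesis
    using assms by (simp add: Sum_any.expand_superset lin_sum [OF assms(1)])
qed

definition NO_term :: "(int \<Rightarrow> complex) \<Rightarrow> Pi_vec field_modes \<Rightarrow> Pi_vec field_modes \<Rightarrow> int \<Rightarrow> Pi_vec \<Rightarrow> int \<Rightarrow> Pi_vec" where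
  "NO_term \<kappa> a b N p j = Pi_scale (\<kappa> j) (if j < 0 then a j (b (N - j) p) else b (N - j) (a j p))"

text \<open>The sum \<open>\<Sum>\<^sub>j \<kappa>(j) :a\<^sub>j b\<^bsub>N-j\<^esub>:\<close>; for \<open>\<kappa> = 1\<close> and \<open>\<kappa>(j) = -j-1\<close> these are the modes of
  \<open>:a(z) b(z):\<close> and \<open>:a'(z) b(z):\<close>.\<close>

definition NO :: "(int \<Rightarrow> complex) \<Rightarrow> Pi_vec field_modes \<Rightarrow> Pi_vec field_modes \<Rightarrow> int \<Rightarrow> Pi_vec \<Rightarrow> Pi_vec" where
  "NO \<kappa> a b N p = Sum_any (NO_term \<kappa> a b N p)"

text \<open>On a vector of weight at most \<open>r\<close> the factor that acts first already
  vanishes far out: b(N - j) for very negative j, a(j) for very large j.\<close>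

lemma NO_term_support:
  assumes "fld s a" "fld t b" "bnd r p"
  shows "{j. NO_term \<kappa> a b N p j \<noteq> 0} \<subseteq> {min 0 (N - r - t)..max 0 (r + s)}"
proof -
  have "NO_term \<kappa> a b N p j = 0" if "j < min 0 (N - r - t) \<or> j > max 0 (r + s)" for j
  proof -
    have "b (N - j) p = 0" if "j < N - r - t"
      using graded_bnd [OF fldD [OF assms(2)] assms(3), of "N - j"] bnd_negative that by force
    moreover have "a j p = 0" if "j > r + s"
      using graded_bnd [OF fldD [OF assms(1)] assms(3), of j] bnd_negative that by force
    ultimately show ?thesis
      using that lin_zero [OF fld_lin [OF assms(1)]] lin_zero [OF fld_lin [OF assms(2)]]
      by (auto simp: NO_term_def)
  qed
  then show ?thesis by (auto simp: not_le intro!: leI)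
qed

lemma NO_term_finite: "fld s a \<Longrightarrow> fld t b \<Longrightarrow> finite {j. NO_term \<kappa> a b N p j \<noteq> 0}"
  using bnd_exists [of p] NO_term_support finite_subset finite_atLeastAtMost_int by metis

lemma graded_NO: assumes "fld s a" "fld t b" "u = s + t - N" shows "graded u (NO \<kappa> a b N)"
  unfolding graded_def
proof (intro conjI allI impI plinI)
  note lins = fld_lin [OF assms(1)] fld_lin [OF assms(2)]
  note fin = NO_term_finite [OF assms(1,2)]
  show "NO \<kappa> a b N (p + q) = NO \<kappa> a b N p + NO \<kappa> a b N q" for p q
  proof -
    have "NO_term \<kappa> a b N (p + q) = (\<lambda>j. NO_term \<kappa> a b N p j + NO_term \<kappa> a b N q j)"
      by (auto simp: NO_term_def lin_add [OF lins(1)] lin_add [OF lins(2)] Pi.scale_right_distrib)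
    then show ?thesis by (simp add: NO_def Sum_any.distrib [OF fin fin])
  qed
  show "NO \<kappa> a b N (Pi_scale x p) = Pi_scale x (NO \<kappa> a b N p)" for x p
  proof -
    have "NO_term \<kappa> a b N (Pi_scale x p) = (\<lambda>j. Pi_scale x (NO_term \<kappa> a b N p j))"
      by (auto simp: NO_term_def lin_scale [OF lins(1)] lin_scale [OF lins(2)] mult.commute)
    then show ?thesis by (simp add: NO_def lin_Sum_any [OF Pi.linear_scale_self fin])
  qed
  fix r p assume "hom r p"
  have "hom (r + u) (NO_term \<kappa> a b N p j)" for j
  proof -
    have eqs: "r + (t - (N - j)) + (s - j) = r + u" "r + (s - j) + (t - (N - j)) = r + u"
      using assms(3) by simp_all
    then have "hom (r + u) (a j (b (N - j) p))" "hom (r + u) (b (N - j) (a j p))"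
      using graded_hom [OF fldD [OF assms(1)] graded_hom [OF fldD [OF assms(2)] \<open>hom r p\<close>], of "N - j" j]
        graded_hom [OF fldD [OF assms(2)] graded_hom [OF fldD [OF assms(1)] \<open>hom r p\<close>], of j "N - j"] by (simp_all only: eqs)
    then show ?thesis by (simp add: NO_term_def hom_scale)
  qed
  then show "hom (r + u) (NO \<kappa> a b N p)"
    unfolding NO_def by (rule hom_Sum_any)
qed

lemma fld_NO: "fld s a \<Longrightarrow> fld t b \<Longrightarrow> u = s + t + m \<Longrightarrow> fld u (\<lambda>n. NO \<kappa> a b (n - m))"
  unfolding fld_def [of u] by (intro allI graded_NO) simp_all

section \<open>Exponentials\<close>

text \<open>\<open>exp_coeff\<close> sums over all compositions of i. Here those of length r are
  collected, by recursion on the first part, so that commutators can be computed by induction on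
  r.\<close>

primrec comp_sum :: "(nat \<Rightarrow> Pi_vec \<Rightarrow> Pi_vec) \<Rightarrow> nat \<Rightarrow> nat \<Rightarrow> Pi_vec \<Rightarrow> Pi_vec" where
  "comp_sum a 0 i p = (if i = 0 then p else 0)"
| "comp_sum a (Suc r) i p = (\<Sum>j\<in>{1..i}. a j (comp_sum a r (i - j) p))"

lemma finite_compositions: "finite {js :: nat list. sum_list js = i \<and> 0 \<notin> set js}"
  and compositions_length: "sum_list js = i \<Longrightarrow> 0 \<notin> set js \<Longrightarrow> length js \<le> i" for js :: "nat list"
proof -
  show len: "length js \<le> i" if "sum_list js = i" "0 \<notin> set js" for js :: "nat list" and i
    using that by (induction js arbitrary: i) (force, fastforce)
  have "{js :: nat list. sum_list js = i \<and> 0 \<notin> set js} \<subseteq> {js. set js \<subseteq> {..i} \<and> length js \<le> i}"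
    using len member_le_sum_list by fastforce
  then show "finite {js :: nat list. sum_list js = i \<and> 0 \<notin> set js}"
    by (rule finite_subset) (simp add: finite_lists_length_le)
qed

lemma sum_compositions:
  assumes "\<And>j. plin (a j)"
  shows "(\<Sum>js | length js = r \<and> sum_list js = i \<and> 0 \<notin> set js. foldr a js p) = comp_sum a r i p"
proof (induction r arbitrary: i)
  case 0
  have "{js :: nat list. length js = 0 \<and> sum_list js = i \<and> 0 \<notin> set js} = (if i = 0 then {[]} else {})"
    by auto
  then show ?case by simp
next
  case (Suc r)
  let ?C = "\<lambda>r i. {js :: nat list. length js = r \<and> sum_list js = i \<and> 0 \<notin> set js}"
  have fin: "finite (?C r i)" for r i
    by (rule finite_subset [OF _ finite_compositions [of i]]) auto
  have eq: "?C (Suc r) i = (\<Union>j\<in>{1..i}. (#) j ` ?C r (i - j))" (is "_ = ?R")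
  proof
    show "?C (Suc r) i \<subseteq> ?R"
    proof
      fix js assume js: "js \<in> ?C (Suc r) i"
      then obtain j ks where "js = j # ks" by (cases js) auto
      with js show "js \<in> ?R" by (auto intro!: bexI [of _ j])
    qed
  qed auto
  have "(\<Sum>js\<in>?C (Suc r) i. foldr a js p) = (\<Sum>j\<in>{1..i}. \<Sum>js\<in>(#) j ` ?C r (i - j). foldr a js p)"
    unfolding eq by (rule sum.UNION_disjoint) (auto simp: fin)
  also have "\<dots> = (\<Sum>j\<in>{1..i}. \<Sum>js\<in>?C r (i - j). a j (foldr a js p))"
    by (simp add: sum.reindex)
  also have "\<dots> = comp_sum a (Suc r) i p"
    by (simp add: Suc.IH lin_sum [OF assms, symmetric])
  finally show ?case .
qed

lemma exp_coeff_eq: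
  assumes "\<And>j. plin (a j)"
  shows "exp_coeff a i p = (\<Sum>r\<le>i. Pi_scale (1 / fact r) (comp_sum a r i p))"
proof -
  let ?C = "{js :: nat list. sum_list js = i \<and> 0 \<notin> set js}"
  have "exp_coeff a i p = (\<Sum>r\<le>i. \<Sum>js | js \<in> ?C \<and> length js = r. Pi_scale (1 / fact (length js)) (foldr a js p))"
    unfolding exp_coeff_def using compositions_length
    by (intro sum.group [symmetric, where g = length]) (auto simp: finite_compositions)
  also have "\<dots> = (\<Sum>r\<le>i. \<Sum>js | length js = r \<and> sum_list js = i \<and> 0 \<notin> set js. Pi_scale (1 / fact r) (foldr a js p))"
    by (intro sum.cong) auto
  finally show ?thesis
    by (simp add: sum_compositions [OF assms] flip: lin_sum [OF Pi.linear_scale_self])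
qed

lemma comp_sum_large: "(\<And>j. plin (a j)) \<Longrightarrow> r > i \<Longrightarrow> comp_sum a r i p = 0"
proof (induction r arbitrary: i)
  case (Suc r)
  show ?case using Suc.prems Suc.IH [OF Suc.prems(1)] by (auto intro!: sum.neutral simp: lin_zero [OF Suc.prems(1)])
qed simp

lemma plin_sum: "(\<And>j. plin (A j)) \<Longrightarrow> plin (\<lambda>p. \<Sum>j\<in>S. A j p)"
  by (rule plinI) (simp_all add: lin_add [of Pi_scale Pi_scale] lin_scale [of Pi_scale Pi_scale] sum.distrib Pi.scale_sum_right)

lemma plin_comp_sum: "(\<And>j. plin (a j)) \<Longrightarrow> plin (comp_sum a r i)"
proof (induction r arbitrary: i)
  case 0
  then show ?case by (cases "i = 0") (simp_all add: plin_ident plin_zero cong: if_cong)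
next
  case (Suc r)
  have "plin (\<lambda>p. \<Sum>j\<in>{1..i}. a j (comp_sum a r (i - j) p))"
    by (rule plin_sum) (rule plin_comp [OF Suc.prems Suc.IH [OF Suc.prems]])
  then show ?case by simp
qed

lemma exp_coeff_eq': "(\<And>j. plin (a j)) \<Longrightarrow> exp_coeff a i = (\<lambda>p. \<Sum>r\<le>i. Pi_scale (1 / fact r) (comp_sum a r i p))"
  by (rule ext) (rule exp_coeff_eq)

lemma plin_exp_coeff: "(\<And>j. plin (a j)) \<Longrightarrow> plin (exp_coeff a i)"
  using plin_sum [of "\<lambda>r p. Pi_scale (1 / fact r) (comp_sum a r i p)" "{..i}"]
  by (simp add: exp_coeff_eq' [of a] plin_scaled plin_comp_sum)

lemma graded_sum: "(\<And>j. j \<in> S \<Longrightarrow> graded s (A j)) \<Longrightarrow> graded s (\<lambda>p. \<Sum>j\<in>S. A j p)"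
  by (induction S rule: infinite_finite_induct) (auto intro: graded_add graded_zero)

lemma graded_exp_coeff:
  assumes "\<And>j. graded (s * int j) (a j)"
  shows "graded (s * int i) (exp_coeff a i)"
proof -
  have "graded (s * int i) (comp_sum a r i)" for r i
  proof (induction r arbitrary: i)
    case 0
    then show ?case
      using graded_ident graded_zero by (cases "i = 0") (simp_all cong: if_cong)
  next
    case (Suc r)
    have "graded (s * int i) (\<lambda>p. \<Sum>j\<in>{1..i}. a j (comp_sum a r (i - j) p))"
      by (intro graded_sum graded_comp [OF assms Suc]) (auto simp: algebra_simps of_nat_diff)
    then show ?case by simp
  qed
  then have "graded (s * int i) (\<lambda>p. \<Sum>r\<le>i. Pi_scale (1 / fact r) (comp_sum a r i p))"
    by (intro graded_sum graded_scale)
  then show ?thesis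
    by (simp add: exp_coeff_eq' [of a] graded_lin [OF assms])
qed

lemma exp_coeff_commute:
  assumes "\<And>j. plin (a j)" "plin D" and "\<And>j p. j > 0 \<Longrightarrow> D (a j p) = a j (D p)"
  shows "D (exp_coeff a i p) = exp_coeff a i (D p)"
proof -
  have "D (comp_sum a r i p) = comp_sum a r i (D p)" for r
    by (induction r arbitrary: i) (simp_all add: lin_zero [OF assms(2)] lin_sum [OF assms(2)] assms(3))
  then show ?thesis
    by (simp add: exp_coeff_eq [OF assms(1)] lin_sum [OF assms(2)] lin_scale [OF assms(2)])
qed

text \<open>The rule [D, exp(sum a_j z^j)] = x z^q exp(sum a_j z^j) when [D, a_q] = x is the only
  nonzero commutator: products of length r contribute r times, and r / r! = 1 / (r - 1)!.\<close>

lemma exp_coeff_derivation: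
  assumes lin: "\<And>j. plin (a j)" "plin D" and "q > 0"
    and D: "\<And>j p. j > 0 \<Longrightarrow> D (a j p) = a j (D p) + (if j = q then Pi_scale x p else 0)"
  shows "D (exp_coeff a i p) = exp_coeff a i (D p) + (if q \<le> i then Pi_scale x (exp_coeff a (i - q) p) else 0)"
proof -
  have cs: "D (comp_sum a r i p) = comp_sum a r i (D p)
      + (if r > 0 \<and> q \<le> i then Pi_scale (x * of_nat r) (comp_sum a (r - 1) (i - q) p) else 0)" for r
  proof (induction r arbitrary: i)
    case 0
    then show ?case by (simp add: lin_zero [OF lin(2)])
  next
    case (Suc r)
    have "D (comp_sum a (Suc r) i p) = (\<Sum>j\<in>{1..i}. a j (D (comp_sum a r (i - j) p)))
      + (\<Sum>j\<in>{1..i}. if j = q then Pi_scale x (comp_sum a r (i - j) p) else 0)"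
      by (simp add: lin_sum [OF lin(2)] D sum.distrib)
    also have "(\<Sum>j\<in>{1..i}. if j = q then Pi_scale x (comp_sum a r (i - j) p) else 0)
        = (if q \<le> i then Pi_scale x (comp_sum a r (i - q) p) else 0)"
      using \<open>q > 0\<close> by (simp add: sum.delta)
    also have "(\<Sum>j\<in>{1..i}. a j (D (comp_sum a r (i - j) p))) = comp_sum a (Suc r) i (D p)
       + (\<Sum>j\<in>{1..i}. if r > 0 \<and> q \<le> i - j then Pi_scale (x * of_nat r) (a j (comp_sum a (r - 1) (i - j - q) p)) else 0)"
      by (subst Suc) (auto simp: lin_add [OF lin(1)] lin_scale [OF lin(1)] lin_zero [OF lin(1)] sum.distrib [symmetric] intro!: sum.cong)
    also have "(\<Sum>j\<in>{1..i}. if r > 0 \<and> q \<le> i - j then Pi_scale (x * of_nat r) (a j (comp_sum a (r - 1) (i - j - q) p)) else 0)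
       = (if q \<le> i then Pi_scale (x * of_nat r) (comp_sum a r (i - q) p) else 0)"
    proof (cases r)
      case (Suc r')
      have "(\<Sum>j\<in>{1..i}. if q \<le> i - j then Pi_scale y (a j (comp_sum a r' (i - j - q) p)) else 0)
        = (\<Sum>j\<in>{1..i - q}. Pi_scale y (a j (comp_sum a r' (i - q - j) p)))" if "q \<le> i" for y
        using that \<open>q > 0\<close> by (intro sum.mono_neutral_cong_right) (auto simp: diff_commute add.commute)
      moreover have "(\<Sum>j\<in>{1..i}. if q \<le> i - j then Pi_scale y (a j (comp_sum a r' (i - j - q) p)) else 0) = 0" if "\<not> q \<le> i" for y
        using that by (intro sum.neutral) auto
      ultimately show ?thesis by (simp add: Suc lin_sum [OF Pi.linear_scale_self] cong: if_cong)
    qed simp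
    finally show ?case
      by (simp add: distrib_left Pi.scale_left_distrib add_ac)
  qed
  show ?thesis
  proof (cases "q \<le> i")
    case True
    have "D (exp_coeff a i p) = (\<Sum>r\<le>i. Pi_scale (1 / fact r) (comp_sum a r i (D p)))
       + (\<Sum>r\<le>i. if r > 0 then Pi_scale (x * of_nat r / fact r) (comp_sum a (r - 1) (i - q) p) else 0)"
      unfolding sum.distrib [symmetric] exp_coeff_eq [OF lin(1)] lin_sum [OF lin(2)] lin_scale [OF lin(2)] cs
      using True by (intro sum.cong) (auto simp: Pi.scale_right_distrib)
    also have "(\<Sum>r\<le>i. if r > 0 then Pi_scale (x * of_nat r / fact r) (comp_sum a (r - 1) (i - q) p) else 0)
      = (\<Sum>r\<in>{1..i}. Pi_scale (x * of_nat r / fact r) (comp_sum a (r - 1) (i - q) p))"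
      by (intro sum.mono_neutral_cong_right) auto
    \<comment> \<open>The length is lowered by one against the factor r; afterwards the lengths
      above i - q drop out, since a composition of i - q has at most i - q parts.\<close>
    also have "\<dots> = (\<Sum>r\<in>{..i - 1}. Pi_scale (x / fact r) (comp_sum a r (i - q) p))"
      using True \<open>q > 0\<close>
      by (intro sum.reindex_bij_witness [where i = Suc and j = "\<lambda>r. r - 1"]) (auto simp: fact_reduce simp del: of_nat_Suc)
    also have "\<dots> = (\<Sum>r\<in>{..i - q}. Pi_scale (x / fact r) (comp_sum a r (i - q) p))"
      using True \<open>q > 0\<close> by (intro sum.mono_neutral_right) (auto simp: comp_sum_large lin)
    also have "\<dots> = Pi_scale x (exp_coeff a (i - q) p)"
      by (simp add: exp_coeff_eq [OF lin(1)] lin_sum [OF Pi.linear_scale_self])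
    finally show ?thesis
      using True by (simp add: exp_coeff_eq [OF lin(1)])
  next
    case False
    then show ?thesis
      by (simp add: exp_coeff_eq [OF lin(1)] lin_sum [OF lin(2)] lin_scale [OF lin(2)] cs cong: if_cong)
  qed
qed

lemma exp_coeff_0 [simp]: "(\<And>j. plin (a j)) \<Longrightarrow> exp_coeff a 0 p = p"
  by (simp add: exp_coeff_eq)

lemma exp_coeff_vanish:
  assumes "\<And>j. plin (a j)" and "\<And>j. 0 < j \<Longrightarrow> j \<le> i \<Longrightarrow> a j p = 0" and "i > 0"
  shows "exp_coeff a i p = 0"
proof -
  have "comp_sum a r i p = 0" if "\<And>j. 0 < j \<Longrightarrow> j \<le> i \<Longrightarrow> a j p = 0" "r > 0" for r i
    using that
  proof (induction r arbitrary: i)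
    case (Suc r)
    then show ?case
      by (cases "r = 0") (auto intro!: sum.neutral simp: lin_zero [OF assms(1)])
  qed simp
  moreover have "comp_sum a 0 i p = 0" using assms(3) by simp
  ultimately have "comp_sum a r i p = 0" for r using assms(2) by (cases "r = 0") auto
  then show ?thesis by (simp add: exp_coeff_eq [OF assms(1)])
qed

text \<open>In a composition of i with at least two parts, the part that acts first on
  \<open>p\<close> is below i and kills it; only the composition [i] remains.\<close>

lemma exp_coeff_last:
  assumes "\<And>j. plin (a j)" and "\<And>j. 0 < j \<Longrightarrow> j < i \<Longrightarrow> a j p = 0" and "i > 0"
  shows "exp_coeff a i p = a i p"
proof -
  have "comp_sum a r i p = 0" if "\<And>j. 0 < j \<Longrightarrow> j < i \<Longrightarrow> a j p = 0" "r > 1" for r i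
    using that
  proof (induction r arbitrary: i)
    case (Suc r)
    have "comp_sum a r (i - j) p = 0" if "j \<in> {1..i}" for j
    proof (cases "r = 1")
      case True
      have "a j' (comp_sum a 0 (i - j - j') p) = 0" if "j' \<in> {1..i - j}" for j'
        using that \<open>j \<in> {1..i}\<close> Suc.prems(1) [of j'] by (auto simp: lin_zero [OF assms(1)])
      then show ?thesis using True by (auto intro!: sum.neutral)
    next
      case False
      then show ?thesis using that Suc by auto
    qed
    then show ?case by (simp add: lin_zero [OF assms(1)])
  qed simp
  then have "Pi_scale (1 / fact r) (comp_sum a r i p) = (if r = 1 then comp_sum a 1 i p else 0)" for r
    using assms(2,3) by (cases "r = 0"; cases "r = 1") auto
  then have "exp_coeff a i p = comp_sum a 1 i p"
    using assms(3) by (simp add: exp_coeff_eq [OF assms(1)])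
  also have "\<dots> = (\<Sum>j\<in>{1..i}. if j = i then a i p else 0)"
    unfolding One_nat_def comp_sum.simps by (intro sum.cong) (auto simp: lin_zero [OF assms(1)])
  also have "\<dots> = a i p" using assms(3) by simp
  finally show ?thesis .
qed

section \<open>The shift operator and the two exponential factors of e^(nc)\<close>

lemma Pi_shift_single [simp]: "Pi_shift lam n (single m q)
   = single m (Polynomial.smult (lam powi n) (pcompose q [:- 2 * of_int n, 1:]))"
  by (simp add: Pi_shift_def)

lemma lookup_Pi_shift: "lookup (Pi_shift lam n p) m
   = Polynomial.smult (lam powi n) (pcompose (lookup p m) [:- 2 * of_int n, 1:])"
  by (simp add: Pi_shift_def lookup_map)

lemma plin_shift: "plin (Pi_shift lam n)"
  by (rule plinI) (auto intro!: poly_mapping_eqI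
    simp: lookup_Pi_shift lookup_add lookup_Pi_scale pcompose_add pcompose_smult smult_add_right mult.commute)

lemma graded_shift: "graded 0 (Pi_shift lam n)"
  by (rule gradedI [OF plin_shift]) (auto intro: hom_single)

lemma shift_heis_mult: "Pi_shift lam n (heis_mult x p) = heis_mult x (Pi_shift lam n p)"
  by (rule additive_eqI [of "\<lambda>p. Pi_shift lam n (heis_mult x p)" "\<lambda>p. heis_mult x (Pi_shift lam n p)"])
    (simp_all add: heis_mult_single lin_add [OF plin_shift] heis_mult_add)

lemma shift_heis_deriv: "Pi_shift lam n (heis_deriv x p) = heis_deriv x (Pi_shift lam n p)"
proof -
  have pc: "pcompose (of_nat c * q) r = of_nat c * pcompose q (r :: complex poly)" for c q r
    by (induction c) (simp_all add: distrib_right pcompose_add)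
  show ?thesis
    by (rule additive_eqI [of "\<lambda>p. Pi_shift lam n (heis_deriv x p)" "\<lambda>p. heis_deriv x (Pi_shift lam n p)"])
     (simp_all add: pc heis_deriv_single lin_add [OF plin_shift] heis_deriv_add)
qed

lemma Pi_c_shift: "Pi_c m (Pi_shift lam n p) = Pi_shift lam n (Pi_c m p)"
  by (cases m "0::int" rule: linorder_cases)
    (simp_all add: Pi_c_simps shift_heis_mult shift_heis_deriv lin_scale [OF plin_shift] lin_minus [OF plin_shift])

lemma Pi_d_shift: "Pi_d m (Pi_shift lam n p) = Pi_shift lam n (Pi_d m p) + (if m = 0 then Pi_scale (2 * of_int n) (Pi_shift lam n p) else 0)"
proof (cases m "0::int" rule: linorder_cases)
  case equal
  have *: "[:0, 1:] * Polynomial.smult x (pcompose q [:- y, 1:])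
      = Polynomial.smult x (pcompose ([:0, 1:] * q) [:- y, 1:]) + Polynomial.smult y (Polynomial.smult x (pcompose q [:- y, 1:]))"
    for x y :: complex and q
    by (simp add: pcompose_pCons smult_diff_right mult.commute [of y])
  show ?thesis
    unfolding equal
    by (rule poly_mapping_eqI)
     (simp only: lookup_Pi_d_0 lookup_add lookup_Pi_scale lookup_Pi_shift mult_minus_left * simp_thms if_True)
qed (simp_all add: Pi_d_simps shift_heis_mult shift_heis_deriv lin_scale [OF plin_shift])

text \<open>\<open>cr n i\<close> is the coefficient of z^i in the creation exponential exp(n sum
  c(-j)/j z^j), and \<open>an n l\<close> that of z^(-l) in exp(n sum c(j)/j z^(-j)). The integer
  index of \<open>cr\<close>, with value 0 below 0, absorbs the test in
  \<open>Pi_exp\<close>.\<close>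

definition cr :: "complex \<Rightarrow> int \<Rightarrow> Pi_vec \<Rightarrow> Pi_vec" where
  "cr n i p = (if i < 0 then 0 else exp_coeff (\<lambda>j. Pi_scale (n / of_nat j) \<circ> Pi_c (- int j)) (nat i) p)"

definition an :: "complex \<Rightarrow> nat \<Rightarrow> Pi_vec \<Rightarrow> Pi_vec" where
  "an n = exp_coeff (\<lambda>j. Pi_scale (n / of_nat j) \<circ> Pi_c (int j))"

lemma plin_scaled_c: "plin (Pi_scale x \<circ> Pi_c m)" "plin (\<lambda>p. Pi_scale x (Pi_c m p))"
  using plin_scaled [OF plin_c] by (simp_all add: comp_def)

lemma plin_cr: "plin (cr n i)" and plin_an: "plin (an n l)"
  unfolding an_def cr_def [abs_def] using plin_zero plin_exp_coeff [OF plin_scaled_c(1)]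
  by (cases "i < 0"; simp)+

lemma graded_cr: "graded i (cr n i)"
proof (cases "i < 0")
  case True
  then show ?thesis by (simp add: cr_def [abs_def] graded_zero)
next
  case False
  have "graded (1 * int (nat i)) (exp_coeff (\<lambda>j. Pi_scale (n / of_nat j) \<circ> Pi_c (- int j)) (nat i))"
    using graded_scale [OF fldD [OF fld_c], of "- int j" for j]
    by (intro graded_exp_coeff) (simp add: comp_def)
  then show ?thesis using False by (simp add: cr_def [abs_def])
qed

lemma graded_an: "graded (- int l) (an n l)"
proof -
  have "graded (- 1 * int l) (an n l)"
    unfolding an_def using graded_scale [OF fldD [OF fld_c], of "int j" for j]
    by (intro graded_exp_coeff) (simp add: comp_def graded_minus)
  then show ?thesis by simp
qed

lemma cr_0 [simp]: "cr n 0 p = p" and an_0 [simp]: "an n 0 p = p"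
  by (simp_all add: cr_def an_def plin_scaled_c)

lemma cr_negative: "i < 0 \<Longrightarrow> cr n i p = 0"
  by (simp add: cr_def)

lemma an_large: "bnd r p \<Longrightarrow> int l > r \<Longrightarrow> an n l p = 0"
  using graded_bnd [OF graded_an] bnd_negative by force

lemma Pi_c_an: "Pi_c m (an n l p) = an n l (Pi_c m p)"
  unfolding an_def
  by (rule exp_coeff_commute) (simp_all add: plin_scaled_c plin_c lin_scale [OF plin_c] Pi_c_commute)

lemma Pi_c_cr: "Pi_c m (cr n i p) = cr n i (Pi_c m p)"
proof (cases "i < 0")
  case False
  then show ?thesis unfolding cr_def
    using exp_coeff_commute [of "\<lambda>j. Pi_scale (n / of_nat j) \<circ> Pi_c (- int j)" "Pi_c m" "nat i" p]
    by (simp add: plin_scaled_c plin_c lin_scale [OF plin_c] Pi_c_commute)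
qed (simp add: cr_negative lin_zero [OF plin_c])

lemma Pi_d_Pi_c: "Pi_d n (Pi_c m p) = Pi_c m (Pi_d n p) - (if m + n = 0 then Pi_scale (2 * of_int m) p else 0)"
  by (simp add: Pi_c_Pi_d)

text \<open>[d(m), (n/m) c(-m)] = 2n for m > 0, and \<open>exp_coeff_derivation\<close> with q = m
  turns this into a shift of the index by m.\<close>

lemma Pi_d_cr: "Pi_d m (cr n i p) = cr n i (Pi_d m p) + (if m > 0 then Pi_scale (2 * n) (cr n (i - m) p) else 0)"
proof (cases "i < 0")
  case True
  then show ?thesis by (simp add: cr_negative lin_zero [OF plin_d])
next
  case False
  let ?a = "\<lambda>j. Pi_scale (n / of_nat j) \<circ> Pi_c (- int j)"
  show ?thesis
  proof (cases "m > 0")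
    case True
    have "Pi_d m (exp_coeff ?a (nat i) p) = exp_coeff ?a (nat i) (Pi_d m p)
       + (if nat m \<le> nat i then Pi_scale (2 * n) (exp_coeff ?a (nat i - nat m) p) else 0)"
    proof (rule exp_coeff_derivation)
      show "Pi_d m (?a j p) = ?a j (Pi_d m p) + (if j = nat m then Pi_scale (2 * n) p else 0)" if "j > 0" for j p
        using that by (auto simp: lin_scale [OF plin_d] Pi_d_Pi_c Pi.scale_right_diff_distrib)
    qed (use True in \<open>simp_all add: plin_scaled_c plin_d\<close>)
    then show ?thesis
      using True False by (auto simp: cr_def nat_diff_distrib)
  next
    case m: False
    have "Pi_d m (exp_coeff ?a (nat i) p) = exp_coeff ?a (nat i) (Pi_d m p)"
      using m by (intro exp_coeff_commute) (auto simp: plin_scaled_c plin_d lin_scale [OF plin_d] Pi_d_Pi_c)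
    then show ?thesis using m False by (simp add: cr_def)
  qed
qed

lemma Pi_d_an: "Pi_d m (an n l p) = an n l (Pi_d m p) + (if m < 0 \<and> - m \<le> int l then Pi_scale (- 2 * n) (an n (l - nat (- m)) p) else 0)"
proof (cases "m < 0")
  case True
  let ?a = "\<lambda>j. Pi_scale (n / of_nat j) \<circ> Pi_c (int j)"
  have "Pi_d m (exp_coeff ?a l p) = exp_coeff ?a l (Pi_d m p)
     + (if nat (- m) \<le> l then Pi_scale (- 2 * n) (exp_coeff ?a (l - nat (- m)) p) else 0)"
  proof (rule exp_coeff_derivation)
    show "Pi_d m (?a j p) = ?a j (Pi_d m p) + (if j = nat (- m) then Pi_scale (- 2 * n) p else 0)" if "j > 0" for j p
      using that by (auto simp: lin_scale [OF plin_d] Pi_d_Pi_c Pi.scale_right_diff_distrib)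
  qed (use True in \<open>simp_all add: plin_scaled_c plin_d\<close>)
  then show ?thesis using True by (auto simp: an_def nat_le_iff)
next
  case False
  then show ?thesis unfolding an_def
    using exp_coeff_commute [of "\<lambda>j. Pi_scale (n / of_nat j) \<circ> Pi_c (int j)" "Pi_d m" l p]
    by (simp add: plin_scaled_c plin_d lin_scale [OF plin_d] Pi_d_Pi_c)
qed

text \<open>\<open>an\<close> vanishes beyond the weight of the vector. The freedom in
  \<open>R\<close> lets two vectors of different weight be treated by sums of the same
  length.\<close>

lemma Pi_exp_eq_sum:
  assumes "bnd r p" "r \<le> int R"
  shows "Pi_exp lam n m p = (\<Sum>l\<le>R. Pi_shift lam n (cr (of_int n) (int l + n - m - 1) (an (- of_int n) l p)))"
proof -
  have *: "(let i = int l + n - m - 1 in if i < 0 then 0 else Pi_shift lam n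
       (exp_coeff (\<lambda>j. Pi_scale (of_int n / of_nat j) \<circ> Pi_c (- int j)) (nat i)
         (exp_coeff (\<lambda>j. Pi_scale (- of_int n / of_nat j) \<circ> Pi_c (int j)) l p)))
     = Pi_shift lam n (cr (of_int n) (int l + n - m - 1) (an (- of_int n) l p))" for l
    by (simp add: cr_def an_def Let_def lin_zero [OF plin_shift])
  show ?thesis
    unfolding Pi_exp_def *
    by (rule Sum_any.expand_superset)
      (use assms in \<open>force simp: an_large lin_zero [OF plin_cr] lin_zero [OF plin_shift] intro: ccontr\<close>)+
qed

lemma Pi_c_exp: "Pi_c k (Pi_exp lam n m p) = Pi_exp lam n m (Pi_c k p)"
proof -
  obtain r where r: "bnd r p" using bnd_exists by blast
  define R where "R = nat (\<bar>r\<bar> + \<bar>k\<bar>)"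
  have rk: "bnd (r - k) (Pi_c k p)" using graded_bnd [OF fldD [OF fld_c] r, of k] by simp
  have R: "r \<le> int R" "r - k \<le> int R" unfolding R_def by linarith+
  show ?thesis
    by (simp add: Pi_exp_eq_sum [OF r R(1)] Pi_exp_eq_sum [OF rk R(2)] lin_sum [OF plin_c] Pi_c_shift Pi_c_cr Pi_c_an)
qed

text \<open>The three signs of \<open>k\<close> have three sources: the creation exponential for k >
  0, the shift of the variable d for k = 0, the annihilation exponential for k < 0.\<close>

lemma Pi_d_exp: "Pi_d k (Pi_exp lam n m p) = Pi_exp lam n m (Pi_d k p) + Pi_scale (2 * of_int n) (Pi_exp lam n (m + k) p)"
proof -
  obtain r where r: "bnd r p" using bnd_exists by blast
  define R where "R = nat (\<bar>r\<bar> + \<bar>k\<bar>)"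
  have rk: "bnd (r - k) (Pi_d k p)" using graded_bnd [OF fldD [OF fld_d] r, of k] by simp
  have R: "r \<le> int R" "r - k \<le> int R" unfolding R_def by linarith+
  let ?f = "\<lambda>k l. Pi_shift lam n (cr (of_int n) (int l + n - (m + k) - 1) (an (- of_int n) l p))"
  \<comment> \<open>For k < 0 the commutator lowers the annihilation index l by -k; the guard
    removes the terms with l < -k, where natural subtraction would be wrong.\<close>
  let ?g = "\<lambda>l. (if k < 0 then if - k \<le> int l then ?f k (l - nat (- k)) else 0 else ?f k l)"
  have "Pi_d k (?f 0 l) = Pi_shift lam n (cr (of_int n) (int l + n - m - 1) (an (- of_int n) l (Pi_d k p))) + Pi_scale (2 * of_int n) (?g l)" for l
    by (cases k "0::int" rule: linorder_cases)
     (simp_all add: Pi_d_shift Pi_d_cr Pi_d_an lin_add [OF plin_cr] lin_add [OF plin_shift] lin_scale [OF plin_shift] lin_scale [OF plin_cr]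
         lin_zero [OF plin_shift] lin_zero [OF plin_cr] algebra_simps of_nat_diff)
  then have "Pi_d k (Pi_exp lam n m p) = Pi_exp lam n m (Pi_d k p) + Pi_scale (2 * of_int n) (\<Sum>l\<le>R. ?g l)"
    unfolding Pi_exp_eq_sum [OF r R(1)] Pi_exp_eq_sum [OF rk R(2)]
    by (simp add: lin_sum [OF plin_d] sum.distrib lin_sum [OF Pi.linear_scale_self])
  also have "(\<Sum>l\<le>R. ?g l) = Pi_exp lam n (m + k) p"
  proof (cases "k < 0")
    case True
    have "(\<Sum>l\<le>R. ?g l) = (\<Sum>l | l \<le> R \<and> - k \<le> int l. ?f k (l - nat (- k)))"
      using True by (simp add: sum.inter_filter [symmetric])
    also have "\<dots> = (\<Sum>l\<le>R - nat (- k). ?f k l)"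
      using True R
      by (intro sum.reindex_bij_witness [where i = "\<lambda>l. l + nat (- k)" and j = "\<lambda>l. l - nat (- k)"])
        (auto simp: R_def nat_le_iff le_diff_conv2 nat_mono)
    also have "\<dots> = Pi_exp lam n (m + k) p"
      using True by (intro Pi_exp_eq_sum [symmetric, OF r]) (auto simp: R_def)
    finally show ?thesis .
  qed (simp add: Pi_exp_eq_sum [OF r R(1)])
  finally show ?thesis .
qed

text \<open>The offset n - 1 combines the factor z^(-n), due to c(0) = -Id, with the convention that
  mode m is the coefficient of z^(-m-1).\<close>

lemma fld_exp: "fld (n - 1) (Pi_exp lam n)"
proof -
  have "graded (n - 1 - m) (Pi_exp lam n m)" for m
  proof -
    have gr: "graded (n - 1 - m) (\<lambda>p. Pi_shift lam n (cr (of_int n) (int l + n - m - 1) (an (- of_int n) l p)))" for l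
      by (rule graded_comp [OF graded_shift graded_comp [OF graded_cr graded_an refl]]) simp
    show ?thesis
      unfolding graded_def
    proof (intro conjI allI impI plinI)
      show "Pi_exp lam n m (p + q) = Pi_exp lam n m p + Pi_exp lam n m q" for p q
      proof -
        obtain r s where "bnd r p" "bnd s q" using bnd_exists by blast
        then have *: "bnd (max r s) p" "bnd (max r s) q" by (auto intro: bnd_mono)
        have R: "max r s \<le> int (nat (max r s))" by linarith
        show ?thesis
          unfolding Pi_exp_eq_sum [OF *(1) R] Pi_exp_eq_sum [OF *(2) R] Pi_exp_eq_sum [OF bnd_add [OF *] R]
          by (simp add: lin_add [OF graded_lin [OF gr]] sum.distrib)
      qed
      show "Pi_exp lam n m (Pi_scale x p) = Pi_scale x (Pi_exp lam n m p)" for x p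
      proof -
        obtain r where r: "bnd r p" using bnd_exists by blast
        then have rx: "bnd r (Pi_scale x p)" by (auto simp: bnd_def in_keys_iff lookup_Pi_scale)
        have R: "r \<le> int (nat r)" by linarith
        show ?thesis
          unfolding Pi_exp_eq_sum [OF r R] Pi_exp_eq_sum [OF rx R]
          by (simp add: lin_scale [OF graded_lin [OF gr]] Pi.scale_sum_right)
      qed
      show "hom (r + (n - 1 - m)) (Pi_exp lam n m p)" if "hom r p" for r p
      proof -
        have R: "r \<le> int (nat r)" by linarith
        show ?thesis
          unfolding Pi_exp_eq_sum [OF hom_imp_bnd [OF that] R] by (intro hom_sum graded_hom [OF gr that])
      qed
    qed
  qed
  then show ?thesis by (simp add: fld_def)
qed

section \<open>The vacuum vector and operators determined by their value on it\<close>

lemma Pi_c_1: "j > 0 \<Longrightarrow> Pi_c j 1 = 0" and Pi_d_1: "j > 0 \<Longrightarrow> Pi_d j 1 = 0"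
  using heis_deriv_single [of _ 0 1] by (simp_all add: Pi_c_simps Pi_d_simps)

lemma an_1: "an x l 1 = (if l = 0 then 1 else 0)"
  unfolding an_def by (auto simp: plin_scaled_c intro!: exp_coeff_vanish) (simp add: Pi_c_1)

lemma Pi_exp_1: "Pi_exp lam n m 1 = Pi_scale (lam powi n) (cr (of_int n) (n - m - 1) 1)"
proof -
  have "Pi_shift lam n 1 = Pi_scale (lam powi n) 1"
    by (simp add: one_pCons flip: single_one)
  moreover have "Pi_shift lam n (cr x i p) = cr x i (Pi_shift lam n p)" for x i p
  proof (cases "i < 0")
    case False
    then show ?thesis unfolding cr_def
      using exp_coeff_commute [of "\<lambda>j. Pi_scale (x / of_nat j) \<circ> Pi_c (- int j)" "Pi_shift lam n" "nat i" p]
      by (simp add: plin_scaled_c plin_shift lin_scale [OF plin_shift] Pi_c_shift)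
  qed (simp add: cr_negative lin_zero [OF plin_shift])
  ultimately show ?thesis
    using Pi_exp_eq_sum [of 0 1 0 lam n m] hom_imp_bnd [OF hom_1] by (simp add: an_1 lin_scale [OF plin_cr])
qed

lemma lookup_heis_mult_0: "lookup (heis_mult x q) 0 = 0"
proof (induction q rule: poly_mapping_single_induct)
  case (single m a)
  have "m + mon x \<noteq> 0"
    using wt_eq_0_iff [of "m + mon x"] by (cases x) (simp_all add: wt_add)
  then show ?case by (simp add: heis_mult_single lookup_single when_def)
qed (simp_all add: lin_zero [OF plin_heis_mult] heis_mult_add lookup_add)

lemma lookup_creation_0: "m < 0 \<Longrightarrow> lookup (Pi_c m q) 0 = 0" "m < 0 \<Longrightarrow> lookup (Pi_d m q) 0 = 0"
  by (simp_all add: Pi_c_simps Pi_d_simps lookup_heis_mult_0)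

lemma lookup_cr_0: "i \<noteq> 0 \<Longrightarrow> lookup (cr x i p) 0 = 0"
proof (cases "i < 0")
  case False
  assume "i \<noteq> 0"
  let ?a = "\<lambda>j. Pi_scale (x / of_nat j) \<circ> Pi_c (- int j)"
  have "lookup (comp_sum ?a r (nat i) p) 0 = 0" for r
    using False \<open>i \<noteq> 0\<close> by (cases r) (auto simp: lookup_sum lookup_Pi_scale lookup_creation_0)
  then show ?thesis
    by (simp add: cr_def False exp_coeff_eq plin_scaled_c lookup_sum lookup_Pi_scale)
qed (simp add: cr_negative)

lemma lookup_exp_0: "m < n - 1 \<Longrightarrow> lookup (Pi_exp lam n m p) 0 = 0"
proof -
  assume "m < n - 1"
  obtain r where "bnd r p" using bnd_exists by blast
  then show ?thesis
    using \<open>m < n - 1\<close> Pi_exp_eq_sum [of r p "nat r" lam n m]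
    by (simp add: lookup_sum lookup_Pi_shift lookup_cr_0)
qed

text \<open>The variables of \<open>Pi_vec\<close> are the c(-j) and d(-j), and d(0) multiplies
  coefficients by d, so these modes reach every monomial from 1.\<close>

lemma Pi_induct [consumes 0, case_names one add scale c d]:
  assumes one: "P 1" and add: "\<And>p q. P p \<Longrightarrow> P q \<Longrightarrow> P (p + q)" and scale: "\<And>a p. P p \<Longrightarrow> P (Pi_scale a p)"
    and c: "\<And>j p. j < 0 \<Longrightarrow> P p \<Longrightarrow> P (Pi_c j p)" and d: "\<And>j p. j \<le> 0 \<Longrightarrow> P p \<Longrightarrow> P (Pi_d j p)"
  shows "P p"
proof -
  have zero: "P 0" using scale [OF one, of 0] by simp
  have mult: "P (heis_mult x q)" if "P q" for x q
  proof (cases x)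
    case (cneg j)
    then show ?thesis using c [of "- int j - 1" q] that by (simp add: Pi_c_simps)
  next
    case (dneg j)
    then show ?thesis using d [of "- int j - 1" q] that by (simp add: Pi_d_simps)
  qed
  have base: "P (single 0 q)" for q
  proof (induction q)
    case (pCons a q)
    have "single 0 (pCons a q) = Pi_scale a 1 + Pi_d 0 (single 0 q)"
      by (simp add: one_pCons flip: single_one single_add)
    then show ?case using add [OF scale [OF one, of a] d [OF _ pCons(2), of 0]] by simp
  qed (simp add: zero)
  have "P (single m q)" for m q
  proof (induction "wt m" arbitrary: m rule: less_induct)
    case less
    show ?case
    proof (cases "m = 0")
      case False
      then obtain x where x: "lookup m x \<noteq> 0"
        by (metis lookup_zero poly_mapping_eqI)
      then have m: "m - mon x + mon x = m" by (rule mon_diff_add)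
      moreover have "wt (m - mon x) < wt (m - mon x + mon x)" by (cases x) (simp_all add: wt_add)
      ultimately have "P (single (m - mon x) q)" using less by simp
      then show ?thesis using mult m by (metis heis_mult_single)
    qed (simp add: base)
  qed
  then show ?thesis
    by (induction p rule: poly_mapping_single_induct) (auto simp: zero add)
qed

text \<open>Up to nonzero factors the positive modes are the partial derivatives in the two families
  of variables.\<close>

lemma vacuum_eq:
  assumes "\<And>j. j > 0 \<Longrightarrow> Pi_c j y = 0" and "\<And>j. j > 0 \<Longrightarrow> Pi_d j y = 0"
  shows "y = single 0 (lookup y 0)"
proof (rule poly_mapping_eqI)
  fix m
  show "lookup y m = lookup (single 0 (lookup y 0)) m"
  proof (cases "m = 0")
    case False
    then obtain x where x: "lookup m x \<noteq> 0"
      by (metis lookup_zero poly_mapping_eqI)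
    have "2 + 2 * complex_of_nat j \<noteq> 0" for j
      using of_nat_neq_0 [of "2 * j + 1", where 'a = complex] by simp
    then have "heis_deriv x y = 0"
      using assms(1) [of "int (var_index x)"] assms(2) [of "int (var_index x)"]
      by (cases x) (simp_all add: Pi_c_simps Pi_d_simps)
    then have "lookup y (m - mon x + mon x) = 0"
      using lookup_heis_deriv [of x y "m - mon x"] by (simp del: of_nat_Suc)
    then show ?thesis using False by (simp add: mon_diff_add [OF x] lookup_single when_def)
  qed simp
qed

text \<open>Like 1, the vector \<open>Y 1\<close> is killed by all positive modes, so it has weight
  0; its weight is also s, hence it vanishes when s is nonzero. As 1 generates the module,
  \<open>Y\<close> is zero. Applied to the difference of two operators with the same commutators,
  this proves the field identities below.\<close>

lemma schur:
  assumes Y: "graded s Y"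
    and c: "\<And>j p. Y (Pi_c j p) = Pi_c j (Y p)" and d: "\<And>j p. Y (Pi_d j p) = Pi_d j (Y p)"
    and "s = 0 \<Longrightarrow> Y 1 = 0"
  shows "Y p = 0"
proof -
  note lin = graded_lin [OF Y]
  have "Y 1 = 0"
  proof (cases "s = 0")
    case False
    have "Pi_c j (Y 1) = 0" "Pi_d j (Y 1) = 0" if "j > 0" for j
      using that c [of j 1] d [of j 1] by (simp_all add: Pi_c_1 Pi_d_1 lin_zero [OF lin])
    then have "Y 1 = single 0 (lookup (Y 1) 0)"
      by (rule vacuum_eq)
    moreover have "lookup (Y 1) 0 = 0"
      using graded_hom [OF Y hom_1] False hom_lookup_0 by force
    ultimately show ?thesis by simp
  qed (use assms in simp)
  then show ?thesis
    by (induction p rule: Pi_induct)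
      (simp_all add: lin_add [OF lin] lin_scale [OF lin] c d lin_zero [OF plin_c] lin_zero [OF plin_d])
qed

lemma plin_exp: "plin (Pi_exp lam n m)"
  by (rule fld_lin [OF fld_exp])

text \<open>On 1 both operators are creation exponentials in commuting modes. Moving d(j) out to the
  left leaves terms symmetric in the two operators but with shifted indices, so the induction is for
  all \<open>m\<close> and \<open>m'\<close>.\<close>

lemma Pi_exp_commute: "Pi_exp lam n m (Pi_exp lam n' m' p) = Pi_exp lam n' m' (Pi_exp lam n m p)"
proof (induction p arbitrary: m m' rule: Pi_induct)
  case one
  have *: "D (cr x i q) = cr x i (D q)" if "plin D" "\<And>j q. D (Pi_c j q) = Pi_c j (D q)" for D x i q
  proof (cases "i < 0")
    case False
    then show ?thesis unfolding cr_def using that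
      exp_coeff_commute [of "\<lambda>j. Pi_scale (x / of_nat j) \<circ> Pi_c (- int j)" D "nat i" q]
      by (simp add: plin_scaled_c lin_scale [OF that(1)])
  qed (simp add: cr_negative lin_zero [OF that(1)])
  show ?case
    unfolding Pi_exp_1 lin_scale [OF plin_exp]
    by (simp add: * [OF plin_exp Pi_c_exp [symmetric]] Pi_exp_1 lin_scale [OF plin_cr] mult.commute)
      (simp add: * [OF plin_cr Pi_c_cr [symmetric]])
next
  case (c j p)
  then show ?case by (simp flip: Pi_c_exp)
next
  case (d j p)
  have eq: "Pi_exp lam n m (Pi_exp lam n' m' (Pi_d j p))
    = Pi_d j (Pi_exp lam n m (Pi_exp lam n' m' p)) - Pi_scale (2 * of_int n) (Pi_exp lam n (m + j) (Pi_exp lam n' m' p))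
      - Pi_scale (2 * of_int n') (Pi_exp lam n m (Pi_exp lam n' (m' + j) p))" for n m n' m'
    by (simp add: Pi_d_exp lin_add [OF plin_exp] lin_scale [OF plin_exp])
  show ?case
    by (simp add: eq [of n m n' m'] eq [of n' m' n m] d(2) [of m m'] d(2) [of "m + j" m'] d(2) [of m "m' + j"])
qed (simp_all add: lin_add [OF plin_exp] lin_scale [OF plin_exp])

subsection \<open>Commutators with normally ordered sums\<close>

lemma NO_linear_comb:
  assumes "fld s a" "fld t b"
  shows "NO (\<lambda>j. x * \<kappa> j + y * \<kappa>' j) a b N p = Pi_scale x (NO \<kappa> a b N p) + Pi_scale y (NO \<kappa>' a b N p)"
proof -
  have "NO_term (\<lambda>j. x * \<kappa> j + y * \<kappa>' j) a b N p
    = (\<lambda>j. Pi_scale x (NO_term \<kappa> a b N p j) + Pi_scale y (NO_term \<kappa>' a b N p j))"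
    by (rule ext) (simp add: NO_term_def Pi.scale_left_distrib)
  moreover have "finite {j. Pi_scale x (NO_term \<kappa> a b N p j) \<noteq> 0}" for x \<kappa>
    by (rule finite_subset [OF _ NO_term_finite [OF assms]]) auto
  ultimately show ?thesis
    by (simp add: NO_def Sum_any.distrib lin_Sum_any [OF Pi.linear_scale_self NO_term_finite [OF assms]])
qed

lemma NO_scale_left: "fld s a \<Longrightarrow> fld t b \<Longrightarrow> NO \<kappa> (\<lambda>n p. Pi_scale x (a n p)) b N p = Pi_scale x (NO \<kappa> a b N p)"
  and NO_scale_right: "fld s a \<Longrightarrow> fld t b \<Longrightarrow> NO \<kappa> a (\<lambda>n p. Pi_scale x (b n p)) N p = Pi_scale x (NO \<kappa> a b N p)"
proof -
  assume a: "fld s a" and b: "fld t b"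
  have "NO_term \<kappa> (\<lambda>n p. Pi_scale x (a n p)) b N p = (\<lambda>j. Pi_scale x (NO_term \<kappa> a b N p j))"
    "NO_term \<kappa> a (\<lambda>n p. Pi_scale x (b n p)) N p = (\<lambda>j. Pi_scale x (NO_term \<kappa> a b N p j))"
    by (rule ext; simp add: NO_term_def lin_scale [OF fld_lin [OF a]] lin_scale [OF fld_lin [OF b]] mult.commute)+
  then show "NO \<kappa> (\<lambda>n p. Pi_scale x (a n p)) b N p = Pi_scale x (NO \<kappa> a b N p)"
    "NO \<kappa> a (\<lambda>n p. Pi_scale x (b n p)) N p = Pi_scale x (NO \<kappa> a b N p)"
    by (simp_all add: NO_def lin_Sum_any [OF Pi.linear_scale_self NO_term_finite [OF a b]])
qed

lemma NO_zero_left: "fld t b \<Longrightarrow> NO \<kappa> (\<lambda>n p. 0) b N p = 0"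
  and NO_zero_right: "fld s a \<Longrightarrow> NO \<kappa> a (\<lambda>n p. 0) N p = 0"
proof -
  show "NO \<kappa> (\<lambda>n p. 0) b N p = 0" if b: "fld t b"
    by (simp add: NO_def NO_term_def [abs_def] lin_zero [OF fld_lin [OF b]] cong: if_cong)
  show "NO \<kappa> a (\<lambda>n p. 0) N p = 0" if a: "fld s a"
    by (simp add: NO_def NO_term_def [abs_def] lin_zero [OF fld_lin [OF a]] cong: if_cong)
qed

lemma NO_delta_left:
  assumes "fld t b"
  shows "NO \<kappa> (\<lambda>n p. if n = q then Pi_scale x p else 0) b N p = Pi_scale (\<kappa> q * x) (b (N - q) p)"
proof -
  have "NO_term \<kappa> (\<lambda>n p. if n = q then Pi_scale x p else 0) b N p
      = (\<lambda>j. if j = q then Pi_scale (\<kappa> q * x) (b (N - q) p) else 0)"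
    by (rule ext) (simp add: NO_term_def lin_zero [OF fld_lin [OF assms]] lin_scale [OF fld_lin [OF assms]])
  then show ?thesis by (simp add: NO_def)
qed

lemma NO_delta_right:
  assumes "fld s a"
  shows "NO \<kappa> a (\<lambda>n p. if n = q then Pi_scale x p else 0) N p = Pi_scale (\<kappa> (N - q) * x) (a (N - q) p)"
proof -
  have "NO_term \<kappa> a (\<lambda>n p. if n = q then Pi_scale x p else 0) N p
      = (\<lambda>j. if j = N - q then Pi_scale (\<kappa> (N - q) * x) (a (N - q) p) else 0)"
    by (rule ext) (auto simp add: NO_term_def lin_zero [OF fld_lin [OF assms]] lin_scale [OF fld_lin [OF assms]])
  then show ?thesis by (simp add: NO_def)
qed

lemma fld_zero: "fld s (\<lambda>n p. 0)"
  by (simp add: fld_def graded_zero)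

lemma fld_delta: "fld q (\<lambda>n p. if n = q then Pi_scale x p else 0)"
  unfolding fld_def
proof
  show "graded (q - n) (\<lambda>p. if n = q then Pi_scale x p else 0)" for n
    using graded_scale [OF graded_ident] graded_zero by (cases "n = q") simp_all
qed

text \<open>Leibniz rule: a commutator acts on each product factor by factor and leaves the cut of
  the normal ordering where it is.\<close>

lemma NO_derivation:
  assumes D: "plin D" and a: "fld s a" and b: "fld t b" and a': "fld s' a'" and b': "fld t' b'"
    and Da: "\<And>j p. D (a j p) = a j (D p) + a' j p" and Db: "\<And>j p. D (b j p) = b j (D p) + b' j p"
  shows "D (NO \<kappa> a b N p) = NO \<kappa> a b N (D p) + NO \<kappa> a' b N p + NO \<kappa> a b' N p"
proof -
  have fin: "finite {j. NO_term \<kappa> a b N q j \<noteq> 0}" "finite {j. NO_term \<kappa> a' b N q j \<noteq> 0}" "finite {j. NO_term \<kappa> a b' N q j \<noteq> 0}" for q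
    using NO_term_finite a b a' b' by blast+
  have eq: "(\<lambda>j. D (NO_term \<kappa> a b N p j)) = (\<lambda>j. (NO_term \<kappa> a b N (D p) j + NO_term \<kappa> a' b N p j) + NO_term \<kappa> a b' N p j)"
    by (rule ext) (simp add: NO_term_def lin_scale [OF D] Da Db lin_add [OF fld_lin [OF a]] lin_add [OF fld_lin [OF b]]
        Pi.scale_right_distrib algebra_simps)
  have fin2: "finite {j. NO_term \<kappa> a b N (D p) j + NO_term \<kappa> a' b N p j \<noteq> 0}"
    by (rule finite_subset [OF _ finite_UnI [OF fin(1) [of "D p"] fin(2) [of p]]]) auto
  show ?thesis
    unfolding NO_def lin_Sum_any [OF D fin(1)] eq Sum_any.distrib [OF fin2 fin(3)] Sum_any.distrib [OF fin(1,2)] ..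
qed

lemma NO_commuting: "(\<And>i j p. a i (b j p) = b j (a i p)) \<Longrightarrow> NO \<kappa> a b N p = Sum_any (\<lambda>j. Pi_scale (\<kappa> j) (a j (b (N - j) p)))"
  by (simp add: NO_def NO_term_def [abs_def] cong: if_cong)

lemma Sum_any_shift: "Sum_any (\<lambda>j::int. f (m + j)) = (Sum_any f :: 'a::comm_monoid_add)"
  by (rule Sum_any.reindex_cong [symmetric, of "\<lambda>j. m + j"]) (auto simp: comp_def)

text \<open>For commuting fields both orderings agree, so a translation of the summation index moves
  only the weight \<kappa>.\<close>

lemma NO_shift_left:
  assumes "\<And>i j p. a i (b j p) = b j (a i p)"
  shows "NO \<kappa> (\<lambda>j. a (m + j)) b N p = NO (\<lambda>j. \<kappa> (j - m)) a b (m + N) p"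
  unfolding NO_commuting [of a, OF assms] NO_commuting [of "\<lambda>j. a (m + j)", OF assms]
  by (subst Sum_any_shift [of _ m, symmetric]) simp

lemma NO_shift_right: "NO \<kappa> a (\<lambda>j. b (m + j)) N p = NO \<kappa> a b (m + N) p"
  by (simp add: NO_def NO_term_def [abs_def] add_diff_eq cong: if_cong)

text \<open>The translation by one carries the cut past the single pair a(m), b(N + 1); exchanging
  these two modes costs one commutator.\<close>

lemma NO_shift_split:
  assumes a: "fld s a" and b: "fld t b"
  shows "NO (\<lambda>_. 1) (\<lambda>j. a (m + 1 + j)) b N p
     = NO (\<lambda>_. 1) (\<lambda>j. a (m + j)) b (N + 1) p + (a m (b (N + 1) p) - b (N + 1) (a m p))"
proof -
  let ?t = "NO_term (\<lambda>_. 1) (\<lambda>j. a (m + j)) b (N + 1) p"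
  let ?x = "a m (b (N + 1) p) - b (N + 1) (a m p)"
  have fin: "finite {j. ?t j \<noteq> 0}"
    by (rule NO_term_finite [OF fld_shift [OF a] b])
  have "NO_term (\<lambda>_. 1) (\<lambda>j. a (m + 1 + j)) b N p j = (\<lambda>j. ?t j + (if j = 0 then ?x else 0)) (1 + j)" for j
    by (cases "j = - 1") (auto simp: NO_term_def algebra_simps)
  then have "NO (\<lambda>_. 1) (\<lambda>j. a (m + 1 + j)) b N p = Sum_any (\<lambda>j. (\<lambda>j. ?t j + (if j = 0 then ?x else 0)) (1 + j))"
    by (simp add: NO_def)
  also have "\<dots> = Sum_any (\<lambda>j. ?t j + (if j = 0 then ?x else 0))"
    by (rule Sum_any_shift)
  also have "\<dots> = NO (\<lambda>_. 1) (\<lambda>j. a (m + j)) b (N + 1) p + ?x"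
    unfolding NO_def by (subst Sum_any.distrib [OF fin]) (auto intro: finite_subset [of _ "{0}"])
  finally show ?thesis .
qed

section \<open>The free field realization on \<open>\<Pi>\<^sub>\<lambda>\<close>\<close>

lemma fldD': "fld s a \<Longrightarrow> t = s - n \<Longrightarrow> graded t (a n)"
  by (simp add: fldD)

lemma scale_comb: "a = b + c * d \<Longrightarrow> Pi_scale a p = Pi_scale b p + Pi_scale c (Pi_scale d p)"
  by (simp add: Pi.scale_left_distrib)

definition dcoef :: "int \<Rightarrow> complex" where "dcoef j = of_int (- j - 1)"

lemma dcoef_0: "dcoef 0 = - 1"
  by (simp add: dcoef_def)

locale whittaker_parameters =
  fixes lam k :: complex
  assumes lam: "lam \<noteq> 0"
begin

abbreviation ep :: "Pi_vec field_modes" where "ep \<equiv> Pi_exp lam 1"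
abbreviation em :: "Pi_vec field_modes" where "em \<equiv> Pi_exp lam (- 1)"

definition nu :: "Pi_vec field_modes" where
  "nu n p = Pi_scale (1 / 2) (Pi_d n p) + Pi_scale (- k / 4) (Pi_c n p)"

definition hh :: "Pi_vec field_modes" where
  "hh n p = Pi_d n p + Pi_scale (k / 2) (Pi_c n p)"

text \<open>The modes of \<open>\<nu>(-1)e\<^bsup>-c\<^esup>\<close>, \<open>\<nu>(-1)\<^sup>2e\<^bsup>-c\<^esup>\<close> and \<open>\<nu>(-2)e\<^bsup>-c\<^esup>\<close>; \<open>gop\<close> is the part of \<open>f\<close> that acts on
  \<open>\<Pi>\<^sub>\<lambda>\<close> alone.\<close>

definition nem :: "Pi_vec field_modes" where "nem n = NO (\<lambda>_. 1) nu em (n - 1)"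
definition nnem :: "Pi_vec field_modes" where "nnem n = NO (\<lambda>_. 1) nu nem (n - 1)"
definition dnem :: "Pi_vec field_modes" where "dnem n = NO dcoef nu em (n - 2)"

definition gop :: "Pi_vec field_modes" where
  "gop n p = - nnem n p - Pi_scale (k + 1) (dnem n p)"

lemma fld_ep: "fld 0 ep" and fld_em: "fld (- 2) em"
  using fld_exp [of 1 lam] fld_exp [of "- 1" lam] by simp_all

lemma fld_nu: "fld 0 nu" and fld_hh: "fld 0 hh"
  unfolding nu_def [abs_def] hh_def [abs_def] by (intro fld_add fld_scale fld_c fld_d)+

lemma fld_nem: "fld (- 1) nem" and fld_dnem: "fld 0 dnem"
  unfolding nem_def [abs_def] dnem_def [abs_def] by (rule fld_NO [OF fld_nu fld_em], simp)+

lemma fld_nnem: "fld 0 nnem"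
  unfolding nnem_def [abs_def] by (rule fld_NO [OF fld_nu fld_nem], simp)

lemma fld_gop: "fld 0 gop"
  unfolding gop_def [abs_def] by (intro fld_diff fld_minus fld_scale fld_nnem fld_dnem)

lemmas plin_ops = plin_c plin_d fld_lin [OF fld_ep] fld_lin [OF fld_em] fld_lin [OF fld_nu] fld_lin [OF fld_hh]
  fld_lin [OF fld_nem] fld_lin [OF fld_nnem] fld_lin [OF fld_dnem] fld_lin [OF fld_gop]
lemmas ops_add = plin_ops [THEN lin_add]
lemmas ops_scale = plin_ops [THEN lin_scale]
lemmas ops_zero = plin_ops [THEN lin_zero]
lemmas ops_minus = plin_ops [THEN lin_minus]
lemmas ops_diff = plin_ops [THEN lin_diff]
lemmas ops_lin = ops_add ops_scale ops_zero ops_minus ops_diff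

abbreviation sc :: "bool \<Rightarrow> complex \<Rightarrow> Pi_vec \<Rightarrow> Pi_vec" where
  "sc b x p \<equiv> if b then Pi_scale x p else 0"

lemma c_ep: "Pi_c j (ep n p) = ep n (Pi_c j p)" and c_em: "Pi_c j (em n p) = em n (Pi_c j p)"
  by (rule Pi_c_exp)+

lemma d_ep: "Pi_d j (ep n p) = ep n (Pi_d j p) + Pi_scale 2 (ep (n + j) p)"
  and d_em: "Pi_d j (em n p) = em n (Pi_d j p) - Pi_scale 2 (em (n + j) p)"
  by (simp_all add: Pi_d_exp)

lemma c_nu: "Pi_c i (nu j p) = nu j (Pi_c i p) + sc (j = - i) (of_int i) p"
  by (auto simp: nu_def Pi_c_Pi_d ops_lin Pi_c_commute [of i j] Pi.scale_right_distrib eq_neg_iff_add_eq_0 add.commute)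

lemma d_nu: "Pi_d i (nu j p) = nu j (Pi_d i p) + sc (j = - i) (- (k / 2) * of_int i) p"
  by (auto simp: nu_def Pi_d_Pi_c ops_lin Pi_d_commute [of i j] Pi.scale_right_diff_distrib add_eq_0_iff2)

text \<open>The lattice elements mu and nu are orthogonal, so h passes through every nu in a
  normally ordered product.\<close>

lemma hh_nu: "hh i (nu j p) = nu j (hh i p)"
  unfolding hh_def c_nu d_nu ops_lin
  by (auto simp: Pi.scale_right_distrib algebra_simps)

text \<open>The constant is <nu, nu> = -k/2, twice the pairing of d/2 with -(k/4) c.\<close>

lemma nu_nu: "nu i (nu j p) = nu j (nu i p) + sc (j = - i) (- (k / 2) * of_int i) p"
proof -
  have "nu i (nu j p) = Pi_scale (1 / 2) (Pi_d i (nu j p)) + Pi_scale (- k / 4) (Pi_c i (nu j p))"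
    by (rule nu_def)
  also have "\<dots> = nu j (nu i p) + sc (j = - i) (- (k / 2) * of_int i) p"
    unfolding c_nu d_nu nu_def [of i p] ops_lin
    by (auto simp: Pi.scale_right_distrib algebra_simps simp flip: Pi.scale_left_distrib)
  finally show ?thesis .
qed

lemma nu_ep: "nu i (ep j p) = ep j (nu i p) + ep (j + i) p"
  and nu_em: "nu i (em j p) = em j (nu i p) - em (j + i) p"
  and hh_ep: "hh i (ep j p) = ep j (hh i p) + Pi_scale 2 (ep (j + i) p)"
  and hh_em: "hh i (em j p) = em j (hh i p) - Pi_scale 2 (em (j + i) p)"
  by (simp_all add: nu_def hh_def c_ep c_em d_ep d_em ops_lin Pi.scale_right_distrib Pi.scale_right_diff_distrib)

lemma ep_em: "ep i (em j p) = em j (ep i p)" and em_em: "em i (em j p) = em j (em i p)" and ep_ep: "ep i (ep j p) = ep j (ep i p)"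
  by (rule Pi_exp_commute)+

text \<open>The constant is <2 mu, 2 mu> = 2k, which is (h, h) = 2 at level k.\<close>

lemma hh_hh: "hh i (hh j p) = hh j (hh i p) + sc (j = - i) (2 * k * of_int i) p"
proof -
  have "hh i (hh j p) = Pi_d i (hh j p) + Pi_scale (k / 2) (Pi_c i (hh j p))"
    by (rule hh_def)
  also have "Pi_c i (hh j p) = hh j (Pi_c i p) + sc (j = - i) (2 * of_int i) p"
    by (auto simp: hh_def ops_lin Pi_c_Pi_d Pi_c_commute [of i j] eq_neg_iff_add_eq_0 add.commute)
  also have "Pi_d i (hh j p) = hh j (Pi_d i p) + sc (j = - i) (k * of_int i) p"
    by (auto simp: hh_def ops_lin Pi_d_Pi_c Pi_d_commute [of i j] add_eq_0_iff2 Pi.scale_right_diff_distrib)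
  also have "hh j (Pi_d i p) + sc (j = - i) (k * of_int i) p + Pi_scale (k / 2) (hh j (Pi_c i p) + sc (j = - i) (2 * of_int i) p)
     = hh j (hh i p) + sc (j = - i) (2 * k * of_int i) p"
  proof -
    have *: "sc (j = - i) (2 * k * of_int i) p = sc (j = - i) (k * of_int i) p + Pi_scale (k / 2) (sc (j = - i) (2 * of_int i) p)"
    proof (cases "j = - i")
      case True
      show ?thesis unfolding if_P [OF True] by (rule scale_comb) simp
    qed simp
    have "hh j (hh i p) = hh j (Pi_d i p) + Pi_scale (k / 2) (hh j (Pi_c i p))"
      by (simp only: hh_def [of i p] ops_add ops_scale)
    then show ?thesis unfolding * by (simp only: Pi.scale_right_distrib add_ac)
  qed
  finally show ?thesis .
qed

subsection \<open>Products of \<open>e\<^bsup>c\<^esup>\<close> and \<open>e\<^bsup>-c\<^esup>\<close>\<close>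

lemma Pi_exp_1_top: "Pi_exp lam n (n - 1) 1 = Pi_scale (lam powi n) 1"
  and Pi_exp_1_large: "m \<ge> n \<Longrightarrow> Pi_exp lam n m 1 = 0"
  by (simp_all add: Pi_exp_1 cr_negative)

lemma ep_0_1: "ep 0 1 = Pi_scale lam 1" and em_m2_1: "em (- 2) 1 = Pi_scale (1 / lam) 1"
  and ep_1: "m > 0 \<Longrightarrow> ep m 1 = 0" and em_1: "m > - 2 \<Longrightarrow> em m 1 = 0"
  using Pi_exp_1_top [of 1] Pi_exp_1_top [of "- 1"] Pi_exp_1_large [of 1 m] Pi_exp_1_large [of "- 1" m]
  by (simp_all add: field_simps)

lemma NO_ep_em_1: "NO \<kappa> ep em (- 2) 1 = Pi_scale (\<kappa> 0) 1"
proof -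
  have "NO_term \<kappa> ep em (- 2) 1 = (\<lambda>j. if j = 0 then Pi_scale (\<kappa> 0) 1 else 0)"
    using lam by (intro ext) (simp add: NO_term_def ep_1 em_1 ops_lin ep_0_1 em_m2_1)
  then show ?thesis by (simp add: NO_def)
qed

text \<open>The field identity e^c(z) e^(-c)(z) = 1, in which N = -2 is the coefficient of z^0. The
  commutators of d with the two factors cancel, so \<open>schur\<close> applies; on 1 only ep(0)
  em(-2) contributes.\<close>

lemma NO_ep_em: "NO (\<lambda>_. 1) ep em N p = (if N = - 2 then p else 0)"
proof -
  let ?Y = "\<lambda>p. NO (\<lambda>_. 1) ep em N p - (if N = - 2 then p else 0)"
  have "graded (0 + -2 - N) (\<lambda>p. if N = - 2 then p else 0)"
    using graded_ident graded_zero by (cases "N = - 2") simp_all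
  then have gr: "graded (0 + -2 - N) ?Y"
    using graded_NO [OF fld_ep fld_em refl] by (intro graded_diff)
  have c: "Pi_c j (NO (\<lambda>_. 1) ep em N p) = NO (\<lambda>_. 1) ep em N (Pi_c j p)" for j p
    using NO_derivation [OF plin_c fld_ep fld_em fld_zero fld_zero, of j _ N p]
    by (simp add: c_ep c_em NO_zero_left [OF fld_em] NO_zero_right [OF fld_ep])
  have d: "Pi_d j (NO (\<lambda>_. 1) ep em N p) = NO (\<lambda>_. 1) ep em N (Pi_d j p)" for j p
  proof -
    have "Pi_d j (NO (\<lambda>_. 1) ep em N p) = NO (\<lambda>_. 1) ep em N (Pi_d j p)
       + NO (\<lambda>_. 1) (\<lambda>n p. Pi_scale 2 (ep (j + n) p)) em N p + NO (\<lambda>_. 1) ep (\<lambda>n p. Pi_scale (- 2) (em (j + n) p)) N p"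
      by (rule NO_derivation [OF plin_d fld_ep fld_em fld_scale [OF fld_shift [OF fld_ep]] fld_scale [OF fld_shift [OF fld_em]]])
        (simp_all add: d_ep d_em add.commute)
    also have "\<dots> = NO (\<lambda>_. 1) ep em N (Pi_d j p)"
      unfolding NO_scale_left [OF fld_shift [OF fld_ep] fld_em] NO_scale_right [OF fld_ep fld_shift [OF fld_em]]
        NO_shift_right NO_shift_left [of ep em, OF ep_em] by simp
    finally show ?thesis .
  qed
  have "?Y p = 0"
    by (rule schur [OF gr]) (auto simp: c d ops_lin NO_ep_em_1)
  then show ?thesis by simp
qed

text \<open>The field identity (e^c)'(z) e^(-c)(z) = c(z). As \<open>dcoef\<close> is linear in the
  mode, the two commutators with d(j) leave 2j times the product of \<open>NO_ep_em\<close>, just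
  what [d(j), c(-j)] gives.\<close>

lemma NO_ep_em_deriv: "NO dcoef ep em N p = Pi_c (N + 2) p"
proof -
  let ?Y = "\<lambda>p. NO dcoef ep em N p - Pi_c (N + 2) p"
  have "graded (0 + -2 - N) (Pi_c (N + 2))"
    by (rule fldD' [OF fld_c]) simp
  then have gr: "graded (0 + -2 - N) ?Y"
    by (intro graded_diff graded_NO [OF fld_ep fld_em refl])
  have c: "Pi_c j (NO dcoef ep em N p) = NO dcoef ep em N (Pi_c j p)" for j p
    using NO_derivation [OF plin_c fld_ep fld_em fld_zero fld_zero, of j _ N p]
    by (simp add: c_ep c_em NO_zero_left [OF fld_em] NO_zero_right [OF fld_ep])
  have d: "Pi_d j (NO dcoef ep em N p) = NO dcoef ep em N (Pi_d j p) + (if j + N = - 2 then Pi_scale (2 * of_int j) p else 0)" for j p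
  proof -
    have "Pi_d j (NO dcoef ep em N p) = NO dcoef ep em N (Pi_d j p)
       + NO dcoef (\<lambda>n p. Pi_scale 2 (ep (j + n) p)) em N p + NO dcoef ep (\<lambda>n p. Pi_scale (- 2) (em (j + n) p)) N p"
      by (rule NO_derivation [OF plin_d fld_ep fld_em fld_scale [OF fld_shift [OF fld_ep]] fld_scale [OF fld_shift [OF fld_em]]])
        (simp_all add: d_ep d_em add.commute)
    also have "\<dots> = NO dcoef ep em N (Pi_d j p) + NO (\<lambda>i. 2 * dcoef (i - j) + (- 2) * dcoef i) ep em (j + N) p"
      unfolding NO_linear_comb [OF fld_ep fld_em] NO_scale_left [OF fld_shift [OF fld_ep] fld_em]
        NO_scale_right [OF fld_ep fld_shift [OF fld_em]] NO_shift_right NO_shift_left [of ep em, OF ep_em] by (simp only: add.assoc)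
    also have "NO (\<lambda>i. 2 * dcoef (i - j) + (- 2) * dcoef i) ep em (j + N) p = NO (\<lambda>i. 2 * of_int j * 1 + 0 * 1) ep em (j + N) p"
      by (rule arg_cong [of _ _ "\<lambda>\<kappa>. NO \<kappa> ep em (j + N) p"]) (simp add: dcoef_def fun_eq_iff right_diff_distrib)
    finally show ?thesis
      unfolding NO_linear_comb [OF fld_ep fld_em] by (simp add: NO_ep_em add.assoc)
  qed
  have Yd: "?Y (Pi_d j p) = Pi_d j (?Y p)" for j p
  proof (cases "j = - N - 2")
    case True
    have "Pi_scale (2 * of_int j) p = - Pi_scale (2 * of_int (N + 2)) p"
      unfolding True Pi.scale_minus_left [symmetric] by simp
    then show ?thesis
      using True by (simp add: ops_diff d Pi_d_Pi_c)
  next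
    case False
    then show ?thesis by (simp add: ops_diff d Pi_d_Pi_c)
  qed
  have "?Y p = 0"
    by (rule schur [OF gr _ Yd]) (simp_all add: c ops_diff NO_ep_em_1 Pi_c_commute Pi_c_simps dcoef_0)
  then show ?thesis by simp
qed

end

lemma NO_add_right:
  assumes a: "fld s a" and b: "fld t b" and b': "fld t' b'"
  shows "NO \<kappa> a (\<lambda>n p. b n p + b' n p) N p = NO \<kappa> a b N p + NO \<kappa> a b' N p"
proof -
  have "NO_term \<kappa> a (\<lambda>n p. b n p + b' n p) N p = (\<lambda>j. NO_term \<kappa> a b N p j + NO_term \<kappa> a b' N p j)"
    by (rule ext) (simp add: NO_term_def lin_add [OF fld_lin [OF a]] Pi.scale_right_distrib)
  then show ?thesis
    by (simp add: NO_def Sum_any.distrib [OF NO_term_finite [OF a b] NO_term_finite [OF a b']])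
qed

lemmas group_ac = add_ac add_diff_eq diff_add_eq diff_diff_eq diff_diff_eq2 eq_diff_eq diff_eq_eq

section \<open>Commutators of the constituents of f with c, nu, h and e\<close>

context whittaker_parameters
begin

lemma NO_nu_commutator:
  assumes D: "plin D" and b: "fld t b" and b': "fld t' b'"
    and Dnu: "\<And>j p. D (nu j p) = nu j (D p) + sc (j = - i) x p" and Db: "\<And>j p. D (b j p) = b j (D p) + b' j p"
  shows "D (NO \<kappa> nu b N p) = NO \<kappa> nu b N (D p) + Pi_scale (\<kappa> (- i) * x) (b (N + i) p) + NO \<kappa> nu b' N p"
  using NO_derivation [OF D fld_nu b fld_delta b' Dnu Db] by (simp add: NO_delta_left [OF b])

lemma c_nem: "Pi_c i (nem n p) = nem n (Pi_c i p) + Pi_scale (of_int i) (em (n + i - 1) p)"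
  unfolding nem_def
  by (subst NO_nu_commutator [OF plin_c fld_em fld_zero c_nu])
    (simp_all add: c_em NO_zero_right [OF fld_nu] algebra_simps)

lemma nu_nem: "nu i (nem n p) = nem n (nu i p) - nem (n + i) p + Pi_scale (- (k / 2) * of_int i) (em (n + i - 1) p)"
proof -
  have "nu i (nem n p) = nem n (nu i p) + Pi_scale (1 * (- (k / 2) * of_int i)) (em (n - 1 + i) p)
    + NO (\<lambda>_. 1) nu (\<lambda>j p. Pi_scale (- 1) (em (i + j) p)) (n - 1) p"
    unfolding nem_def
    by (rule NO_nu_commutator [OF plin_ops(5) fld_em fld_scale [OF fld_shift [OF fld_em]] nu_nu])
      (simp add: nu_em add.commute)
  then show ?thesis
    unfolding NO_scale_right [OF fld_nu fld_shift [OF fld_em]] NO_shift_right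
    by (simp add: nem_def algebra_simps)
qed

lemma hh_nu': "hh i (nu j p) = nu j (hh i p) + sc (j = - i) 0 p"
  by (simp add: hh_nu)

lemma hh_NO_nu:
  assumes b: "fld t b" and "\<And>j p. hh i (b j p) = b j (hh i p) - Pi_scale 2 (b (j + i) p)"
  shows "hh i (NO \<kappa> nu b N p) = NO \<kappa> nu b N (hh i p) - Pi_scale 2 (NO \<kappa> nu b (N + i) p)"
proof -
  have "hh i (NO \<kappa> nu b N p) = NO \<kappa> nu b N (hh i p) + Pi_scale (\<kappa> (- i) * 0) (b (N + i) p)
    + NO \<kappa> nu (\<lambda>j p. Pi_scale (- 2) (b (i + j) p)) N p"
    by (rule NO_nu_commutator [OF plin_ops(6) b fld_scale [OF fld_shift [OF b]] hh_nu'])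
      (simp add: assms add.commute)
  then show ?thesis
    unfolding NO_scale_right [OF fld_nu fld_shift [OF b]] NO_shift_right
    by (simp add: add.commute)
qed

lemma hh_nem: "hh i (nem n p) = nem n (hh i p) - Pi_scale 2 (nem (n + i) p)"
  unfolding nem_def hh_NO_nu [OF fld_em hh_em] by (simp add: algebra_simps)

lemma hh_nnem: "hh i (nnem n p) = nnem n (hh i p) - Pi_scale 2 (nnem (n + i) p)"
  unfolding nnem_def hh_NO_nu [OF fld_nem hh_nem] by (simp add: algebra_simps)

lemma hh_dnem: "hh i (dnem n p) = dnem n (hh i p) - Pi_scale 2 (dnem (n + i) p)"
  unfolding dnem_def hh_NO_nu [OF fld_em hh_em] by (simp add: algebra_simps)

lemma hh_gop: "hh i (gop n p) = gop n (hh i p) - Pi_scale 2 (gop (n + i) p)"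
  unfolding gop_def ops_lin hh_nnem hh_dnem
  by (simp add: Pi.scale_right_diff_distrib Pi.scale_left_commute del: Pi.scale_scale)

lemma nu_nnem: "nu i (nnem n p) = nnem n (nu i p) - nnem (n + i) p + Pi_scale (- k * of_int i) (nem (n + i - 1) p)"
proof -
  let ?x = "- (k / 2) * of_int i"
  have "nu i (nnem n p) = nnem n (nu i p) + Pi_scale (1 * ?x) (nem (n - 1 + i) p)
    + NO (\<lambda>_. 1) nu (\<lambda>j p. Pi_scale (- 1) (nem (i + j) p) + Pi_scale ?x (em (i - 1 + j) p)) (n - 1) p"
    unfolding nnem_def
    by (rule NO_nu_commutator [OF plin_ops(5) fld_nem _ nu_nu, of "- 1 - i"])
      (use fld_shift [OF fld_nem, of i] fld_shift [OF fld_em, of "i - 1"]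
       in \<open>auto simp: nu_nem algebra_simps intro!: fld_add fld_diff fld_scale fld_minus\<close>)
  also have "NO (\<lambda>_. 1) nu (\<lambda>j p. Pi_scale (- 1) (nem (i + j) p) + Pi_scale ?x (em (i - 1 + j) p)) (n - 1) p
     = Pi_scale (- 1) (nnem (n + i) p) + Pi_scale ?x (nem (n + i - 1) p)"
    unfolding NO_add_right [OF fld_nu fld_scale [OF fld_shift [OF fld_nem]] fld_scale [OF fld_shift [OF fld_em]]]
      NO_scale_right [OF fld_nu fld_shift [OF fld_em]] NO_scale_right [OF fld_nu fld_shift [OF fld_nem]] NO_shift_right
    by (simp add: nem_def nnem_def algebra_simps)
  finally show ?thesis
    by (simp add: algebra_simps flip: Pi.scale_left_distrib)
qed

lemma nu_dnem: "nu i (dnem n p) = dnem n (nu i p) - dnem (n + i) p + Pi_scale (- (k / 2) * of_int i * of_int (i - 1)) (em (n + i - 2) p)"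
proof -
  have "nu i (dnem n p) = dnem n (nu i p) + Pi_scale (dcoef (- i) * (- (k / 2) * of_int i)) (em (n - 2 + i) p)
    + NO dcoef nu (\<lambda>j p. Pi_scale (- 1) (em (i + j) p)) (n - 2) p"
    unfolding dnem_def
    by (rule NO_nu_commutator [OF plin_ops(5) fld_em fld_scale [OF fld_shift [OF fld_em]] nu_nu])
      (simp add: nu_em add.commute)
  moreover have "dcoef (- i) * (- (k / 2) * of_int i) = - (k / 2) * of_int i * of_int (i - 1)"
    by (simp add: dcoef_def algebra_simps)
  moreover have "n - 2 + i = n + i - 2" "i + (n - 2) = n + i - 2" by simp_all
  ultimately show ?thesis
    unfolding NO_scale_right [OF fld_nu fld_shift [OF fld_em]] NO_shift_right
    by (simp add: dnem_def)
qed

text \<open>The correction terms in \<open>nem\<close> and \<open>em\<close> come from contracting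
  nu with the nu inside f. They enter the sums that produce the central term of
  [f(m), f(n)].\<close>

lemma nu_gop: "nu i (gop n p) = gop n (nu i p) - gop (n + i) p + Pi_scale (k * of_int i) (nem (n + i - 1) p)
   + Pi_scale ((k + 1) * (k / 2) * of_int i * of_int (i - 1)) (em (n + i - 2) p)"
proof -
  have "Pi_scale (- k * of_int i) q = - Pi_scale (k * of_int i) q" for q
    by simp
  moreover have "Pi_scale (k + 1) (Pi_scale (- (k / 2) * of_int i * of_int (i - 1)) q)
      = - Pi_scale ((k + 1) * (k / 2) * of_int i * of_int (i - 1)) q" for q
    unfolding Pi.scale_scale Pi.scale_minus_left [symmetric] by simp
  ultimately show ?thesis
    unfolding gop_def ops_lin nu_nnem nu_dnem Pi.scale_right_diff_distrib Pi.scale_right_distrib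
    by (simp add: group_ac)
qed

lemma ep_nu: "ep a (nu j p) = nu j (ep a p) + Pi_scale (- 1) (ep (a + j) p)"
  and em_nu: "em a (nu j p) = nu j (em a p) + em (a + j) p"
  by (simp_all add: nu_ep nu_em)

lemma ep_shift: "fld (0 - a) (\<lambda>j p. Pi_scale x (ep (a + j) p))"
  by (rule fld_scale [OF fld_shift [OF fld_ep]])

text \<open>Contracting nu with e^c leaves -e^c(z) e^(-c)(z) = -1.\<close>

lemma ep_nem: "ep a (nem n p) = nem n (ep a p) + sc (n = - 1 - a) (- 1) p"
proof -
  have "ep a (nem n p) = nem n (ep a p) + NO (\<lambda>_. 1) (\<lambda>j p. Pi_scale (- 1) (ep (a + j) p)) em (n - 1) p
     + NO (\<lambda>_. 1) nu (\<lambda>_ _. 0) (n - 1) p"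
    unfolding nem_def
    by (rule NO_derivation [where D = "ep a" and a' = "\<lambda>j p. Pi_scale (- 1) (ep (a + j) p)" and b' = "\<lambda>_ _. 0",
          OF plin_exp fld_nu fld_em ep_shift fld_zero]) (simp_all add: ep_nu ep_em)
  also have "\<dots> = nem n (ep a p) + sc (n = - 1 - a) (- 1) p"
    unfolding NO_scale_left [OF fld_shift [OF fld_ep] fld_em] NO_shift_left [of ep em, OF ep_em] NO_ep_em
      NO_zero_right [OF fld_nu] by auto
  finally show ?thesis .
qed

lemma NO_dcoef_shift:
  assumes "fld s a" "fld t b"
  shows "NO (\<lambda>j. dcoef (j - m)) a b N p = NO dcoef a b N p + Pi_scale (of_int m) (NO (\<lambda>_. 1) a b N p)"
proof -
  have "(\<lambda>j. dcoef (j - m)) = (\<lambda>j. 1 * dcoef j + of_int m * 1)"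
    by (simp add: dcoef_def fun_eq_iff)
  then show ?thesis using NO_linear_comb [OF assms, of 1 dcoef "of_int m" "\<lambda>_. 1"] by simp
qed

text \<open>Contracting nu with e^c leaves e^c(z) e^(-c)(z) with the weights of a derivative;
  translating the index by a splits it into \<open>NO_ep_em_deriv\<close> and a times
  \<open>NO_ep_em\<close>.\<close>

lemma ep_dnem: "ep a (dnem n p) = dnem n (ep a p) - Pi_c (a + n) p - sc (n = - a) (of_int a) p"
proof -
  have "ep a (dnem n p) = dnem n (ep a p) + NO dcoef (\<lambda>j p. Pi_scale (- 1) (ep (a + j) p)) em (n - 2) p
     + NO dcoef nu (\<lambda>_ _. 0) (n - 2) p"
    unfolding dnem_def
    by (rule NO_derivation [where D = "ep a" and a' = "\<lambda>j p. Pi_scale (- 1) (ep (a + j) p)" and b' = "\<lambda>_ _. 0",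
          OF plin_exp fld_nu fld_em ep_shift fld_zero]) (simp_all add: ep_nu ep_em)
  also have "\<dots> = dnem n (ep a p) - Pi_c (a + n) p - sc (n = - a) (of_int a) p"
    unfolding NO_scale_left [OF fld_shift [OF fld_ep] fld_em] NO_shift_left [of ep em, OF ep_em] NO_dcoef_shift [OF fld_ep fld_em]
      NO_ep_em NO_ep_em_deriv NO_zero_right [OF fld_nu] by (auto simp: algebra_simps)
  finally show ?thesis .
qed

lemma nu_1: "j > 0 \<Longrightarrow> nu j 1 = 0" and hh_1: "j > 0 \<Longrightarrow> hh j 1 = 0"
  by (simp_all add: nu_def hh_def Pi_c_1 Pi_d_1)

lemma NO_nu_em_1:
  assumes "N \<ge> - 2"
  shows "NO \<kappa> nu em N 1 = Pi_scale (\<kappa> 0) (em N (nu 0 1))"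
proof -
  have "NO_term \<kappa> nu em N 1 = (\<lambda>j. if j = 0 then Pi_scale (\<kappa> 0) (em N (nu 0 1)) else 0)"
    using assms by (intro ext) (auto simp: NO_term_def nu_1 em_1 ops_zero)
  then show ?thesis by (simp add: NO_def)
qed

lemma nem_1: "m \<ge> - 1 \<Longrightarrow> nem m 1 = em (m - 1) (nu 0 1)"
  by (simp add: nem_def NO_nu_em_1)

lemma em_nu_0_1: "em (- 2) (nu 0 1) = Pi_scale (1 / lam) (nu 0 1) + Pi_scale (1 / lam) 1"
  by (simp add: em_nu em_m2_1 ops_scale)

lemma em_nu_0_1_large: "m > - 2 \<Longrightarrow> em m (nu 0 1) = 0"
  by (simp add: em_nu em_1 ops_zero)

lemma nem_1_large: "m \<ge> 0 \<Longrightarrow> nem m 1 = 0"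
  by (simp add: nem_1 em_nu_0_1_large)

text \<open>h differs from d by a multiple of c, so together with c it determines the commutators
  with d.\<close>

lemma schur_hh:
  assumes Y: "graded s Y" and c: "\<And>j p. Y (Pi_c j p) = Pi_c j (Y p)" and hh: "\<And>j p. Y (hh j p) = hh j (Y p)"
    and "s = 0 \<Longrightarrow> Y 1 = 0"
  shows "Y p = 0"
proof (rule schur [OF Y c])
  have d: "Pi_d j p = hh j p - Pi_scale (k / 2) (Pi_c j p)" for j p by (simp add: hh_def)
  show "Y (Pi_d j p) = Pi_d j (Y p)" for j p
    unfolding d by (simp add: lin_diff [OF graded_lin [OF Y]] lin_scale [OF graded_lin [OF Y]] c hh)
qed (use assms in auto)

text \<open>Since \<open>ep\<close> and \<open>nem\<close> do not commute, each unit of translation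
  moves one pair of modes across the cut and costs the constant of \<open>ep_nem\<close>. These
  costs add up to a, in both directions.\<close>

lemma NO_ep_nem_shift: "NO (\<lambda>_. 1) (\<lambda>j. ep (a + j)) nem N p = NO (\<lambda>_. 1) ep nem (a + N) p - sc (N = - 1 - a) (of_int a) p"
proof -
  have split: "NO (\<lambda>_. 1) (\<lambda>j. ep (m + 1 + j)) nem N p = NO (\<lambda>_. 1) (\<lambda>j. ep (m + j)) nem (N + 1) p - sc (N = - 2 - m) 1 p" for m N
    using NO_shift_split [OF fld_ep fld_nem, of m N p] by (auto simp: ep_nem)
  have "\<forall>N. NO (\<lambda>_. 1) (\<lambda>j. ep (a + j)) nem N p = NO (\<lambda>_. 1) ep nem (a + N) p - sc (N = - 1 - a) (of_int a) p"
  proof (induction a rule: int_induct [where k = 0])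
    case base
    then show ?case by simp
  next
    case (step1 a)
    show ?case
    proof
      fix N
      show "NO (\<lambda>_. 1) (\<lambda>j. ep (a + 1 + j)) nem N p = NO (\<lambda>_. 1) ep nem (a + 1 + N) p - sc (N = - 1 - (a + 1)) (of_int (a + 1)) p"
        unfolding split step1(2) [rule_format] by (auto simp: Pi.scale_left_distrib algebra_simps)
    qed
  next
    case (step2 a)
    show ?case
    proof
      fix N
      have eqs: "a - 1 + 1 = a" "N - 1 + 1 = N" "(N - 1 = - 2 - (a - 1)) = (N = - a)" by auto
      have "NO (\<lambda>_. 1) (\<lambda>j. ep (a - 1 + j)) nem N p = NO (\<lambda>_. 1) (\<lambda>j. ep (a + j)) nem (N - 1) p + sc (N = - a) 1 p"
        using split [of "a - 1" "N - 1", unfolded eqs] by simp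
      then show "NO (\<lambda>_. 1) (\<lambda>j. ep (a - 1 + j)) nem N p = NO (\<lambda>_. 1) ep nem (a - 1 + N) p - sc (N = - 1 - (a - 1)) (of_int (a - 1)) p"
        unfolding step2(2) [rule_format] by (auto simp: Pi.scale_left_diff_distrib algebra_simps)
    qed
  qed
  then show ?thesis by blast
qed

text \<open>The field identity e^c(z) (nu e^(-c))(z) = nu(z) - c(z), with -c as the effect of the
  ordering. Both sides have the same commutators with c and h, and for N = 0 both send 1 to nu(0) 1
  + 1.\<close>

lemma NO_ep_nem: "NO (\<lambda>_. 1) ep nem (N - 1) p = nu N p - Pi_c N p"
proof -
  let ?Q = "NO (\<lambda>_. 1) ep nem (N - 1)"
  let ?Y = "\<lambda>p. ?Q p - nu N p + Pi_c N p"
  have gr: "graded (- N) ?Y"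
    by (intro graded_add graded_diff graded_NO [OF fld_ep fld_nem] fldD' [OF fld_nu] fldD' [OF fld_c]) simp_all
  have c: "Pi_c i (?Q p) = ?Q (Pi_c i p) + sc (N = - i) (of_int i) p" for i p
  proof -
    have "Pi_c i (?Q p) = ?Q (Pi_c i p) + NO (\<lambda>_. 1) (\<lambda>_ _. 0) nem (N - 1) p
       + NO (\<lambda>_. 1) ep (\<lambda>j p. Pi_scale (of_int i) (em (i - 1 + j) p)) (N - 1) p"
      by (rule NO_derivation [OF plin_c fld_ep fld_nem fld_zero fld_scale [OF fld_shift [OF fld_em]]])
        (simp_all add: c_ep c_nem algebra_simps)
    also have "\<dots> = ?Q (Pi_c i p) + sc (N = - i) (of_int i) p"
      unfolding NO_scale_right [OF fld_ep fld_shift [OF fld_em]] NO_shift_right NO_ep_em NO_zero_left [OF fld_nem] by auto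
    finally show ?thesis .
  qed
  have hh: "hh i (?Q p) = ?Q (hh i p) - sc (N = - i) (2 * of_int i) p" for i p
  proof -
    have "hh i (?Q p) = ?Q (hh i p) + NO (\<lambda>_. 1) (\<lambda>j p. Pi_scale 2 (ep (i + j) p)) nem (N - 1) p
       + NO (\<lambda>_. 1) ep (\<lambda>j p. Pi_scale (- 2) (nem (i + j) p)) (N - 1) p"
      by (rule NO_derivation [OF plin_ops(6) fld_ep fld_nem fld_scale [OF fld_shift [OF fld_ep]] fld_scale [OF fld_shift [OF fld_nem]]])
        (simp_all add: hh_ep hh_nem add.commute)
    also have "\<dots> = ?Q (hh i p) - sc (N = - i) (2 * of_int i) p"
      unfolding NO_scale_left [OF fld_shift [OF fld_ep] fld_nem] NO_scale_right [OF fld_ep fld_shift [OF fld_nem]]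
        NO_ep_nem_shift NO_shift_right by (auto simp: Pi.scale_right_diff_distrib)
    finally show ?thesis .
  qed
  have hc: "hh i (Pi_c N p) = Pi_c N (hh i p) + sc (N = - i) (2 * of_int i) p" for i p
    by (auto simp: hh_def Pi_d_Pi_c ops_lin Pi_c_commute [of i])
  have "?Y p = 0"
  proof (rule schur_hh [OF gr])
    show "?Y (Pi_c j p) = Pi_c j (?Y p)" for j p
      by (simp add: ops_lin c c_nu Pi_c_commute [of j])
    show "?Y (hh j p) = hh j (?Y p)" for j p
      by (simp add: ops_lin hh hh_nu hc)
    assume "- N = 0"
    then have N: "N = 0" by simp
    have "NO_term (\<lambda>_. 1) ep nem (- 1) 1 = (\<lambda>j. if j = 0 then Pi_scale lam (em (- 2) (nu 0 1)) else 0)"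
      by (intro ext) (auto simp: NO_term_def ep_1 ep_0_1 nem_1_large nem_1 ops_zero ops_scale)
    then have "?Q 1 = nu 0 1 + 1"
      using lam by (simp add: N NO_def em_nu_0_1 Pi.scale_right_distrib)
    then show "?Y 1 = 0" by (simp add: N Pi_c_simps)
  qed
  then show ?thesis by (simp add: algebra_simps)
qed

lemma ep_nnem: "ep a (nnem n p) = nnem n (ep a p) - Pi_scale 2 (nu (a + n) p) + Pi_c (a + n) p + sc (n = - a) (of_int a) p"
proof -
  have "ep a (nnem n p) = nnem n (ep a p) + NO (\<lambda>_. 1) (\<lambda>j p. Pi_scale (- 1) (ep (a + j) p)) nem (n - 1) p
     + NO (\<lambda>_. 1) nu (\<lambda>j p. sc (j = - 1 - a) (- 1) p) (n - 1) p"
    unfolding nnem_def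
    by (rule NO_derivation [where D = "ep a" and a' = "\<lambda>j p. Pi_scale (- 1) (ep (a + j) p)" and b' = "\<lambda>j p. sc (j = - 1 - a) (- 1) p",
          OF plin_exp fld_nu fld_nem ep_shift fld_delta]) (simp_all add: ep_nu ep_nem)
  also have "\<dots> = nnem n (ep a p) - NO (\<lambda>_. 1) ep nem (a + n - 1) p + sc (n = - a) (of_int a) p - nu (a + n) p"
    unfolding NO_scale_left [OF fld_shift [OF fld_ep] fld_nem] NO_delta_right [OF fld_nu] NO_ep_nem_shift
    by (auto simp: algebra_simps)
  finally show ?thesis
    by (simp add: NO_ep_nem Pi.scale_left_distrib [of 1 1, simplified])
qed

text \<open>The e-f relation on \<open>Pi_vec\<close>. The coefficient k + 1 of the derivative term
  is what turns 2 nu - c into 2 nu + k c = h and the constant -a into k a.\<close>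

lemma ep_gop: "ep a (gop n p) = gop n (ep a p) + hh (a + n) p + sc (n = - a) (k * of_int a) p"
proof -
  have "hh m p = Pi_scale 2 (nu m p) + Pi_scale k (Pi_c m p)" for m
    by (simp add: hh_def nu_def Pi.scale_right_distrib Pi.scale_left_distrib [symmetric] flip: Pi.scale_minus_left)
  moreover have "sc b (k * of_int a) p = Pi_scale k (sc b (of_int a) p)" for b
    by simp
  ultimately show ?thesis
    unfolding gop_def ops_lin ep_nnem ep_dnem Pi.scale_right_diff_distrib Pi.scale_left_distrib
    by (simp add: group_ac del: Pi.scale_scale)
qed

end

text \<open>On polynomials in the c(-j) the annihilation exponential is trivial and the shift is a
  scalar, so e^c acts through its creation exponential alone.\<close>

inductive c_poly :: "Pi_vec \<Rightarrow> bool" where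
  one: "c_poly 1"
| add: "c_poly p \<Longrightarrow> c_poly q \<Longrightarrow> c_poly (p + q)"
| scale: "c_poly p \<Longrightarrow> c_poly (Pi_scale a p)"
| c: "c_poly p \<Longrightarrow> j < 0 \<Longrightarrow> c_poly (Pi_c j p)"

lemma c_poly_c: "c_poly p \<Longrightarrow> i > 0 \<Longrightarrow> Pi_c i p = 0"
  by (induction rule: c_poly.induct)
    (simp_all add: Pi_c_1 lin_add [OF plin_c] lin_scale [OF plin_c] Pi_c_commute [of i] lin_zero [OF plin_c])

lemma c_poly_shift: "c_poly p \<Longrightarrow> Pi_shift lam n p = Pi_scale (lam powi n) p"
proof (induction rule: c_poly.induct)
  case one
  then show ?case by (simp add: one_pCons flip: single_one)
qed (simp_all add: lin_add [OF plin_shift] lin_scale [OF plin_shift] Pi.scale_right_distrib mult.commute lin_scale [OF plin_c] flip: Pi_c_shift)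

lemma c_poly_an: "c_poly p \<Longrightarrow> an x l p = (if l = 0 then p else 0)"
  unfolding an_def by (auto simp: plin_scaled_c intro!: exp_coeff_vanish) (simp add: c_poly_c)

lemma c_poly_exp: "c_poly p \<Longrightarrow> Pi_exp lam n m p = Pi_shift lam n (cr (of_int n) (n - m - 1) p)"
proof -
  assume p: "c_poly p"
  obtain r where r: "bnd r p" using bnd_exists by blast
  have R: "r \<le> int (nat r)" by linarith
  have "Pi_exp lam n m p = (\<Sum>l\<le>nat r. if l = 0 then Pi_shift lam n (cr (of_int n) (n - m - 1) p) else 0)"
    unfolding Pi_exp_eq_sum [OF r R]
    by (rule sum.cong) (simp_all add: c_poly_an [OF p] lin_zero [OF plin_cr] lin_zero [OF plin_shift])
  then show ?thesis by simp
qed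

lemma cr_shift: "Pi_shift lam n (cr x i p) = cr x i (Pi_shift lam n p)"
proof (cases "i < 0")
  case False
  then show ?thesis unfolding cr_def
    using exp_coeff_commute [of "\<lambda>j. Pi_scale (x / of_nat j) \<circ> Pi_c (- int j)" "Pi_shift lam n" "nat i" p]
    by (simp add: plin_scaled_c plin_shift lin_scale [OF plin_shift] Pi_c_shift)
qed (simp add: cr_negative lin_zero [OF plin_shift])

lemma shift_inverse: "lam \<noteq> 0 \<Longrightarrow> Pi_shift lam (- n) (Pi_shift lam n p) = p"
  by (rule poly_mapping_eqI)
    (simp add: lookup_Pi_shift pcompose_smult power_int_minus pcompose_pCons flip: pcompose_assoc)

section \<open>Generation by e and h, and vectors annihilated by positive modes of e\<close>

context whittaker_parameters
begin

text \<open>On polynomials in the c(-i), the mode e(-j) is lambda times the coefficient of z^j in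
  exp(sum c(-i)/i z^i). Its linear part is c(-j)/j and the rest involves smaller indices only, so
  c(-j) is recovered by induction on j; d is then h minus a multiple of c.\<close>

lemma Pi_cyclic:
  assumes one: "P 1" and add: "\<And>p q. P p \<Longrightarrow> P q \<Longrightarrow> P (p + q)" and scale: "\<And>a p. P p \<Longrightarrow> P (Pi_scale a p)"
    and ep: "\<And>n p. P p \<Longrightarrow> P (ep n p)" and hh: "\<And>n p. P p \<Longrightarrow> P (hh n p)"
  shows "P p"
proof -
  have zero: "P 0" using scale [OF one, of 0] by simp
  have sum: "P (sum f A)" if "\<And>x. x \<in> A \<Longrightarrow> P (f x)" for f :: "nat \<Rightarrow> Pi_vec" and A
    using that by (induction A rule: infinite_finite_induct) (auto simp: zero add)
  have c_sum: "c_poly (sum f A)" if "\<And>x. x \<in> A \<Longrightarrow> c_poly (f x)" for f :: "nat \<Rightarrow> Pi_vec" and A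
    using that c_poly.scale [OF c_poly.one, of 0] by (induction A rule: infinite_finite_induct) (auto intro: c_poly.add)
  define a :: "nat \<Rightarrow> Pi_vec \<Rightarrow> Pi_vec" where "a = (\<lambda>j. Pi_scale (1 / of_nat j) \<circ> Pi_c (- int j))"
  have a: "a l p = Pi_scale (1 / of_nat l) (Pi_c (- int l) p)" for l p by (simp add: a_def)
  have plin_a: "plin (a l)" for l using plin_scaled_c by (simp add: a_def)
  have c: "P (Pi_c (- int j) p)" if "j > 0" "c_poly p" "P p" for j p
    using that
  proof (induction j arbitrary: p rule: less_induct)
    case (less j)
    \<comment> \<open>Below j all modes are available by the induction hypothesis, which also
      requires staying among polynomials in c.\<close>
    have cs: "P (comp_sum a r i p) \<and> c_poly (comp_sum a r i p)" if "i < j" for r i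
      using that
    proof (induction r arbitrary: i)
      case 0
      then show ?case using less.prems c_poly.scale [OF c_poly.one, of 0] by (simp add: zero)
    next
      case (Suc r)
      have "P (a l (comp_sum a r (i - l) p)) \<and> c_poly (a l (comp_sum a r (i - l) p))" if "l \<in> {1..i}" for l
      proof -
        have "P (comp_sum a r (i - l) p) \<and> c_poly (comp_sum a r (i - l) p)"
          using that Suc by (intro Suc.IH) auto
        then show ?thesis
          using less.IH [of l "comp_sum a r (i - l) p"] that Suc.prems by (simp add: a scale c_poly.scale c_poly.c)
      qed
      then show ?case by (auto intro!: sum c_sum)
    qed
    \<comment> \<open>A composition of j of length other than 1 has only parts below j.\<close>
    have cs': "P (comp_sum a r j p)" if "r \<noteq> 1" for r
    proof (cases r)
      case 0
      then show ?thesis using less.prems zero by simp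
    next
      case (Suc r')
      have "P (a l (comp_sum a r' (j - l) p))" if l: "l \<in> {1..j}" for l
      proof (cases "l = j")
        case True
        then show ?thesis
          using \<open>r \<noteq> 1\<close> Suc by (cases r') (auto simp: a zero lin_zero [OF plin_c])
      next
        case False
        with l have "j - l < j" "l < j" "l > 0" by auto
        then show ?thesis using cs [of "j - l" r'] less.IH [of l "comp_sum a r' (j - l) p"] by (simp add: a scale)
      qed
      then show ?thesis using Suc by (auto intro!: sum)
    qed
    have "P (Pi_scale (1 / lam) (ep (- int j) p))"
      by (intro scale ep less.prems)
    also have "Pi_scale (1 / lam) (ep (- int j) p) = (\<Sum>r\<le>j. Pi_scale (1 / fact r) (comp_sum a r j p))"
      using lam less.prems exp_coeff_eq [of a, OF plin_a]
      by (simp add: c_poly_exp cr_shift c_poly_shift lin_scale [OF plin_cr]) (simp add: cr_def a_def)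
    also have "\<dots> = comp_sum a 1 j p + (\<Sum>r\<in>{..j} - {1}. Pi_scale (1 / fact r) (comp_sum a r j p))"
      using less.prems by (subst sum.remove [of _ 1]) auto
    finally have A: "P (comp_sum a 1 j p + (\<Sum>r\<in>{..j} - {1}. Pi_scale (1 / fact r) (comp_sum a r j p)))" .
    have B: "P (Pi_scale (- 1) (\<Sum>r\<in>{..j} - {1}. Pi_scale (1 / fact r) (comp_sum a r j p)))"
      by (intro scale sum cs') simp
    have "P (comp_sum a 1 j p)" using add [OF A B] by simp
    also have "comp_sum a 1 j p = (\<Sum>l\<in>{1..j}. if l = j then a j p else 0)"
      unfolding One_nat_def comp_sum.simps by (intro sum.cong) (auto simp: lin_zero [OF plin_a])
    also have "\<dots> = a j p" using less.prems by simp
    finally have "P (Pi_scale (of_nat j) (a j p))" by (rule scale)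
    then show ?case using less.prems by (simp add: a)
  qed
  have base: "P p" if "c_poly p" for p
    using that
  proof (induction rule: c_poly.induct)
    case (c p j)
    then show ?case using \<open>\<And>j p. _ \<Longrightarrow> _ \<Longrightarrow> _ \<Longrightarrow> P (Pi_c (- int j) p)\<close> [of "nat (- j)" p] by simp
  qed (use one add scale in auto)
  \<comment> \<open>c(-j) is known to preserve \<open>P\<close> only on polynomials in c. The
    induction that adds d is therefore on a property closed under all strings of creation modes of
    c; h(j) with j <= 0 commutes with such strings and can be moved to the left.\<close>
  define Q where "Q p \<longleftrightarrow> (\<forall>js. (\<forall>j\<in>set js. j < 0) \<longrightarrow> P (foldr Pi_c js p))" for p
  have foldr_lin: "plin (foldr Pi_c js)" for js
    by (induction js) (simp_all add: id_def comp_def plin_ident plin_comp [OF plin_c])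
  have foldr_c: "foldr Pi_c js (Pi_c j p) = foldr Pi_c (js @ [j]) p" for js j p
    by simp
  have foldr_hh: "foldr Pi_c js (hh j p) = hh j (foldr Pi_c js p)" if "\<forall>i\<in>set js. i < 0" "j \<le> 0" for js j p
    using that by (induction js) (auto simp: hh_def Pi_c_Pi_d lin_add [OF plin_c] lin_scale [OF plin_c] Pi_c_commute)
  have "Q p"
  proof (induction p rule: Pi_induct)
    case one
    have "c_poly (foldr Pi_c js 1)" if "\<forall>i\<in>set js. i < 0" for js
      using that by (induction js) (simp_all add: c_poly.one c_poly.c)
    then show ?case using base by (auto simp: Q_def)
  next
    case (d j p)
    have 1: "foldr Pi_c js (Pi_d j p) = hh j (foldr Pi_c js p) + Pi_scale (- (k / 2)) (foldr Pi_c (js @ [j]) p)"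
      if js: "\<forall>i\<in>set js. i < 0" for js
    proof -
      have "Pi_d j p = hh j p + Pi_scale (- (k / 2)) (Pi_c j p)" by (simp add: hh_def)
      then show ?thesis
        by (simp only: lin_add [OF foldr_lin] lin_scale [OF foldr_lin] foldr_hh [OF js d(1)] foldr_c)
    qed
    have 2: "P (foldr Pi_c (js @ [j]) p)" if "\<forall>i\<in>set js. i < 0" for js
    proof (cases "j = 0")
      case True
      then have "foldr Pi_c (js @ [j]) p = Pi_scale (- 1) (foldr Pi_c js p)"
        by (simp add: Pi_c_simps lin_minus [OF foldr_lin])
      then show ?thesis using d that scale by (simp only: Q_def)
    next
      case False
      then have "\<forall>i\<in>set (js @ [j]). i < 0" using d that by auto
      then show ?thesis using d(2) unfolding Q_def by blast
    qed
    show ?case unfolding Q_def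
    proof (intro allI impI)
      fix js :: "int list" assume js: "\<forall>i\<in>set js. i < 0"
      show "P (foldr Pi_c js (Pi_d j p))"
        unfolding 1 [OF js] using d(2) js by (intro add hh scale 2) (simp_all add: Q_def)
    qed
  next
    case (c j p)
    show ?case unfolding Q_def foldr_c
    proof (intro allI impI)
      fix js :: "int list" assume "\<forall>i\<in>set js. i < 0"
      then have "\<forall>i\<in>set (js @ [j]). i < 0" using c by auto
      then show "P (foldr Pi_c (js @ [j]) p)" using c(2) unfolding Q_def by blast
    qed
  qed (auto simp: Q_def lin_add [OF foldr_lin] lin_scale [OF foldr_lin] intro: add scale)
  then show "P p" unfolding Q_def by (metis empty_iff foldr.simps(1) id_apply list.set(1))
qed

text \<open>e(l) y is the shift of \<open>an (-1) l y\<close> plus terms that contain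
  \<open>an (-1) l' y\<close> with l' > l, so these vectors vanish, in descending order from the
  weight bound. In ascending order, \<open>an (-1) j y\<close> is then -c(j) y / j.\<close>

lemma ep_annihilated:
  assumes "\<And>j. j > 0 \<Longrightarrow> ep j y = 0" and "i > 0"
  shows "Pi_c i y = 0"
proof -
  obtain r where r: "bnd r y" using bnd_exists by blast
  let ?R = "nat r"
  have R: "r \<le> int ?R" by linarith
  have an: "an (- 1) l y = 0" if "l > 0" for l
    using that
  proof (induction "?R - l" arbitrary: l rule: less_induct)
    case less
    show ?case
    proof (cases "l \<le> ?R")
      case False
      then show ?thesis using an_large [OF r] by simp
    next
      case True
      have "0 = ep (int l) y" using assms less by simp
      also have "\<dots> = (\<Sum>l'\<le>?R. Pi_shift lam 1 (cr 1 (int l' - int l) (an (- 1) l' y)))"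
        using Pi_exp_eq_sum [OF r R, of lam 1 "int l"] by simp
      also have "\<dots> = (\<Sum>l'\<le>?R. if l' = l then Pi_shift lam 1 (an (- 1) l y) else 0)"
      proof (rule sum.cong)
        fix l' assume "l' \<in> {..?R}"
        have "an (- 1) l' y = 0" if "l' > l"
          using less.hyps [of l'] that \<open>l' \<in> {..?R}\<close> by auto
        then show "Pi_shift lam 1 (cr 1 (int l' - int l) (an (- 1) l' y)) = (if l' = l then Pi_shift lam 1 (an (- 1) l y) else 0)"
          by (cases l' l rule: linorder_cases) (auto simp: cr_negative lin_zero [OF plin_cr] lin_zero [OF plin_shift])
      qed simp
      also have "\<dots> = Pi_shift lam 1 (an (- 1) l y)" using True by simp
      finally show ?thesis
        using shift_inverse [OF lam, of 1 "an (- 1) l y"] by (simp add: lin_zero [OF plin_shift])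
    qed
  qed
  have "Pi_c (int j) y = 0" if "j > 0" for j
    using that
  proof (induction j rule: less_induct)
    case (less j)
    have "an (- 1) j y = Pi_scale (- 1 / of_nat j) (Pi_c (int j) y)"
      unfolding an_def using less by (subst exp_coeff_last) (auto simp: plin_scaled_c)
    then show ?case using an [OF \<open>j > 0\<close>] less by simp
  qed
  from this [of "nat i"] assms(2) show ?thesis by simp
qed

lemma exp_single_0: "Pi_exp lam n (n - 1) (single 0 q) = Pi_shift lam n (single 0 q)"
proof -
  have "bnd 0 (single 0 q)" by (simp add: bnd_def)
  then show ?thesis using Pi_exp_eq_sum [of 0 _ 0 lam n "n - 1"] by simp
qed

text \<open>Evaluating the vacuum coefficient at the point where \<open>\<nu>(0) = -1\<close> makes the contributions of \<open>\<nu>(0)\<close>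
  next to \<open>e\<^bsup>-c\<^esup>\<close> disappear.\<close>

definition rho :: "Pi_vec \<Rightarrow> complex" where
  "rho p = poly (lookup p 0) (- 2 - k / 2)"

lemma lin_rho: "lin Pi_scale (*) rho"
  by unfold_locales (auto simp: rho_def lookup_add lookup_Pi_scale algebra_simps)

lemmas rho_lin = lin_add [OF lin_rho] lin_scale [OF lin_rho] lin_zero [OF lin_rho] lin_diff [OF lin_rho] lin_minus [OF lin_rho]

lemma rho_1 [simp]: "rho 1 = 1"
  by (simp add: rho_def lookup_one)

text \<open>Applied to the difference of the two sides of a commutation relation between \<open>e\<^bsup>-c\<^esup>\<close>-type fields, this reduces
  the relation to one scalar identity, the vacuum expectation.\<close>

lemma vacuum_criterion:
  assumes X: "\<And>m n. graded (s - m - n) (X m n)"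
    and ep: "\<And>m n j p. X m n (ep j p) = ep j (X m n p)"
    and hh: "\<And>m n j p. X m n (hh j p) = hh j (X m n p) + Pi_scale 2 (X (m + j) n p) + Pi_scale 2 (X m (n + j) p)"
    and rho: "\<And>m n. m + n = s \<Longrightarrow> rho (X m n 1) = 0"
  shows "X m n p = 0"
proof -
  note lin = graded_lin [OF X]
  have hom: "hom (s - m - n) (X m n 1)" for m n
    using graded_hom [OF X hom_1] by simp
  \<comment> \<open>\<open>X m n\<close> commutes with e(j), and e(j) kills 1 for j > 0.\<close>
  have ann: "Pi_c j (X m n 1) = 0" if "j > 0" for j m n
  proof (rule ep_annihilated [OF _ that])
    show "ep j (X m n 1) = 0" if "j > 0" for j
      using that by (simp add: ep [symmetric] ep_1 lin_zero [OF lin])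
  qed
  have one: "X m n 1 = 0" for m n
  proof (induction "nat (s - m - n)" arbitrary: m n rule: less_induct)
    case less
    show ?case
    proof (cases "s - m - n" "0 :: int" rule: linorder_cases)
      case equal
      let ?q = "lookup (X m n 1) 0"
      have y: "X m n 1 = single 0 ?q"
        using hom_0_eq [of "X m n 1"] hom [of m n] equal by simp
      \<comment> \<open>\<open>X m n 1\<close> has the form q(d) v_1 and, like 1 itself, is an
        eigenvector of e(0) for lambda. So q is invariant under the shift by 2, hence constant, and
        \<open>rho\<close> detects it.\<close>
      have "Pi_shift lam 1 (X m n 1) = ep 0 (X m n 1)"
        using exp_single_0 [of 1 ?q] by (subst (1 2) y) simp
      also have "\<dots> = Pi_scale lam (X m n 1)"
        by (simp add: ep [symmetric] ep_0_1 lin_scale [OF lin])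
      finally have "lookup (Pi_shift lam 1 (X m n 1)) 0 = lookup (Pi_scale lam (X m n 1)) 0"
        by simp
      then have "Polynomial.smult lam (pcompose ?q [:- 2, 1:]) = Polynomial.smult lam ?q"
        by (simp add: lookup_Pi_shift lookup_Pi_scale)
      then have "pcompose ?q [:- 2, 1:] = ?q" using lam by (metis smult_cancel)
      then have "?q = [:rho (X m n 1):]"
        unfolding rho_def by (rule poly_periodic_const)
      then show ?thesis using rho [of m n] equal y by simp
    next
      case greater
      \<comment> \<open>h(j) with j > 0 turns \<open>X m n 1\<close> into vectors of the same family
        with a larger index sum, zero by induction.\<close>
      have "hh j (X m n 1) = 0" if "j > 0" for j
        using hh [of m n j 1] less [of "m + j" n] less [of m "n + j"] that greater
        by (simp add: hh_1 lin_zero [OF lin])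
      then have "Pi_d j (X m n 1) = 0" if "j > 0" for j
        using that ann [OF that, of m n] by (force simp: hh_def)
      then have "X m n 1 = single 0 (lookup (X m n 1) 0)"
        using ann by (intro vacuum_eq)
      then show ?thesis using hom_lookup_0 [OF hom] greater by (metis less_irrefl single_zero)
    qed (use hom [of m n] hom_negative in blast)
  qed
  have "\<forall>m n. X m n p = 0"
    by (rule Pi_cyclic [where P = "\<lambda>p. \<forall>m n. X m n p = 0"])
      (simp_all add: one lin_add [OF lin] lin_scale [OF lin] ep hh lin_zero [OF plin_exp] ops_zero)
  then show ?thesis by blast
qed

end

lemma sum_quadratic: "(\<Sum>i\<in>{1..M}. a + b * of_nat i + c * (of_nat i)\<^sup>2)
   = a * of_nat M + b * (of_nat M * (of_nat M + 1) / 2) + c * (of_nat M * (of_nat M + 1) * (2 * of_nat M + 1) / 6)"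
  for a b c :: complex
  by (induction M) (simp_all add: field_simps power2_eq_square)

section \<open>Vacuum expectations and the two relations behind [f(m), f(n)] = 0\<close>

context whittaker_parameters
begin

lemma rho_nu_neg: "j < 0 \<Longrightarrow> rho (nu j p) = 0"
  by (simp add: rho_def nu_def lookup_add lookup_minus lookup_Pi_scale lookup_creation_0)

lemma rho_em_neg: "n < - 2 \<Longrightarrow> rho (em n p) = 0"
  by (simp add: rho_def lookup_exp_0)

text \<open>As c(0) = -Id, nu(0) is d/2 + k/4, which equals -1 at d = -2 - k/2, the point at which
  \<open>rho\<close> evaluates.\<close>

lemma rho_nu_0: "rho (nu 0 p) = - rho p"
  by (simp add: rho_def nu_def lookup_add lookup_minus lookup_Pi_scale lookup_Pi_d_0 Pi_c_simps field_simps)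

text \<open>On the right of e^(-c), nu(0) becomes nu(0) + 1 on the left, and this evaluates to
  0.\<close>

lemma rho_em_nu_0: "rho (em n (nu 0 p)) = 0"
  by (simp add: em_nu rho_lin rho_nu_0)

text \<open>For j < 0 the mode nu(j) stands on the left and creates; j = 0 vanishes by the choice of
  the evaluation point; for j > M the mode of \<open>b\<close> is too low to have a vacuum
  component.\<close>

lemma rho_NO_nu:
  assumes b: "fld t b" and b0: "\<And>n q. rho (b n (nu 0 q)) = 0"
    and neg: "\<And>n q. n < N - int M \<Longrightarrow> rho (b n q) = 0"
  shows "rho (NO \<kappa> nu b N p) = (\<Sum>i\<in>{1..M}. \<kappa> (int i) * rho (b (N - int i) (nu (int i) p)))"
proof -
  let ?f = "\<lambda>j. rho (NO_term \<kappa> nu b N p j)"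
  have "?f j = 0" if "j \<notin> int ` {1..M}" for j
  proof (cases "j < 0")
    case False
    with that consider "j = 0" | "j > int M"
      by (metis atLeastAtMost_iff image_eqI int_nat_eq linorder_not_le nat_le_iff nat_less_eq_zless not_less_eq_eq One_nat_def le_zero_eq nat_0_iff verit_la_disequality)
    then show ?thesis using b0 neg by cases (simp_all add: NO_term_def rho_lin)
  qed (simp add: NO_term_def rho_lin rho_nu_neg)
  then have *: "Sum_any ?f = (\<Sum>j\<in>int ` {1..M}. ?f j)"
    by (intro Sum_any.expand_superset) auto
  have "rho (NO \<kappa> nu b N p) = Sum_any ?f"
    by (simp only: NO_def lin_Sum_any [OF lin_rho NO_term_finite [OF fld_nu b]])
  also have "\<dots> = (\<Sum>j\<in>int ` {1..M}. ?f j)"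
    by (rule *)
  also have "\<dots> = (\<Sum>i\<in>{1..M}. ?f (int i))"
    by (simp add: sum.reindex)
  also have "\<dots> = (\<Sum>i\<in>{1..M}. \<kappa> (int i) * rho (b (N - int i) (nu (int i) p)))"
    by (simp add: NO_term_def rho_lin)
  finally show ?thesis .
qed

lemma rho_NO_nu_em: "N - int M \<le> - 2 \<Longrightarrow>
  rho (NO \<kappa> nu em N p) = (\<Sum>i\<in>{1..M}. \<kappa> (int i) * rho (em (N - int i) (nu (int i) p)))"
  by (rule rho_NO_nu [OF fld_em rho_em_nu_0]) (auto intro: rho_em_neg)

lemma rho_nem_neg: "n < 0 \<Longrightarrow> rho (nem n p) = 0"
  using rho_NO_nu_em [of "n - 1" 0] by (simp add: nem_def)

lemma rho_nem_nu_0: "rho (nem n (nu 0 p)) = 0"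
proof -
  have "rho (nem n (nu 0 p)) = (\<Sum>i\<in>{1..nat (n + 1)}. 1 * rho (em (n - 1 - int i) (nu (int i) (nu 0 p))))"
    unfolding nem_def by (rule rho_NO_nu_em) linarith
  also have "\<dots> = 0"
  proof (intro sum.neutral ballI)
    fix i assume "i \<in> {1..nat (n + 1)}"
    then have "nu (int i) (nu 0 p) = nu 0 (nu (int i) p)" by (simp add: nu_nu [of "int i"])
    then show "1 * rho (em (n - 1 - int i) (nu (int i) (nu 0 p))) = 0" by (simp add: rho_em_nu_0)
  qed
  finally show ?thesis .
qed

lemma rho_NO_nu_nem: "N - int M \<le> 0 \<Longrightarrow>
  rho (NO \<kappa> nu nem N p) = (\<Sum>i\<in>{1..M}. \<kappa> (int i) * rho (nem (N - int i) (nu (int i) p)))"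
  by (rule rho_NO_nu [OF fld_nem rho_nem_nu_0]) (auto intro: rho_nem_neg)

lemma rho_dnem: "rho (dnem (int m) p) = - (\<Sum>i\<in>{1..m}. of_nat (i + 1) * rho (em (int m - 2 - int i) (nu (int i) p)))"
proof -
  have "rho (dnem (int m) p) = (\<Sum>i\<in>{1..m}. dcoef (int i) * rho (em (int m - 2 - int i) (nu (int i) p)))"
    unfolding dnem_def by (rule rho_NO_nu_em) simp
  also have "\<dots> = (\<Sum>i\<in>{1..m}. - (of_nat (i + 1) * rho (em (int m - 2 - int i) (nu (int i) p))))"
    by (intro sum.cong) (simp_all add: dcoef_def algebra_simps)
  finally show ?thesis by (simp only: sum_negf)
qed

lemma rho_nnem: "rho (nnem (int m) p)
   = (\<Sum>i\<in>{1..m}. \<Sum>j\<in>{1..m - i}. rho (em (int (m - i) - 2 - int j) (nu (int j) (nu (int i) p))))"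
proof -
  have "rho (nem (int m - 1 - int i) q) = (\<Sum>j\<in>{1..m - i}. rho (em (int (m - i) - 2 - int j) (nu (int j) q)))"
    if "i \<in> {1..m}" for i q
    using that rho_NO_nu_em [of "int m - 2 - int i" "m - i" "\<lambda>_. 1" q] by (simp add: nem_def of_nat_diff algebra_simps)
  then show ?thesis
    unfolding nnem_def by (subst rho_NO_nu_nem [of _ m]) simp_all
qed

text \<open>The two modes commute, so either may stand on the right or on the left: an index above
  -2 kills 1, one below -2 leaves no vacuum component.\<close>

lemma rho_em_em: "rho (em a (em b 1)) = (if a = - 2 \<and> b = - 2 then 1 / lam\<^sup>2 else 0)"
proof -
  have "rho (em a (em b 1)) = 0" if "a > - 2 \<or> b > - 2"
    using that em_em [of a b 1] by (auto simp: em_1 ops_lin rho_lin)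
  moreover have "rho (em a (em b 1)) = 0" if "a < - 2" using that by (rule rho_em_neg)
  moreover have "rho (em a (em b 1)) = 0" if "b < - 2" using that em_em [of a b 1] by (simp add: rho_em_neg)
  ultimately show ?thesis
    by (cases "a = - 2"; cases "b = - 2") (auto simp: em_m2_1 ops_lin rho_lin power2_eq_square neq_iff)
qed

lemma rho_NO_em_em: "rho (NO \<kappa> em em N 1) = (if N = - 4 then \<kappa> (- 2) / lam\<^sup>2 else 0)"
proof -
  have "rho (NO_term \<kappa> em em N 1 j) = (if j = - 2 then if N = - 4 then \<kappa> (- 2) / lam\<^sup>2 else 0 else 0)" for j
    by (auto simp: NO_term_def rho_lin rho_em_em)
  then show ?thesis
    by (simp add: NO_def lin_Sum_any [OF lin_rho NO_term_finite [OF fld_em fld_em]])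
qed

text \<open>Up to a shift of the index by one, the modes of e^(-2c).\<close>

abbreviation zz :: "Pi_vec field_modes" where "zz \<equiv> NO (\<lambda>_. 1) em em"

lemma fld_zz: "fld (- 4) zz"
  unfolding fld_def by (intro allI graded_NO [OF fld_em fld_em]) simp

lemma fld_em_shift: "fld (- 2 - a) (\<lambda>j. em (a + j))"
  by (rule fld_shift [OF fld_em])

lemma em_nem: "em a (nem n p) = nem n (em a p) + zz (a + n - 1) p"
proof -
  have "em a (nem n p) = nem n (em a p) + NO (\<lambda>_. 1) (\<lambda>j. em (a + j)) em (n - 1) p + NO (\<lambda>_. 1) nu (\<lambda>_ _. 0) (n - 1) p"
    unfolding nem_def
    by (rule NO_derivation [where D = "em a" and a' = "\<lambda>j. em (a + j)" and b' = "\<lambda>_ _. 0",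
        OF plin_exp fld_nu fld_em fld_em_shift fld_zero]) (simp_all add: em_nu em_em [of a])
  then show ?thesis
    unfolding NO_shift_left [of em em, OF em_em] NO_zero_right [OF fld_nu] by (simp add: algebra_simps)
qed

lemma em_dnem: "em a (dnem n p) = dnem n (em a p) + NO (\<lambda>j. dcoef (j - a)) em em (a + n - 2) p"
proof -
  have "em a (dnem n p) = dnem n (em a p) + NO dcoef (\<lambda>j. em (a + j)) em (n - 2) p + NO dcoef nu (\<lambda>_ _. 0) (n - 2) p"
    unfolding dnem_def
    by (rule NO_derivation [where D = "em a" and a' = "\<lambda>j. em (a + j)" and b' = "\<lambda>_ _. 0",
        OF plin_exp fld_nu fld_em fld_em_shift fld_zero]) (simp_all add: em_nu em_em [of a])
  then show ?thesis
    unfolding NO_shift_left [of em em, OF em_em] NO_zero_right [OF fld_nu] by (simp add: algebra_simps)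
qed

lemma em_nnem: "em a (nnem n p) = nnem n (em a p) + NO (\<lambda>_. 1) (\<lambda>j. em (a + j)) nem (n - 1) p
   + NO (\<lambda>_. 1) nu (\<lambda>j. zz (a - 1 + j)) (n - 1) p"
  unfolding nnem_def
  by (rule NO_derivation [where D = "em a" and a' = "\<lambda>j. em (a + j)" and b' = "\<lambda>j. zz (a - 1 + j)",
        OF plin_exp fld_nu fld_nem fld_em_shift fld_shift [OF fld_zz]]) (simp_all add: em_nu em_nem algebra_simps)

lemma zz_nu_0: "zz N (nu 0 p) = nu 0 (zz N p) + Pi_scale 2 (zz N p)"
proof -
  have "nu 0 (zz N p) = zz N (nu 0 p) + NO (\<lambda>_. 1) (\<lambda>j p. Pi_scale (- 1) (em j p)) em N p
     + NO (\<lambda>_. 1) em (\<lambda>j p. Pi_scale (- 1) (em j p)) N p"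
    by (rule NO_derivation [OF plin_ops(5) fld_em fld_em fld_scale [OF fld_em] fld_scale [OF fld_em]]) (simp_all add: nu_em)
  then show ?thesis
    unfolding NO_scale_left [OF fld_em fld_em] NO_scale_right [OF fld_em fld_em]
    by (simp add: Pi.scale_left_distrib [of 1 1, simplified])
qed

lemma rho_zz_nu_1: "rho (NO (\<lambda>_. 1) nu (\<lambda>j. zz (a - 1 + j)) (- a - 3) 1) = 1 / lam\<^sup>2"
proof -
  have "rho (NO_term (\<lambda>_. 1) nu (\<lambda>j. zz (a - 1 + j)) (- a - 3) 1 j) = (if j = 0 then rho (zz (- 4) (nu 0 1)) else 0)" for j
    using lin_zero [OF graded_lin [OF fldD [OF fld_zz]]]
    by (cases j "0::int" rule: linorder_cases) (auto simp: NO_term_def rho_lin rho_nu_neg nu_1)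
  then have "rho (NO (\<lambda>_. 1) nu (\<lambda>j. zz (a - 1 + j)) (- a - 3) 1) = rho (zz (- 4) (nu 0 1))"
    by (simp add: NO_def lin_Sum_any [OF lin_rho NO_term_finite [OF fld_nu fld_shift [OF fld_zz]]])
  then show ?thesis
    by (simp add: zz_nu_0 rho_lin rho_nu_0 rho_NO_em_em)
qed

text \<open>Raising a by one moves the cut by one and costs the commutator \<open>em_nem\<close>,
  with vacuum value 1/lam^2; at a = -2 every term vanishes.\<close>

lemma rho_NO_em_nem: "rho (NO (\<lambda>_. 1) (\<lambda>j. em (a + j)) nem (- a - 3) 1) = of_int (a + 2) / lam\<^sup>2"
proof -
  let ?q = "\<lambda>a. rho (NO (\<lambda>_. 1) (\<lambda>j. em (a + j)) nem (- a - 3) 1)"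
  have step: "?q (a + 1) = ?q a + 1 / lam\<^sup>2" for a
  proof -
    have idx: "- (a + 1) - 3 = - a - 4" "- a - 4 + 1 = - a - 3" "a + (- a - 3) - 1 = - 4" by simp_all
    show ?thesis
      unfolding idx(1) NO_shift_split [OF fld_em fld_nem, of a "- a - 4" 1] idx em_nem
      by (simp add: rho_lin rho_NO_em_em)
  qed
  have "rho (NO_term (\<lambda>_. 1) (\<lambda>j. em (- 2 + j)) nem (- 1) 1 j) = 0" for j
    by (cases j "0::int" rule: linorder_cases)
      (auto simp: NO_term_def rho_em_neg em_1 em_m2_1 ops_lin rho_lin rho_nem_neg)
  then have "rho (NO (\<lambda>_. 1) (\<lambda>j. em (- 2 + j)) nem (- 1) 1) = 0"
    unfolding NO_def lin_Sum_any [OF lin_rho NO_term_finite [OF fld_em_shift fld_nem]] by (simp only: Sum_any.neutral)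
  then have "?q (- 2) = 0" by simp
  have "?q (- 2 + b) = of_int b / lam\<^sup>2" for b
  proof (induction b rule: int_induct [where k = 0])
    case base
    then show ?case using \<open>?q (- 2) = 0\<close> by simp
  next
    case (step1 b)
    then show ?case using step [of "- 2 + b"] by (simp add: add_divide_distrib algebra_simps)
  next
    case (step2 b)
    then show ?case using step [of "- 2 + (b - 1)"] by (simp add: diff_divide_distrib add_divide_distrib algebra_simps)
  qed
  from this [of "a + 2"] show ?thesis by simp
qed

text \<open>The commutator with \<open>nnem\<close> contributes (a + 2) + 1, that with
  \<open>dnem\<close> contributes a + 1.\<close>

lemma rho_em_gop:
  assumes "n = - a - 2"
  shows "rho (em a (gop n 1)) - rho (gop n (em a 1)) = - (of_int (a + 3) + (k + 1) * of_int (a + 1)) / lam\<^sup>2"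
proof -
  have idx: "n - 1 = - a - 3" "a + n - 2 = - 4" using assms by simp_all
  have "rho (em a (nnem n 1)) = rho (nnem n (em a 1)) + of_int (a + 2) / lam\<^sup>2 + 1 / lam\<^sup>2"
    unfolding em_nnem idx by (simp add: rho_lin rho_NO_em_nem rho_zz_nu_1)
  moreover have "rho (em a (dnem n 1)) = rho (dnem n (em a 1)) + of_int (a + 1) / lam\<^sup>2"
    unfolding em_dnem idx by (simp add: rho_lin rho_NO_em_em dcoef_def)
  ultimately show ?thesis
    by (simp add: gop_def ops_lin rho_lin add_divide_distrib diff_divide_distrib algebra_simps)
qed

text \<open>The e^(-c) operators that accompany L(i) L(s - i) in [f(m), f(n)], summed over i with
  weight \<kappa>(i) (\<open>W_eq\<close>). The weights of interest are 2i - s, from the Virasoro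
  bracket, and i^3 - i, from its central term.\<close>

definition W :: "(int \<Rightarrow> complex) \<Rightarrow> int \<Rightarrow> int \<Rightarrow> int \<Rightarrow> Pi_vec \<Rightarrow> Pi_vec" where
  "W \<kappa> s m n = NO (\<lambda>t. \<kappa> (m - 2 - t)) em em (m + n - 4 - s)"

lemma graded_W: "graded (s - m - n) (W \<kappa> s m n)"
  unfolding W_def by (rule graded_NO [OF fld_em fld_em]) simp

lemma ep_W: "ep j (W \<kappa> s m n p) = W \<kappa> s m n (ep j p)"
  unfolding W_def
  using NO_derivation [where D = "ep j" and a' = "\<lambda>_ _. 0" and b' = "\<lambda>_ _. 0", OF plin_exp fld_em fld_em fld_zero fld_zero]
  by (simp add: ep_em NO_zero_left [OF fld_em] NO_zero_right [OF fld_em])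

lemma hh_W: "hh i (W \<kappa> s m n p) = W \<kappa> s m n (hh i p) - Pi_scale 2 (W \<kappa> s (m + i) n p) - Pi_scale 2 (W \<kappa> s m (n + i) p)"
proof -
  have "hh i (W \<kappa> s m n p) = W \<kappa> s m n (hh i p) + NO (\<lambda>t. \<kappa> (m - 2 - t)) (\<lambda>j p. Pi_scale (- 2) (em (i + j) p)) em (m + n - 4 - s) p
    + NO (\<lambda>t. \<kappa> (m - 2 - t)) em (\<lambda>j p. Pi_scale (- 2) (em (i + j) p)) (m + n - 4 - s) p"
    unfolding W_def
    by (rule NO_derivation [OF plin_ops(6) fld_em fld_em fld_scale [OF fld_em_shift] fld_scale [OF fld_em_shift]])
      (simp_all add: hh_em add.commute)
  also have "\<dots> = W \<kappa> s m n (hh i p) + Pi_scale (- 2) (W \<kappa> s (m + i) n p) + Pi_scale (- 2) (W \<kappa> s m (n + i) p)"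
    unfolding NO_scale_left [OF fld_em_shift fld_em] NO_scale_right [OF fld_em fld_em_shift] NO_shift_right NO_shift_left [of em em, OF em_em]
    by (simp add: W_def algebra_simps)
  finally show ?thesis by simp
qed

lemma rho_W: "m + n = s \<Longrightarrow> rho (W \<kappa> s m n 1) = \<kappa> m / lam\<^sup>2"
  by (simp add: W_def rho_NO_em_em)

text \<open>The component of [f(m), f(n)] = 0 at L(s), divided by k + 2. The commutators with e and
  h follow from \<open>ep_gop\<close>, \<open>hh_em\<close> and \<open>hh_gop\<close>; the vacuum
  expectation is a linear identity in m and n.\<close>

lemma em_gop_relation:
  "Pi_scale (k + 2) (W (\<lambda>i. of_int (2 * i - s)) s m n p)
    + (em (m - 2 - s) (gop n p) - gop n (em (m - 2 - s) p)) + (gop m (em (n - 2 - s) p) - em (n - 2 - s) (gop m p)) = 0"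
proof (rule vacuum_criterion [where X = "\<lambda>m n p. Pi_scale (k + 2) (W (\<lambda>i. of_int (2 * i - s)) s m n p)
    + (em (m - 2 - s) (gop n p) - gop n (em (m - 2 - s) p)) + (gop m (em (n - 2 - s) p) - em (n - 2 - s) (gop m p))"])
  note lin = plin_exp [THEN lin_add] plin_exp [THEN lin_scale] plin_exp [THEN lin_diff]
  fix m n :: int
  show "graded (s - m - n) (\<lambda>p. Pi_scale (k + 2) (W (\<lambda>i. of_int (2 * i - s)) s m n p)
    + (em (m - 2 - s) (gop n p) - gop n (em (m - 2 - s) p)) + (gop m (em (n - 2 - s) p) - em (n - 2 - s) (gop m p)))"
    by (intro graded_add graded_diff graded_scale graded_W graded_comp [OF fldD [OF fld_em] fldD [OF fld_gop]]
      graded_comp [OF fldD [OF fld_gop] fldD [OF fld_em]]) simp_all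
  show "Pi_scale (k + 2) (W (\<lambda>i. of_int (2 * i - s)) s m n (ep j p))
    + (em (m - 2 - s) (gop n (ep j p)) - gop n (em (m - 2 - s) (ep j p))) + (gop m (em (n - 2 - s) (ep j p)) - em (n - 2 - s) (gop m (ep j p)))
   = ep j (Pi_scale (k + 2) (W (\<lambda>i. of_int (2 * i - s)) s m n p)
    + (em (m - 2 - s) (gop n p) - gop n (em (m - 2 - s) p)) + (gop m (em (n - 2 - s) p) - em (n - 2 - s) (gop m p)))" for j p
  proof -
    have ge: "gop n (ep j q) = ep j (gop n q) - hh (j + n) q - sc (n = - j) (k * of_int j) q" for n q
      by (simp add: ep_gop)
    have eh: "em a (hh i q) = hh i (em a q) + Pi_scale 2 (em (a + i) q)" for a i q
      by (simp add: hh_em)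
    have idx: "m - 2 - s + (j + n) = n - 2 - s + (j + m)" by simp
    show ?thesis
      unfolding ep_em [symmetric] ge lin eh ep_W idx
      by (auto simp: ep_W lin ep_em [symmetric] ops_lin)
  qed
  show "Pi_scale (k + 2) (W (\<lambda>i. of_int (2 * i - s)) s m n (hh j p))
    + (em (m - 2 - s) (gop n (hh j p)) - gop n (em (m - 2 - s) (hh j p))) + (gop m (em (n - 2 - s) (hh j p)) - em (n - 2 - s) (gop m (hh j p)))
   = hh j (Pi_scale (k + 2) (W (\<lambda>i. of_int (2 * i - s)) s m n p)
    + (em (m - 2 - s) (gop n p) - gop n (em (m - 2 - s) p)) + (gop m (em (n - 2 - s) p) - em (n - 2 - s) (gop m p)))
   + Pi_scale 2 (Pi_scale (k + 2) (W (\<lambda>i. of_int (2 * i - s)) s (m + j) n p)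
    + (em (m + j - 2 - s) (gop n p) - gop n (em (m + j - 2 - s) p)) + (gop (m + j) (em (n - 2 - s) p) - em (n - 2 - s) (gop (m + j) p)))
   + Pi_scale 2 (Pi_scale (k + 2) (W (\<lambda>i. of_int (2 * i - s)) s m (n + j) p)
    + (em (m - 2 - s) (gop (n + j) p) - gop (n + j) (em (m - 2 - s) p)) + (gop m (em (n + j - 2 - s) p) - em (n + j - 2 - s) (gop m p)))" for j p
  proof -
    have idx: "m + j - 2 - s = m - 2 - s + j" "n + j - 2 - s = n - 2 - s + j" by simp_all
    show ?thesis
      unfolding idx
      by (simp add: hh_W hh_em hh_gop ops_lin lin Pi.scale_right_distrib Pi.scale_right_diff_distrib Pi.scale_left_commute [of 2] del: Pi.scale_scale)
  qed
  assume mn: "m + n = s"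
  have 1: "n = - (m - 2 - s) - 2" "m = - (n - 2 - s) - 2" using mn by simp_all
  have 2: "complex_of_int s = of_int m + of_int n" using mn by auto
  show "rho (Pi_scale (k + 2) (W (\<lambda>i. of_int (2 * i - s)) s m n 1)
    + (em (m - 2 - s) (gop n 1) - gop n (em (m - 2 - s) 1)) + (gop m (em (n - 2 - s) 1) - em (n - 2 - s) (gop m 1))) = 0"
    using rho_em_gop [OF 1(1)] rho_em_gop [OF 1(2)] mn
    by (simp add: rho_lin rho_W 2 add_divide_distrib diff_divide_distrib algebra_simps)
qed

lemma rho_gop_0: "rho (gop 0 p) = 0"
  using rho_nnem [of 0 p] rho_dnem [of 0 p] by (simp add: gop_def rho_lin)

text \<open>In \<open>rho_em_gop\<close> the opposite ordering contributes nothing: em(t - 2) kills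
  1 for t > 0, and for t = 0 it is a scalar on 1 while \<open>rho\<close> kills gop(0).\<close>

lemma rho_em_gop_1: "rho (em (int t - 2) (gop (- int t) 1)) = (k - (k + 2) * of_nat t) / lam\<^sup>2"
proof -
  have "rho (gop (- int t) (em (int t - 2) 1)) = 0"
    by (cases "t = 0") (simp_all add: em_m2_1 em_1 ops_lin rho_lin rho_gop_0)
  then show ?thesis
    using rho_em_gop [of "- int t" "int t - 2"] by (simp add: algebra_simps)
qed

lemma rho_em_nem_1: "rho (em (int t - 2) (nem (- int t - 1) 1)) = 1 / lam\<^sup>2"
  by (simp add: em_nem rho_lin rho_nem_neg rho_NO_em_em)

lemma nu_nem_1: "j > 0 \<Longrightarrow> nu j (nem n 1) = - nem (n + j) 1 - Pi_scale ((k / 2) * of_int j) (em (n + j - 1) 1)"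
  and nu_em_1: "j > 0 \<Longrightarrow> nu j (em n 1) = - em (n + j) 1"
  and nu_gop_1: "j > 0 \<Longrightarrow> nu j (gop n 1) = - gop (n + j) 1 + Pi_scale (k * of_int j) (nem (n + j - 1) 1)
    + Pi_scale ((k + 1) * (k / 2) * of_int j * of_int (j - 1)) (em (n + j - 2) 1)"
  by (simp_all add: nu_nem nu_em nu_gop nu_1 ops_lin)

lemma rho_em_em_1: "rho (em (int t - 2) (em (- int t - 2) 1)) = (if t = 0 then 1 / lam\<^sup>2 else 0)"
  by (simp add: rho_em_em)

text \<open>nu(i) is absorbed by \<open>nu_gop_1\<close>, which leaves expectations at distance
  \<open>t\<close> from the vacuum; the pure e^(-c) term is visible only at t = 0.\<close>

lemma rho_em_nu_gop:
  assumes "i > 0" "M = t + i"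
  shows "rho (em (int M - 2 - int i) (nu (int i) (gop (- int M) 1)))
    = (- (k - (k + 2) * of_nat t) + k * of_nat i + (if t = 0 then (k + 1) * (k / 2) * of_nat i * (of_nat i - 1) else 0)) / lam\<^sup>2"
proof -
  have idx: "int M - 2 - int i = int t - 2" "- int M + int i = - int t" using assms by simp_all
  have "int i > 0" using assms by simp
  show ?thesis
    unfolding nu_gop_1 [OF \<open>int i > 0\<close>] idx
    by (simp add: ops_lin rho_lin rho_em_gop_1 rho_em_nem_1 rho_em_em_1 add_divide_distrib diff_divide_distrib)
qed

lemma rho_em_nu_nu_gop:
  assumes "i > 0" "j > 0" "M = t + j + i"
  shows "rho (em (int (M - i) - 2 - int j) (nu (int j) (nu (int i) (gop (- int M) 1))))
    = ((k - (k + 2) * of_nat t) - k * of_nat j - k * of_nat i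
       - (if t = 0 then (k + 1) * (k / 2) * (of_nat j * (of_nat j - 1) + of_nat i * (of_nat i - 1)) + k\<^sup>2 / 2 * of_nat i * of_nat j else 0)) / lam\<^sup>2"
proof -
  have idx: "int (M - i) - 2 - int j = int t - 2" "- int M + int i = - int (t + j)" "- int (t + j) + int j = - int t"
    "- int (t + j) - 1 + int j = - int t - 1" "- int (t + j) - 2 + int j = - int t - 2"
    using assms by simp_all
  have pos: "int i > 0" "int j > 0" using assms by simp_all
  show ?thesis
    unfolding nu_gop_1 [OF pos(1)] idx ops_lin nu_gop_1 [OF pos(2)] nu_nem_1 [OF pos(2)] nu_em_1 [OF pos(2)]
    by (simp add: ops_lin rho_lin rho_em_gop_1 rho_em_nem_1 rho_em_em_1 add_divide_distrib diff_divide_distrib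
       power2_eq_square algebra_simps)
qed

lemma sum_last: "M > 0 \<Longrightarrow> (\<Sum>i\<in>{1..M}. (f i + (if i = M then y else 0)) / c) = ((\<Sum>i\<in>{1..M}. f i) + y) / c"
  for c :: complex and M :: nat
  by (simp add: sum.distrib sum.delta flip: sum_divide_distrib)

text \<open>The origin of the central charge: for k different from -2 the constant is -(k + 2)^2 d_k
  / 12. \<open>nnem\<close> gives a double sum and \<open>dnem\<close> a single sum, with quadratic
  summands and boundary terms from t = 0.\<close>

lemma rho_gop_gop:
  assumes "M > 0"
  shows "rho (gop (int M) (gop (- int M) 1))
    = - ((k + 2)\<^sup>2 - 6 * (k + 1)\<^sup>2 * (k + 2)) / 12 * (of_nat M ^ 3 - of_nat M) / lam\<^sup>2"
proof -
  let ?q = "gop (- int M) 1" and ?M = "of_nat M :: complex"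
  \<comment> \<open>The contributions of t = 0, which occur only for i + j = M.\<close>
  define B where "B i j = (k + 1) * (k / 2) * (j * (j - 1) + i * (i - 1)) + k\<^sup>2 / 2 * i * j" for i j
  have inner: "(\<Sum>j\<in>{1..M - i}. rho (em (int (M - i) - 2 - int j) (nu (int j) (nu (int i) ?q))))
    = ((?M - of_nat i) * (k - k * ?M) - (?M - of_nat i) * (?M - of_nat i - 1) - (if i = M then 0 else B (of_nat i) (?M - of_nat i))) / lam\<^sup>2"
    if "i \<in> {1..M}" for i
  proof -
    define L where "L = M - i"
    have L: "M = L + i" using that by (simp add: L_def)
    have "(\<Sum>j\<in>{1..L}. rho (em (int L - 2 - int j) (nu (int j) (nu (int i) ?q))))
      = (\<Sum>j\<in>{1..L}. ((k - k * ?M - 2 * of_nat L) + 2 * of_nat j + 0 * (of_nat j)\<^sup>2 - (if j = L then B (of_nat i) (of_nat j) else 0)) / lam\<^sup>2)"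
    proof (rule sum.cong)
      fix j assume j: "j \<in> {1..L}"
      then have "M = (L - j) + j + i" using L by simp
      from rho_em_nu_nu_gop [OF _ _ this] j that
      show "rho (em (int L - 2 - int j) (nu (int j) (nu (int i) ?q)))
        = ((k - k * ?M - 2 * of_nat L) + 2 * of_nat j + 0 * (of_nat j)\<^sup>2 - (if j = L then B (of_nat i) (of_nat j) else 0)) / lam\<^sup>2"
        by (auto simp: L of_nat_diff B_def algebra_simps)
    qed simp
    also have "\<dots> = ((\<Sum>j\<in>{1..L}. (k - k * ?M - 2 * of_nat L) + 2 * of_nat j + 0 * (of_nat j)\<^sup>2)
       - (\<Sum>j\<in>{1..L}. if j = L then B (of_nat i) (of_nat j) else 0)) / lam\<^sup>2"
      by (simp only: sum_subtractf sum_divide_distrib [symmetric])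
    also have "(\<Sum>j\<in>{1..L}. if j = L then B (of_nat i) (of_nat j) else 0) = (if i = M then 0 else B (of_nat i) (of_nat L))"
      using L by (simp add: sum.delta)
    finally show ?thesis
      unfolding sum_quadratic L_def [symmetric] using L by (simp add: algebra_simps)
  qed
  have "rho (nnem (int M) ?q) = (\<Sum>i\<in>{1..M}. ((?M - of_nat i) * (k - k * ?M) - (?M - of_nat i) * (?M - of_nat i - 1)
      - (if i = M then 0 else B (of_nat i) (?M - of_nat i))) / lam\<^sup>2)"
    unfolding rho_nnem by (intro sum.cong inner refl)
  \<comment> \<open>For i = M the inner sum is empty. Subtracting the polynomial B(i, M - i) for
    every i makes the summand uniform, and its value B(M, 0) is added back.\<close>
  also have "\<dots> = (\<Sum>i\<in>{1..M}. (((?M * (k - k * ?M) - ?M * (?M - 1) - (k + 1) * (k / 2) * (?M * (?M - 1)))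
         + (- (k - k * ?M) + 2 * ?M - 1 - ((k + 1) * (k / 2) * (- 2 * ?M) + k\<^sup>2 / 2 * ?M)) * of_nat i
         + (- 1 - (k + 1) * k + k\<^sup>2 / 2) * (of_nat i)\<^sup>2) + (if i = M then (k + 1) * (k / 2) * (?M * (?M - 1)) else 0)) / lam\<^sup>2)"
  proof (rule sum.cong)
    have quad: "(?M - x) * (k - k * ?M) - (?M - x) * (?M - x - 1) - B x (?M - x)
      = (?M * (k - k * ?M) - ?M * (?M - 1) - (k + 1) * (k / 2) * (?M * (?M - 1)))
         + (- (k - k * ?M) + 2 * ?M - 1 - ((k + 1) * (k / 2) * (- 2 * ?M) + k\<^sup>2 / 2 * ?M)) * x
         + (- 1 - (k + 1) * k + k\<^sup>2 / 2) * x\<^sup>2" for x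
      by (simp add: B_def power2_eq_square field_simps)
    fix i
    have "B ?M 0 = (k + 1) * (k / 2) * (?M * (?M - 1))" by (simp add: B_def)
    then show "((?M - of_nat i) * (k - k * ?M) - (?M - of_nat i) * (?M - of_nat i - 1) - (if i = M then 0 else B (of_nat i) (?M - of_nat i))) / lam\<^sup>2
      = (((?M * (k - k * ?M) - ?M * (?M - 1) - (k + 1) * (k / 2) * (?M * (?M - 1)))
         + (- (k - k * ?M) + 2 * ?M - 1 - ((k + 1) * (k / 2) * (- 2 * ?M) + k\<^sup>2 / 2 * ?M)) * of_nat i
         + (- 1 - (k + 1) * k + k\<^sup>2 / 2) * (of_nat i)\<^sup>2) + (if i = M then (k + 1) * (k / 2) * (?M * (?M - 1)) else 0)) / lam\<^sup>2"
      unfolding quad [of "of_nat i", symmetric] by (cases "i = M") simp_all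
  qed simp
  also have "\<dots> = ((\<Sum>i\<in>{1..M}. (?M * (k - k * ?M) - ?M * (?M - 1) - (k + 1) * (k / 2) * (?M * (?M - 1)))
         + (- (k - k * ?M) + 2 * ?M - 1 - ((k + 1) * (k / 2) * (- 2 * ?M) + k\<^sup>2 / 2 * ?M)) * of_nat i
         + (- 1 - (k + 1) * k + k\<^sup>2 / 2) * (of_nat i)\<^sup>2) + (k + 1) * (k / 2) * (?M * (?M - 1))) / lam\<^sup>2"
    by (rule sum_last [OF assms])
  finally have nnem: "rho (nnem (int M) ?q) = \<dots>" .
  have "rho (dnem (int M) ?q) = - (\<Sum>i\<in>{1..M}. ((k * (?M - 1) + 2 * ?M - 0 + (k * ?M + 2 * ?M - k - 2) * of_nat i + (- 2) * (of_nat i)\<^sup>2)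
       + (if i = M then (?M + 1) * ((k + 1) * (k / 2) * ?M * (?M - 1)) else 0)) / lam\<^sup>2)"
    unfolding rho_dnem
  proof (intro arg_cong [of _ _ uminus] sum.cong)
    fix i assume i: "i \<in> {1..M}"
    then have M: "M = (M - i) + i" "i > 0" by simp_all
    show "of_nat (i + 1) * rho (em (int M - 2 - int i) (nu (int i) ?q)) = ((k * (?M - 1) + 2 * ?M - 0 + (k * ?M + 2 * ?M - k - 2) * of_nat i + (- 2) * (of_nat i)\<^sup>2)
       + (if i = M then (?M + 1) * ((k + 1) * (k / 2) * ?M * (?M - 1)) else 0)) / lam\<^sup>2"
      unfolding rho_em_nu_gop [OF M(2,1)] using i
      by (auto simp: of_nat_diff power2_eq_square field_simps)
  qed simp
  also have "\<dots> = - (((\<Sum>i\<in>{1..M}. k * (?M - 1) + 2 * ?M - 0 + (k * ?M + 2 * ?M - k - 2) * of_nat i + (- 2) * (of_nat i)\<^sup>2)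
       + (?M + 1) * ((k + 1) * (k / 2) * ?M * (?M - 1))) / lam\<^sup>2)"
    by (rule arg_cong [OF sum_last [OF assms]])
  finally have dnem: "rho (dnem (int M) ?q) = \<dots>" .
  show ?thesis
    unfolding gop_def [of "int M"] rho_lin nnem dnem sum_quadratic
    using lam by (simp add: field_simps power2_eq_square power3_eq_cube)
qed

lemma rho_gop_pos: "m > 0 \<Longrightarrow> gop m 1 = 0"
  using graded_hom [OF fldD [OF fld_gop] hom_1] hom_negative by force

text \<open>The component of [f(m), f(n)] = 0 without Virasoro modes: (k + 2)^2 comes from the two
  factors (k + 2) omega, d_k / 12 from the Virasoro central term. Negative m follows from positive m
  by antisymmetry.\<close>

lemma gop_gop_relation:
  assumes "k \<noteq> - 2"
  shows "Pi_scale ((k + 2)\<^sup>2 * d_level k / 12) (W (\<lambda>i. of_int (i ^ 3 - i)) 0 m n p) + (gop m (gop n p) - gop n (gop m p)) = 0"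
proof (rule vacuum_criterion [where s = 0 and X = "\<lambda>m n p. Pi_scale ((k + 2)\<^sup>2 * d_level k / 12) (W (\<lambda>i. of_int (i ^ 3 - i)) 0 m n p)
     + (gop m (gop n p) - gop n (gop m p))"])
  let ?\<kappa> = "\<lambda>i. of_int (i ^ 3 - i) :: complex" and ?x = "(k + 2)\<^sup>2 * d_level k / 12"
  note lin = plin_exp [THEN lin_add] plin_exp [THEN lin_scale] plin_exp [THEN lin_diff]
  fix m n :: int
  show "graded (0 - m - n) (\<lambda>p. Pi_scale ?x (W ?\<kappa> 0 m n p) + (gop m (gop n p) - gop n (gop m p)))"
    by (intro graded_add graded_diff graded_scale graded_W graded_comp [OF fldD [OF fld_gop] fldD [OF fld_gop]]) simp_all
  show "Pi_scale ?x (W ?\<kappa> 0 m n (ep j p)) + (gop m (gop n (ep j p)) - gop n (gop m (ep j p)))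
     = ep j (Pi_scale ?x (W ?\<kappa> 0 m n p) + (gop m (gop n p) - gop n (gop m p)))" for j p
    by (auto simp: lin ep_W ep_gop ops_lin hh_gop add_ac)
  show "Pi_scale ?x (W ?\<kappa> 0 m n (hh j p)) + (gop m (gop n (hh j p)) - gop n (gop m (hh j p)))
     = hh j (Pi_scale ?x (W ?\<kappa> 0 m n p) + (gop m (gop n p) - gop n (gop m p)))
      + Pi_scale 2 (Pi_scale ?x (W ?\<kappa> 0 (m + j) n p) + (gop (m + j) (gop n p) - gop n (gop (m + j) p)))
      + Pi_scale 2 (Pi_scale ?x (W ?\<kappa> 0 m (n + j) p) + (gop m (gop (n + j) p) - gop (n + j) (gop m p)))" for j p
    by (simp add: hh_W hh_gop ops_lin Pi.scale_right_distrib Pi.scale_right_diff_distrib Pi.scale_left_commute [of 2] del: Pi.scale_scale)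
  assume mn: "m + n = 0"
  have pos: "?x * (?\<kappa> m / lam\<^sup>2) + (rho (gop m (gop (- m) 1)) - rho (gop (- m) (gop m 1))) = 0" if "m > 0" for m
  proof -
    have eq1: "rho (gop m (gop (- m) 1)) = - ((k + 2)\<^sup>2 - 6 * (k + 1)\<^sup>2 * (k + 2)) / 12 * ?\<kappa> m / lam\<^sup>2"
      using rho_gop_gop [of "nat m"] that by simp
    have eq2: "(k + 2)\<^sup>2 * d_level k = (k + 2)\<^sup>2 - 6 * (k + 1)\<^sup>2 * (k + 2)"
      using assms by (simp add: d_level_def field_simps power2_eq_square eq_neg_iff_add_eq_0)
    have "rho (gop m (gop (- m) 1)) = - (?x * (?\<kappa> m / lam\<^sup>2))"
      unfolding eq1 eq2 [symmetric] by simp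
    then show ?thesis
      using that by (simp add: rho_gop_pos ops_lin rho_lin)
  qed
  have "?x * (?\<kappa> m / lam\<^sup>2) + (rho (gop m (gop (- m) 1)) - rho (gop (- m) (gop m 1))) = 0"
  proof (cases m "0::int" rule: linorder_cases)
    case less
    then show ?thesis using pos [of "- m"] by (simp add: diff_divide_distrib field_simps)
  qed (use pos in simp_all)
  moreover have "n = - m" using mn by simp
  ultimately show "rho (Pi_scale ?x (W ?\<kappa> 0 m n 1) + (gop m (gop n 1) - gop n (gop m 1))) = 0"
    by (simp add: rho_lin rho_W)
qed

end

section \<open>Quotients of modules\<close>

lemma complex_ring_simps [simp]:
  "carrier complex_ring = UNIV" "\<one>\<^bsub>complex_ring\<^esub> = 1" "\<zero>\<^bsub>complex_ring\<^esub> = 0"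
  "a \<otimes>\<^bsub>complex_ring\<^esub> b = a * b" "a \<oplus>\<^bsub>complex_ring\<^esub> b = a + b"
  by (simp_all add: complex_ring_def)

lemma cring_complex_ring: "cring complex_ring"
proof (rule cringI)
  show "abelian_group complex_ring"
    by (rule abelian_groupI) (auto simp: algebra_simps intro: exI [of _ "- x" for x])
  show "comm_monoid complex_ring"
    by (rule comm_monoidI) (auto simp: algebra_simps)
qed (auto simp: algebra_simps)

abbreviation cmodule :: "(complex, 'v, 'm) module_scheme \<Rightarrow> bool" where
  "cmodule \<equiv> Module.module complex_ring"

lemma cmoduleI:
  fixes M (structure)
  assumes "\<zero> \<in> carrier M" "\<And>x y. x \<in> carrier M \<Longrightarrow> y \<in> carrier M \<Longrightarrow> x \<oplus> y \<in> carrier M"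
    "\<And>a x. x \<in> carrier M \<Longrightarrow> a \<odot> x \<in> carrier M"
    "\<And>x y z. x \<in> carrier M \<Longrightarrow> y \<in> carrier M \<Longrightarrow> z \<in> carrier M \<Longrightarrow> (x \<oplus> y) \<oplus> z = x \<oplus> (y \<oplus> z)"
    "\<And>x y. x \<in> carrier M \<Longrightarrow> y \<in> carrier M \<Longrightarrow> x \<oplus> y = y \<oplus> x"
    "\<And>x. x \<in> carrier M \<Longrightarrow> \<zero> \<oplus> x = x"
    "\<And>x. x \<in> carrier M \<Longrightarrow> (- 1) \<odot> x \<oplus> x = \<zero>"
    "\<And>a b x. x \<in> carrier M \<Longrightarrow> (a + b) \<odot> x = a \<odot> x \<oplus> b \<odot> x"
    "\<And>a x y. x \<in> carrier M \<Longrightarrow> y \<in> carrier M \<Longrightarrow> a \<odot> (x \<oplus> y) = a \<odot> x \<oplus> a \<odot> y"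
    "\<And>a b x. x \<in> carrier M \<Longrightarrow> (a * b) \<odot> x = a \<odot> (b \<odot> x)" "\<And>x. x \<in> carrier M \<Longrightarrow> 1 \<odot> x = x"
  shows "cmodule M"
proof (rule Module.moduleI [OF cring_complex_ring])
  show "abelian_group M"
  proof (rule abelian_groupI)
    show "\<exists>y\<in>carrier M. y \<oplus> x = \<zero>" if "x \<in> carrier M" for x
      using assms(7) [OF that] assms(3) [OF that] by blast
  qed (use assms in simp_all)
qed (use assms in auto)

lemma free_space_simps [simp]:
  "carrier (free_space B) = {p. keys p \<subseteq> B}" "\<zero>\<^bsub>free_space B\<^esub> = 0"
  "p \<oplus>\<^bsub>free_space B\<^esub> q = p + q" "a \<odot>\<^bsub>free_space B\<^esub> p = fscale a p"
  by (simp_all add: free_space_def)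

lemma keys_fscale: "keys (fscale a p) \<subseteq> keys p"
  by (auto simp: in_keys_iff lookup_map)

lemma cmodule_free_space: "cmodule (free_space B)"
proof (rule cmoduleI)
  show "x \<oplus>\<^bsub>free_space B\<^esub> y \<in> carrier (free_space B)" if "x \<in> carrier (free_space B)" "y \<in> carrier (free_space B)" for x y
    using that keys_add [of x y] by simp blast
  show "a \<odot>\<^bsub>free_space B\<^esub> x \<in> carrier (free_space B)" if "x \<in> carrier (free_space B)" for x a
    using that keys_fscale [of a x] by auto
qed (simp_all add: free.scale_left_distrib free.scale_right_distrib add_ac)

definition epi :: "(complex, 'v, 'm) module_scheme \<Rightarrow> (complex, 'w, 'n) module_scheme \<Rightarrow> ('v \<Rightarrow> 'w) \<Rightarrow> bool" where
  "epi V Q c \<longleftrightarrow> carrier Q = c ` carrier V \<and> \<zero>\<^bsub>Q\<^esub> = c \<zero>\<^bsub>V\<^esub> \<and>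
     (\<forall>x\<in>carrier V. \<forall>y\<in>carrier V. c (x \<oplus>\<^bsub>V\<^esub> y) = c x \<oplus>\<^bsub>Q\<^esub> c y) \<and>
     (\<forall>a. \<forall>x\<in>carrier V. c (a \<odot>\<^bsub>V\<^esub> x) = a \<odot>\<^bsub>Q\<^esub> c x)"

text \<open>Quotients and tensor products are bare records with operations on sets; their module
  axioms are read off along the surjection from \<open>V\<close>.\<close>

lemma epi_module:
  assumes V: "cmodule V" and c: "epi V Q c"
  shows "cmodule Q"
proof -
  interpret V: Module.module complex_ring V by (rule V)
  have sub: "(- 1) \<odot>\<^bsub>V\<^esub> x \<oplus>\<^bsub>V\<^esub> x = \<zero>\<^bsub>V\<^esub>" "x \<oplus>\<^bsub>V\<^esub> (- 1) \<odot>\<^bsub>V\<^esub> x = \<zero>\<^bsub>V\<^esub>" if "x \<in> carrier V" for x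
    using V.smult_l_distr [of "- 1" 1 x] V.smult_l_distr [of 1 "- 1" x] V.smult_one [of x] V.smult_l_null [of x] that by simp_all
  have c': "carrier Q = c ` carrier V" "\<zero>\<^bsub>Q\<^esub> = c \<zero>\<^bsub>V\<^esub>"
    "\<And>x y. x \<in> carrier V \<Longrightarrow> y \<in> carrier V \<Longrightarrow> c x \<oplus>\<^bsub>Q\<^esub> c y = c (x \<oplus>\<^bsub>V\<^esub> y)"
    "\<And>a x. x \<in> carrier V \<Longrightarrow> a \<odot>\<^bsub>Q\<^esub> c x = c (a \<odot>\<^bsub>V\<^esub> x)"
    using c by (auto simp: epi_def)
  have l: "(a + b) \<odot>\<^bsub>V\<^esub> x = a \<odot>\<^bsub>V\<^esub> x \<oplus>\<^bsub>V\<^esub> b \<odot>\<^bsub>V\<^esub> x" "(a * b) \<odot>\<^bsub>V\<^esub> x = a \<odot>\<^bsub>V\<^esub> (b \<odot>\<^bsub>V\<^esub> x)" "1 \<odot>\<^bsub>V\<^esub> x = x"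
    if "x \<in> carrier V" for a b x
    using V.smult_l_distr [of a b x] V.smult_assoc1 [of a b x] V.smult_one [of x] that by simp_all
  show ?thesis
    by (rule cmoduleI) (auto simp: c' sub l V.a_ac V.smult_r_distr)
qed

context
  fixes V :: "(complex, 'v, 'm) module_scheme" (structure) and N
  assumes V: "cmodule V" and N: "submodule N complex_ring V"
begin

interpretation V: Module.module complex_ring V by (rule V)

lemma abelian_subgroup_submodule: "abelian_subgroup N V"
  using submodule.axioms(1) [OF N] V.abelian_group_axioms
  by (intro abelian_subgroupI3 additive_subgroup.intro)

interpretation N: abelian_subgroup N V by (rule abelian_subgroup_submodule)

lemma submodule_smult: "x \<in> N \<Longrightarrow> a \<odot> x \<in> N"
  using submodule.smult_closed [OF N, of a x] by simp

lemma coset_eq_iff: "x \<in> carrier V \<Longrightarrow> y \<in> carrier V \<Longrightarrow> N +> x = N +> y \<longleftrightarrow> x \<ominus> y \<in> N"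
  using N.a_repr_independence' [of x y] N.a_rcos_self [of x] N.a_rcos_module [of y x] by (auto simp: a_minus_def)

lemma coset_eq_zero_iff: "x \<in> carrier V \<Longrightarrow> N +> x = N \<longleftrightarrow> x \<in> N"
  using N.a_rcos_self N.a_rcos_const by blast

lemma coset_zero: "N +> \<zero> = N"
  by (simp add: N.a_subset)

text \<open>An additive \<open>f\<close> that preserves \<open>N\<close> sends all members of a
  coset into one coset, so the union has equal members. This evaluates the unions by which quotients
  and \<open>tensor_map\<close> define their operations.\<close>

lemma Union_cosets:
  assumes f: "\<And>x. x \<in> carrier V \<Longrightarrow> f x \<in> carrier V" "\<And>x. x \<in> N \<Longrightarrow> f x \<in> N"
    and add: "\<And>x y. x \<in> carrier V \<Longrightarrow> y \<in> carrier V \<Longrightarrow> f (x \<oplus> y) = f x \<oplus> f y"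
    and x: "x \<in> carrier V"
  shows "(\<Union>y\<in>N +> x. N +> f y) = N +> f x"
proof -
  have "N +> f y = N +> f x" if y: "y \<in> N +> x" for y
  proof -
    obtain n where n: "n \<in> N" "y = n \<oplus> x" using y by (auto simp: a_r_coset_def')
    then have nV: "n \<in> carrier V" using N.a_subset by blast
    have "f y \<in> N +> f x" using n f(2) add [OF nV x] by (auto simp: a_r_coset_def')
    then show ?thesis using N.a_repr_independence' [of "f y" "f x"] f x by simp
  qed
  moreover have "x \<in> N +> x" using N.a_rcos_self x by blast
  ultimately show ?thesis by blast
qed

lemma epi_quot_space: "epi V (quot_space V N) (\<lambda>x. N +> x)"
  unfolding epi_def
proof (intro conjI ballI allI)
  show "carrier (quot_space V N) = (\<lambda>x. N +> x) ` carrier V"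
    by (auto simp: quot_space_def A_RCOSETS_def')
  show "\<zero>\<^bsub>quot_space V N\<^esub> = N +> \<zero>" by (simp add: quot_space_def coset_zero)
  fix x y assume x: "x \<in> carrier V" and y: "y \<in> carrier V"
  then show "N +> (x \<oplus> y) = (N +> x) \<oplus>\<^bsub>quot_space V N\<^esub> (N +> y)"
    by (simp add: quot_space_def N.a_rcos_sum)
next
  fix a x assume x: "x \<in> carrier V"
  have "(\<Union>y\<in>N +> x. N +> (a \<odot> y)) = N +> (a \<odot> x)"
    by (rule Union_cosets) (use x submodule_smult V.smult_r_distr in auto)
  then show "N +> (a \<odot> x) = a \<odot>\<^bsub>quot_space V N\<^esub> (N +> x)"
    by (simp add: quot_space_def)
qed

end

section \<open>Representations presented by words\<close>

text \<open>\<open>lie_module\<close> without the bracket axiom. The tensor algebra satisfies only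
  this much; its bracket relations hold modulo \<open>enveloping_relations\<close>.\<close>

definition linrep :: "('g, 'v) rep \<Rightarrow> bool" where
  "linrep M \<longleftrightarrow> cmodule M \<and> (\<forall>x. \<forall>v\<in>carrier M. act M x v \<in> carrier M) \<and>
     (\<forall>x. \<forall>v\<in>carrier M. \<forall>w\<in>carrier M. act M x (v \<oplus>\<^bsub>M\<^esub> w) = act M x v \<oplus>\<^bsub>M\<^esub> act M x w) \<and>
     (\<forall>x a. \<forall>v\<in>carrier M. act M x (a \<odot>\<^bsub>M\<^esub> v) = a \<odot>\<^bsub>M\<^esub> act M x v)"

lemma quot_rep_simps [simp]:
  "carrier (quot_rep M N) = carrier (quot_space M N)" "\<zero>\<^bsub>quot_rep M N\<^esub> = \<zero>\<^bsub>quot_space M N\<^esub>"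
  "x \<oplus>\<^bsub>quot_rep M N\<^esub> y = x \<oplus>\<^bsub>quot_space M N\<^esub> y" "a \<odot>\<^bsub>quot_rep M N\<^esub> y = a \<odot>\<^bsub>quot_space M N\<^esub> y"
  "act (quot_rep M N) = (\<lambda>x X. \<Union>v\<in>X. N +>\<^bsub>M\<^esub> act M x v)"
  by (simp_all add: quot_rep_def Module.module.extend_def)

lemma tensor_algebra_simps [simp]:
  "carrier tensor_algebra = UNIV" "\<zero>\<^bsub>tensor_algebra\<^esub> = 0" "p \<oplus>\<^bsub>tensor_algebra\<^esub> q = p + q"
  "a \<odot>\<^bsub>tensor_algebra\<^esub> p = fscale a p" "act tensor_algebra = (\<lambda>x. push ((#) x))"
  by (simp_all add: tensor_algebra_def Module.module.extend_def free_space_def)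

lemma push_single [simp]: "push g (single x a) = single (g x) a"
  by (cases "a = 0") (simp_all add: push_def)

lemma push_add: "push g (p + q) = push g p + push g q"
  unfolding push_def by (rule setsum_keys_plus_distrib) (simp_all add: single_add)

lemma push_zero [simp]: "push g 0 = 0"
  by (simp add: push_def)

lemma push_fscale: "push g (fscale a p) = fscale a (push g p)"
  by (rule additive_eqI [of "\<lambda>p. push g (fscale a p)" "\<lambda>p. fscale a (push g p)"])
    (simp_all add: push_add free.scale_right_distrib)

lemma lin_push: "lin fscale fscale (push g)"
  by unfold_locales (simp_all add: push_add push_fscale)

definition rep_epi :: "('g, 'v) rep \<Rightarrow> ('g, 'w) rep \<Rightarrow> ('v \<Rightarrow> 'w) \<Rightarrow> bool" where
  "rep_epi M Q c \<longleftrightarrow> epi M Q c \<and> (\<forall>x. \<forall>v\<in>carrier M. c (act M x v) = act Q x (c v))"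

lemma rep_epi_linrep:
  assumes "linrep M" "rep_epi M Q c"
  shows "linrep Q"
proof -
  have M: "cmodule M" "\<And>x v. v \<in> carrier M \<Longrightarrow> act M x v \<in> carrier M"
    "\<And>x v w. v \<in> carrier M \<Longrightarrow> w \<in> carrier M \<Longrightarrow> act M x (v \<oplus>\<^bsub>M\<^esub> w) = act M x v \<oplus>\<^bsub>M\<^esub> act M x w"
    "\<And>x a v. v \<in> carrier M \<Longrightarrow> act M x (a \<odot>\<^bsub>M\<^esub> v) = a \<odot>\<^bsub>M\<^esub> act M x v"
    using assms(1) by (simp_all add: linrep_def)
  have c: "epi M Q c" "carrier Q = c ` carrier M"
    "\<And>x y. x \<in> carrier M \<Longrightarrow> y \<in> carrier M \<Longrightarrow> c x \<oplus>\<^bsub>Q\<^esub> c y = c (x \<oplus>\<^bsub>M\<^esub> y)"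
    "\<And>a x. x \<in> carrier M \<Longrightarrow> a \<odot>\<^bsub>Q\<^esub> c x = c (a \<odot>\<^bsub>M\<^esub> x)"
    "\<And>x v. v \<in> carrier M \<Longrightarrow> act Q x (c v) = c (act M x v)"
    using assms(2) by (auto simp: rep_epi_def epi_def)
  interpret M: Module.module complex_ring M by (rule M)
  show ?thesis
    unfolding linrep_def using epi_module [OF M(1) c(1)] by (auto simp: c(2-) M(2-))
qed

lemma rep_epi_comp: "rep_epi M Q c \<Longrightarrow> rep_epi Q R d \<Longrightarrow> rep_epi M R (\<lambda>x. d (c x))"
  by (auto simp: rep_epi_def epi_def image_image)

lemma rep_epi_quot:
  assumes M: "linrep M" and N: "subrep N M"
  shows "rep_epi M (quot_rep M N) (\<lambda>x. N +>\<^bsub>M\<^esub> x)"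
proof -
  have *: "cmodule M" "submodule N complex_ring M" using M N by (simp_all add: linrep_def subrep_def)
  have "N +>\<^bsub>M\<^esub> act M x v = (\<Union>w\<in>N +>\<^bsub>M\<^esub> v. N +>\<^bsub>M\<^esub> act M x w)" if "v \<in> carrier M" for x v
    by (rule Union_cosets [OF *, symmetric]) (use M N that in \<open>auto simp: linrep_def subrep_def\<close>)
  then show ?thesis
    using epi_quot_space [OF *] by (simp add: rep_epi_def epi_def)
qed

lemma cmodule_tensor_algebra: "cmodule tensor_algebra"
  by (rule cmoduleI) (simp_all add: free.scale_left_distrib free.scale_right_distrib add_ac)

lemma linrep_tensor_algebra: "linrep tensor_algebra"
  by (simp add: linrep_def cmodule_tensor_algebra push_add push_fscale)

definition lideal :: "('g list \<Rightarrow>\<^sub>0 complex) set \<Rightarrow> bool" where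
  "lideal J \<longleftrightarrow> free.subspace J \<and> (\<forall>x. \<forall>y\<in>J. push ((#) x) y \<in> J)"

lemma lidealD: "lideal J \<Longrightarrow> free.subspace J" "lideal J \<Longrightarrow> y \<in> J \<Longrightarrow> push ((#) x) y \<in> J"
  by (simp_all add: lideal_def)

lemma submodule_iff:
  assumes "cmodule M"
  shows "submodule N complex_ring M \<longleftrightarrow> N \<subseteq> carrier M \<and> \<zero>\<^bsub>M\<^esub> \<in> N \<and> (\<forall>x\<in>N. \<forall>y\<in>N. x \<oplus>\<^bsub>M\<^esub> y \<in> N) \<and> (\<forall>a. \<forall>x\<in>N. a \<odot>\<^bsub>M\<^esub> x \<in> N)"
    (is "_ \<longleftrightarrow> ?R")
proof -
  interpret M: Module.module complex_ring M by (rule assms)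
  show ?thesis
  proof
    assume N: "submodule N complex_ring M"
    then interpret abelian_subgroup N M by (rule abelian_subgroup_submodule [OF assms])
    show ?R using submodule_smult [OF assms N] a_subset by auto
  next
    assume R: ?R
    have "\<ominus>\<^bsub>M\<^esub> x \<in> N" if "x \<in> N" for x
    proof -
      have x: "x \<in> carrier M" using R that by blast
      have "\<ominus>\<^bsub>M\<^esub> x = (- 1) \<odot>\<^bsub>M\<^esub> x"
        using M.smult_l_distr [of "- 1" 1 x] M.smult_l_null [of x] M.smult_one [of x] x
        by (intro M.minus_equality) (simp_all)
      then show ?thesis using R that by simp
    qed
    then show "submodule N complex_ring M" using R by (intro M.submoduleI) auto
  qed
qed

lemma lideal_iff: "subrep J tensor_algebra \<longleftrightarrow> lideal J"
  by (auto simp: subrep_def lideal_def submodule_iff [OF cmodule_tensor_algebra] free.subspace_def)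

lemma map_zero_fun [simp]: "Poly_Mapping.map (\<lambda>a. 0) p = 0"
  by (rule poly_mapping_eqI) (simp add: lookup_map)

definition bract :: "('g \<Rightarrow>\<^sub>0 complex) \<Rightarrow> ('g list \<Rightarrow>\<^sub>0 complex) \<Rightarrow> ('g list \<Rightarrow>\<^sub>0 complex)" where
  "bract b y = (\<Sum>z\<in>keys b. fscale (lookup b z) (push ((#) z) y))"

lemma bract_single [simp]: "bract (single z a) y = fscale a (push ((#) z) y)"
  by (cases "a = 0") (simp_all add: bract_def)

lemma bract_add: "bract (b + b') y = bract b y + bract b' y"
  unfolding bract_def by (rule setsum_keys_plus_distrib) (simp_all add: free.scale_left_distrib)

lemma bract_zero [simp]: "bract 0 y = 0" and bract_minus: "bract (- b) y = - bract b y"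
  by (simp_all add: bract_def sum_negf)

lemma lin_bract: "lin fscale fscale (bract b)"
  by unfold_locales (simp_all add: bract_def push_add push_fscale free.scale_right_distrib sum.distrib free.scale_sum_right mult.commute)

text \<open>\<open>enveloping_relations\<close> already contains the relations multiplied on the
  right by every word, so linearity in \<open>w\<close> suffices.\<close>

lemma bracket_mem:
  assumes I: "free.subspace I" "enveloping_relations br \<subseteq> I"
  shows "push ((#) x) (push ((#) y) w) - push ((#) y) (push ((#) x) w) - bract (br x y) w \<in> I"
proof -
  let ?f = "\<lambda>w. push ((#) x) (push ((#) y) w) - push ((#) y) (push ((#) x) w) - bract (br x y) w"
  show "?f w \<in> I"
  proof (induction w rule: poly_mapping_single_induct)
    case zero
    then show ?case using I by (simp add: free.subspace_0 lin_zero [OF lin_bract])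
  next
    case (single u a)
    have "bract (br x y) (single u a) = fscale a (push (\<lambda>z. z # u) (br x y))"
      by (simp add: bract_def push_def free.scale_sum_right mult.commute)
    then have "?f (single u a) = fscale a (single (x # y # u) 1 - single (y # x # u) 1
        - push (\<lambda>z. z # u) (br x y))"
      by (simp add: free.scale_right_diff_distrib)
    then show ?case
      using I by (auto simp: enveloping_relations_def intro!: free.subspace_scale)
  next
    case (add p q)
    have "?f (p + q) = ?f p + ?f q"
      by (simp add: push_add lin_add [OF lin_bract])
    then show ?case using add free.subspace_add [OF I(1)] by metis
  qed
qed

definition lgen :: "('g list \<Rightarrow>\<^sub>0 complex) set \<Rightarrow> ('g list \<Rightarrow>\<^sub>0 complex) set" where
  "lgen S = \<Inter>{J. lideal J \<and> S \<subseteq> J}"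

lemma lideal_lgen: "lideal (lgen S)" and lgen_superset: "S \<subseteq> lgen S" and lgen_minimal: "lideal J \<Longrightarrow> S \<subseteq> J \<Longrightarrow> lgen S \<subseteq> J"
  by (auto simp: lgen_def lideal_def free.subspace_def)

lemma cyclic_null_eq: "cyclic_null br S = lgen (enveloping_relations br \<union> S)"
  by (simp add: cyclic_null_def gen_subrep_def lgen_def lideal_iff)

text \<open>A cyclic module as the tensor algebra modulo \<open>ker\<close>. Subrepresentations
  become left ideals above \<open>ker\<close>, so quotients of quotients, which live in different
  types, are compared inside the tensor algebra.\<close>

locale presented =
  fixes M :: "('g, 'v) rep" and q :: "('g list \<Rightarrow>\<^sub>0 complex) \<Rightarrow> 'v"
  assumes epi: "rep_epi tensor_algebra M q"
begin

lemma linrep: "linrep M"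
  using rep_epi_linrep [OF linrep_tensor_algebra epi] .

lemma cmodule: "cmodule M"
  using linrep by (simp add: linrep_def)

sublocale M: Module.module complex_ring M by (rule cmodule)

lemma carrier_eq: "carrier M = range q"
  and q_0: "\<zero>\<^bsub>M\<^esub> = q 0" and q_add: "q (x + y) = q x \<oplus>\<^bsub>M\<^esub> q y" and q_scale: "q (fscale a x) = a \<odot>\<^bsub>M\<^esub> q x"
  and q_act: "q (push ((#) g) x) = act M g (q x)"
  using epi by (auto simp: rep_epi_def epi_def)

lemma q_closed [simp]: "q x \<in> carrier M"
  by (simp add: carrier_eq)

lemma q_minus: "q (- x) = \<ominus>\<^bsub>M\<^esub> q x"
proof -
  have "q (- x) \<oplus>\<^bsub>M\<^esub> q x = \<zero>\<^bsub>M\<^esub>" by (simp add: q_0 flip: q_add)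
  then show ?thesis by (intro M.minus_equality [symmetric]) simp_all
qed

lemma q_diff: "q (x - y) = q x \<ominus>\<^bsub>M\<^esub> q y"
  using q_add [of x "- y"] by (simp add: q_minus a_minus_def)

lemma q_sum: "finite A \<Longrightarrow> q (sum f A) = (\<Oplus>\<^bsub>M\<^esub>i\<in>A. q (f i))"
  by (induction A rule: finite_induct) (simp_all add: q_0 q_add)

definition ker where "ker = {y. q y = \<zero>\<^bsub>M\<^esub>}"

lemma q_eq_iff: "q x = q y \<longleftrightarrow> x - y \<in> ker"
proof -
  have "q x = (q x \<ominus>\<^bsub>M\<^esub> q y) \<oplus>\<^bsub>M\<^esub> q y"
    by (simp add: a_minus_def M.a_assoc M.l_neg)
  then have "q x \<ominus>\<^bsub>M\<^esub> q y = \<zero>\<^bsub>M\<^esub> \<longleftrightarrow> q x = q y"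
    by (auto simp: a_minus_def M.r_neg)
  then show ?thesis by (simp add: ker_def q_diff)
qed

lemma lideal_preimage: "subrep N M \<Longrightarrow> lideal {y. q y \<in> N}"
  by (auto simp: subrep_def submodule_iff [OF cmodule] lideal_def free.subspace_def q_add q_scale q_act q_0)

lemma image_preimage: "subrep N M \<Longrightarrow> q ` {y. q y \<in> N} = N"
  by (auto simp: subrep_def submodule_iff [OF cmodule] carrier_eq)

lemma subrep_image: "lideal J \<Longrightarrow> subrep (q ` J) M"
  unfolding subrep_def submodule_iff [OF cmodule] lideal_def free.subspace_def
  by (auto simp flip: q_add q_scale q_act simp: q_0)

lemma subrep_zero: "subrep {\<zero>\<^bsub>M\<^esub>} M"
  using subrep_image [of "{0}"] by (simp add: lideal_def free.subspace_def q_0)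

lemma ker_eq: "ker = {y. q y \<in> {\<zero>\<^bsub>M\<^esub>}}"
  by (simp add: ker_def)

lemma lideal_ker: "lideal ker"
  unfolding ker_eq by (rule lideal_preimage [OF subrep_zero])

lemma mem_image_iff: "lideal J \<Longrightarrow> ker \<subseteq> J \<Longrightarrow> q y \<in> q ` J \<longleftrightarrow> y \<in> J"
proof
  assume J: "lideal J" "ker \<subseteq> J"
  show "y \<in> J" if y: "q y \<in> q ` J"
  proof -
    obtain z where z: "z \<in> J" "q y = q z" using y by auto
    then have "y - z \<in> J" using J q_eq_iff by blast
    then show ?thesis using free.subspace_add [OF lidealD(1) [OF J(1)] _ z(1), of "y - z"] by simp
  qed
qed auto

lemma ker_preimage: "subrep N M \<Longrightarrow> ker \<subseteq> {y. q y \<in> N}"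
  by (auto simp: ker_def subrep_def submodule_iff [OF cmodule])

lemma subrep_gen: "subrep (gen_subrep M S) M" if "S \<subseteq> carrier M"
proof -
  have "carrier M \<in> {N. subrep N M \<and> S \<subseteq> N}"
    using that linrep M.carrier_is_submodule by (auto simp: subrep_def linrep_def)
  then have "gen_subrep M S \<subseteq> carrier M" unfolding gen_subrep_def by blast
  then show ?thesis
    unfolding subrep_def submodule_iff [OF cmodule]
    by (auto simp: gen_subrep_def subrep_def submodule_iff [OF cmodule])
qed

lemma gen_subrep_preimage: "q y \<in> gen_subrep M (q ` S) \<longleftrightarrow> y \<in> lgen (ker \<union> S)"
proof
  let ?J = "lgen (ker \<union> S)"
  assume "q y \<in> gen_subrep M (q ` S)"
  moreover have "q ` S \<subseteq> q ` ?J" using lgen_superset [of "ker \<union> S"] by auto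
  then have "gen_subrep M (q ` S) \<subseteq> q ` ?J"
    unfolding gen_subrep_def using subrep_image [OF lideal_lgen, of "ker \<union> S"] by blast
  ultimately show "y \<in> ?J"
    using mem_image_iff [OF lideal_lgen] lgen_superset [of "ker \<union> S"] by blast
next
  assume "y \<in> lgen (ker \<union> S)"
  moreover have "lgen (ker \<union> S) \<subseteq> {y. q y \<in> gen_subrep M (q ` S)}"
  proof (rule lgen_minimal)
    have sub: "subrep (gen_subrep M (q ` S)) M" by (rule subrep_gen) (auto simp: carrier_eq)
    show "lideal {y. q y \<in> gen_subrep M (q ` S)}" by (rule lideal_preimage [OF sub])
    show "ker \<union> S \<subseteq> {y. q y \<in> gen_subrep M (q ` S)}"
      using ker_preimage [OF sub] by (auto simp: gen_subrep_def)
  qed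
  ultimately show "q y \<in> gen_subrep M (q ` S)" by blast
qed

lemma lie_module:
  assumes "enveloping_relations br \<subseteq> ker"
  shows "lie_module br M"
proof -
  have "act M x (act M y (q w)) \<ominus>\<^bsub>M\<^esub> act M y (act M x (q w))
    = (\<Oplus>\<^bsub>M\<^esub>z\<in>keys (br x y). lookup (br x y) z \<odot>\<^bsub>M\<^esub> act M z (q w))" for x y w
  proof -
    have "push ((#) x) (push ((#) y) w) - push ((#) y) (push ((#) x) w) - bract (br x y) w \<in> ker"
      using bracket_mem [OF lidealD(1) [OF lideal_ker] assms] .
    then have "q (push ((#) x) (push ((#) y) w) - push ((#) y) (push ((#) x) w)) = q (bract (br x y) w)"
      by (simp add: q_eq_iff)
    then show ?thesis
      by (simp add: q_diff q_act bract_def q_sum q_scale)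
  qed
  then show ?thesis
    using linrep by unfold_locales (auto simp: linrep_def carrier_eq)
qed

lemma presented_quot: "subrep N M \<Longrightarrow> presented (quot_rep M N) (\<lambda>y. N +>\<^bsub>M\<^esub> q y)"
  using rep_epi_comp [OF epi rep_epi_quot [OF linrep]] by unfold_locales

lemma ker_quot: "subrep N M \<Longrightarrow> presented.ker (quot_rep M N) (\<lambda>y. N +>\<^bsub>M\<^esub> q y) = {y. q y \<in> N}"
  using presented.ker_def [OF presented_quot] coset_eq_zero_iff [OF cmodule]
  by (auto simp: subrep_def quot_space_def)

text \<open>A largest proper left ideal above \<open>ker\<close> makes the maximal subrepresentation
  unique, which gives meaning to \<open>THE\<close> in \<open>simple_quotient\<close>.\<close>

lemma the_maximal_subrep:
  assumes J: "lideal J" "ker \<subseteq> J" "J \<noteq> UNIV"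
    and max: "\<And>J'. lideal J' \<Longrightarrow> ker \<subseteq> J' \<Longrightarrow> J' \<noteq> UNIV \<Longrightarrow> J' \<subseteq> J"
  shows "(THE N. maximal_subrep N M) = q ` J"
proof (rule the_equality)
  have proper: "{y. q y \<in> N} \<noteq> UNIV" if "subrep N M" "N \<noteq> carrier M" for N
    using image_preimage [OF that(1)] that(2) carrier_eq by metis
  have le: "N \<subseteq> q ` J" if "subrep N M" "N \<noteq> carrier M" for N
    using max [OF lideal_preimage [OF that(1)] ker_preimage [OF that(1)] proper [OF that]] image_preimage [OF that(1)] by blast
  have "q ` J \<noteq> carrier M"
    using mem_image_iff [OF J(1,2)] J(3) carrier_eq by blast
  then show "maximal_subrep (q ` J) M"
    using subrep_image [OF J(1)] le by (auto simp: maximal_subrep_def)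
  then show "N = q ` J" if "maximal_subrep N M" for N
    using that le [of N] unfolding maximal_subrep_def by blast
qed

end

lemma presented_tensor_algebra: "presented tensor_algebra (\<lambda>y. y)"
  by unfold_locales (simp add: rep_epi_def epi_def)

lemma presented_universal_cyclic:
  "presented (universal_cyclic br S) (\<lambda>y. cyclic_null br S +>\<^bsub>tensor_algebra\<^esub> y)"
  "presented.ker (universal_cyclic br S) (\<lambda>y. cyclic_null br S +>\<^bsub>tensor_algebra\<^esub> y) = lgen (enveloping_relations br \<union> S)"
proof -
  have "subrep (cyclic_null br S) tensor_algebra"
    by (simp add: cyclic_null_eq lideal_iff lideal_lgen)
  then show "presented (universal_cyclic br S) (\<lambda>y. cyclic_null br S +>\<^bsub>tensor_algebra\<^esub> y)"
    "presented.ker (universal_cyclic br S) (\<lambda>y. cyclic_null br S +>\<^bsub>tensor_algebra\<^esub> y) = lgen (enveloping_relations br \<union> S)"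
    unfolding universal_cyclic_def
    using presented.presented_quot [OF presented_tensor_algebra] presented.ker_quot [OF presented_tensor_algebra]
    by (simp_all add: cyclic_null_eq)
qed

text \<open>Both modules are the tensor algebra modulo the same left ideal; \<open>SOME\<close>
  picks a preimage, and equality of the kernels makes the choice harmless.\<close>

lemma lie_isomorphicI:
  assumes "presented M q" "presented N q'" "presented.ker M q = presented.ker N q'"
    and "enveloping_relations br \<subseteq> presented.ker M q"
  shows "lie_isomorphic br M N"
proof -
  interpret M: presented M q by fact
  interpret N: presented N q' by fact
  define \<phi> where "\<phi> v = q' (SOME y. q y = v)" for v
  have \<phi>: "\<phi> (q y) = q' y" for y
  proof -
    have "q (SOME z. q z = q y) = q y" by (rule someI [of _ y]) simp
    then show ?thesis unfolding \<phi>_def using M.q_eq_iff N.q_eq_iff assms(3) by blast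
  qed
  have "\<phi> \<in> iso (add_monoid M) (add_monoid N)"
  proof (rule isoI)
    show "\<phi> \<in> Group.hom (add_monoid M) (add_monoid N)"
      by (rule homI) (auto simp: M.carrier_eq \<phi> simp flip: M.q_add N.q_add)
    have "inj_on \<phi> (range q)"
      using M.q_eq_iff N.q_eq_iff assms(3) by (auto simp: inj_on_def \<phi>)
    moreover have "\<phi> ` range q = range q'" by (auto simp: \<phi> image_iff)
    ultimately show "bij_betw \<phi> (carrier (add_monoid M)) (carrier (add_monoid N))"
      by (simp add: bij_betw_def M.carrier_eq N.carrier_eq)
  qed
  moreover have "\<phi> (a \<odot>\<^bsub>M\<^esub> v) = a \<odot>\<^bsub>N\<^esub> \<phi> v" "\<phi> (act M x v) = act N x (\<phi> v)" if "v \<in> carrier M" for a x v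
    using that by (auto simp: M.carrier_eq \<phi> simp flip: M.q_scale N.q_scale M.q_act N.q_act)
  ultimately show ?thesis
    unfolding lie_isomorphic_def
    using M.lie_module [OF assms(4)] N.lie_module [OF assms(4) [unfolded assms(3)]] by blast
qed

section \<open>Graded left ideals\<close>

lemma free_subspaceD:
  assumes "free.subspace J"
  shows "0 \<in> J" "x \<in> J \<Longrightarrow> y \<in> J \<Longrightarrow> x + y \<in> J" "x \<in> J \<Longrightarrow> y \<in> J \<Longrightarrow> x - y \<in> J" "x \<in> J \<Longrightarrow> fscale a x \<in> J"
    "x \<in> J \<Longrightarrow> - x \<in> J" "(\<And>i. i \<in> A \<Longrightarrow> f i \<in> J) \<Longrightarrow> sum f A \<in> J"
  using assms by (auto simp: free.subspace_0 free.subspace_add free.subspace_diff free.subspace_scale free.subspace_neg free.subspace_sum)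

lemma subspace_from_singles:
  assumes "free.subspace J" "\<And>u. u \<in> keys y \<Longrightarrow> single u 1 \<in> J"
  shows "y \<in> J"
proof -
  have "y = (\<Sum>u\<in>keys y. fscale (lookup y u) (single u 1))"
    by (simp add: poly_mapping_sum_single)
  also have "\<dots> \<in> J"
    using assms by (intro free_subspaceD(6) free_subspaceD(4))
  finally show ?thesis .
qed

lemma lideal_UNIV:
  assumes "lideal J" "single [] 1 \<in> J"
  shows "J = UNIV"
proof -
  have "single u 1 \<in> J" for u
    by (induction u) (use assms lidealD(2) [OF assms(1)] in force)+
  then show ?thesis using subspace_from_singles [OF lidealD(1) [OF assms(1)]] by blast
qed

definition wdeg :: "('g \<Rightarrow> int) \<Rightarrow> 'g list \<Rightarrow> int" where
  "wdeg deg u = sum_list (map deg u)"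

definition part :: "('g \<Rightarrow> int) \<Rightarrow> int \<Rightarrow> ('g list \<Rightarrow>\<^sub>0 complex) \<Rightarrow> ('g list \<Rightarrow>\<^sub>0 complex)" where
  "part deg d y = (\<Sum>u\<in>keys y. if wdeg deg u = d then single u (lookup y u) else 0)"

lemma lookup_part: "lookup (part deg d y) u = (if wdeg deg u = d then lookup y u else 0)"
proof -
  have "lookup (part deg d y) u
      = (\<Sum>v\<in>keys y. if v = u then if wdeg deg u = d then lookup y u else 0 else 0)"
    unfolding part_def lookup_sum by (rule sum.cong) (auto simp: lookup_single)
  then show ?thesis by (simp add: sum.delta in_keys_iff)
qed

lemma part_add: "part deg d (x + y) = part deg d x + part deg d y"
  by (auto intro!: poly_mapping_eqI simp: lookup_part lookup_add)

definition degree_op :: "('g \<Rightarrow> int) \<Rightarrow> ('g list \<Rightarrow>\<^sub>0 complex) \<Rightarrow> ('g list \<Rightarrow>\<^sub>0 complex)" where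
  "degree_op deg y = (\<Sum>u\<in>keys y. single u (of_int (wdeg deg u) * lookup y u))"

lemma lookup_degree_op: "lookup (degree_op deg y) u = of_int (wdeg deg u) * lookup y u"
proof -
  have "lookup (degree_op deg y) u
      = (\<Sum>v\<in>keys y. if v = u then of_int (wdeg deg u) * lookup y u else 0)"
    unfolding degree_op_def lookup_sum by (rule sum.cong) (auto simp: lookup_single)
  then show ?thesis by (simp add: sum.delta in_keys_iff)
qed

text \<open>The nonzero degrees are eliminated one at a time: \<open>degree_op\<close> minus d
  removes degree d and multiplies the degree 0 part by -d, which can be divided out.\<close>

lemma part_mem:
  assumes J: "free.subspace J" and D: "\<And>y. y \<in> J \<Longrightarrow> degree_op deg y \<in> J"
    and "y \<in> J"
  shows "part deg 0 y \<in> J"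
proof -
  have "part deg 0 y \<in> J" if "finite A" "0 \<notin> A" "y \<in> J" "wdeg deg ` keys y \<subseteq> insert 0 A" for A y
    using that
  proof (induction A arbitrary: y rule: finite_induct)
    case empty
    then have "part deg 0 y = y"
      by (intro poly_mapping_eqI) (auto simp: lookup_part in_keys_iff image_subset_iff)
    then show ?case using empty by simp
  next
    case (insert d A)
    let ?z = "degree_op deg y - fscale (of_int d) y"
    have z: "lookup ?z u = of_int (wdeg deg u - d) * lookup y u" for u
      by (simp add: lookup_minus lookup_degree_op lookup_map algebra_simps)
    have "?z \<in> J" using insert.prems D by (intro free_subspaceD [OF J])
    moreover have "wdeg deg ` keys ?z \<subseteq> insert 0 A"
      using insert.prems(3) by (auto simp: in_keys_iff z image_subset_iff Ball_def)
    ultimately have "part deg 0 ?z \<in> J" using insert by auto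
    moreover have "part deg 0 ?z = fscale (- of_int d) (part deg 0 y)"
      by (rule poly_mapping_eqI) (simp add: lookup_part z lookup_map)
    ultimately have "fscale (- 1 / of_int d) (fscale (- of_int d) (part deg 0 y)) \<in> J"
      by (simp only: free_subspaceD [OF J])
    then show ?case using insert.prems by (simp del: free.scale_minus_left)
  qed
  from this [of "wdeg deg ` keys y - {0}" y] assms show ?thesis by auto
qed

text \<open>The grading operator is an infinite sum of words. On finitely many words it agrees, modulo \<open>I\<close>, with left
  multiplication \<open>T\<close> by a partial sum, and such a multiplication preserves every left ideal; that is what forces all
  left ideals above \<open>I\<close> to be graded.\<close>

locale graded_cyclic =
  fixes br :: "'g bracket" and deg :: "'g \<Rightarrow> int" and I :: "('g list \<Rightarrow>\<^sub>0 complex) set" and a c :: complex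
    and top :: "('g list \<Rightarrow>\<^sub>0 complex) set"
  assumes lideal: "lideal I" and enveloping: "enveloping_relations br \<subseteq> I"
    and eigen: "finite U \<Longrightarrow> \<exists>T. lin fscale fscale T \<and> (\<forall>J. lideal J \<longrightarrow> T ` J \<subseteq> J) \<and>
      (\<forall>u\<in>U. T (single u 1) - fscale (c * (a + of_int (wdeg deg u))) (single u 1) \<in> I)"
    and c: "c \<noteq> 0"
    and top: "free.subspace top" "single [] 1 \<in> top"
    and top_degree: "p \<in> top \<Longrightarrow> u \<in> keys p \<Longrightarrow> wdeg deg u = 0"
    and top_closed: "p \<in> top \<Longrightarrow> deg x \<le> 0 \<Longrightarrow> \<exists>p'\<in>top. push ((#) x) p - p' \<in> I"
    and top_simple: "lideal J \<Longrightarrow> I \<subseteq> J \<Longrightarrow> p \<in> top \<Longrightarrow> p \<in> J \<Longrightarrow> p \<notin> I \<Longrightarrow> single [] 1 \<in> J"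
    and nontrivial: "single [] 1 \<notin> I"
begin

lemmas subI = free_subspaceD [OF lidealD(1) [OF lideal]]

lemma part_0_mem:
  assumes J: "lideal J" "I \<subseteq> J" and "y \<in> J"
  shows "part deg 0 y \<in> J"
proof (rule part_mem [OF lidealD(1) [OF J(1)] _ \<open>y \<in> J\<close>])
  note subJ = free_subspaceD [OF lidealD(1) [OF J(1)]]
  fix y assume y: "y \<in> J"
  obtain T where T: "lin fscale fscale T" "\<And>J. lideal J \<Longrightarrow> T ` J \<subseteq> J"
    "\<And>u. u \<in> keys y \<Longrightarrow> T (single u 1) - fscale (c * (a + of_int (wdeg deg u))) (single u 1) \<in> I"
    using eigen [of "keys y"] by auto
  let ?t = "\<lambda>u. fscale (lookup y u) (T (single u 1) - fscale (c * (a + of_int (wdeg deg u))) (single u 1))"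
  have "(\<Sum>u\<in>keys y. ?t u) \<in> J"
    using T(3) J(2) by (intro subJ(6) subJ(4)) auto
  also have "(\<Sum>u\<in>keys y. ?t u) = T y - fscale c (fscale a y + degree_op deg y)"
  proof -
    have "T y = T (\<Sum>u\<in>keys y. fscale (lookup y u) (single u 1))"
      by (simp add: poly_mapping_sum_single)
    also have "\<dots> = (\<Sum>u\<in>keys y. fscale (lookup y u) (T (single u 1)))"
      by (simp only: lin_sum [OF T(1)] lin_scale [OF T(1)])
    finally have Ty: "T y = \<dots>" .
    have "fscale a y = (\<Sum>u\<in>keys y. single u (a * lookup y u))"
      by (subst poly_mapping_sum_single [of y, symmetric], unfold free.scale_sum_right) simp
    then have "fscale c (fscale a y + degree_op deg y)
       = (\<Sum>u\<in>keys y. single u (lookup y u * (c * (a + of_int (wdeg deg u)))))"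
      by (simp add: degree_op_def free.scale_sum_right algebra_simps flip: sum.distrib single_add)
    then show ?thesis by (simp add: Ty free.scale_right_diff_distrib sum_subtractf)
  qed
  finally have X: "T y - fscale c (fscale a y + degree_op deg y) \<in> J" .
  have "T y \<in> J" using T(2) [OF J(1)] y by blast
  then have "fscale c (fscale a y + degree_op deg y) \<in> J" using subJ(3) [OF \<open>T y \<in> J\<close> X] by simp
  then have "fscale (1 / c) (fscale c (fscale a y + degree_op deg y)) - fscale a y \<in> J"
    by (rule subJ(3) [OF subJ(4) subJ(4) [OF y]])
  then show "degree_op deg y \<in> J" using c by simp
qed

inductive_set gen_top :: "('g list \<Rightarrow>\<^sub>0 complex) set" where
  base: "p \<in> top \<Longrightarrow> p \<in> gen_top"
| ideal: "p \<in> I \<Longrightarrow> p \<in> gen_top"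
| add: "p \<in> gen_top \<Longrightarrow> p' \<in> gen_top \<Longrightarrow> p + p' \<in> gen_top"
| scale: "p \<in> gen_top \<Longrightarrow> fscale x p \<in> gen_top"
| step: "p \<in> gen_top \<Longrightarrow> deg x > 0 \<Longrightarrow> push ((#) x) p \<in> gen_top"

lemma gen_top_subspace: "free.subspace gen_top"
  using gen_top.intros gen_top.ideal [OF subI(1)] by (auto simp: free.subspace_def)

text \<open>A PBW-type argument: modulo \<open>I\<close>, x y p = y x p + [x, y] p, and both terms
  are covered by the induction hypothesis for p, which is stated for all generators at once.
  Generators of degree at most 0 are absorbed by \<open>top_closed\<close>.\<close>

lemma gen_top_UNIV: "gen_top = UNIV"
proof -
  note sub = free_subspaceD [OF gen_top_subspace]
  have "\<forall>x. push ((#) x) p \<in> gen_top" if "p \<in> gen_top" for p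
    using that
  proof (induction rule: gen_top.induct)
    case (base p)
    have "push ((#) x) p \<in> gen_top" for x
    proof (cases "deg x > 0")
      case False
      then obtain p' where p': "p' \<in> top" "push ((#) x) p - p' \<in> I"
        using top_closed [OF base, of x] by auto
      then show ?thesis using sub(2) [OF gen_top.ideal [OF p'(2)] gen_top.base [OF p'(1)]] by simp
    qed (simp add: gen_top.step gen_top.base base)
    then show ?case ..
  next
    case (ideal p)
    then show ?case using lidealD(2) [OF lideal] by (blast intro: gen_top.ideal)
  next
    case (step p y)
    have "push ((#) x) (push ((#) y) p) \<in> gen_top" for x
    proof -
      have "push ((#) x) (push ((#) y) p) - push ((#) y) (push ((#) x) p) - bract (br x y) p \<in> gen_top"
        using bracket_mem [OF lidealD(1) [OF lideal] enveloping] by (rule gen_top.ideal)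
      moreover have "push ((#) y) (push ((#) x) p) \<in> gen_top"
        using step by (blast intro: gen_top.step)
      moreover have "bract (br x y) p \<in> gen_top"
        unfolding bract_def using step by (blast intro: sub)
      ultimately have "push ((#) x) (push ((#) y) p) - push ((#) y) (push ((#) x) p) - bract (br x y) p
          + (push ((#) y) (push ((#) x) p) + bract (br x y) p) \<in> gen_top"
        by (intro sub(2))
      then show ?thesis by simp
    qed
    then show ?case ..
  qed (auto simp: push_add push_fscale intro: gen_top.add gen_top.scale)
  then have "lideal gen_top" using gen_top_subspace by (simp add: lideal_def)
  then show ?thesis using top(2) by (intro lideal_UNIV gen_top.base)
qed

text \<open>A generator of positive degree sends \<open>top\<close>, which has degree 0, and words
  of positive degree to positive degree; so a \<open>step\<close> has no component in
  \<open>top\<close>.\<close>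

lemma decompose: "\<exists>p\<in>top. \<exists>z. (\<forall>u\<in>keys z. wdeg deg u > 0) \<and> y - p - z \<in> I"
proof -
  have "y \<in> gen_top" by (simp add: gen_top_UNIV)
  then show ?thesis
  proof (induction rule: gen_top.induct)
    case (base p)
    then show ?case by (intro bexI [of _ p] exI [of _ 0]) (simp_all add: subI)
  next
    case (ideal p)
    then show ?case by (intro bexI [of _ 0] exI [of _ 0]) (simp_all add: free_subspaceD [OF top(1)])
  next
    case (add y y')
    then obtain p z p' z' where *: "p \<in> top" "p' \<in> top" "\<forall>u\<in>keys z. wdeg deg u > 0" "y - p - z \<in> I"
      "\<forall>u\<in>keys z'. wdeg deg u > 0" "y' - p' - z' \<in> I" by blast
    have "y + y' - (p + p') - (z + z') = (y - p - z) + (y' - p' - z')" by simp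
    then have "y + y' - (p + p') - (z + z') \<in> I" using * subI(2) by metis
    moreover have "\<forall>u\<in>keys (z + z'). wdeg deg u > 0" using * keys_add [of z z'] by blast
    moreover have "p + p' \<in> top" using * free_subspaceD [OF top(1)] by blast
    ultimately show ?case by blast
  next
    case (scale y x)
    then obtain p z where *: "p \<in> top" "\<forall>u\<in>keys z. wdeg deg u > 0" "y - p - z \<in> I" by blast
    have "fscale x y - fscale x p - fscale x z = fscale x (y - p - z)" by (simp add: free.scale_right_diff_distrib)
    then have "fscale x y - fscale x p - fscale x z \<in> I" using * subI(4) by metis
    moreover have "\<forall>u\<in>keys (fscale x z). wdeg deg u > 0" using * keys_fscale [of x z] by blast
    moreover have "fscale x p \<in> top" using * free_subspaceD [OF top(1)] by blast
    ultimately show ?case by blast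
  next
    case (step y x)
    then obtain p z where *: "p \<in> top" "\<forall>u\<in>keys z. wdeg deg u > 0" "y - p - z \<in> I" by blast
    have keys: "keys (push ((#) x) q) \<subseteq> (#) x ` keys q" for q
      using keys_sum [of "\<lambda>u. single (x # u) (lookup q u)" "keys q"]
      by (fastforce simp: push_def split: if_splits)
    have "push ((#) x) y - 0 - push ((#) x) (p + z) = push ((#) x) (y - p - z)"
      by (simp add: lin_diff [OF lin_push] push_add)
    then have "push ((#) x) y - 0 - push ((#) x) (p + z) \<in> I" using * lidealD(2) [OF lideal] by metis
    moreover have "\<forall>u\<in>keys (push ((#) x) (p + z)). wdeg deg u > 0"
      using keys [of "p + z"] keys_add [of p z] * top_degree [OF *(1)] step by (fastforce simp: wdeg_def)
    moreover have "0 \<in> top" using free_subspaceD [OF top(1)] by blast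
    ultimately show ?case by blast
  qed
qed

text \<open>Modulo \<open>I\<close> the degree 0 part of y is an element of \<open>top\<close>. It
  lies in \<open>J\<close>, and if it were outside \<open>I\<close>, \<open>top_simple\<close> would
  put 1 into \<open>J\<close>.\<close>

lemma proper_ideal_part:
  assumes J: "lideal J" "I \<subseteq> J" "J \<noteq> UNIV" and y: "y \<in> J"
  shows "part deg 0 y \<in> I"
proof -
  let ?y = "part deg 0 y"
  obtain p z where p: "p \<in> top" and z: "\<forall>u\<in>keys z. wdeg deg u > 0" and "?y - p - z \<in> I"
    using decompose [of ?y] by blast
  then have "part deg 0 (?y - p - z) \<in> I" by (intro part_0_mem lideal subset_refl)
  moreover have "part deg 0 (?y - p - z) = ?y - p"
  proof (rule poly_mapping_eqI)
    fix u
    have "wdeg deg u = 0 \<Longrightarrow> lookup z u = 0" and "wdeg deg u \<noteq> 0 \<Longrightarrow> lookup p u = 0"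
      using z [rule_format, of u] top_degree [OF p, of u] by (auto simp: in_keys_iff)
    then show "lookup (part deg 0 (?y - p - z)) u = lookup (?y - p) u"
      by (simp add: lookup_part lookup_minus)
  qed
  ultimately have yp: "?y - p \<in> I" by simp
  note subJ = free_subspaceD [OF lidealD(1) [OF J(1)]]
  have "?y - (?y - p) \<in> J"
    using subJ(3) [OF part_0_mem [OF J(1,2) y] subsetD [OF J(2) yp]] .
  then have "p \<in> J" by simp
  then have "p \<in> I"
    using top_simple [OF J(1,2) p] lideal_UNIV [OF J(1)] J(3) by auto
  from subI(2) [OF yp this] show ?thesis by simp
qed

definition maximal_ideal where
  "maximal_ideal = {y. \<exists>J. lideal J \<and> I \<subseteq> J \<and> J \<noteq> UNIV \<and> y \<in> J}"

lemma maximal_ideal_upper: "lideal J \<Longrightarrow> I \<subseteq> J \<Longrightarrow> J \<noteq> UNIV \<Longrightarrow> J \<subseteq> maximal_ideal"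
  by (auto simp: maximal_ideal_def)

lemma part_Nil: "part deg 0 (single [] 1) = single [] 1"
  by (rule poly_mapping_eqI) (auto simp: lookup_part lookup_single wdeg_def when_def)

lemma I_proper: "I \<noteq> UNIV"
  using nontrivial by blast

lemma maximal_ideal_proper: "single [] 1 \<notin> maximal_ideal"
  using proper_ideal_part part_Nil nontrivial by (force simp: maximal_ideal_def)

lemma I_subset_maximal_ideal: "I \<subseteq> maximal_ideal"
  using maximal_ideal_upper [OF lideal subset_refl I_proper] .

text \<open>Only sums need an argument: if J + J' contained 1, then 1 would be a sum of two degree 0
  parts, both of which lie in \<open>I\<close>.\<close>

lemma lideal_maximal_ideal: "lideal maximal_ideal"
  unfolding lideal_def free.subspace_def
proof (intro conjI allI ballI)
  show "0 \<in> maximal_ideal" using I_subset_maximal_ideal subI(1) by blast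
  show "fscale x y \<in> maximal_ideal" if "y \<in> maximal_ideal" for x y
    using that by (auto simp: maximal_ideal_def lideal_def free.subspace_def)
  show "push ((#) x) y \<in> maximal_ideal" if "y \<in> maximal_ideal" for x y
    using that by (auto simp: maximal_ideal_def lideal_def)
  fix y y' assume "y \<in> maximal_ideal" "y' \<in> maximal_ideal"
  then obtain J J' where J: "lideal J" "I \<subseteq> J" "J \<noteq> UNIV" "y \<in> J" and J': "lideal J'" "I \<subseteq> J'" "J' \<noteq> UNIV" "y' \<in> J'"
    by (auto simp: maximal_ideal_def)
  let ?S = "{x + x' | x x'. x \<in> J \<and> x' \<in> J'}"
  have "lideal ?S"
    using J(1) J'(1) free.subspace_sums [OF lidealD(1) [OF J(1)] lidealD(1) [OF J'(1)]]
    by (fastforce simp: lideal_def push_add)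
  moreover have "I \<subseteq> ?S"
  proof
    show "x \<in> ?S" if "x \<in> I" for x
      using that J(2) free_subspaceD(1) [OF lidealD(1) [OF J'(1)]] by force
  qed
  moreover have "single [] 1 \<notin> ?S"
  proof
    assume "single [] 1 \<in> ?S"
    then obtain x x' where x: "single [] 1 = x + x'" "x \<in> J" "x' \<in> J'" by blast
    have "part deg 0 (x + x') \<in> I"
      unfolding part_add using proper_ideal_part [OF J(1-3) x(2)] proper_ideal_part [OF J'(1-3) x(3)] by (rule subI(2))
    then show False using nontrivial part_Nil x(1) by simp
  qed
  ultimately show "y + y' \<in> maximal_ideal"
    using J(4) J'(4) unfolding maximal_ideal_def by blast
qed

lemma maximal_ideal_eq:
  assumes "lideal J" "I \<subseteq> J" "J \<noteq> UNIV" and "\<And>J'. lideal J' \<Longrightarrow> J \<subseteq> J' \<Longrightarrow> J' = J \<or> J' = UNIV"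
  shows "maximal_ideal = J"
  using assms(4) [OF lideal_maximal_ideal] maximal_ideal_upper [OF assms(1-3)] maximal_ideal_proper by blast

end

text \<open>x y u = y x u + [x, y] u modulo \<open>I\<close>; both terms are covered by the shorter
  word u, the second because [x, y] has degree deg x + deg y.\<close>

lemma smooth_word:
  assumes I: "lideal I" "enveloping_relations br \<subseteq> I"
    and br: "\<And>x y z. z \<in> keys (br x y) \<Longrightarrow> deg z = deg x + deg y"
    and ann: "\<And>x. deg x < 0 \<Longrightarrow> single [x] 1 \<in> I"
  shows "\<exists>N::int. \<forall>x. deg x < N \<longrightarrow> single (x # u) 1 \<in> I"
proof (induction u)
  case Nil
  then show ?case using ann by blast
next
  case (Cons y u)
  then obtain N where N: "\<And>x. deg x < N \<Longrightarrow> single (x # u) 1 \<in> I" by blast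
  note sub = free_subspaceD [OF lidealD(1) [OF I(1)]]
  have "single (x # y # u) 1 \<in> I" if x: "deg x < min N (N - deg y)" for x
  proof -
    have "push ((#) x) (push ((#) y) (single u 1)) - push ((#) y) (push ((#) x) (single u 1))
        - bract (br x y) (single u 1) \<in> I"
      by (rule bracket_mem [OF lidealD(1) [OF I(1)] I(2)])
    moreover have "bract (br x y) (single u 1) \<in> I"
      unfolding bract_def
    proof (intro sub(6) sub(4))
      fix z assume "z \<in> keys (br x y)"
      then show "push ((#) z) (single u 1) \<in> I" using br [of z x y] N [of z] x by simp
    qed
    moreover have "push ((#) y) (push ((#) x) (single u 1)) \<in> I"
      using lidealD(2) [OF I(1) N [of x], of y] x by simp
    ultimately have "single (x # y # u) 1 - single (y # x # u) 1 - bract (br x y) (single u 1)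
        + (bract (br x y) (single u 1) + single (y # x # u) 1) \<in> I"
      by (intro sub(2)) simp_all
    then show ?thesis by simp
  qed
  then show ?case by blast
qed

lemma smooth:
  assumes "lideal I" "enveloping_relations br \<subseteq> I"
    and "\<And>x y z. z \<in> keys (br x y) \<Longrightarrow> deg z = deg x + deg y"
    and "\<And>x. deg x < 0 \<Longrightarrow> single [x] 1 \<in> I"
  shows "\<exists>N::int. \<forall>x. deg x < N \<longrightarrow> push ((#) x) y \<in> I"
proof (induction y rule: poly_mapping_single_induct)
  case zero
  then show ?case using free_subspaceD [OF lidealD(1) [OF assms(1)]] by simp
next
  case (single u a)
  obtain N where "\<And>x. deg x < N \<Longrightarrow> single (x # u) 1 \<in> I"
    using smooth_word [where u = u and deg = deg, OF assms] by blast
  then have "fscale a (single (x # u) 1) \<in> I" if "deg x < N" for x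
    using that free_subspaceD [OF lidealD(1) [OF assms(1)]] by blast
  then show ?case by auto
next
  case (add p q)
  then obtain N N' where "\<forall>x. deg x < N \<longrightarrow> push ((#) x) p \<in> I" "\<forall>x. deg x < N' \<longrightarrow> push ((#) x) q \<in> I" by blast
  then show ?case
    using free_subspaceD [OF lidealD(1) [OF assms(1)]] by (intro exI [of _ "min N N'"]) (auto simp: push_add)
qed

section \<open>A Fock space realization of the Virasoro algebra\<close>

text \<open>The zero modes of c and d are replaced by 0 and by the scalar -hw: on the original space
  c(0) = -Id, whereas here 1 is to become a Virasoro highest weight vector of weight
  \<open>hw\<close>.\<close>

definition fock_c :: "Pi_vec field_modes" where
  "fock_c n p = (if n = 0 then 0 else Pi_c n p)"

definition fock_d :: "complex \<Rightarrow> Pi_vec field_modes" where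
  "fock_d hw n p = (if n = 0 then Pi_scale (- hw) p else Pi_d n p)"

text \<open>Two free bosons with background charge x = d + ((2 - cc)/48) c. The central charge is 2
  - 12 <x, x> = cc, because <x, x> = (2 - cc)/12, and L(0) 1 = -d(0) 1 gives the weight.\<close>

definition fock_L :: "complex \<Rightarrow> complex \<Rightarrow> Pi_vec field_modes" where
  "fock_L cc hw n p = Pi_scale (1 / 2) (NO (\<lambda>_. 1) fock_c (fock_d hw) n p)
     - Pi_scale (of_int (n + 1)) (fock_d hw n p) - Pi_scale ((2 - cc) / 48 * of_int (n + 1)) (fock_c n p)"

context
  fixes cc hw :: complex
begin

abbreviation (input) "fc \<equiv> fock_c"
abbreviation (input) "fd \<equiv> fock_d hw"
abbreviation (input) "fL \<equiv> fock_L cc hw"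
abbreviation (input) "sel b x p \<equiv> (if b then Pi_scale x p else 0)"

lemma fld_fc: "fld 0 fock_c" and fld_fd: "fld 0 (fock_d hw)"
proof -
  have "graded (0 - n) (fock_c n) \<and> graded (0 - n) (fock_d hw n)" for n
    using fldD [OF fld_c, of n] fldD [OF fld_d, of n] graded_zero graded_scale [OF graded_ident]
    by (cases "n = 0") (simp_all add: fock_c_def [abs_def] fock_d_def [abs_def] del: Pi.scale_minus_left)
  then show "fld 0 fock_c" "fld 0 (fock_d hw)" by (simp_all add: fld_def)
qed

lemma fld_fL: "fld 0 (fock_L cc hw)"
  unfolding fld_def
proof
  fix n
  show "graded (0 - n) (fock_L cc hw n)"
    unfolding fock_L_def [abs_def]
    by (intro graded_diff graded_scale fldD fld_fc fld_fd graded_NO [OF fld_fc fld_fd]) simp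
qed

lemmas fock_lin = fld_lin [OF fld_fc, THEN lin_add] fld_lin [OF fld_fd, THEN lin_add] fld_lin [OF fld_fL, THEN lin_add]
  fld_lin [OF fld_fc, THEN lin_scale] fld_lin [OF fld_fd, THEN lin_scale] fld_lin [OF fld_fL, THEN lin_scale]
  fld_lin [OF fld_fc, THEN lin_diff] fld_lin [OF fld_fd, THEN lin_diff] fld_lin [OF fld_fL, THEN lin_diff]
  fld_lin [OF fld_fc, THEN lin_zero] fld_lin [OF fld_fd, THEN lin_zero] fld_lin [OF fld_fL, THEN lin_zero]

lemma fc_fc: "fc m (fc n p) = fc n (fc m p)"
  using Pi_c_commute [of m n p]
  by (cases "m = 0"; cases "n = 0"; simp add: fock_c_def fock_d_def lin_scale [OF plin_c] lin_scale [OF plin_d]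
      lin_zero [OF plin_c] lin_zero [OF plin_d] eq_neg_iff_add_eq_0 add.commute [of n m] del: Pi.scale_minus_left)

lemma fd_fd: "fd m (fd n p) = fd n (fd m p)"
  using Pi_d_commute [of m n p]
  by (cases "m = 0"; cases "n = 0"; simp add: fock_c_def fock_d_def lin_scale [OF plin_c] lin_scale [OF plin_d]
      lin_zero [OF plin_c] lin_zero [OF plin_d] eq_neg_iff_add_eq_0 add.commute [of n m] del: Pi.scale_minus_left)

lemma fc_fd: "fc m (fd n p) = fd n (fc m p) + sel (n = - m) (2 * of_int m) p"
  using Pi_c_Pi_d [of m n p]
  by (cases "m = 0"; cases "n = 0"; simp add: fock_c_def fock_d_def lin_scale [OF plin_c] lin_scale [OF plin_d]
      lin_zero [OF plin_c] lin_zero [OF plin_d] eq_neg_iff_add_eq_0 add.commute [of n m] del: Pi.scale_minus_left)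

lemma fd_fc: "fd m (fc n p) = fc n (fd m p) + sel (n = - m) (2 * of_int m) p"
  using fc_fd [of n m p] by (auto simp flip: Pi.scale_left_distrib)

lemma Pi_d_0_fock: "Pi_d 0 (fc n p) = fc n (Pi_d 0 p)" "Pi_d 0 (fd n p) = fd n (Pi_d 0 p)"
  using Pi_c_Pi_d [of n 0 p] Pi_d_commute [of 0 n p]
  by (auto simp: fock_c_def fock_d_def lin_zero [OF plin_d] lin_scale [OF plin_d] lin_minus [OF plin_d])

lemma Pi_d_0_fL: "Pi_d 0 (fL n p) = fL n (Pi_d 0 p)"
proof -
  have "Pi_d 0 (NO (\<lambda>_. 1) fock_c (fock_d hw) n p) = NO (\<lambda>_. 1) fock_c (fock_d hw) n (Pi_d 0 p)
     + NO (\<lambda>_. 1) (\<lambda>j p. 0) (fock_d hw) n p + NO (\<lambda>_. 1) fock_c (\<lambda>j p. 0) n p"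
    by (rule NO_derivation [OF plin_d fld_fc fld_fd fld_zero fld_zero]) (simp_all add: Pi_d_0_fock)
  then have "Pi_d 0 (NO (\<lambda>_. 1) fock_c (fock_d hw) n p) = NO (\<lambda>_. 1) fock_c (fock_d hw) n (Pi_d 0 p)"
    by (simp add: NO_zero_left [OF fld_fd] NO_zero_right [OF fld_fc])
  then show ?thesis
    by (simp add: fock_L_def lin_diff [OF plin_d] lin_scale [OF plin_d] Pi_d_0_fock)
qed

lemma fc_fL: "fc n (fL m p) = fL m (fc n p) + Pi_scale (of_int n) (fc (m + n) p) - sel (m = - n) (2 * of_int n * of_int (m + 1)) p"
proof -
  have "fock_c n (NO (\<lambda>_. 1) fock_c (fock_d hw) m p) = NO (\<lambda>_. 1) fock_c (fock_d hw) m (fock_c n p)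
     + NO (\<lambda>_. 1) (\<lambda>j p. 0) (fock_d hw) m p + NO (\<lambda>_. 1) fock_c (\<lambda>j p. sel (j = - n) (2 * of_int n) p) m p"
    by (rule NO_derivation [OF fld_lin [OF fld_fc] fld_fc fld_fd fld_zero fld_delta]) (simp_all add: fc_fc [of n] fc_fd)
  then have "fock_c n (NO (\<lambda>_. 1) fock_c (fock_d hw) m p) = NO (\<lambda>_. 1) fock_c (fock_d hw) m (fock_c n p) + Pi_scale (2 * of_int n) (fc (m + n) p)"
    unfolding NO_zero_left [OF fld_fd] NO_delta_right [OF fld_fc] by simp
  then show ?thesis
    by (simp add: fock_L_def fock_lin fc_fc [of n m] fc_fd Pi.scale_right_distrib algebra_simps cong: if_cong)
qed

lemma fd_fL: "fd n (fL m p) = fL m (fd n p) + Pi_scale (of_int n) (fd (m + n) p)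
    - sel (m = - n) (2 * ((2 - cc) / 48) * of_int n * of_int (m + 1)) p"
proof -
  have "fock_d hw n (NO (\<lambda>_. 1) fock_c (fock_d hw) m p) = NO (\<lambda>_. 1) fock_c (fock_d hw) m (fock_d hw n p)
     + NO (\<lambda>_. 1) (\<lambda>j p. sel (j = - n) (2 * of_int n) p) (fock_d hw) m p + NO (\<lambda>_. 1) fock_c (\<lambda>j p. 0) m p"
    by (rule NO_derivation [OF fld_lin [OF fld_fd] fld_fc fld_fd fld_delta fld_zero]) (simp_all add: fd_fd [of n] fd_fc)
  then have "fock_d hw n (NO (\<lambda>_. 1) fock_c (fock_d hw) m p) = NO (\<lambda>_. 1) fock_c (fock_d hw) m (fock_d hw n p) + Pi_scale (2 * of_int n) (fd (m + n) p)"
    unfolding NO_zero_right [OF fld_fc] NO_delta_left [OF fld_fd] by simp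
  then show ?thesis
    by (simp add: fock_L_def fock_lin fd_fd [of n m] fd_fc Pi.scale_right_distrib algebra_simps cong: if_cong)
qed

lemma fc_1: "n \<ge> 0 \<Longrightarrow> fc n 1 = 0" and fd_1: "n > 0 \<Longrightarrow> fd n 1 = 0" and fd_0: "fd 0 p = Pi_scale (- hw) p"
  and fc_0: "fc 0 p = 0"
  by (auto simp: fock_c_def fock_d_def Pi_c_1 Pi_d_1)

lemma NO_fock_1: "NO (\<lambda>_. 1) fock_c (fock_d hw) n 1 = (\<Sum>j\<in>{1..nat (- n)}. fc (- int j) (fd (n + int j) 1))"
proof -
  have "NO_term (\<lambda>_. 1) fock_c (fock_d hw) n 1 j = 0" if "j \<notin> {n..-1}" for j
    using that by (cases "j < 0") (simp_all add: NO_term_def fc_1 fd_1 fock_lin)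
  then have "NO (\<lambda>_. 1) fock_c (fock_d hw) n 1 = (\<Sum>j\<in>{n..-1}. NO_term (\<lambda>_. 1) fock_c (fock_d hw) n 1 j)"
    unfolding NO_def by (intro Sum_any.expand_superset) blast+
  also have "\<dots> = (\<Sum>j\<in>{1..nat (- n)}. fc (- int j) (fd (n + int j) 1))"
    by (rule sum.reindex_bij_witness [where j = "\<lambda>j. nat (- j)" and i = "\<lambda>j. - int j"]) (auto simp: NO_term_def)
  finally show ?thesis .
qed

lemma fL_1: "n > 0 \<Longrightarrow> fL n 1 = 0" and fL_0_1: "fL 0 1 = Pi_scale hw 1"
  by (simp_all add: fock_L_def NO_fock_1 fc_1 fd_1 fd_0)

lemma fL_fc: "fL m (fc n p) = fc n (fL m p) - Pi_scale (of_int n) (fc (m + n) p) + sel (m = - n) (2 * of_int n * of_int (m + 1)) p"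
  and fL_fd: "fL m (fd n p) = fd n (fL m p) - Pi_scale (of_int n) (fd (m + n) p)
    + sel (m = - n) (2 * ((2 - cc) / 48) * of_int n * of_int (m + 1)) p"
  by (simp_all add: fc_fL fd_fL)

lemma fL_fL_1:
  assumes "M > 0"
  shows "fL (int M) (fL (- int M) 1) = Pi_scale (2 * of_nat M * hw + cc * (of_nat M ^ 3 - of_nat M) / 12) 1"
proof -
  let ?m = "of_nat M :: complex"
  have summand: "fL (int M) (fc (- int j) (fd (- int M + int j) 1))
      = Pi_scale (0 + 2 * ?m * of_nat j + (- 2) * (of_nat j)\<^sup>2 + (if j = M then 2 * ?m * (?m + 1) * hw else 0)) 1" if "j \<in> {1..M}" for j
  proof -
    have 1: "fL (int M) (fd (- int M + int j) 1) = 0"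
      using that assms by (simp add: fL_fd fL_1 fd_1 fock_lin)
    have idx: "int M + - int j = int M - int j" by simp
    have 2: "fc (int M - int j) (fd (- int M + int j) 1) = Pi_scale (2 * (?m - of_nat j)) 1"
      using that by (simp add: fc_fd fc_1 fock_lin)
    show ?thesis
      unfolding fL_fc 1 idx 2 using that
      by (auto simp: fock_lin fd_0 power2_eq_square algebra_simps simp del: Pi.scale_minus_left
          simp flip: Pi.scale_left_distrib Pi.scale_left_diff_distrib Pi.scale_minus_left)
  qed
  have last: "(\<Sum>j\<in>{1..M}. f j + (if j = M then y else 0)) = (\<Sum>j\<in>{1..M}. f j) + y" for f :: "nat \<Rightarrow> complex" and y
    using assms by (simp add: sum.distrib sum.delta)
  have A: "fL (int M) (NO (\<lambda>_. 1) fock_c (fock_d hw) (- int M) 1)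
      = Pi_scale (?m * ?m * (?m + 1) - (?m * (?m + 1) * (2 * ?m + 1) / 3) + 2 * ?m * (?m + 1) * hw) 1"
  proof -
    have "fL (int M) (NO (\<lambda>_. 1) fock_c (fock_d hw) (- int M) 1) = (\<Sum>j\<in>{1..M}.
       Pi_scale (0 + 2 * ?m * of_nat j + (- 2) * (of_nat j)\<^sup>2 + (if j = M then 2 * ?m * (?m + 1) * hw else 0)) 1)"
      unfolding NO_fock_1 lin_sum [OF fld_lin [OF fld_fL]] using summand by (intro sum.cong) simp_all
    then show ?thesis
      unfolding Pi.scale_sum_left [symmetric] last sum_quadratic by (simp add: field_simps)
  qed
  have B: "fL (int M) (fd (- int M) 1) = Pi_scale (- ?m * hw - 2 * ((2 - cc) / 48) * ?m * (?m + 1)) 1"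
    "fL (int M) (fc (- int M) 1) = Pi_scale (- 2 * ?m * (?m + 1)) 1"
    using assms by (simp_all add: fL_fd fL_fc fL_1 fock_lin fd_0 fc_0 Pi.scale_left_diff_distrib)
  have "fL (int M) (fL (- int M) 1) = Pi_scale (1 / 2 * (?m * ?m * (?m + 1) - (?m * (?m + 1) * (2 * ?m + 1) / 3) + 2 * ?m * (?m + 1) * hw)
      - (1 - ?m) * (- ?m * hw - 2 * ((2 - cc) / 48) * ?m * (?m + 1)) - (2 - cc) / 48 * (1 - ?m) * (- 2 * ?m * (?m + 1))) 1"
  proof -
    have co: "complex_of_int (- int M + 1) = 1 - ?m" by simp
    show ?thesis
      unfolding fock_L_def [of cc hw "- int M"] fock_lin A B co Pi.scale_scale Pi.scale_left_diff_distrib [symmetric] ..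
  qed
  then show ?thesis by (simp add: field_simps power3_eq_cube)
qed

text \<open>The defect \<open>Y\<close> of the Virasoro relation commutes with all Heisenberg modes,
  so \<open>schur\<close> reduces it to its value on 1, which \<open>fL_fL_1\<close> computes for m
  > 0 and antisymmetry for m < 0.\<close>

lemma virasoro_fock:
  "fL m (fL n p) = fL n (fL m p) + Pi_scale (of_int (m - n)) (fL (m + n) p) + sel (m + n = 0) (cc * of_int (m ^ 3 - m) / 12) p"
proof -
  define Y where "Y m n p = fL m (fL n p) - fL n (fL m p) - Pi_scale (of_int (m - n)) (fL (m + n) p)
     - sel (m + n = 0) (cc * of_int (m ^ 3 - m) / 12) p" for m n p
  have gY: "graded (- m - n) (Y m n)" for m n
  proof -
    have "graded (- m - n) (\<lambda>p. sel (m + n = 0) (cc * of_int (m ^ 3 - m) / 12) p)"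
    proof (cases "m + n = 0")
      case True
      then have "- m - n = 0" by simp
      show ?thesis unfolding \<open>- m - n = 0\<close> using True graded_scale [OF graded_ident] by simp
    qed (simp add: graded_zero)
    then show ?thesis unfolding Y_def [abs_def]
      by (intro graded_diff graded_comp [OF fldD [OF fld_fL] fldD [OF fld_fL]] graded_scale fldD' [OF fld_fL]) simp_all
  qed
  have sel_minus: "sel b x (q :: Pi_vec) - sel b y q = sel b (x - y) q" for b x y q
    by (simp add: Pi.scale_left_diff_distrib)
  \<comment> \<open>Apart from L(m) L(n) itself the first group is symmetric in m and n; of the
    corrections only the last two terms survive antisymmetrization.\<close>
  have fcLL: "fc r (fL m (fL n p)) = (fL m (fL n (fc r p)) + Pi_scale (of_int r) (fL m (fc (n + r) p) + fL n (fc (m + r) p))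
      - sel (n = - r) (2 * of_int r * of_int (n + 1)) (fL m p) - sel (m = - r) (2 * of_int r * of_int (m + 1)) (fL n p))
      + Pi_scale (of_int (r * (m + r))) (fc (m + n + r) p) - sel (m + n + r = 0) (2 * of_int (r * (m + r) * (n + 1))) p" for r m n p
  proof -
    have 1: "fc (m + r) (fL n p) = fL n (fc (m + r) p) + Pi_scale (of_int (m + r)) (fc (m + n + r) p)
       - sel (m + n + r = 0) (2 * of_int (m + r) * of_int (n + 1)) p"
      using fc_fL [of "m + r" n p] by (simp only: add_eq_0_iff) (simp add: algebra_simps)
    show ?thesis
      unfolding fc_fL [of r m] 1 unfolding fc_fL [of r n] fock_lin
      by (simp add: fock_lin Pi.scale_right_distrib Pi.scale_right_diff_distrib algebra_simps cong: if_cong)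
  qed
  obtain z where z: "2 * ((2 - cc) / 48) = z" by blast
  note fd_fL' = fd_fL [unfolded z]
  have fdLL: "fd r (fL m (fL n p)) = (fL m (fL n (fd r p)) + Pi_scale (of_int r) (fL m (fd (n + r) p) + fL n (fd (m + r) p))
      - sel (n = - r) (z * of_int r * of_int (n + 1)) (fL m p) - sel (m = - r) (z * of_int r * of_int (m + 1)) (fL n p))
      + Pi_scale (of_int (r * (m + r))) (fd (m + n + r) p) - sel (m + n + r = 0) (z * of_int (r * (m + r) * (n + 1))) p" for r m n p
  proof -
    have 1: "fd (m + r) (fL n p) = fL n (fd (m + r) p) + Pi_scale (of_int (m + r)) (fd (m + n + r) p)
       - sel (m + n + r = 0) (z * of_int (m + r) * of_int (n + 1)) p"
      using fd_fL' [of "m + r" n p] by (simp only: add_eq_0_iff) (simp add: algebra_simps)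
    show ?thesis
      unfolding fd_fL' [of r m] 1 unfolding fd_fL' [of r n] fock_lin
      by (simp add: fock_lin Pi.scale_right_distrib Pi.scale_right_diff_distrib algebra_simps cong: if_cong)
  qed
  have sel_scale: "sel b x q = Pi_scale (if b then x else 0) q" for b x and q :: Pi_vec by simp
  have coef: "of_int (r * (m + r)) - of_int (r * (n + r)) - of_int (m - n) * of_int r = (0 :: complex)"
    "(if m + n + r = 0 then y * of_int (r * (m + r) * (n + 1)) - y * of_int (r * (n + r) * (m + 1)) - of_int (m - n) * (y * of_int r * of_int (m + n + 1)) else 0) = (0 :: complex)"
    for r m n y
  proof -
    show "of_int (r * (m + r)) - of_int (r * (n + r)) - of_int (m - n) * of_int r = (0 :: complex)"
      by (simp add: algebra_simps)
    have "y * of_int (r * (m + r) * (n + 1)) - y * of_int (r * (n + r) * (m + 1)) - of_int (m - n) * (y * of_int r * of_int (m + n + 1)) = (0 :: complex)" if "m + n + r = 0"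
    proof -
      have r: "r = - m - n" using that by simp
      show ?thesis unfolding r by (simp add: algebra_simps)
    qed
    then show "(if m + n + r = 0 then y * of_int (r * (m + r) * (n + 1)) - y * of_int (r * (n + r) * (m + 1)) - of_int (m - n) * (y * of_int r * of_int (m + n + 1)) else 0) = (0 :: complex)" by simp
  qed
  have fcY: "fc r (Y m n p) = Y m n (fc r p)" for r m n p
  proof -
    have "fc r (Y m n p) - Y m n (fc r p) = Pi_scale (of_int (r * (m + r)) - of_int (r * (n + r)) - of_int (m - n) * of_int r) (fc (m + n + r) p)
      - Pi_scale (if m + n + r = 0 then 2 * of_int (r * (m + r) * (n + 1)) - 2 * of_int (r * (n + r) * (m + 1)) - of_int (m - n) * (2 * of_int r * of_int (m + n + 1)) else 0) p"
      unfolding Y_def fock_lin fcLL fc_fL [of r "m + n"]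
      by (simp add: fock_lin add.commute [of n m] add_eq_0_iff2 [of "m + n"] Pi.scale_left_diff_distrib Pi.scale_right_distrib Pi.scale_right_diff_distrib)
        (simp add: left_diff_distrib Pi.scale_left_diff_distrib)
    also have "\<dots> = 0" unfolding coef by simp
    finally show ?thesis by simp
  qed
  have fdY: "fd r (Y m n p) = Y m n (fd r p)" for r m n p
  proof -
    have "fd r (Y m n p) - Y m n (fd r p) = Pi_scale (of_int (r * (m + r)) - of_int (r * (n + r)) - of_int (m - n) * of_int r) (fd (m + n + r) p)
      - Pi_scale (if m + n + r = 0 then z * of_int (r * (m + r) * (n + 1)) - z * of_int (r * (n + r) * (m + 1)) - of_int (m - n) * (z * of_int r * of_int (m + n + 1)) else 0) p"
      unfolding Y_def fock_lin fdLL fd_fL' [of r "m + n"]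
      by (simp add: fock_lin add.commute [of n m] add_eq_0_iff2 [of "m + n"] Pi.scale_left_diff_distrib Pi.scale_right_distrib Pi.scale_right_diff_distrib)
        (simp add: left_diff_distrib Pi.scale_left_diff_distrib)
    also have "\<dots> = 0" unfolding coef by simp
    finally show ?thesis by simp
  qed
  have pos: "Y m (- m) 1 = 0" if "m > 0" for m
    using fL_fL_1 [of "nat m"] that
    by (simp add: Y_def fL_1 fock_lin fL_0_1 Pi.scale_left_distrib)
  have anti: "Y m n p = - Y n m p" for m n p
  proof (cases "m + n = 0")
    case True
    then have n: "n = - m" by simp
    show ?thesis by (simp add: n Y_def algebra_simps diff_divide_distrib flip: Pi.scale_left_distrib)
  qed (simp add: Y_def add.commute algebra_simps flip: Pi.scale_left_distrib)
  have Y1: "Y m n 1 = 0" if "- m - n = 0"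
  proof (cases m "0::int" rule: linorder_cases)
    case less
    then show ?thesis using pos [of "- m"] anti [of m "- m"] that by simp
  next
    case equal
    then show ?thesis using that by (simp add: Y_def)
  next
    case greater
    have n: "n = - m" using that by simp
    show ?thesis unfolding n by (rule pos [OF greater])
  qed
  \<comment> \<open>The original zero modes have to be treated separately: c(0) is -Id, and d(0)
    commutes with everything by \<open>Pi_d_0_fL\<close>.\<close>
  have Yc: "Y m n (Pi_c j p) = Pi_c j (Y m n p)" for j p
    using fcY [of j m n p] lin_minus [OF graded_lin [OF gY [of m n]], of p] by (cases "j = 0") (simp_all add: fock_c_def Pi_c_simps)
  have Yd: "Y m n (Pi_d j p) = Pi_d j (Y m n p)" for j p
  proof (cases "j = 0")
    case True
    then show ?thesis
      by (simp add: Y_def lin_diff [OF plin_d] lin_scale [OF plin_d] lin_zero [OF plin_d] Pi_d_0_fL)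
  next
    case False
    then show ?thesis using fdY [of j m n p] by (simp add: fock_d_def)
  qed
  have "Y m n p = 0" by (rule schur [OF gY Yc Yd Y1])
  then show ?thesis unfolding Y_def by (simp only: diff_eq_eq add_0 add_ac)
qed

end

section \<open>Words acting on a vector\<close>

definition evalw :: "('g, 'v) rep \<Rightarrow> 'v \<Rightarrow> ('g list \<Rightarrow>\<^sub>0 complex) \<Rightarrow> 'v" where
  "evalw M w y = (\<Oplus>\<^bsub>M\<^esub>u\<in>keys y. lookup y u \<odot>\<^bsub>M\<^esub> foldr (act M) u w)"

context lie_module
begin

lemma smult_closed' [simp]: "v \<in> carrier M \<Longrightarrow> a \<odot>\<^bsub>M\<^esub> v \<in> carrier M"
  by (rule smult_closed) simp_all

lemma smult_distribs: "v \<in> carrier M \<Longrightarrow> (a + b) \<odot>\<^bsub>M\<^esub> v = a \<odot>\<^bsub>M\<^esub> v \<oplus>\<^bsub>M\<^esub> b \<odot>\<^bsub>M\<^esub> v"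
  "v \<in> carrier M \<Longrightarrow> v' \<in> carrier M \<Longrightarrow> a \<odot>\<^bsub>M\<^esub> (v \<oplus>\<^bsub>M\<^esub> v') = a \<odot>\<^bsub>M\<^esub> v \<oplus>\<^bsub>M\<^esub> a \<odot>\<^bsub>M\<^esub> v'"
  "v \<in> carrier M \<Longrightarrow> (a * b) \<odot>\<^bsub>M\<^esub> v = a \<odot>\<^bsub>M\<^esub> (b \<odot>\<^bsub>M\<^esub> v)" "v \<in> carrier M \<Longrightarrow> 1 \<odot>\<^bsub>M\<^esub> v = v" "v \<in> carrier M \<Longrightarrow> 0 \<odot>\<^bsub>M\<^esub> v = \<zero>\<^bsub>M\<^esub>"
  "a \<odot>\<^bsub>M\<^esub> \<zero>\<^bsub>M\<^esub> = \<zero>\<^bsub>M\<^esub>"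
  using smult_l_distr [of a b v] smult_r_distr [of a v v'] smult_assoc1 [of a b v] smult_one [of v] smult_l_null [of v] smult_r_null [of a]
  by simp_all

lemma act_zero [simp]: "act M x \<zero>\<^bsub>M\<^esub> = \<zero>\<^bsub>M\<^esub>"
  using act_smult [of "\<zero>\<^bsub>M\<^esub>" x 0] act_closed [of "\<zero>\<^bsub>M\<^esub>" x] by (simp add: smult_distribs)

context
  fixes w assumes w: "w \<in> carrier M"
begin

lemma word_closed [simp]: "foldr (act M) u w \<in> carrier M"
  by (induction u) (simp_all add: w act_closed)

lemma evalw_closed [simp]: "evalw M w y \<in> carrier M"
  by (simp add: evalw_def)

lemma evalw_superset:
  assumes "finite A" "keys y \<subseteq> A"
  shows "evalw M w y = (\<Oplus>\<^bsub>M\<^esub>u\<in>A. lookup y u \<odot>\<^bsub>M\<^esub> foldr (act M) u w)"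
  unfolding evalw_def
  by (rule add.finprod_mono_neutral_cong_left) (use assms in \<open>auto simp: in_keys_iff smult_distribs\<close>)

lemma evalw_add: "evalw M w (x + y) = evalw M w x \<oplus>\<^bsub>M\<^esub> evalw M w y"
proof -
  let ?A = "keys x \<union> keys y"
  have "evalw M w (x + y) = (\<Oplus>\<^bsub>M\<^esub>u\<in>?A. lookup (x + y) u \<odot>\<^bsub>M\<^esub> foldr (act M) u w)"
    by (rule evalw_superset) (simp_all add: keys_add)
  also have "\<dots> = (\<Oplus>\<^bsub>M\<^esub>u\<in>?A. lookup x u \<odot>\<^bsub>M\<^esub> foldr (act M) u w \<oplus>\<^bsub>M\<^esub> lookup y u \<odot>\<^bsub>M\<^esub> foldr (act M) u w)"
    by (simp add: lookup_add smult_distribs)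
  also have "\<dots> = evalw M w x \<oplus>\<^bsub>M\<^esub> evalw M w y"
    by (subst (1 2) evalw_superset [of ?A]) (auto intro!: finsum_addf)
  finally show ?thesis .
qed

lemma evalw_single: "evalw M w (single u a) = a \<odot>\<^bsub>M\<^esub> foldr (act M) u w"
  by (subst evalw_superset [of "{u}"]) (auto simp: lookup_single)

lemma evalw_zero: "evalw M w 0 = \<zero>\<^bsub>M\<^esub>"
  by (simp add: evalw_def)

lemma evalw_fscale: "evalw M w (fscale a y) = a \<odot>\<^bsub>M\<^esub> evalw M w y"
  by (induction y rule: poly_mapping_single_induct)
    (simp_all add: evalw_zero evalw_single evalw_add free.scale_right_distrib smult_distribs)

lemma evalw_push: "evalw M w (push ((#) x) y) = act M x (evalw M w y)"
  by (induction y rule: poly_mapping_single_induct)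
    (simp_all add: evalw_zero evalw_single evalw_add push_add act_add act_smult)

lemma evalw_Nil: "evalw M w (single [] a) = a \<odot>\<^bsub>M\<^esub> w"
  by (simp add: evalw_single)

lemma evalw_minus: "evalw M w (- y) = \<ominus>\<^bsub>M\<^esub> evalw M w y"
proof -
  have "evalw M w (- y) \<oplus>\<^bsub>M\<^esub> evalw M w y = \<zero>\<^bsub>M\<^esub>" by (simp add: evalw_zero flip: evalw_add)
  then show ?thesis by (intro minus_equality [symmetric]) simp_all
qed

lemma evalw_diff: "evalw M w (x - y) = evalw M w x \<ominus>\<^bsub>M\<^esub> evalw M w y"
  using evalw_add [of x "- y"] by (simp add: evalw_minus a_minus_def)

lemma lideal_evalw: "lideal {y. evalw M w y = \<zero>\<^bsub>M\<^esub>}"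
  by (simp add: lideal_def free.subspace_def evalw_zero evalw_add evalw_fscale evalw_push smult_distribs)

lemma evalw_push_right: "evalw M w (push (\<lambda>z. z # u) b) = (\<Oplus>\<^bsub>M\<^esub>z\<in>keys b. lookup b z \<odot>\<^bsub>M\<^esub> act M z (foldr (act M) u w))"
proof -
  have "evalw M w (\<Sum>z\<in>A. single (z # u) (lookup b z))
     = (\<Oplus>\<^bsub>M\<^esub>z\<in>A. lookup b z \<odot>\<^bsub>M\<^esub> act M z (foldr (act M) u w))" if "finite A" for A
    using that by induction (simp_all add: evalw_zero evalw_add evalw_single act_closed)
  then show ?thesis by (simp add: push_def)
qed

lemma evalw_enveloping: "enveloping_relations br \<subseteq> {y. evalw M w y = \<zero>\<^bsub>M\<^esub>}"
proof -
  have "v \<ominus>\<^bsub>M\<^esub> v = \<zero>\<^bsub>M\<^esub>" if "v \<in> carrier M" for v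
    using that by (simp add: a_minus_def r_neg)
  then show ?thesis
    by (auto simp: enveloping_relations_def evalw_diff evalw_single evalw_push_right act_bracket smult_distribs act_closed)
qed

lemma lgen_evalw:
  assumes "S \<subseteq> {y. evalw M w y = \<zero>\<^bsub>M\<^esub>}"
  shows "lgen (enveloping_relations br \<union> S) \<subseteq> {y. evalw M w y = \<zero>\<^bsub>M\<^esub>}"
  using assms evalw_enveloping by (intro lgen_minimal lideal_evalw) simp

lemma evalw_eigen_relation: "evalw M w (eigen_relation x a) = \<zero>\<^bsub>M\<^esub> \<longleftrightarrow> act M x w = a \<odot>\<^bsub>M\<^esub> w"
proof -
  have "v \<ominus>\<^bsub>M\<^esub> v' = \<zero>\<^bsub>M\<^esub> \<longleftrightarrow> v = v'" if "v \<in> carrier M" "v' \<in> carrier M" for v v'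
  proof
    assume *: "v \<ominus>\<^bsub>M\<^esub> v' = \<zero>\<^bsub>M\<^esub>"
    have "v = (v \<ominus>\<^bsub>M\<^esub> v') \<oplus>\<^bsub>M\<^esub> v'" using that by (simp add: a_minus_def a_assoc l_neg)
    then show "v = v'" using that by (simp add: *)
  qed (use that in \<open>simp add: a_minus_def r_neg\<close>)
  then show ?thesis
    using w by (simp add: eigen_relation_def evalw_diff evalw_single smult_distribs act_closed)
qed

lemma subrep_range_evalw: "subrep (range (evalw M w)) M"
proof -
  have "cmodule M" by unfold_locales
  show ?thesis
    by (simp add: subrep_def submodule_iff [OF \<open>cmodule M\<close>] flip: evalw_add evalw_fscale evalw_push evalw_zero)
      (auto simp: image_iff intro: evalw_zero [symmetric])
qed

text \<open>In a simple module the words applied to a nonzero vector form a nonzero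
  subrepresentation, hence everything.\<close>

lemma presented_evalw:
  assumes "\<And>N. subrep N M \<Longrightarrow> N \<noteq> {\<zero>\<^bsub>M\<^esub>} \<Longrightarrow> N = carrier M" "w \<noteq> \<zero>\<^bsub>M\<^esub>"
  shows "presented M (evalw M w)"
proof -
  have "evalw M w (single [] 1) = w" using w by (simp add: evalw_Nil smult_distribs)
  then have "range (evalw M w) \<noteq> {\<zero>\<^bsub>M\<^esub>}" using assms(2) by (metis rangeI singletonD)
  then have "range (evalw M w) = carrier M" using assms(1) subrep_range_evalw by blast
  then show ?thesis
    by (simp add: presented_def rep_epi_def epi_def evalw_zero evalw_add evalw_fscale evalw_push)
qed

end

end

section \<open>Irreducible highest weight modules of the Virasoro algebra\<close>

definition bracket_sum :: "('g \<Rightarrow> Pi_vec) \<Rightarrow> ('g \<Rightarrow>\<^sub>0 complex) \<Rightarrow> Pi_vec" where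
  "bracket_sum f b = (\<Sum>z\<in>keys b. Pi_scale (lookup b z) (f z))"

lemma bracket_sum_add: "bracket_sum f (b + b') = bracket_sum f b + bracket_sum f b'"
  unfolding bracket_sum_def by (rule setsum_keys_plus_distrib) (simp_all add: Pi.scale_left_distrib)

lemma bracket_sum_single [simp]: "bracket_sum f (single z a) = Pi_scale a (f z)"
  by (cases "a = 0") (simp_all add: bracket_sum_def)

lemma bracket_sum_zero [simp]: "bracket_sum f 0 = 0" and bracket_sum_minus: "bracket_sum f (- b) = - bracket_sum f b"
  by (simp_all add: bracket_sum_def sum_negf)

lemma Pi_space_simps [simp]: "carrier Pi_space = UNIV" "\<zero>\<^bsub>Pi_space\<^esub> = 0" "p \<oplus>\<^bsub>Pi_space\<^esub> q = p + q" "a \<odot>\<^bsub>Pi_space\<^esub> p = Pi_scale a p"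
  by (simp_all add: Pi_space_def)

definition Pi_rep :: "('g \<Rightarrow> Pi_vec \<Rightarrow> Pi_vec) \<Rightarrow> ('g, Pi_vec) rep" where
  "Pi_rep A = Module.module.extend Pi_space \<lparr>act = A\<rparr>"

lemma Pi_rep_simps [simp]: "carrier (Pi_rep A) = UNIV" "\<zero>\<^bsub>Pi_rep A\<^esub> = 0" "p \<oplus>\<^bsub>Pi_rep A\<^esub> q = p + q" "a \<odot>\<^bsub>Pi_rep A\<^esub> p = Pi_scale a p" "act (Pi_rep A) = A"
  by (simp_all add: Pi_rep_def Module.module.extend_def Pi_space_def)

lemma cmodule_Pi_rep: "cmodule (Pi_rep A)"
  by (rule cmoduleI) (simp_all add: Pi.scale_left_distrib Pi.scale_right_distrib add_ac)

lemma lie_module_Pi_rep: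
  assumes "\<And>x. plin (A x)" and "\<And>x y p. A x (A y p) - A y (A x p) = bracket_sum (\<lambda>z. A z p) (br x y)"
  shows "lie_module br (Pi_rep A)"
proof -
  interpret Module.module complex_ring "Pi_rep A" by (rule cmodule_Pi_rep)
  have "p \<ominus>\<^bsub>Pi_rep A\<^esub> q = p - q" for p q
  proof -
    have "\<ominus>\<^bsub>Pi_rep A\<^esub> q = - q" by (rule minus_equality) simp_all
    then show ?thesis by (simp add: a_minus_def)
  qed
  moreover have "(\<Oplus>\<^bsub>Pi_rep A\<^esub>z\<in>S. f z) = sum f S" if "finite S" for f :: "'a \<Rightarrow> Pi_vec" and S
    using that by induction simp_all
  ultimately show ?thesis
    using assms(2) lin_add [OF assms(1)] lin_scale [OF assms(1)]
    by unfold_locales (simp_all add: bracket_sum_def)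
qed

definition fock_rep :: "complex \<Rightarrow> complex \<Rightarrow> (virasoro, Pi_vec) rep" where
  "fock_rep cc hw = Pi_rep (\<lambda>x. case x of L n \<Rightarrow> fock_L cc hw n | C \<Rightarrow> Pi_scale cc)"

lemma lie_module_fock_rep: "lie_module virasoro_bracket (fock_rep cc hw)"
  unfolding fock_rep_def
proof (rule lie_module_Pi_rep)
  show "plin (case x of L n \<Rightarrow> fock_L cc hw n | C \<Rightarrow> Pi_scale cc)" for x
    using fld_lin [OF fld_fL] Pi.linear_scale_self by (cases x) simp_all
  show "(case x of L n \<Rightarrow> fock_L cc hw n | C \<Rightarrow> Pi_scale cc) ((case y of L n \<Rightarrow> fock_L cc hw n | C \<Rightarrow> Pi_scale cc) p)
      - (case y of L n \<Rightarrow> fock_L cc hw n | C \<Rightarrow> Pi_scale cc) ((case x of L n \<Rightarrow> fock_L cc hw n | C \<Rightarrow> Pi_scale cc) p)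
      = bracket_sum (\<lambda>z. (case z of L n \<Rightarrow> fock_L cc hw n | C \<Rightarrow> Pi_scale cc) p) (virasoro_bracket x y)" for x y p
  proof (cases x)
    case x: (L m)
    show ?thesis
    proof (cases y)
      case y: (L n)
      show ?thesis
        by (simp add: x y bracket_sum_add virasoro_fock [of cc hw m n p])
    qed (simp add: x fock_lin)
  qed (cases y; simp add: fock_lin)
qed

fun virasoro_degree :: "virasoro \<Rightarrow> int" where
  "virasoro_degree (L n) = - n"
| "virasoro_degree C = 0"

lemma virasoro_bracket_degree:
  "z \<in> keys (virasoro_bracket x y) \<Longrightarrow> virasoro_degree z = virasoro_degree x + virasoro_degree y"
  using keys_add by (cases x; cases y) (fastforce split: if_splits)+

definition Verma_ideal :: "complex \<Rightarrow> complex \<Rightarrow> (virasoro list \<Rightarrow>\<^sub>0 complex) set" where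
  "Verma_ideal cc hw = lgen (enveloping_relations virasoro_bracket \<union>
     ({eigen_relation (L n) (if n = 0 then hw else 0) | n. n \<ge> 0} \<union> {eigen_relation C cc}))"

lemma lideal_Verma: "lideal (Verma_ideal cc hw)"
  unfolding Verma_ideal_def by (rule lideal_lgen)

lemma enveloping_Verma: "enveloping_relations virasoro_bracket \<subseteq> Verma_ideal cc hw"
  and Verma_relations: "n \<ge> 0 \<Longrightarrow> eigen_relation (L n) (if n = 0 then hw else 0) \<in> Verma_ideal cc hw"
    "eigen_relation C cc \<in> Verma_ideal cc hw"
  unfolding Verma_ideal_def by (rule order_trans [OF _ lgen_superset] subsetD [OF lgen_superset]; force)+

text \<open>The vacuum of the Fock space satisfies the defining relations and is nonzero, so the
  left ideal that they generate is proper. No PBW theorem enters.\<close>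

lemma Verma_nontrivial: "single [] 1 \<notin> Verma_ideal cc hw"
proof -
  let ?M = "fock_rep cc hw"
  interpret lie_module virasoro_bracket ?M by (rule lie_module_fock_rep)
  have 1: "1 \<in> carrier ?M" and 0: "\<zero>\<^bsub>?M\<^esub> = 0" by (simp_all add: fock_rep_def)
  have rel: "evalw ?M 1 (eigen_relation (L n) (if n = 0 then hw else 0)) = \<zero>\<^bsub>?M\<^esub>" if "n \<ge> 0" for n
    unfolding evalw_eigen_relation [OF 1] using that by (cases "n = 0") (simp_all add: fock_rep_def fL_1 fL_0_1)
  have rel': "evalw ?M 1 (eigen_relation C cc) = \<zero>\<^bsub>?M\<^esub>"
    unfolding evalw_eigen_relation [OF 1] by (simp add: fock_rep_def)
  have "Verma_ideal cc hw \<subseteq> {y. evalw ?M 1 y = \<zero>\<^bsub>?M\<^esub>}"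
    unfolding Verma_ideal_def by (rule lgen_evalw [OF 1]) (use rel rel' in blast)
  moreover have "evalw ?M 1 (single [] 1) = 1"
    unfolding evalw_Nil [OF 1] by (simp add: fock_rep_def)
  ultimately show ?thesis using 0 by auto
qed

lemma Verma_L0:
  "single (L 0 # u) 1 - fscale (hw + of_int (wdeg virasoro_degree u)) (single u 1) \<in> Verma_ideal cc hw"
proof (induction u)
  case Nil
  then show ?case using Verma_relations(1) [of 0 hw cc] by (simp add: eigen_relation_def wdeg_def)
next
  case (Cons x u)
  let ?I = "Verma_ideal cc hw" and ?u = "single u 1"
  note sub = free_subspaceD [OF lidealD(1) [OF lideal_Verma]]
  have 1: "push ((#) (L 0)) (push ((#) x) ?u) - push ((#) x) (push ((#) (L 0)) ?u) - bract (virasoro_bracket (L 0) x) ?u \<in> ?I"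
    by (rule bracket_mem [OF lidealD(1) [OF lideal_Verma] enveloping_Verma])
  have 2: "push ((#) x) (single (L 0 # u) 1 - fscale (hw + of_int (wdeg virasoro_degree u)) ?u) \<in> ?I"
    by (rule lidealD(2) [OF lideal_Verma Cons])
  have 3: "bract (virasoro_bracket (L 0) x) ?u = fscale (of_int (virasoro_degree x)) (push ((#) x) ?u)"
    by (cases x) (simp_all add: bract_add)
  from sub(2) [OF 1 2] show ?case
    by (simp add: 3 lin_diff [OF lin_push] push_fscale wdeg_def algebra_simps flip: single_diff single_add)
qed

text \<open>L(0) itself records the degree: T is left multiplication by L(0), the factor is 1, and
  \<open>top\<close> is the line spanned by the generator.\<close>

lemma graded_cyclic_Verma:
  "graded_cyclic virasoro_bracket virasoro_degree (Verma_ideal cc hw) hw 1 (range (single []))"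
proof
  let ?I = "Verma_ideal cc hw"
  note sub = free_subspaceD [OF lidealD(1) [OF lideal_Verma]]
  show "lideal ?I" "enveloping_relations virasoro_bracket \<subseteq> ?I" "single [] 1 \<notin> ?I"
    by (rule lideal_Verma enveloping_Verma Verma_nontrivial)+
  show "\<exists>T. lin fscale fscale T \<and> (\<forall>J. lideal J \<longrightarrow> T ` J \<subseteq> J) \<and>
      (\<forall>u\<in>U. T (single u 1) - fscale (1 * (hw + of_int (wdeg virasoro_degree u))) (single u 1) \<in> ?I)"
    for U :: "virasoro list set"
    using Verma_L0 lin_push lidealD(2) by (intro exI [of _ "push ((#) (L 0))"]) auto
  show "free.subspace (range (single [] :: complex \<Rightarrow> virasoro list \<Rightarrow>\<^sub>0 complex))"
    by (auto simp: free.subspace_def image_iff single_zero simp flip: single_add) (metis single_zero)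
  show "\<exists>p'\<in>range (single []). push ((#) x) p - p' \<in> ?I" if p: "p \<in> range (single [])" and x: "virasoro_degree x \<le> 0" for p x
  proof -
    obtain b where b: "p = single [] b" using p by auto
    have "\<exists>e. eigen_relation x e \<in> ?I" using Verma_relations(1) [of _ hw cc] Verma_relations(2) [of cc hw] x by (cases x) auto
    then obtain e where "eigen_relation x e \<in> ?I" ..
    then have "fscale b (eigen_relation x e) \<in> ?I" by (rule sub)
    then show ?thesis
      by (intro bexI [of _ "single [] (b * e)"]) (simp_all add: b eigen_relation_def free.scale_right_diff_distrib)
  qed
  show "single [] 1 \<in> J" if J: "lideal J" "p \<in> J" and p: "p \<in> range (single [])" "p \<notin> ?I" for J p
  proof -
    obtain b where b: "p = single [] b" using p by auto
    then have "b \<noteq> 0" using p(2) sub(1) by auto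
    then show ?thesis
      using free_subspaceD(4) [OF lidealD(1) [OF J(1)] J(2), of "1 / b"] by (simp add: b)
  qed
qed (auto simp: wdeg_def split: if_splits)

lemma (in graded_cyclic) presented_simple_quotient:
  assumes "presented M q" "presented.ker M q = I"
  shows "\<exists>q'. presented (simple_quotient M) q' \<and> presented.ker (simple_quotient M) q' = maximal_ideal"
proof -
  interpret M: presented M q by (rule assms)
  have J: "lideal maximal_ideal" "M.ker \<subseteq> maximal_ideal" "maximal_ideal \<noteq> UNIV"
    using lideal_maximal_ideal I_subset_maximal_ideal maximal_ideal_proper by (auto simp: assms(2))
  have the: "(THE N. maximal_subrep N M) = q ` maximal_ideal"
    by (rule M.the_maximal_subrep [OF J]) (simp add: assms(2) maximal_ideal_upper)
  have sub: "subrep (q ` maximal_ideal) M" by (rule M.subrep_image [OF J(1)])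
  show ?thesis
    unfolding simple_quotient_def the
    using M.presented_quot [OF sub] M.ker_quot [OF sub] M.mem_image_iff [OF J(1,2)] by auto
qed

lemma virasoro_irreducible_presented:
  "\<exists>q. presented (virasoro_irreducible cc hw) q \<and> presented.ker (virasoro_irreducible cc hw) q
     = graded_cyclic.maximal_ideal (Verma_ideal cc hw)"
  unfolding virasoro_irreducible_def virasoro_Verma_def
  by (rule graded_cyclic.presented_simple_quotient [OF graded_cyclic_Verma presented_universal_cyclic(1)])
    (unfold Verma_ideal_def, rule presented_universal_cyclic(2))

text \<open>C commutes with every generator modulo the ideal, so its value on the generator
  propagates through all words.\<close>

lemma Verma_C: "push ((#) C) y - fscale cc y \<in> Verma_ideal cc hw"
proof (induction y rule: poly_mapping_single_induct)
  case zero
  then show ?case using free_subspaceD(1) [OF lidealD(1) [OF lideal_Verma]] by simp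
next
  case (add p q)
  then show ?case
    using free_subspaceD(2) [OF lidealD(1) [OF lideal_Verma] add] by (simp add: push_add free.scale_right_distrib add_diff_add)
next
  case (single u a)
  let ?I = "Verma_ideal cc hw"
  note sub = free_subspaceD [OF lidealD(1) [OF lideal_Verma]]
  have "single (C # u) 1 - single u cc \<in> ?I"
  proof (induction u)
    case Nil
    then show ?case using Verma_relations(2) [of cc hw] by (simp add: eigen_relation_def)
  next
    case (Cons x u)
    let ?u = "single u 1"
    have 1: "push ((#) C) (push ((#) x) ?u) - push ((#) x) (push ((#) C) ?u) - bract (virasoro_bracket C x) ?u \<in> ?I"
      by (rule bracket_mem [OF lidealD(1) [OF lideal_Verma] enveloping_Verma])
    have 2: "push ((#) x) (single (C # u) 1 - single u cc) \<in> ?I"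
      by (rule lidealD(2) [OF lideal_Verma Cons])
    from sub(2) [OF 1 2] show ?case by (simp add: lin_diff [OF lin_push])
  qed
  then have "fscale a (single (C # u) 1 - single u cc) \<in> ?I" by (rule sub)
  then show ?case by (simp add: free.scale_right_diff_distrib mult.commute)
qed

locale highest_weight = V: lie_module virasoro_bracket V
  for V :: "(virasoro, 'v) rep" +
  fixes cc hw :: complex and vh :: 'v
  assumes C: "v \<in> carrier V \<Longrightarrow> act V C v = cc \<odot>\<^bsub>V\<^esub> v"
    and smooth: "v \<in> carrier V \<Longrightarrow> \<exists>N::int. \<forall>n>N. act V (L n) v = \<zero>\<^bsub>V\<^esub>"
    and vh: "vh \<in> carrier V" "vh \<noteq> \<zero>\<^bsub>V\<^esub>"
    and L_vh: "n > 0 \<Longrightarrow> act V (L n) vh = \<zero>\<^bsub>V\<^esub>" "act V (L 0) vh = hw \<odot>\<^bsub>V\<^esub> vh"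
    and simple: "subrep N V \<Longrightarrow> N \<noteq> {\<zero>\<^bsub>V\<^esub>} \<Longrightarrow> N = carrier V"

lemma (in graded_cyclic) simple_presented:
  assumes "presented M q" "presented.ker M q = maximal_ideal" "subrep N M" "N \<noteq> {\<zero>\<^bsub>M\<^esub>}"
  shows "N = carrier M"
proof -
  interpret M: presented M q by (rule assms)
  let ?J = "{y. q y \<in> N}"
  have ker: "M.ker \<subseteq> ?J" by (rule M.ker_preimage [OF assms(3)])
  have "?J = UNIV"
  proof (rule ccontr)
    assume "?J \<noteq> UNIV"
    then have "?J \<subseteq> M.ker"
      using ker I_subset_maximal_ideal assms(2) maximal_ideal_upper [OF M.lideal_preimage [OF assms(3)]] by auto
    then have "q ` ?J \<subseteq> {\<zero>\<^bsub>M\<^esub>}" by (auto simp: M.ker_def)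
    then have "N \<subseteq> {\<zero>\<^bsub>M\<^esub>}" using M.image_preimage [OF assms(3)] by simp
    moreover have "\<zero>\<^bsub>M\<^esub> \<in> N" using assms(3) by (simp add: subrep_def submodule_iff [OF M.cmodule])
    ultimately show False using assms(4) by auto
  qed
  then show ?thesis using M.image_preimage [OF assms(3)] M.carrier_eq by simp
qed

lemma highest_weight_irreducible: "\<exists>v. highest_weight (virasoro_irreducible cc hw) cc hw v"
proof -
  let ?V = "virasoro_irreducible cc hw" and ?I = "Verma_ideal cc hw"
  obtain q where q: "presented ?V q" "presented.ker ?V q = graded_cyclic.maximal_ideal ?I"
    using virasoro_irreducible_presented by blast
  interpret G: graded_cyclic virasoro_bracket virasoro_degree ?I hw 1 "range (single [])"
    by (rule graded_cyclic_Verma)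
  interpret V: presented ?V q by (rule q)
  have sub: "x - y \<in> ?I \<Longrightarrow> q x = q y" for x y
    using V.q_eq_iff q(2) G.I_subset_maximal_ideal by auto
  have lm: "lie_module virasoro_bracket ?V"
    using V.lie_module enveloping_Verma G.I_subset_maximal_ideal q(2) by (metis subset_trans)
  have "highest_weight ?V cc hw (q (single [] 1))"
  proof (rule highest_weight.intro [OF lm], unfold_locales)
    show "act ?V C v = cc \<odot>\<^bsub>?V\<^esub> v" if "v \<in> carrier ?V" for v
      using that sub [OF Verma_C] by (auto simp: V.carrier_eq simp flip: V.q_act V.q_scale)
    show "\<exists>N::int. \<forall>n>N. act ?V (L n) v = \<zero>\<^bsub>?V\<^esub>" if v: "v \<in> carrier ?V" for v
    proof -
      obtain y where y: "v = q y" using v V.carrier_eq by auto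
      have ann: "single [x] 1 \<in> ?I" if "virasoro_degree x < 0" for x
      proof (cases x)
        case (L n)
        then show ?thesis using that Verma_relations(1) [of n hw cc] by (simp add: eigen_relation_def)
      qed (use that in simp)
      obtain N where N: "\<And>x. virasoro_degree x < N \<Longrightarrow> push ((#) x) y \<in> ?I"
        using smooth [where deg = virasoro_degree and y = y, OF lideal_Verma enveloping_Verma virasoro_bracket_degree ann] by blast
      have "act ?V (L n) v = \<zero>\<^bsub>?V\<^esub>" if "n > - N" for n
        using N [of "L n"] sub [of "push ((#) (L n)) y" 0] that by (simp add: y V.q_0 flip: V.q_act)
      then show ?thesis by blast
    qed
    have L: "act ?V (L n) (q (single [] 1)) = (if n = 0 then hw else 0) \<odot>\<^bsub>?V\<^esub> q (single [] 1)" if "n \<ge> 0" for n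
      using sub [of "single [L n] 1" "single [] (if n = 0 then hw else 0)"] Verma_relations(1) [OF that, of hw cc]
      by (simp add: eigen_relation_def flip: V.q_act V.q_scale)
    show "act ?V (L n) (q (single [] 1)) = \<zero>\<^bsub>?V\<^esub>" if "n > 0" for n
      using L [of n] that by (simp add: V.q_0 flip: V.q_scale)
    show "act ?V (L 0) (q (single [] 1)) = hw \<odot>\<^bsub>?V\<^esub> q (single [] 1)"
      using L [of 0] by simp
    show "q (single [] 1) \<noteq> \<zero>\<^bsub>?V\<^esub>"
      using G.maximal_ideal_proper q(2) by (auto simp: V.ker_def)
    show "N = carrier ?V" if "subrep N ?V" "N \<noteq> {\<zero>\<^bsub>?V\<^esub>}" for N
      by (rule G.simple_presented [OF q that])
  qed simp
  then show ?thesis ..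
qed

section \<open>Tensor products\<close>

lemma submodule_lin_span:
  assumes V: "cmodule V" and S: "S \<subseteq> carrier V"
  shows "submodule (lin_span V S) complex_ring V" "S \<subseteq> lin_span V S" "submodule N complex_ring V \<Longrightarrow> S \<subseteq> N \<Longrightarrow> lin_span V S \<subseteq> N"
proof -
  interpret V: Module.module complex_ring V by (rule V)
  have "carrier V \<in> {N. submodule N complex_ring V \<and> S \<subseteq> N}"
    using S V.carrier_is_submodule by simp
  then have "lin_span V S \<subseteq> carrier V" unfolding lin_span_def by blast
  then show "submodule (lin_span V S) complex_ring V"
    unfolding submodule_iff [OF V] by (auto simp: lin_span_def submodule_iff [OF V])
qed (auto simp: lin_span_def)

definition tens :: "(complex, 'v, 'm) module_scheme \<Rightarrow> 'v \<Rightarrow> Pi_vec \<Rightarrow> ('v \<times> Pi_vec \<Rightarrow>\<^sub>0 complex) set" where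
  "tens V v p = tensor_null V Pi_space +>\<^bsub>free_space (carrier V \<times> UNIV)\<^esub> single (v, p) 1"

text \<open>The map \<phi> tensor id on the free space, before the bilinear relations are imposed;
  it descends to the tensor product when \<phi> is a coordinate of \<open>V\<close>.\<close>

definition contract :: "('v \<Rightarrow> complex) \<Rightarrow> ('v \<times> Pi_vec \<Rightarrow>\<^sub>0 complex) \<Rightarrow> Pi_vec" where
  "contract \<phi> x = (\<Sum>u\<in>keys x. Pi_scale (lookup x u * \<phi> (fst u)) (snd u))"

lemma contract_add: "contract \<phi> (x + y) = contract \<phi> x + contract \<phi> y"
  unfolding contract_def by (rule setsum_keys_plus_distrib) (simp_all add: distrib_right Pi.scale_left_distrib)

lemma contract_zero [simp]: "contract \<phi> 0 = 0"
  by (simp add: contract_def)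

lemma contract_single [simp]: "contract \<phi> (single (v, p) a) = Pi_scale (a * \<phi> v) p"
  by (cases "a = 0") (simp_all add: contract_def)

lemma contract_fscale: "contract \<phi> (fscale a x) = Pi_scale a (contract \<phi> x)"
  by (induction x rule: poly_mapping_single_induct)
    (auto simp: contract_add free.scale_right_distrib Pi.scale_right_distrib mult.assoc split: prod.splits)

lemma contract_diff: "contract \<phi> (x - y) = contract \<phi> x - contract \<phi> y"
  using contract_add [of \<phi> "x - y" y] by simp

text \<open>A linear section of a surjection from a free space onto \<open>V\<close> provides coordinates on \<open>V\<close>, and thereby
  coordinate maps from the tensor product that separate its elements.\<close>

locale sectioned = V: Module.module complex_ring V
  for V :: "(complex, 'v, 'm) module_scheme" +
  fixes q :: "('i \<Rightarrow>\<^sub>0 complex) \<Rightarrow> 'v" and sec :: "'v \<Rightarrow> ('i \<Rightarrow>\<^sub>0 complex)"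
  assumes q_closed [simp]: "q x \<in> carrier V" and q_add: "q (x + y) = q x \<oplus>\<^bsub>V\<^esub> q y" and q_fscale: "q (fscale a x) = a \<odot>\<^bsub>V\<^esub> q x"
    and q_sec: "v \<in> carrier V \<Longrightarrow> q (sec v) = v"
    and sec_add: "v \<in> carrier V \<Longrightarrow> v' \<in> carrier V \<Longrightarrow> sec (v \<oplus>\<^bsub>V\<^esub> v') = sec v + sec v'"
    and sec_smult: "v \<in> carrier V \<Longrightarrow> sec (a \<odot>\<^bsub>V\<^esub> v) = fscale a (sec v)"
begin

abbreviation "FF \<equiv> free_space (carrier V \<times> UNIV) :: (complex, 'v \<times> Pi_vec \<Rightarrow>\<^sub>0 complex) module"
abbreviation "N0 \<equiv> tensor_null V Pi_space"
abbreviation "T \<equiv> tensor_space V Pi_space"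
abbreviation coset where "coset x \<equiv> N0 +>\<^bsub>FF\<^esub> x"

lemma V_closed [simp]: "v \<in> carrier V \<Longrightarrow> a \<odot>\<^bsub>V\<^esub> v \<in> carrier V"
  by (rule V.smult_closed) simp_all

declare free_space_simps(1) [simp del]

lemma cmodule_F: "cmodule FF"
  by (rule cmodule_free_space)

lemma in_F: "x \<in> carrier FF \<longleftrightarrow> fst ` keys x \<subseteq> carrier V"
  by (auto simp: image_subset_iff free_space_simps)

lemma single_F: "v \<in> carrier V \<Longrightarrow> single (v, p) a \<in> carrier FF"
  by (simp add: in_F)

lemma F_zero [simp]: "0 \<in> carrier FF"
  by (simp add: in_F)

lemma F_add: "x \<in> carrier FF \<Longrightarrow> y \<in> carrier FF \<Longrightarrow> x + y \<in> carrier FF" and F_diff: "x \<in> carrier FF \<Longrightarrow> y \<in> carrier FF \<Longrightarrow> x - y \<in> carrier FF"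
  and F_fscale: "x \<in> carrier FF \<Longrightarrow> fscale a x \<in> carrier FF"
  using keys_add [of x y] keys_diff [of x y] keys_fscale [of a x] by (simp_all add: in_F) blast+

lemma bilinear_relations_F: "bilinear_relations V Pi_space \<subseteq> carrier FF"
  unfolding bilinear_relations_def by (safe; intro F_diff single_F V.add.m_closed V_closed; simp)

lemma submodule_N0: "submodule N0 complex_ring FF"
  and relations_N0: "bilinear_relations V Pi_space \<subseteq> N0"
  and N0_minimal: "submodule N complex_ring FF \<Longrightarrow> bilinear_relations V Pi_space \<subseteq> N \<Longrightarrow> N0 \<subseteq> N"
  using submodule_lin_span [OF cmodule_F bilinear_relations_F] by (auto simp: tensor_null_def)

lemmas N0_iff = submodule_N0 [unfolded submodule_iff [OF cmodule_F]]

lemma F_minus: "x \<in> carrier FF \<Longrightarrow> y \<in> carrier FF \<Longrightarrow> x \<ominus>\<^bsub>FF\<^esub> y = x - y"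
proof -
  assume x: "x \<in> carrier FF" and y: "y \<in> carrier FF"
  interpret FF: Module.module complex_ring FF by (rule cmodule_F)
  have "\<ominus>\<^bsub>FF\<^esub> y = - y" using F_diff [of 0 y] y by (intro FF.minus_equality) simp_all
  then show ?thesis by (simp add: a_minus_def)
qed

lemma coset_eq: "x \<in> carrier FF \<Longrightarrow> y \<in> carrier FF \<Longrightarrow> coset x = coset y \<longleftrightarrow> x - y \<in> N0"
  using coset_eq_iff [OF cmodule_F submodule_N0] F_minus by simp

lemma epi_T: "epi FF T coset"
  using epi_quot_space [OF cmodule_F submodule_N0] by (simp add: tensor_space_def)

lemma cmodule_T: "cmodule T"
  by (rule epi_module [OF cmodule_F epi_T])

sublocale T: Module.module complex_ring T by (rule cmodule_T)

lemma T_carrier: "carrier T = coset ` carrier FF" and T_zero: "\<zero>\<^bsub>T\<^esub> = coset 0"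
  and coset_add: "x \<in> carrier FF \<Longrightarrow> y \<in> carrier FF \<Longrightarrow> coset (x + y) = coset x \<oplus>\<^bsub>T\<^esub> coset y"
  and coset_fscale: "x \<in> carrier FF \<Longrightarrow> coset (fscale a x) = a \<odot>\<^bsub>T\<^esub> coset x"
  using epi_T by (simp_all add: epi_def)

lemma tens_closed [simp]: "v \<in> carrier V \<Longrightarrow> tens V v p \<in> carrier T"
  unfolding T_carrier tens_def by (rule imageI [OF single_F])

lemma tens_add_left: "v \<in> carrier V \<Longrightarrow> v' \<in> carrier V \<Longrightarrow> tens V (v \<oplus>\<^bsub>V\<^esub> v') p = tens V v p \<oplus>\<^bsub>T\<^esub> tens V v' p"
  and tens_add_right: "v \<in> carrier V \<Longrightarrow> tens V v (p + p') = tens V v p \<oplus>\<^bsub>T\<^esub> tens V v p'"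
  and tens_smult_left: "v \<in> carrier V \<Longrightarrow> tens V (a \<odot>\<^bsub>V\<^esub> v) p = a \<odot>\<^bsub>T\<^esub> tens V v p"
  and tens_smult_right: "v \<in> carrier V \<Longrightarrow> tens V v (Pi_scale a p) = a \<odot>\<^bsub>T\<^esub> tens V v p"
proof -
  assume v: "v \<in> carrier V"
  have rel: "x \<in> bilinear_relations V Pi_space \<Longrightarrow> x \<in> N0" for x using relations_N0 by blast
  show "tens V (v \<oplus>\<^bsub>V\<^esub> v') p = tens V v p \<oplus>\<^bsub>T\<^esub> tens V v' p" if v': "v' \<in> carrier V"
  proof -
    have "single (v \<oplus>\<^bsub>V\<^esub> v', p) 1 - (single (v, p) 1 + single (v', p) 1) \<in> N0"
      using v v' by (intro rel) (unfold bilinear_relations_def diff_diff_eq [symmetric], simp only: Un_iff mem_Collect_eq Pi_space_simps, blast)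
    then show ?thesis
      using v v' by (simp add: tens_def coset_eq single_F F_add flip: coset_add)
  qed
  have "single (v, p + p') 1 - (single (v, p) 1 + single (v, p') 1) \<in> N0"
    using v by (intro rel) (unfold bilinear_relations_def diff_diff_eq [symmetric], simp only: Un_iff mem_Collect_eq Pi_space_simps, blast)
  then show "tens V v (p + p') = tens V v p \<oplus>\<^bsub>T\<^esub> tens V v p'"
    using v by (simp add: tens_def coset_eq single_F F_add flip: coset_add)
  have fs: "single u a = fscale a (single u 1)" for u :: "'v \<times> Pi_vec" by simp
  have "single (a \<odot>\<^bsub>V\<^esub> v, p) 1 - fscale a (single (v, p) 1) \<in> N0"
    unfolding fs [symmetric] using v by (intro rel) (unfold bilinear_relations_def, simp, blast)
  then show "tens V (a \<odot>\<^bsub>V\<^esub> v) p = a \<odot>\<^bsub>T\<^esub> tens V v p"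
    using v unfolding tens_def coset_fscale [OF single_F [OF v], symmetric] by (subst coset_eq) (auto intro!: single_F F_fscale)
  have "single (v, Pi_scale a p) 1 - fscale a (single (v, p) 1) \<in> N0"
    unfolding fs [symmetric] using v by (intro rel) (unfold bilinear_relations_def, simp, blast)
  then show "tens V v (Pi_scale a p) = a \<odot>\<^bsub>T\<^esub> tens V v p"
    using v unfolding tens_def coset_fscale [OF single_F [OF v], symmetric] by (subst coset_eq) (auto intro!: single_F F_fscale)
qed

lemma smult_zero_T [simp]: "t \<in> carrier T \<Longrightarrow> 0 \<odot>\<^bsub>T\<^esub> t = \<zero>\<^bsub>T\<^esub>"
  using T.smult_l_null by simp

lemma tens_zero_right [simp]: "v \<in> carrier V \<Longrightarrow> tens V v 0 = \<zero>\<^bsub>T\<^esub>"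
  using tens_smult_right [of v 0 0] by simp

lemma tens_zero_left [simp]: "tens V \<zero>\<^bsub>V\<^esub> p = \<zero>\<^bsub>T\<^esub>"
  using tens_smult_left [of "\<zero>\<^bsub>V\<^esub>" 0 p] V.smult_r_null [of 0] by simp

lemma T_induct [consumes 1, case_names tens add]:
  assumes t: "t \<in> carrier T" and tens: "\<And>v p. v \<in> carrier V \<Longrightarrow> P (tens V v p)"
    and add: "\<And>t t'. t \<in> carrier T \<Longrightarrow> t' \<in> carrier T \<Longrightarrow> P t \<Longrightarrow> P t' \<Longrightarrow> P (t \<oplus>\<^bsub>T\<^esub> t')"
  shows "P t"
proof -
  obtain x where x: "x \<in> carrier FF" "t = coset x" using t T_carrier by auto
  have single: "P (coset (single (v, p) a))" if v: "v \<in> carrier V" for v p a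
  proof -
    have "coset (single (v, p) a) = tens V (a \<odot>\<^bsub>V\<^esub> v) p"
      using coset_fscale [OF single_F [OF v], of a p 1] tens_smult_left [OF v, of a p] by (simp add: tens_def)
    then show ?thesis using tens v by simp
  qed
  have "(\<Sum>u\<in>S. single u (lookup x u)) \<in> carrier FF \<and> P (coset (\<Sum>u\<in>S. single u (lookup x u)))"
    if "finite S" "S \<subseteq> keys x" for S
    using that
  proof induction
    case empty
    then show ?case using tens [of "\<zero>\<^bsub>V\<^esub>" 0] by (simp add: T_zero)
  next
    case (insert u S)
    have u: "fst u \<in> carrier V" using insert x(1) by (auto simp: in_F)
    have 1: "single u (lookup x u) \<in> carrier FF" "P (coset (single u (lookup x u)))"
      using single_F [OF u, of "snd u"] single [OF u, of "snd u"] by (simp_all)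
    show ?case
      unfolding sum.insert [OF insert.hyps(1,2)]
      using insert 1 F_add coset_add add T_carrier by (metis (no_types, lifting) image_eqI insert_subset)
  qed
  from this [of "keys x"] show ?thesis by (simp add: x(2) poly_mapping_sum_single)
qed

definition coord :: "'i \<Rightarrow> 'v \<Rightarrow> complex" where "coord u v = lookup (sec v) u"

lemma coord_add: "v \<in> carrier V \<Longrightarrow> v' \<in> carrier V \<Longrightarrow> coord u (v \<oplus>\<^bsub>V\<^esub> v') = coord u v + coord u v'"
  and coord_smult: "v \<in> carrier V \<Longrightarrow> coord u (a \<odot>\<^bsub>V\<^esub> v) = a * coord u v"
  by (simp_all add: coord_def sec_add sec_smult lookup_add lookup_map)

lemma contract_N0: "x \<in> N0 \<Longrightarrow> contract (coord u) x = 0"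
proof -
  have "N0 \<subseteq> {x \<in> carrier FF. contract (coord u) x = 0}"
  proof (rule N0_minimal)
    show "submodule {x \<in> carrier FF. contract (coord u) x = 0} complex_ring FF"
      unfolding submodule_iff [OF cmodule_F] using F_add F_fscale F_zero
      by (auto simp: contract_add contract_fscale)
    show "bilinear_relations V Pi_space \<subseteq> {x \<in> carrier FF. contract (coord u) x = 0}"
    proof
      fix x assume x: "x \<in> bilinear_relations V Pi_space"
      then have "contract (coord u) x = 0"
        by (auto simp: bilinear_relations_def contract_diff coord_add coord_smult Pi.scale_left_distrib Pi.scale_right_distrib mult.commute)
      then show "x \<in> {x \<in> carrier FF. contract (coord u) x = 0}" using x bilinear_relations_F by blast
    qed
  qed
  then show "x \<in> N0 \<Longrightarrow> contract (coord u) x = 0" by blast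
qed

text \<open>\<open>SOME\<close> picks a representative of the coset; by \<open>contract_N0\<close>
  the value does not depend on it.\<close>

definition comp :: "'i \<Rightarrow> ('v \<times> Pi_vec \<Rightarrow>\<^sub>0 complex) set \<Rightarrow> Pi_vec" where
  "comp u t = contract (coord u) (SOME x. x \<in> t)"

lemma comp_coset: "x \<in> carrier FF \<Longrightarrow> comp u (coset x) = contract (coord u) x"
proof -
  assume x: "x \<in> carrier FF"
  interpret abelian_subgroup N0 FF by (rule abelian_subgroup_submodule [OF cmodule_F submodule_N0])
  have "x \<in> coset x" using a_rcos_self [OF x] .
  then have "(SOME y. y \<in> coset x) \<in> coset x" by (rule someI)
  then obtain n where "n \<in> N0" "(SOME y. y \<in> coset x) = n + x" by (auto simp: a_r_coset_def')
  then show ?thesis by (simp add: comp_def contract_add contract_N0)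
qed

lemma comp_tens: "v \<in> carrier V \<Longrightarrow> comp u (tens V v p) = Pi_scale (coord u v) p"
  unfolding tens_def by (subst comp_coset [OF single_F]) simp_all

lemma comp_add: "t \<in> carrier T \<Longrightarrow> t' \<in> carrier T \<Longrightarrow> comp u (t \<oplus>\<^bsub>T\<^esub> t') = comp u t + comp u t'"
  and comp_smult: "t \<in> carrier T \<Longrightarrow> comp u (a \<odot>\<^bsub>T\<^esub> t) = Pi_scale a (comp u t)"
  unfolding T_carrier
  by (auto simp: comp_coset contract_add contract_fscale F_add F_fscale simp flip: coset_add coset_fscale)

lemma comp_zero [simp]: "comp u \<zero>\<^bsub>T\<^esub> = 0"
  using comp_smult [of "\<zero>\<^bsub>T\<^esub>" u 0] T.smult_r_null [of 0] by simp

lemma smult_diff_T: "t \<in> carrier T \<Longrightarrow> t' \<in> carrier T \<Longrightarrow> t \<ominus>\<^bsub>T\<^esub> t' = t \<oplus>\<^bsub>T\<^esub> (- 1) \<odot>\<^bsub>T\<^esub> t'"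
proof -
  assume t: "t \<in> carrier T" "t' \<in> carrier T"
  have "(- 1) \<odot>\<^bsub>T\<^esub> t' \<oplus>\<^bsub>T\<^esub> t' = \<zero>\<^bsub>T\<^esub>"
    using T.smult_l_distr [of "- 1" 1 t'] T.smult_one [of t'] t by simp
  then have "\<ominus>\<^bsub>T\<^esub> t' = (- 1) \<odot>\<^bsub>T\<^esub> t'" using t by (intro T.minus_equality) simp_all
  then show ?thesis by (simp add: a_minus_def)
qed

lemma comp_finsum: "f \<in> A \<rightarrow> carrier T \<Longrightarrow> finite A \<Longrightarrow> comp u (\<Oplus>\<^bsub>T\<^esub>i\<in>A. f i) = (\<Sum>i\<in>A. comp u (f i))"
  by (rotate_tac, induction A rule: finite_induct) (simp_all add: comp_add)

text \<open>Inverse to the coordinates: since q(sec v) = v, a tensor is the sum over u of the image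
  of u under \<open>q\<close>, tensored with its coordinate at u.\<close>

definition assemble :: "('i \<Rightarrow>\<^sub>0 Pi_vec) \<Rightarrow> ('v \<times> Pi_vec \<Rightarrow>\<^sub>0 complex) set" where
  "assemble g = (\<Oplus>\<^bsub>T\<^esub>u\<in>keys g. tens V (q (single u 1)) (lookup g u))"

lemma assemble_superset: "finite A \<Longrightarrow> keys g \<subseteq> A \<Longrightarrow>
    assemble g = (\<Oplus>\<^bsub>T\<^esub>u\<in>A. tens V (q (single u 1)) (lookup g u))"
  unfolding assemble_def by (rule T.add.finprod_mono_neutral_cong_left) (auto simp: in_keys_iff)

lemma assemble_add: "assemble (g + g') = assemble g \<oplus>\<^bsub>T\<^esub> assemble g'"
proof -
  let ?A = "keys g \<union> keys g'"
  have "assemble (g + g') = (\<Oplus>\<^bsub>T\<^esub>u\<in>?A. tens V (q (single u 1)) (lookup (g + g') u))"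
    by (rule assemble_superset) (simp_all add: keys_add)
  also have "\<dots> = (\<Oplus>\<^bsub>T\<^esub>u\<in>?A. tens V (q (single u 1)) (lookup g u) \<oplus>\<^bsub>T\<^esub> tens V (q (single u 1)) (lookup g' u))"
    by (simp add: lookup_add tens_add_right)
  also have "\<dots> = assemble g \<oplus>\<^bsub>T\<^esub> assemble g'"
    by (subst (1 2) assemble_superset [of ?A]) (auto intro!: T.finsum_addf)
  finally show ?thesis .
qed

lemma assemble_tens: "assemble (Poly_Mapping.map (\<lambda>a. Pi_scale a p) z) = tens V (q z) p"
proof (induction z rule: poly_mapping_single_induct)
  case zero
  have "q 0 = \<zero>\<^bsub>V\<^esub>" using q_fscale [of 0 0] V.smult_l_null [of "q 0"] by simp
  moreover have "Poly_Mapping.map (\<lambda>a. Pi_scale a p) (0 :: 'i \<Rightarrow>\<^sub>0 complex) = 0" by (rule poly_mapping_eqI) (simp add: lookup_map)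
  ultimately show ?case by (simp add: assemble_def)
next
  case (single u a)
  have "q (single u a) = a \<odot>\<^bsub>V\<^esub> q (single u 1)" using q_fscale [of a "single u 1"] by simp
  then show ?case
    by (subst assemble_superset [of "{u}"]) (auto simp: lookup_map lookup_single in_keys_iff when_def tens_smult_left tens_smult_right)
next
  case (add x y)
  have "Poly_Mapping.map (\<lambda>a. Pi_scale a p) (x + y) = Poly_Mapping.map (\<lambda>a. Pi_scale a p) x + Poly_Mapping.map (\<lambda>a. Pi_scale a p) y"
    by (rule poly_mapping_eqI) (simp add: lookup_map lookup_add Pi.scale_left_distrib)
  then show ?case using add by (simp add: assemble_add q_add tens_add_left)
qed

lemma assemble_comp: "t \<in> carrier T \<Longrightarrow> \<exists>g. t = assemble g \<and> (\<forall>u. lookup g u = comp u t)"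
proof (induction t rule: T_induct)
  case (tens v p)
  show ?case
    by (intro exI [of _ "Poly_Mapping.map (\<lambda>a. Pi_scale a p) (sec v)"])
      (simp add: assemble_tens q_sec tens comp_tens lookup_map coord_def)
next
  case (add t t')
  then obtain g g' where "t = assemble g" "\<forall>u. lookup g u = comp u t" "t' = assemble g'" "\<forall>u. lookup g' u = comp u t'"
    by blast
  then show ?case using add(1,2)
    by (intro exI [of _ "g + g'"]) (simp add: assemble_add lookup_add comp_add)
qed

text \<open>By \<open>assemble_comp\<close> an element can be rebuilt from its coordinates. Through
  this, identities in the tensor product become identities in \<open>Pi_vec\<close>.\<close>

lemma T_eqI:
  assumes "t \<in> carrier T" "t' \<in> carrier T" "\<And>u. comp u t = comp u t'"
  shows "t = t'"
proof -
  obtain g g' where g: "t = assemble g" "\<And>u. lookup g u = comp u t" "t' = assemble g'" "\<And>u. lookup g' u = comp u t'"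
    using assemble_comp [OF assms(1)] assemble_comp [OF assms(2)] by auto
  then have "g = g'" using assms(3) by (intro poly_mapping_eqI) simp
  then show ?thesis using g by simp
qed

end

section \<open>Index bookkeeping for the products of fields\<close>

lemma keys_push: "keys (push g x) \<subseteq> g ` keys x"
proof -
  have "keys (push g x) \<subseteq> (\<Union>u\<in>keys x. keys (single (g u) (lookup x u)))"
    unfolding push_def by (rule keys_sum)
  then show ?thesis by (auto split: if_splits)
qed

text \<open>Summand i of a product with r = -1 holds the modes -1 - i and i of the left field;
  together they exhaust the integers.\<close>

lemma Sum_any_int_split:
  fixes f :: "int \<Rightarrow> 'a::comm_monoid_add"
  assumes "finite {j. f j \<noteq> 0}"
  shows "Sum_any f = Sum_any (\<lambda>i::nat. f (- 1 - int i) + f (int i))"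
proof -
  obtain N :: nat where N: "\<And>j. f j \<noteq> 0 \<Longrightarrow> \<bar>j\<bar> \<le> int N"
  proof -
    have "nat \<bar>j\<bar> \<le> (\<Sum>j\<in>{j. f j \<noteq> 0}. nat \<bar>j\<bar>)" if "f j \<noteq> 0" for j
      using that assms by (intro member_le_sum) auto
    then have "\<bar>j\<bar> \<le> int (\<Sum>j\<in>{j. f j \<noteq> 0}. nat \<bar>j\<bar>)" if "f j \<noteq> 0" for j
      using that by (simp add: nat_le_iff)
    then show ?thesis using that by blast
  qed
  have "Sum_any f = (\<Sum>j\<in>{- int N - 1..int N}. f j)"
    by (intro Sum_any.expand_superset) (auto dest!: N)
  also have "{- int N - 1..int N} = (\<lambda>i. - 1 - int i) ` {..N} \<union> int ` {..N}"
  proof (intro equalityI subsetI)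
    fix j assume "j \<in> {- int N - 1..int N}"
    then show "j \<in> (\<lambda>i. - 1 - int i) ` {..N} \<union> int ` {..N}"
    proof (cases "j < 0")
      case True
      then have "j = - 1 - int (nat (- 1 - j))" "nat (- 1 - j) \<le> N" using \<open>j \<in> _\<close> by auto
      then show ?thesis by blast
    next
      case False
      then have "j = int (nat j)" "nat j \<le> N" using \<open>j \<in> _\<close> by auto
      then show ?thesis by blast
    qed
  qed auto
  also have "sum f \<dots> = (\<Sum>j\<in>(\<lambda>i. - 1 - int i) ` {..N}. f j) + (\<Sum>j\<in>int ` {..N}. f j)"
    by (intro sum.union_disjoint) auto
  also have "\<dots> = (\<Sum>i\<le>N. f (- 1 - int i) + f (int i))"
    by (simp add: sum.reindex inj_on_def sum.distrib)
  also have "\<dots> = Sum_any (\<lambda>i::nat. f (- 1 - int i) + f (int i))"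
  proof (intro Sum_any.expand_superset [symmetric])
    have "f (- 1 - int i) + f (int i) = 0" if "i > N" for i
      using that N [of "- 1 - int i"] N [of "int i"] by force
    then show "{i. f (- 1 - int i) + f (int i) \<noteq> 0} \<subseteq> {..N}" by (auto simp: not_less [symmetric])
  qed simp
  finally show ?thesis .
qed

lemma Sum_any_nat_Suc:
  fixes g :: "nat \<Rightarrow> 'a::comm_monoid_add"
  assumes "finite {i. g i \<noteq> 0}"
  shows "Sum_any g = g 0 + Sum_any (\<lambda>i. g (Suc i))"
proof -
  obtain N where "\<forall>i\<in>{i. g i \<noteq> 0}. i \<le> N" using assms [unfolded finite_nat_set_iff_bounded_le] by (rule exE)
  then have N: "g i \<noteq> 0 \<Longrightarrow> i \<le> N" for i by simp
  have "Sum_any g = (\<Sum>i\<le>Suc N. g i)" by (intro Sum_any.expand_superset subsetI) (auto intro: le_SucI N)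
  also have "\<dots> = g 0 + (\<Sum>i\<le>N. g (Suc i))" by (rule sum.atMost_Suc_shift)
  also have "(\<Sum>i\<le>N. g (Suc i)) = Sum_any (\<lambda>i. g (Suc i))"
    by (intro Sum_any.expand_superset [symmetric] subsetI) (auto dest: N)
  finally show ?thesis .
qed

text \<open>For r = -2 the pairs are -2 - i and i, and the integer -1 is left out.\<close>

lemma Sum_any_int_split':
  fixes f :: "int \<Rightarrow> 'a::comm_monoid_add"
  assumes "finite {j. f j \<noteq> 0}" "f (- 1) = 0"
  shows "Sum_any f = Sum_any (\<lambda>i::nat. f (- 2 - int i) + f (int i))"
proof -
  have fin: "finite {i::nat. f (g i) \<noteq> 0}" if "inj g" for g
    using finite_vimageI [OF assms(1) that] by (simp add: vimage_def)
  have fins: "finite {i::nat. f (- 1 - int i) \<noteq> 0}" "finite {i::nat. f (int i) \<noteq> 0}" "finite {i::nat. f (- 2 - int i) \<noteq> 0}"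
    by (rule fin; simp add: inj_on_def)+
  have "Sum_any f = Sum_any (\<lambda>i. f (- 1 - int i)) + Sum_any (\<lambda>i. f (int i))"
    unfolding Sum_any_int_split [OF assms(1)] by (rule Sum_any.distrib [OF fins(1,2)])
  also have "Sum_any (\<lambda>i. f (- 1 - int i)) = Sum_any (\<lambda>i. f (- 2 - int i))"
  proof -
    have "- 1 - int (Suc i) = - 2 - int i" for i by simp
    then show ?thesis unfolding Sum_any_nat_Suc [OF fins(1)] by (simp only: of_nat_0 diff_zero assms(2) add_0)
  qed
  also have "\<dots> + Sum_any (\<lambda>i. f (int i)) = Sum_any (\<lambda>i. f (- 2 - int i) + f (int i))"
    by (rule Sum_any.distrib [OF fins(3,2), symmetric])
  finally show ?thesis .
qed

lemma fld_vanish: "fld s a \<Longrightarrow> \<exists>N::int. \<forall>n>N. a n p = 0"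
proof -
  assume a: "fld s a"
  obtain r where "bnd r p" using bnd_exists by blast
  then have "a n p = 0" if "n > r + s" for n
    using graded_bnd [OF fldD [OF a], of r p n] bnd_negative that by force
  then show ?thesis by blast
qed

text \<open>The coefficients of 1/(1 - x) and 1/(1 - x)^2; they make the products with r = -1 and r
  = -2 the normally ordered product and the one with a derivative on the left field.\<close>

lemma gchoose_minus_1: "(- 1) ^ i * ((- 1 :: complex) gchoose i) = 1"
  and gchoose_minus_2: "(- 1) ^ i * ((- 2 :: complex) gchoose i) = of_nat (Suc i)"
proof -
  have s: "(- 1) ^ i * ((- 1) ^ i * x) = (x :: complex)" for x
    by (simp add: mult.assoc [symmetric] power_mult_distrib [symmetric])
  show "(- 1) ^ i * ((- 1 :: complex) gchoose i) = 1"
    using gbinomial_minus [of "1 :: complex" i] binomial_gbinomial [of i i, where 'a = complex] by (simp add: s)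
  have "(of_nat (Suc i) :: complex) gchoose i = of_nat (Suc i)"
    using binomial_gbinomial [of "Suc i" i, where 'a = complex] by simp
  then show "(- 1) ^ i * ((- 2 :: complex) gchoose i) = of_nat (Suc i)"
    using gbinomial_minus [of "2 :: complex" i] by (simp add: s add.commute)
qed

section \<open>Linear operators, fields and their products on the tensor product\<close>

context sectioned
begin

definition vlin :: "('v \<Rightarrow> 'v) \<Rightarrow> bool" where
  "vlin A \<longleftrightarrow> (\<forall>v\<in>carrier V. A v \<in> carrier V) \<and> (\<forall>v\<in>carrier V. \<forall>v'\<in>carrier V. A (v \<oplus>\<^bsub>V\<^esub> v') = A v \<oplus>\<^bsub>V\<^esub> A v') \<and>
     (\<forall>a. \<forall>v\<in>carrier V. A (a \<odot>\<^bsub>V\<^esub> v) = a \<odot>\<^bsub>V\<^esub> A v)"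

lemma vlin_id: "vlin id"
  by (simp add: vlin_def)

definition tlin :: "(('v \<times> Pi_vec \<Rightarrow>\<^sub>0 complex) set \<Rightarrow> ('v \<times> Pi_vec \<Rightarrow>\<^sub>0 complex) set) \<Rightarrow> bool" where
  "tlin A \<longleftrightarrow> (\<forall>t\<in>carrier T. A t \<in> carrier T) \<and> (\<forall>t\<in>carrier T. \<forall>t'\<in>carrier T. A (t \<oplus>\<^bsub>T\<^esub> t') = A t \<oplus>\<^bsub>T\<^esub> A t') \<and>
     (\<forall>a. \<forall>t\<in>carrier T. A (a \<odot>\<^bsub>T\<^esub> t) = a \<odot>\<^bsub>T\<^esub> A t)"

lemma tlinD: "tlin A \<Longrightarrow> t \<in> carrier T \<Longrightarrow> A t \<in> carrier T"
  "tlin A \<Longrightarrow> t \<in> carrier T \<Longrightarrow> t' \<in> carrier T \<Longrightarrow> A (t \<oplus>\<^bsub>T\<^esub> t') = A t \<oplus>\<^bsub>T\<^esub> A t'"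
  "tlin A \<Longrightarrow> t \<in> carrier T \<Longrightarrow> A (a \<odot>\<^bsub>T\<^esub> t) = a \<odot>\<^bsub>T\<^esub> A t"
  by (simp_all add: tlin_def)

lemma tlin_zero: "tlin A \<Longrightarrow> A \<zero>\<^bsub>T\<^esub> = \<zero>\<^bsub>T\<^esub>"
  using tlinD(3) [of A "\<zero>\<^bsub>T\<^esub>" 0] tlinD(1) [of A "\<zero>\<^bsub>T\<^esub>"] T.smult_r_null [of 0] by simp

lemma tlin_comp: "tlin A \<Longrightarrow> tlin B \<Longrightarrow> tlin (\<lambda>t. A (B t))"
  by (simp add: tlin_def)

lemma T_smult: "t \<in> carrier T \<Longrightarrow> (a + b) \<odot>\<^bsub>T\<^esub> t = a \<odot>\<^bsub>T\<^esub> t \<oplus>\<^bsub>T\<^esub> b \<odot>\<^bsub>T\<^esub> t"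
  "t \<in> carrier T \<Longrightarrow> t' \<in> carrier T \<Longrightarrow> a \<odot>\<^bsub>T\<^esub> (t \<oplus>\<^bsub>T\<^esub> t') = a \<odot>\<^bsub>T\<^esub> t \<oplus>\<^bsub>T\<^esub> a \<odot>\<^bsub>T\<^esub> t'"
  "t \<in> carrier T \<Longrightarrow> (a * b) \<odot>\<^bsub>T\<^esub> t = a \<odot>\<^bsub>T\<^esub> (b \<odot>\<^bsub>T\<^esub> t)" "t \<in> carrier T \<Longrightarrow> 1 \<odot>\<^bsub>T\<^esub> t = t" "a \<odot>\<^bsub>T\<^esub> \<zero>\<^bsub>T\<^esub> = \<zero>\<^bsub>T\<^esub>"
  using T.smult_l_distr [of a b t] T.smult_r_distr [of a t t'] T.smult_assoc1 [of a b t] T.smult_one [of t] T.smult_r_null [of a] by simp_all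

lemma tlin_add: "tlin A \<Longrightarrow> tlin B \<Longrightarrow> tlin (\<lambda>t. A t \<oplus>\<^bsub>T\<^esub> B t)"
  by (simp add: tlin_def T_smult T.a_ac)

lemma tlin_smult: "tlin A \<Longrightarrow> tlin (\<lambda>t. a \<odot>\<^bsub>T\<^esub> A t)"
  by (simp add: tlin_def T_smult flip: T_smult(3)) (simp add: mult.commute)

lemma tlin_ident: "tlin (\<lambda>t. t)"
  by (simp add: tlin_def)

lemma tlin_eqI:
  assumes "tlin A" "tlin B" "\<And>v p. v \<in> carrier V \<Longrightarrow> A (tens V v p) = B (tens V v p)" "t \<in> carrier T"
  shows "A t = B t"
  using assms(4) by (induction t rule: T_induct) (simp_all add: assms(3) tlinD(2) [OF assms(1)] tlinD(2) [OF assms(2)])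

lemma tensor_map_coset:
  assumes A: "vlin A" and B: "plin B" and x: "x \<in> carrier FF"
  shows "tensor_map V Pi_space A B (coset x) = coset (push (map_prod A B) x)" "push (map_prod A B) x \<in> carrier FF"
proof -
  have AV: "\<And>v. v \<in> carrier V \<Longrightarrow> A v \<in> carrier V" "\<And>v v'. v \<in> carrier V \<Longrightarrow> v' \<in> carrier V \<Longrightarrow> A (v \<oplus>\<^bsub>V\<^esub> v') = A v \<oplus>\<^bsub>V\<^esub> A v'"
    "\<And>a v. v \<in> carrier V \<Longrightarrow> A (a \<odot>\<^bsub>V\<^esub> v) = a \<odot>\<^bsub>V\<^esub> A v"
    using A by (simp_all add: vlin_def)
  have FF: "push (map_prod A B) y \<in> carrier FF" if "y \<in> carrier FF" for y
  proof -
    have "fst ` keys (push (map_prod A B) y) \<subseteq> fst ` map_prod A B ` keys y"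
      by (intro image_mono keys_push)
    also have "\<dots> = A ` fst ` keys y" by (simp add: image_image)
    also have "\<dots> \<subseteq> carrier V" using that AV(1) by (auto simp: in_F)
    finally show ?thesis by (simp add: in_F)
  qed
  then show "push (map_prod A B) x \<in> carrier FF" using x .
  have "N0 \<subseteq> {y \<in> carrier FF. push (map_prod A B) y \<in> N0}"
  proof (rule N0_minimal)
    show "submodule {y \<in> carrier FF. push (map_prod A B) y \<in> N0} complex_ring FF"
      unfolding submodule_iff [OF cmodule_F] using F_add F_fscale N0_iff by (auto simp: push_add push_fscale)
    show "bilinear_relations V Pi_space \<subseteq> {y \<in> carrier FF. push (map_prod A B) y \<in> N0}"
    proof
      fix y assume y: "y \<in> bilinear_relations V Pi_space"
      then have "push (map_prod A B) y \<in> bilinear_relations V Pi_space"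
        unfolding bilinear_relations_def
        by (elim UnE CollectE exE conjE; simp add: lin_diff [OF lin_push] AV lin_add [OF B] lin_scale [OF B]; blast intro: AV(1))
      then show "y \<in> {y \<in> carrier FF. push (map_prod A B) y \<in> N0}"
        using y bilinear_relations_F relations_N0 by blast
    qed
  qed
  then have "(\<Union>y\<in>coset x. coset (push (map_prod A B) y)) = coset (push (map_prod A B) x)"
    using FF x by (intro Union_cosets [OF cmodule_F submodule_N0]) (auto simp: push_add)
  then show "tensor_map V Pi_space A B (coset x) = coset (push (map_prod A B) x)"
    by (simp add: tensor_map_def)
qed

lemma tensor_map_tens: "vlin A \<Longrightarrow> plin B \<Longrightarrow> v \<in> carrier V \<Longrightarrow> tensor_map V Pi_space A B (tens V v p) = tens V (A v) (B p)"
  using tensor_map_coset [OF _ _ single_F, of A B v p 1] by (simp add: tens_def)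

lemma tlin_tensor_map: "vlin A \<Longrightarrow> plin B \<Longrightarrow> tlin (tensor_map V Pi_space A B)"
  unfolding tlin_def T_carrier
  by (auto simp: tensor_map_coset push_add push_fscale F_add F_fscale simp flip: coset_add coset_fscale)

definition nterm where
  "nterm r a b n t i = ((- 1) ^ i * (of_int r gchoose i)) \<odot>\<^bsub>T\<^esub>
     (a (r - int i) (b (n + int i) t) \<ominus>\<^bsub>T\<^esub> ((- 1) powi r) \<odot>\<^bsub>T\<^esub> b (r + n - int i) (a (int i) t))"

lemma nth_product_eq: "nth_product T r a b n t = (\<Oplus>\<^bsub>T\<^esub>i\<in>{i. nterm r a b n t i \<noteq> \<zero>\<^bsub>T\<^esub>}. nterm r a b n t i)"
  by (simp add: nth_product_def Let_def nterm_def)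

lemma tlin_nterm:
  assumes "\<And>n. tlin (a n)" "\<And>n. tlin (b n)"
  shows "tlin (\<lambda>t. nterm r a b n t i)"
proof -
  have 1: "tlin (\<lambda>t. ((- 1) ^ i * (of_int r gchoose i)) \<odot>\<^bsub>T\<^esub>
     (a (r - int i) (b (n + int i) t) \<oplus>\<^bsub>T\<^esub> (- 1) \<odot>\<^bsub>T\<^esub> (((- 1) powi r) \<odot>\<^bsub>T\<^esub> b (r + n - int i) (a (int i) t))))"
    using assms by (intro tlin_smult tlin_add tlin_comp [of "a _" "b _"] tlin_comp [of "b _" "a _"])
  have 2: "nterm r a b n t i = ((- 1) ^ i * (of_int r gchoose i)) \<odot>\<^bsub>T\<^esub>
     (a (r - int i) (b (n + int i) t) \<oplus>\<^bsub>T\<^esub> (- 1) \<odot>\<^bsub>T\<^esub> (((- 1) powi r) \<odot>\<^bsub>T\<^esub> b (r + n - int i) (a (int i) t)))" if "t \<in> carrier T" for t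
    unfolding nterm_def using that assms tlinD(1) by (subst smult_diff_T) auto
  show ?thesis using 1 by (simp add: tlin_def 2)
qed

lemma comp_nth_product:
  assumes "\<And>n. tlin (a n)" "\<And>n. tlin (b n)" "t \<in> carrier T" "finite {i. nterm r a b n t i \<noteq> \<zero>\<^bsub>T\<^esub>}"
  shows "comp u (nth_product T r a b n t) = Sum_any (\<lambda>i. comp u (nterm r a b n t i))" "nth_product T r a b n t \<in> carrier T"
    "finite {i. comp u (nterm r a b n t i) \<noteq> 0}"
proof -
  have c: "nterm r a b n t i \<in> carrier T" for i
    using tlinD(1) [OF tlin_nterm [OF assms(1,2)] assms(3)] .
  have sub: "{i. comp u (nterm r a b n t i) \<noteq> 0} \<subseteq> {i. nterm r a b n t i \<noteq> \<zero>\<^bsub>T\<^esub>}" by auto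
  show "comp u (nth_product T r a b n t) = Sum_any (\<lambda>i. comp u (nterm r a b n t i))"
    unfolding nth_product_eq Sum_any.expand_superset [OF assms(4) sub] using c by (intro comp_finsum assms) auto
  show "nth_product T r a b n t \<in> carrier T" unfolding nth_product_eq using c by (intro T.finsum_closed) auto
  show "finite {i. comp u (nterm r a b n t i) \<noteq> 0}" using sub assms(4) finite_subset by blast
qed

lemma nterm_finite:
  assumes "\<And>n. tlin (a n)" "\<And>n. tlin (b n)" "\<And>v p. v \<in> carrier V \<Longrightarrow> finite {i. nterm r a b n (tens V v p) i \<noteq> \<zero>\<^bsub>T\<^esub>}"
    and "t \<in> carrier T"
  shows "finite {i. nterm r a b n t i \<noteq> \<zero>\<^bsub>T\<^esub>}"
  using assms(4)
proof (induction t rule: T_induct)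
  case (add t t')
  show ?case
    by (rule finite_subset [OF _ finite_UnI [OF add(3,4)]])
      (use add in \<open>auto simp: tlinD(2) [OF tlin_nterm [OF assms(1,2)]]\<close>)
qed (rule assms)

text \<open>The index set of the sum depends on the vector. In coordinates it becomes
  \<open>Sum_any\<close>, which is additive on finite supports; finiteness on pure tensors extends
  to all elements.\<close>

lemma tlin_nth_product:
  assumes "\<And>n. tlin (a n)" "\<And>n. tlin (b n)" "\<And>v p. v \<in> carrier V \<Longrightarrow> finite {i. nterm r a b n (tens V v p) i \<noteq> \<zero>\<^bsub>T\<^esub>}"
  shows "tlin (nth_product T r a b n)"
proof -
  note fin = nterm_finite [where r = r and n = n, OF assms]
  note lin = tlin_nterm [where r = r and n = n, OF assms(1,2)]
  note c = comp_nth_product [where r = r and n = n, OF assms(1,2) _ fin]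
  have 1: "nth_product T r a b n (t \<oplus>\<^bsub>T\<^esub> t') = nth_product T r a b n t \<oplus>\<^bsub>T\<^esub> nth_product T r a b n t'"
    if t: "t \<in> carrier T" "t' \<in> carrier T" for t t'
  proof (rule T_eqI)
    fix u
    have "comp u (nterm r a b n (t \<oplus>\<^bsub>T\<^esub> t') i) = comp u (nterm r a b n t i) + comp u (nterm r a b n t' i)" for i
      using t by (simp add: tlinD(2) [OF lin] comp_add tlinD(1) [OF lin])
    then show "comp u (nth_product T r a b n (t \<oplus>\<^bsub>T\<^esub> t')) = comp u (nth_product T r a b n t \<oplus>\<^bsub>T\<^esub> nth_product T r a b n t')"
      using t by (simp add: comp_add c Sum_any.distrib)
  qed (use t c in auto)
  have 2: "nth_product T r a b n (x \<odot>\<^bsub>T\<^esub> t) = x \<odot>\<^bsub>T\<^esub> nth_product T r a b n t" if t: "t \<in> carrier T" for t x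
  proof (rule T_eqI)
    fix u
    have "comp u (nterm r a b n (x \<odot>\<^bsub>T\<^esub> t) i) = Pi_scale x (comp u (nterm r a b n t i))" for i
      using t by (simp add: tlinD(3) [OF lin] comp_smult tlinD(1) [OF lin])
    then show "comp u (nth_product T r a b n (x \<odot>\<^bsub>T\<^esub> t)) = comp u (x \<odot>\<^bsub>T\<^esub> nth_product T r a b n t)"
      using t by (simp add: comp_smult c lin_Sum_any [OF Pi.linear_scale_self])
  qed (use t c in auto)
  show ?thesis using 1 2 c by (simp add: tlin_def)
qed

abbreviation onPi where "onPi B \<equiv> tensor_map V Pi_space id B"

lemma pi_tens: "plin B \<Longrightarrow> v \<in> carrier V \<Longrightarrow> onPi B (tens V v p) = tens V v (B p)"
  by (simp add: tensor_map_tens vlin_id)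

lemma tlin_pi: "plin B \<Longrightarrow> tlin (onPi B)"
  by (rule tlin_tensor_map [OF vlin_id])

lemma tens_diff_right: "v \<in> carrier V \<Longrightarrow> tens V v (p - p') = tens V v p \<ominus>\<^bsub>T\<^esub> tens V v p'"
  using tens_add_right [of v p "Pi_scale (- 1) p'"] tens_smult_right [of v "- 1" p'] by (simp add: smult_diff_T)

lemma nterm_pi:
  assumes "\<And>n. plin (a n)" "\<And>n. plin (b n)" "v \<in> carrier V"
  shows "nterm r (\<lambda>n. onPi (a n)) (\<lambda>n. onPi (b n)) n (tens V v p) i
    = tens V v (Pi_scale ((- 1) ^ i * (of_int r gchoose i)) (a (r - int i) (b (n + int i) p) - Pi_scale ((- 1) powi r) (b (r + n - int i) (a (int i) p))))"
  using assms by (simp add: nterm_def pi_tens tens_diff_right tens_smult_right)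

lemma nterm_pi_finite:
  assumes a: "fld s a" and b: "fld s' b" and v: "v \<in> carrier V"
  shows "finite {i. nterm r (\<lambda>n. onPi (a n)) (\<lambda>n. onPi (b n)) n (tens V v p) i \<noteq> \<zero>\<^bsub>T\<^esub>}"
proof -
  obtain N N' where N: "\<And>n. n > N \<Longrightarrow> a n p = 0" "\<And>n. n > N' \<Longrightarrow> b n p = 0"
    using fld_vanish [OF a] fld_vanish [OF b] by meson
  have "{i. nterm r (\<lambda>n. onPi (a n)) (\<lambda>n. onPi (b n)) n (tens V v p) i \<noteq> \<zero>\<^bsub>T\<^esub>} \<subseteq> {..nat (max N (N' - n))}"
  proof
    fix i assume i: "i \<in> {i. nterm r (\<lambda>n. onPi (a n)) (\<lambda>n. onPi (b n)) n (tens V v p) i \<noteq> \<zero>\<^bsub>T\<^esub>}"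
    show "i \<in> {..nat (max N (N' - n))}"
    proof (rule ccontr)
      assume "i \<notin> {..nat (max N (N' - n))}"
      then have "a (int i) p = 0" "b (n + int i) p = 0" by (auto intro!: N)
      then show False
        using i v by (simp add: nterm_pi [OF fld_lin [OF a] fld_lin [OF b]] lin_zero [OF fld_lin [OF a]] lin_zero [OF fld_lin [OF b]])
    qed
  qed
  then show ?thesis using finite_subset by blast
qed

lemma tlin_nth_product_pi: "fld s a \<Longrightarrow> fld s' b \<Longrightarrow> tlin (nth_product T r (\<lambda>n. onPi (a n)) (\<lambda>n. onPi (b n)) n)"
  by (intro tlin_nth_product tlin_pi fld_lin nterm_pi_finite)

lemma nth_product_pi_tens:
  assumes a: "fld s a" and b: "fld s' b" and v: "v \<in> carrier V"
  shows "nth_product T (- 1) (\<lambda>n. onPi (a n)) (\<lambda>n. onPi (b n)) n (tens V v p) = tens V v (NO (\<lambda>_. 1) a b (n - 1) p)"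
    and "nth_product T (- 2) (\<lambda>n. onPi (a n)) (\<lambda>n. onPi (b n)) n (tens V v p) = tens V v (NO dcoef a b (n - 2) p)"
proof -
  note lins = fld_lin [OF a] fld_lin [OF b]
  have c: "comp u (nth_product T r (\<lambda>n. onPi (a n)) (\<lambda>n. onPi (b n)) n (tens V v p))
     = Sum_any (\<lambda>i. Pi_scale (coord u v) (Pi_scale ((- 1) ^ i * (of_int r gchoose i)) (a (r - int i) (b (n + int i) p) - Pi_scale ((- 1) powi r) (b (r + n - int i) (a (int i) p)))))"
    for r u
    unfolding comp_nth_product(1) [OF tlin_pi [OF lins(1)] tlin_pi [OF lins(2)] tens_closed [OF v] nterm_pi_finite [OF a b v]]
    by (simp add: v nterm_pi lins comp_tens)
  have fin: "finite {j. Pi_scale x (NO_term \<kappa> a b N p j) \<noteq> 0}" for x \<kappa> N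
    by (rule finite_subset [OF _ NO_term_finite [OF a b, of \<kappa> N p]]) auto
  have closed: "nth_product T r (\<lambda>n. onPi (a n)) (\<lambda>n. onPi (b n)) n (tens V v p) \<in> carrier T" for r
    using tlinD(1) [OF tlin_nth_product_pi [OF a b]] v by simp
  show "nth_product T (- 1) (\<lambda>n. onPi (a n)) (\<lambda>n. onPi (b n)) n (tens V v p) = tens V v (NO (\<lambda>_. 1) a b (n - 1) p)"
  proof (rule T_eqI [OF closed])
    fix u
    have "Pi_scale (coord u v) (NO (\<lambda>_. 1) a b (n - 1) p) = Sum_any (\<lambda>j. Pi_scale (coord u v) (NO_term (\<lambda>_. 1) a b (n - 1) p j))"
      unfolding NO_def by (rule lin_Sum_any [OF Pi.linear_scale_self NO_term_finite [OF a b]])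
    also have "\<dots> = comp u (nth_product T (- 1) (\<lambda>n. onPi (a n)) (\<lambda>n. onPi (b n)) n (tens V v p))"
      unfolding c Sum_any_int_split [OF fin] of_int_minus of_int_1 gchoose_minus_1
      by (simp add: NO_term_def power_int_minus Pi.scale_right_distrib algebra_simps)
    finally show "comp u (nth_product T (- 1) (\<lambda>n. onPi (a n)) (\<lambda>n. onPi (b n)) n (tens V v p)) = comp u (tens V v (NO (\<lambda>_. 1) a b (n - 1) p))"
      using v by (simp add: comp_tens)
  qed (use v in simp)
  show "nth_product T (- 2) (\<lambda>n. onPi (a n)) (\<lambda>n. onPi (b n)) n (tens V v p) = tens V v (NO dcoef a b (n - 2) p)"
  proof (rule T_eqI [OF closed])
    fix u
    let ?f = "\<lambda>j. Pi_scale (coord u v) (NO_term dcoef a b (n - 2) p j)"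
    have "Pi_scale (coord u v) (NO dcoef a b (n - 2) p) = Sum_any ?f"
      unfolding NO_def by (rule lin_Sum_any [OF Pi.linear_scale_self NO_term_finite [OF a b]])
    also have "\<dots> = comp u (nth_product T (- 2) (\<lambda>n. onPi (a n)) (\<lambda>n. onPi (b n)) n (tens V v p))"
    proof -
      \<comment> \<open>\<open>dcoef\<close> vanishes at -1, the one mode that the pairs for r = -2
        leave out.\<close>
      have 0: "?f (- 1) = 0" by (simp add: NO_term_def dcoef_def)
      show ?thesis
        unfolding c Sum_any_int_split' [OF fin 0] of_int_minus of_int_numeral gchoose_minus_2
        by (simp add: NO_term_def power_int_minus dcoef_def Pi.scale_right_distrib Pi.scale_right_diff_distrib algebra_simps)
    qed
    finally show "comp u (nth_product T (- 2) (\<lambda>n. onPi (a n)) (\<lambda>n. onPi (b n)) n (tens V v p)) = comp u (tens V v (NO dcoef a b (n - 2) p))"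
      using v by (simp add: comp_tens)
  qed (use v in simp)
qed

text \<open>Operators on the tensor product are controlled only on its carrier, and linearity keeps
  all intermediate vectors there. This allows nested products to be replaced from the inside
  out.\<close>

lemma nth_product_cong:
  assumes "\<And>n t. t \<in> carrier T \<Longrightarrow> a n t = a' n t" "\<And>n t. t \<in> carrier T \<Longrightarrow> b n t = b' n t"
    and "\<And>n. tlin (a n)" "\<And>n. tlin (b n)" "t \<in> carrier T"
  shows "nth_product T r a b n t = nth_product T r a' b' n t"
proof -
  have "nterm r a b n t i = nterm r a' b' n t i" for i
    using assms(5) tlinD(1) [OF assms(3) assms(5)] tlinD(1) [OF assms(4) assms(5)] by (simp add: nterm_def assms(1,2) [symmetric])
  then show ?thesis by (simp add: nth_product_eq)
qed

end

section \<open>The affine Lie algebra acts on the tensor product\<close>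

locale free_field_realization = whittaker_parameters lam k + highest_weight V "d_level k" hw vh + sectioned V q sec
  for lam k :: complex and V :: "(virasoro, 'v) rep" and hw vh and q :: "('i \<Rightarrow>\<^sub>0 complex) \<Rightarrow> 'v" and sec +
  assumes level: "k \<noteq> - 2"
begin

abbreviation "M \<equiv> affine_tensor k lam V"
abbreviation LL where "LL n \<equiv> act V (L n)"

lemma M_simps [simp]: "carrier M = carrier T" "\<zero>\<^bsub>M\<^esub> = \<zero>\<^bsub>T\<^esub>" "t \<oplus>\<^bsub>M\<^esub> t' = t \<oplus>\<^bsub>T\<^esub> t'" "a \<odot>\<^bsub>M\<^esub> t = a \<odot>\<^bsub>T\<^esub> t"
  by (simp_all add: affine_tensor_def Let_def Module.module.extend_def)

lemma tlin_cong: "tlin A \<Longrightarrow> (\<And>t. t \<in> carrier T \<Longrightarrow> B t = A t) \<Longrightarrow> tlin B"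
  by (simp add: tlin_def)

lemma act_M: "act M x = (case x of
    E n \<Rightarrow> onPi (ep n)
  | F n \<Rightarrow> field_add T (field_scale T (k + 2) (nth_product T (- 1) (\<lambda>n. tensor_map V Pi_space (LL (n - 1)) id) (\<lambda>n. onPi (em n))))
               (field_add T
                 (field_scale T (- 1) (nth_product T (- 1) (field_add T (field_scale T (1 / 2) (\<lambda>n. onPi (Pi_d n))) (field_scale T (- k / 4) (\<lambda>n. onPi (Pi_c n))))
                   (nth_product T (- 1) (field_add T (field_scale T (1 / 2) (\<lambda>n. onPi (Pi_d n))) (field_scale T (- k / 4) (\<lambda>n. onPi (Pi_c n)))) (\<lambda>n. onPi (em n)))))
                 (field_scale T (- (k + 1)) (nth_product T (- 2) (field_add T (field_scale T (1 / 2) (\<lambda>n. onPi (Pi_d n))) (field_scale T (- k / 4) (\<lambda>n. onPi (Pi_c n)))) (\<lambda>n. onPi (em n))))) n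
  | H n \<Rightarrow> field_scale T 2 (field_add T (field_scale T (1 / 2) (\<lambda>n. onPi (Pi_d n))) (field_scale T (k / 4) (\<lambda>n. onPi (Pi_c n)))) n
  | K \<Rightarrow> (\<lambda>t. k \<odot>\<^bsub>T\<^esub> t))"
  by (cases x) (simp_all add: affine_tensor_def Let_def Module.module.extend_def)

lemma vlin_LL: "vlin (LL n)"
  using V.act_closed V.act_add V.act_smult by (simp add: vlin_def)

lemma LL_closed [simp]: "v \<in> carrier V \<Longrightarrow> LL n v \<in> carrier V"
  by (rule V.act_closed)

abbreviation nu_T where "nu_T \<equiv> field_add T (field_scale T (1 / 2) (\<lambda>n. onPi (Pi_d n))) (field_scale T (- k / 4) (\<lambda>n. onPi (Pi_c n)))"

lemma nu_T_eq: "tlin (nu_T n)" "t \<in> carrier T \<Longrightarrow> nu_T n t = onPi (nu n) t"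
proof -
  show lin: "tlin (nu_T n)"
    unfolding field_add_def field_scale_def by (intro tlin_add tlin_smult tlin_pi plin_ops)
  have eq: "nu_T n (tens V v p) = onPi (nu n) (tens V v p)" if "v \<in> carrier V" for v p
    using that unfolding field_add_def field_scale_def
    by (simp add: pi_tens plin_ops nu_def tens_add_right tens_smult_right del: Pi.scale_minus_left)
  show "nu_T n t = onPi (nu n) t" if "t \<in> carrier T"
    by (rule tlin_eqI [OF lin tlin_pi [OF plin_ops(5)] eq that])
qed

lemma act_E: "act M (E n) = onPi (ep n)" and act_K: "act M K = (\<lambda>t. k \<odot>\<^bsub>T\<^esub> t)"
  by (simp_all add: act_M)

lemma tlin_act_H: "tlin (act M (H n))"
  unfolding act_M field_add_def field_scale_def affine_sl2.case by (intro tlin_add tlin_smult tlin_pi plin_ops)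

lemma act_H_tens: "v \<in> carrier V \<Longrightarrow> act M (H n) (tens V v p) = tens V v (hh n p)"
  unfolding act_M field_add_def field_scale_def affine_sl2.case
  by (simp add: pi_tens plin_ops hh_def tens_add_right tens_smult_right T_smult flip: T_smult(3))

lemma tlin_act_E: "tlin (act M (E n))" and tlin_act_K: "tlin (act M K)"
  unfolding act_E act_K by (intro tlin_pi plin_ops tlin_smult tlin_ident)+

lemma act_E_tens: "v \<in> carrier V \<Longrightarrow> act M (E n) (tens V v p) = tens V v (ep n p)"
  by (simp add: act_E pi_tens plin_ops)

lemma act_K_tens: "v \<in> carrier V \<Longrightarrow> act M K (tens V v p) = tens V v (Pi_scale k p)"
  by (simp add: act_K tens_smult_right)

lemma nu_em_T: "tlin (nth_product T (- 1) nu_T (\<lambda>n. onPi (em n)) n)"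
    "t \<in> carrier T \<Longrightarrow> nth_product T (- 1) nu_T (\<lambda>n. onPi (em n)) n t = onPi (nem n) t"
  and dnu_em_T: "tlin (nth_product T (- 2) nu_T (\<lambda>n. onPi (em n)) n)"
    "t \<in> carrier T \<Longrightarrow> nth_product T (- 2) nu_T (\<lambda>n. onPi (em n)) n t = onPi (dnem n) t"
proof -
  have cong: "nth_product T r nu_T (\<lambda>n. onPi (em n)) n t = nth_product T r (\<lambda>n. onPi (nu n)) (\<lambda>n. onPi (em n)) n t" if "t \<in> carrier T" for r n t
    by (rule nth_product_cong [OF nu_T_eq(2) refl nu_T_eq(1) tlin_pi [OF plin_ops(4)] that])
  have lin: "tlin (nth_product T r (\<lambda>n. onPi (nu n)) (\<lambda>n. onPi (em n)) n)" for r n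
    by (rule tlin_nth_product_pi [OF fld_nu fld_em])
  show "tlin (nth_product T (- 1) nu_T (\<lambda>n. onPi (em n)) n)" "tlin (nth_product T (- 2) nu_T (\<lambda>n. onPi (em n)) n)"
    by (rule tlin_cong [OF lin cong], assumption)+
  show "nth_product T (- 1) nu_T (\<lambda>n. onPi (em n)) n t = onPi (nem n) t" if "t \<in> carrier T"
    unfolding cong [OF that]
    by (rule tlin_eqI [OF lin tlin_pi [OF plin_ops(7)] _ that]) (simp add: nth_product_pi_tens [OF fld_nu fld_em] pi_tens plin_ops flip: nem_def)
  show "nth_product T (- 2) nu_T (\<lambda>n. onPi (em n)) n t = onPi (dnem n) t" if "t \<in> carrier T"
    unfolding cong [OF that]
    by (rule tlin_eqI [OF lin tlin_pi [OF plin_ops(9)] _ that]) (simp add: nth_product_pi_tens [OF fld_nu fld_em] pi_tens plin_ops flip: dnem_def)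
qed

lemma nu_nu_em_T: "tlin (nth_product T (- 1) nu_T (nth_product T (- 1) nu_T (\<lambda>n. onPi (em n))) n)"
    "t \<in> carrier T \<Longrightarrow> nth_product T (- 1) nu_T (nth_product T (- 1) nu_T (\<lambda>n. onPi (em n))) n t = onPi (nnem n) t"
proof -
  have cong: "nth_product T (- 1) nu_T (nth_product T (- 1) nu_T (\<lambda>n. onPi (em n))) n t = nth_product T (- 1) (\<lambda>n. onPi (nu n)) (\<lambda>n. onPi (nem n)) n t"
    if "t \<in> carrier T" for n t
    by (rule nth_product_cong [OF nu_T_eq(2) nu_em_T(2) nu_T_eq(1) nu_em_T(1) that])
  have lin: "tlin (nth_product T (- 1) (\<lambda>n. onPi (nu n)) (\<lambda>n. onPi (nem n)) n)" for n
    by (rule tlin_nth_product_pi [OF fld_nu fld_nem])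
  show "tlin (nth_product T (- 1) nu_T (nth_product T (- 1) nu_T (\<lambda>n. onPi (em n))) n)"
    by (rule tlin_cong [OF lin cong], assumption)
  show "nth_product T (- 1) nu_T (nth_product T (- 1) nu_T (\<lambda>n. onPi (em n))) n t = onPi (nnem n) t" if "t \<in> carrier T"
    unfolding cong [OF that]
    by (rule tlin_eqI [OF lin tlin_pi [OF plin_ops(8)] _ that]) (simp add: nth_product_pi_tens [OF fld_nu fld_nem] pi_tens plin_ops flip: nnem_def)
qed

abbreviation omega_T where "omega_T \<equiv> (\<lambda>n. tensor_map V Pi_space (LL (n - 1)) id)"

lemma plin_id: "plin id"
  using plin_ident by (simp add: id_def)

lemma LL_em_finite:
  assumes v: "v \<in> carrier V"
  shows "finite {j. LL j v \<noteq> \<zero>\<^bsub>V\<^esub> \<and> em (n - j) p \<noteq> 0}"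
proof -
  obtain N N' where N: "\<And>j. j > N \<Longrightarrow> LL j v = \<zero>\<^bsub>V\<^esub>" "\<And>j. j > N' \<Longrightarrow> em j p = 0"
    using smooth [OF v] fld_vanish [OF fld_em, of p] by meson
  have "{j. LL j v \<noteq> \<zero>\<^bsub>V\<^esub> \<and> em (n - j) p \<noteq> 0} \<subseteq> {n - N'..N}"
  proof
    fix j assume j: "j \<in> {j. LL j v \<noteq> \<zero>\<^bsub>V\<^esub> \<and> em (n - j) p \<noteq> 0}"
    then have "\<not> j > N" "\<not> n - j > N'" using N(1) [of j] N(2) [of "n - j"] by auto
    then show "j \<in> {n - N'..N}" by auto
  qed
  then show ?thesis using finite_subset by blast
qed

lemma nterm_omega:
  assumes v: "v \<in> carrier V"
  shows "nterm (- 1) omega_T (\<lambda>n. onPi (em n)) n (tens V v p) i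
    = tens V (LL (- 2 - int i) v) (em (n - 2 - (- 2 - int i)) p) \<oplus>\<^bsub>T\<^esub> tens V (LL (int i - 1) v) (em (n - 2 - (int i - 1)) p)"
proof -
  have comm: "n - 1 - int i = n - int i - 1" by simp
  have "n - 2 - (- 2 - int i) = n + int i" "n - 2 - (int i - 1) = - 1 + n - int i" "- 1 - int i - 1 = - 2 - int i" by simp_all
  then show ?thesis
  using v unfolding nterm_def of_int_minus of_int_1 gchoose_minus_1
  by (simp add: pi_tens plin_ops tensor_map_tens [OF vlin_LL plin_id] power_int_minus smult_diff_T T_smult flip: T_smult(3))
    (simp only: comm)
qed

text \<open>omega and e^(-c) act on different factors, so both orderings agree and the product is a
  plain sum over all modes. The index n - 2 - j results from omega_n = L(n - 1) and the index n - 1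
  of the product.\<close>

lemma omega_em_T: "tlin (nth_product T (- 1) omega_T (\<lambda>n. onPi (em n)) n)"
  and comp_omega_em: "v \<in> carrier V \<Longrightarrow> comp u (nth_product T (- 1) omega_T (\<lambda>n. onPi (em n)) n (tens V v p))
     = Sum_any (\<lambda>j. Pi_scale (coord u (LL j v)) (em (n - 2 - j) p))"
proof -
  have lin1: "tlin (omega_T n)" and lin2: "tlin (onPi (em n))" for n
    by (rule tlin_tensor_map [OF vlin_LL plin_id], rule tlin_pi [OF plin_ops(4)])
  have fin: "finite {i. nterm (- 1) omega_T (\<lambda>n. onPi (em n)) n (tens V v p) i \<noteq> \<zero>\<^bsub>T\<^esub>}" if v: "v \<in> carrier V" for v p n
  proof -
    let ?S = "{j. LL j v \<noteq> \<zero>\<^bsub>V\<^esub> \<and> em (n - 2 - j) p \<noteq> 0}"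
    have "{i. nterm (- 1) omega_T (\<lambda>n. onPi (em n)) n (tens V v p) i \<noteq> \<zero>\<^bsub>T\<^esub>} \<subseteq> (\<lambda>i. - 2 - int i) -` ?S \<union> (\<lambda>i. int i - 1) -` ?S"
    proof
      fix i assume i: "i \<in> {i. nterm (- 1) omega_T (\<lambda>n. onPi (em n)) n (tens V v p) i \<noteq> \<zero>\<^bsub>T\<^esub>}"
      have z: "tens V (LL j v) (em (n - 2 - j) p) = \<zero>\<^bsub>T\<^esub>" if "j \<notin> ?S" for j
      proof (cases "em (n - 2 - j) p = 0")
        case False
        then have "LL j v = \<zero>\<^bsub>V\<^esub>" using that by blast
        then show ?thesis by simp
      qed (simp add: v)
      have "- 2 - int i \<in> ?S \<or> int i - 1 \<in> ?S"
      proof (rule ccontr)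
        assume "\<not> ?thesis"
        then have 1: "- 2 - int i \<notin> ?S" and 2: "int i - 1 \<notin> ?S" by blast+
        have "nterm (- 1) omega_T (\<lambda>n. onPi (em n)) n (tens V v p) i = \<zero>\<^bsub>T\<^esub>"
          unfolding nterm_omega [OF v] z [OF 1] z [OF 2] by (rule T.l_zero [OF T.zero_closed])
        with i show False by blast
      qed
      then show "i \<in> (\<lambda>i. - 2 - int i) -` ?S \<union> (\<lambda>i. int i - 1) -` ?S" by blast
    qed
    moreover have "finite ((\<lambda>i. - 2 - int i) -` ?S)" "finite ((\<lambda>i. int i - 1) -` ?S)"
      using LL_em_finite [OF v] by (intro finite_vimageI; simp add: inj_on_def)+
    ultimately show ?thesis using finite_subset by blast
  qed
  show "tlin (nth_product T (- 1) omega_T (\<lambda>n. onPi (em n)) n)"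
    by (rule tlin_nth_product [OF lin1 lin2 fin])
  assume v: "v \<in> carrier V"
  let ?f = "\<lambda>j. Pi_scale (coord u (LL j v)) (em (n - 2 - j) p)"
  have "coord u \<zero>\<^bsub>V\<^esub> = 0" using coord_smult [of "\<zero>\<^bsub>V\<^esub>" u 0] V.smult_r_null [of 0] by simp
  then have "finite {j. ?f j \<noteq> 0}"
    by (intro finite_subset [OF _ LL_em_finite [OF v, of "n - 2" p]]) auto
  then have fin': "finite {j. ?f (- 1 + j) \<noteq> 0}"
    using finite_vimageI [of "{j. ?f j \<noteq> 0}" "\<lambda>j. - 1 + j"] by (simp add: inj_on_def vimage_def)
  have "comp u (nth_product T (- 1) omega_T (\<lambda>n. onPi (em n)) n (tens V v p)) = Sum_any (\<lambda>i. ?f (- 2 - int i) + ?f (int i - 1))"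
    unfolding comp_nth_product(1) [OF lin1 lin2 tens_closed [OF v] fin [OF v]]
    using v by (simp add: nterm_omega comp_add comp_tens)
  also have "\<dots> = Sum_any (\<lambda>i. ?f (- 1 + (- 1 - int i)) + ?f (- 1 + int i))"
  proof -
    have "- 2 - int i = - 1 + (- 1 - int i)" "int i - 1 = - 1 + int i" for i by simp_all
    then show ?thesis by (simp only:)
  qed
  also have "\<dots> = Sum_any (\<lambda>j. ?f (- 1 + j))" by (rule Sum_any_int_split [OF fin', symmetric])
  also have "\<dots> = Sum_any ?f" by (rule Sum_any_shift)
  finally show "comp u (nth_product T (- 1) omega_T (\<lambda>n. onPi (em n)) n (tens V v p)) = Sum_any ?f" .
qed

lemma act_F: "act M (F n) t = (k + 2) \<odot>\<^bsub>T\<^esub> nth_product T (- 1) omega_T (\<lambda>n. onPi (em n)) n t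
   \<oplus>\<^bsub>T\<^esub> ((- 1) \<odot>\<^bsub>T\<^esub> nth_product T (- 1) nu_T (nth_product T (- 1) nu_T (\<lambda>n. onPi (em n))) n t
   \<oplus>\<^bsub>T\<^esub> (- (k + 1)) \<odot>\<^bsub>T\<^esub> nth_product T (- 2) nu_T (\<lambda>n. onPi (em n)) n t)"
  by (simp add: act_M field_add_def field_scale_def)

lemma tlin_act_F: "tlin (act M (F n))"
  unfolding act_F [abs_def] by (intro tlin_add tlin_smult omega_em_T nu_nu_em_T dnu_em_T)

lemma tlin_act: "tlin (act M x)"
  by (cases x) (simp_all add: tlin_act_E tlin_act_F tlin_act_H tlin_act_K)

lemma comp_act_F:
  assumes v: "v \<in> carrier V"
  shows "comp u (act M (F n) (tens V v p))
    = Pi_scale (k + 2) (Sum_any (\<lambda>j. Pi_scale (coord u (LL j v)) (em (n - 2 - j) p))) + Pi_scale (coord u v) (gop n p)"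
proof -
  note tc = tens_closed [OF v, of p]
  show ?thesis
    unfolding act_F nu_nu_em_T(2) [OF tc] dnu_em_T(2) [OF tc] pi_tens [OF plin_ops(8) v] pi_tens [OF plin_ops(9) v] comp_omega_em [OF v, symmetric]
    using tlinD(1) [OF omega_em_T tc] v
    by (simp add: comp_add comp_smult comp_tens gop_def Pi.scale_right_diff_distrib mult.commute)
      (simp add: algebra_simps Pi.scale_left_distrib Pi.scale_left_diff_distrib)
qed

end

lemma Sum_any_pairs:
  fixes g :: "'a \<Rightarrow> 'b \<Rightarrow> 'c::comm_monoid_add"
  assumes "finite {x. (case x of (a, b) \<Rightarrow> g a b) \<noteq> 0}"
  shows "Sum_any (\<lambda>a. Sum_any (\<lambda>b. g a b)) = Sum_any (\<lambda>(a, b). g a b)"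
proof (rule Sum_any.cartesian_product)
  let ?S = "{x. (case x of (a, b) \<Rightarrow> g a b) \<noteq> 0}"
  show "finite (fst ` ?S \<times> snd ` ?S)" using assms by simp
  show "{a. \<exists>b. g a b \<noteq> 0} \<times> {b. \<exists>a. g a b \<noteq> 0} \<subseteq> fst ` ?S \<times> snd ` ?S"
    by (force simp: image_iff)
qed

lemma Sum_any_diff:
  fixes f g :: "'a \<Rightarrow> 'b::ab_group_add"
  assumes "finite {a. f a \<noteq> 0}" "finite {a. g a \<noteq> 0}"
  shows "Sum_any (\<lambda>a. f a - g a) = Sum_any f - Sum_any g"
proof -
  have "finite {a. f a - g a \<noteq> 0}"
    by (rule finite_subset [OF _ finite_UnI [OF assms]]) auto
  from Sum_any.distrib [OF this assms(2)] show ?thesis by simp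
qed

context whittaker_parameters
begin

lemma W_eq: "W \<kappa> s m n p = Sum_any (\<lambda>i. Pi_scale (\<kappa> i) (em (m - 2 - i) (em (n - 2 - (s - i)) p)))"
proof -
  have "W \<kappa> s m n p = Sum_any (\<lambda>t. Pi_scale (\<kappa> (m - 2 - t)) (em t (em (m + n - 4 - s - t) p)))"
    unfolding W_def by (rule NO_commuting) (rule em_em)
  also have "\<dots> = Sum_any (\<lambda>i. Pi_scale (\<kappa> i) (em (m - 2 - i) (em (n - 2 - (s - i)) p)))"
  proof (rule Sum_any.reindex_cong [where l = "\<lambda>i. m - 2 - i"])
    show "bij (\<lambda>i. m - 2 - i)" by (rule bij_betw_byWitness [where f' = "\<lambda>i. m - 2 - i"]) auto
    show "(\<lambda>t. Pi_scale (\<kappa> (m - 2 - t)) (em t (em (m + n - 4 - s - t) p))) \<circ> (\<lambda>i. m - 2 - i)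
      = (\<lambda>i. Pi_scale (\<kappa> i) (em (m - 2 - i) (em (n - 2 - (s - i)) p)))"
      by (auto simp: algebra_simps)
  qed
  finally show ?thesis .
qed

lemma W_finite: "finite {i. Pi_scale (\<kappa> i) (em (m - 2 - i) (em (n - 2 - (s - i)) p)) \<noteq> 0}"
proof -
  have "finite {j. NO_term (\<lambda>t. \<kappa> (m - 2 - t)) em em (m + n - 4 - s) p j \<noteq> 0}"
    by (rule NO_term_finite [OF fld_em fld_em])
  from finite_vimageI [OF this, of "\<lambda>i. m - 2 - i"]
  have "finite {i. NO_term (\<lambda>t. \<kappa> (m - 2 - t)) em em (m + n - 4 - s) p (m - 2 - i) \<noteq> 0}"
    by (simp add: inj_on_def vimage_def)
  moreover have "NO_term (\<lambda>t. \<kappa> (m - 2 - t)) em em (m + n - 4 - s) p (m - 2 - i) = Pi_scale (\<kappa> i) (em (m - 2 - i) (em (n - 2 - (s - i)) p))" for i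
  proof -
    have idx: "m + n - 4 - s - (m - 2 - i) = n - 2 - (s - i)" "m - 2 - (m - 2 - i) = i" by simp_all
    show ?thesis unfolding NO_term_def idx em_em [of "n - 2 - (s - i)"] if_cancel ..
  qed
  ultimately show ?thesis by simp
qed

lemma W_vanish: "\<exists>N. \<forall>s<N. W (\<kappa> s) s m n p = 0"
proof -
  obtain r where r: "bnd r p" using bnd_exists by blast
  have "W (\<kappa> s) s m n p = 0" if "s < m + n - r" for s
    using graded_bnd [OF graded_W [where \<kappa> = "\<kappa> s" and s = s and m = m and n = n] r] that bnd_negative by force
  then show ?thesis by blast
qed

end

section \<open>The brackets of the affine generators on the tensor product\<close>

context free_field_realization
begin

lemma coord_zero: "coord u \<zero>\<^bsub>V\<^esub> = 0"
  using coord_smult [of "\<zero>\<^bsub>V\<^esub>" u 0] V.smult_r_null [of 0] by simp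

lemma tlin_finsum: "tlin A \<Longrightarrow> f \<in> S \<rightarrow> carrier T \<Longrightarrow> finite S \<Longrightarrow> A (\<Oplus>\<^bsub>T\<^esub>i\<in>S. f i) = (\<Oplus>\<^bsub>T\<^esub>i\<in>S. A (f i))"
proof (rotate_tac 2, induction S rule: finite_induct)
  case (insert x S)
  then have "f \<in> S \<rightarrow> carrier T" "f x \<in> carrier T" "(\<lambda>i. A (f i)) \<in> S \<rightarrow> carrier T" "A (f x) \<in> carrier T"
    using tlinD(1) by auto
  then show ?case using insert by (simp add: tlinD(2))
qed (simp add: tlin_zero)

lemma tens_LL_em:
  fixes n :: int and p :: Pi_vec
  assumes v: "v \<in> carrier V"
  defines "S \<equiv> {j. LL j v \<noteq> \<zero>\<^bsub>V\<^esub> \<and> em (n - 2 - j) p \<noteq> 0}"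
  shows "tlin A \<Longrightarrow> Sum_any (\<lambda>j. comp u (A (tens V (LL j v) (em (n - 2 - j) p)))) = (\<Sum>j\<in>S. comp u (A (tens V (LL j v) (em (n - 2 - j) p))))"
    and "act M (F n) (tens V v p) = (k + 2) \<odot>\<^bsub>T\<^esub> (\<Oplus>\<^bsub>T\<^esub>j\<in>S. tens V (LL j v) (em (n - 2 - j) p)) \<oplus>\<^bsub>T\<^esub> tens V v (gop n p)"
proof -
  have S: "finite S" unfolding S_def by (rule LL_em_finite [OF v])
  have z: "tens V (LL j v) (em (n - 2 - j) p) = \<zero>\<^bsub>T\<^esub>" if "j \<notin> S" for j
  proof (cases "em (n - 2 - j) p = 0")
    case False
    then have "LL j v = \<zero>\<^bsub>V\<^esub>" using that S_def by blast
    then show ?thesis by simp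
  qed (simp add: v)
  show sum: "Sum_any (\<lambda>j. comp u (B (tens V (LL j v) (em (n - 2 - j) p)))) = (\<Sum>j\<in>S. comp u (B (tens V (LL j v) (em (n - 2 - j) p))))"
    if "tlin B" for B u
  proof (rule Sum_any.expand_superset [OF S], rule subsetI, rule ccontr)
    fix j assume "j \<in> {j. comp u (B (tens V (LL j v) (em (n - 2 - j) p))) \<noteq> 0}" "j \<notin> S"
    then show False using z [of j] tlin_zero [OF that] by simp
  qed
  show "act M (F n) (tens V v p) = (k + 2) \<odot>\<^bsub>T\<^esub> (\<Oplus>\<^bsub>T\<^esub>j\<in>S. tens V (LL j v) (em (n - 2 - j) p)) \<oplus>\<^bsub>T\<^esub> tens V v (gop n p)"
  proof (rule T_eqI)
    show "act M (F n) (tens V v p) \<in> carrier T" using tlinD(1) [OF tlin_act] v by simp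
    fix u'
    show "comp u' (act M (F n) (tens V v p)) = comp u' ((k + 2) \<odot>\<^bsub>T\<^esub> (\<Oplus>\<^bsub>T\<^esub>j\<in>S. tens V (LL j v) (em (n - 2 - j) p)) \<oplus>\<^bsub>T\<^esub> tens V v (gop n p))"
      using sum [OF tlin_ident, of u'] v S
      by (simp add: comp_act_F comp_add comp_smult comp_finsum comp_tens)
  qed (use v in simp)
qed

lemma comp_tlin_act_F:
  assumes A: "tlin A" and v: "v \<in> carrier V"
  shows "comp u (A (act M (F n) (tens V v p)))
    = Pi_scale (k + 2) (Sum_any (\<lambda>j. comp u (A (tens V (LL j v) (em (n - 2 - j) p))))) + comp u (A (tens V v (gop n p)))"
proof -
  let ?S = "{j. LL j v \<noteq> \<zero>\<^bsub>V\<^esub> \<and> em (n - 2 - j) p \<noteq> 0}"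
  have S: "finite ?S" by (rule LL_em_finite [OF v])
  have tc: "tens V (LL j v) (em (n - 2 - j) p) \<in> carrier T" for j using v by simp
  have fc: "(\<Oplus>\<^bsub>T\<^esub>j\<in>?S. tens V (LL j v) (em (n - 2 - j) p)) \<in> carrier T" using tc by simp
  have "A (act M (F n) (tens V v p)) = (k + 2) \<odot>\<^bsub>T\<^esub> (\<Oplus>\<^bsub>T\<^esub>j\<in>?S. A (tens V (LL j v) (em (n - 2 - j) p))) \<oplus>\<^bsub>T\<^esub> A (tens V v (gop n p))"
    unfolding tens_LL_em(2) [OF v] using fc v S tc
    by (simp add: tlinD(2) [OF A] tlinD(3) [OF A] tlin_finsum [OF A])
  then show ?thesis
    unfolding tens_LL_em(1) [OF v A]
    using v S tc tlinD(1) [OF A] by (simp add: comp_add comp_smult comp_finsum)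
qed

lemma LL_sum_finite: "v \<in> carrier V \<Longrightarrow> plin B \<Longrightarrow> finite {j. Pi_scale (coord u (LL j v)) (B (em (n - j) p)) \<noteq> 0}"
  by (rule finite_subset [OF _ LL_em_finite [of v n p]]) (auto simp: coord_zero lin_zero)

lemma coord_LL_LL:
  assumes "v \<in> carrier V"
  shows "coord u (LL i (LL j v)) - coord u (LL j (LL i v))
    = of_int (i - j) * coord u (LL (i + j) v) + (if i + j = 0 then of_int (i ^ 3 - i) / 12 * (d_level k * coord u v) else 0)"
proof -
  have fs: "coord u (\<Oplus>\<^bsub>V\<^esub>z\<in>S. f z) = (\<Sum>z\<in>S. coord u (f z))" if "finite S" "f \<in> S \<rightarrow> carrier V" for S :: "virasoro set" and f
    using that by (induction S rule: finite_induct) (simp_all add: coord_zero coord_add)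
  have add: "(\<Sum>z\<in>keys (x + y). lookup (x + y) z * g z)
     = (\<Sum>z\<in>keys x. lookup x z * g z) + (\<Sum>z\<in>keys y. lookup y z * g z)"
    for x y :: "virasoro \<Rightarrow>\<^sub>0 complex" and g :: "virasoro \<Rightarrow> complex"
    by (rule setsum_keys_plus_distrib) (simp_all add: distrib_right)
  have single: "(\<Sum>z\<in>keys (single y a). lookup (single y a) z * g z) = a * g y"
    for y :: virasoro and a and g :: "virasoro \<Rightarrow> complex"
    by (cases "a = 0") simp_all
  have diff: "coord u (a \<ominus>\<^bsub>V\<^esub> b) = coord u a - coord u b" if "a \<in> carrier V" "b \<in> carrier V" for a b
  proof -
    have "a = (a \<ominus>\<^bsub>V\<^esub> b) \<oplus>\<^bsub>V\<^esub> b" using that by (simp add: a_minus_def V.a_assoc V.l_neg)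
    then show ?thesis using that coord_add [of "a \<ominus>\<^bsub>V\<^esub> b" b u] by simp
  qed
  have "coord u (LL i (LL j v)) - coord u (LL j (LL i v)) = coord u (LL i (LL j v) \<ominus>\<^bsub>V\<^esub> LL j (LL i v))"
    using assms by (simp add: diff)
  also have "\<dots> = (\<Sum>z\<in>keys (virasoro_bracket (L i) (L j)). lookup (virasoro_bracket (L i) (L j)) z * coord u (act V z v))"
    unfolding V.act_bracket [OF assms] using assms V.act_closed by (subst fs) (auto simp: coord_smult)
  finally show ?thesis
    using assms by (simp add: add single C coord_smult)
qed

lemma LL_em_em_finite:
  assumes v: "v \<in> carrier V"
  shows "finite {x. (case x of (j, i) \<Rightarrow> Pi_scale (coord u (LL i (LL j v))) (em (m - 2 - i) (em (n - 2 - j) p))) \<noteq> 0}"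
proof -
  have "finite (SIGMA j:{j. LL j v \<noteq> \<zero>\<^bsub>V\<^esub> \<and> em (n - 2 - j) p \<noteq> 0}. {i. LL i (LL j v) \<noteq> \<zero>\<^bsub>V\<^esub> \<and> em (m - 2 - i) (em (n - 2 - j) p) \<noteq> 0})"
    using LL_em_finite v by (intro finite_SigmaI) auto
  moreover have "LL i \<zero>\<^bsub>V\<^esub> = \<zero>\<^bsub>V\<^esub>" for i by (rule V.act_zero)
  ultimately show ?thesis
    by (elim rev_finite_subset) (auto simp: coord_zero ops_zero)
qed

text \<open>The products L(i) L(j) are antisymmetrized by the Virasoro bracket. What then stands at
  L(s) vanishes by \<open>em_gop_relation\<close>, and what carries no mode vanishes by
  \<open>gop_gop_relation\<close>.\<close>

lemma comp_F_F:
  assumes v: "v \<in> carrier V"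
  shows "comp u (act M (F m) (act M (F n) (tens V v p))) - comp u (act M (F n) (act M (F m) (tens V v p))) = 0"
proof -
  define c where "c s = coord u (LL s v)" for s
  \<comment> \<open>\<open>D\<close> carries a Virasoro mode from both factors, \<open>G\<close> one
    from the factor acting first, \<open>H'\<close> one from the factor acting second.\<close>
  define D where "D m n = Sum_any (\<lambda>(j, i). Pi_scale (coord u (LL i (LL j v))) (em (m - 2 - i) (em (n - 2 - j) p)))" for m n
  define G where "G m n = Sum_any (\<lambda>s. Pi_scale (c s) (gop m (em (n - 2 - s) p)))" for m n
  define H' where "H' m n = Sum_any (\<lambda>s. Pi_scale (c s) (em (m - 2 - s) (gop n p)))" for m n
  define w where "w s = W (\<lambda>i. of_int (2 * i - s)) s m n p" for s
  have finG: "finite {s. Pi_scale (c s) (gop m (em (n - 2 - s) p)) \<noteq> 0}" for m n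
    unfolding c_def using LL_sum_finite [OF v plin_ops(10)] .
  have finH: "finite {s. Pi_scale (c s) (em (m - 2 - s) (gop n p)) \<noteq> 0}" for m n
    unfolding c_def using LL_sum_finite [OF v plin_ident] .
  have FF: "comp u (act M (F m) (act M (F n) (tens V v p)))
      = Pi_scale (k + 2) (Pi_scale (k + 2) (D m n) + G m n + H' m n) + Pi_scale (coord u v) (gop m (gop n p))" for m n
  proof -
    have fin1: "finite {j. Sum_any (\<lambda>i. Pi_scale (coord u (LL i (LL j v))) (em (m - 2 - i) (em (n - 2 - j) p))) \<noteq> 0}"
      by (rule finite_subset [OF _ LL_em_finite [OF v, of "n - 2" p]]) (auto simp: coord_zero ops_zero V.act_zero)
    have fin2: "finite {j. Pi_scale (k + 2) (Sum_any (\<lambda>i. Pi_scale (coord u (LL i (LL j v))) (em (m - 2 - i) (em (n - 2 - j) p)))) \<noteq> 0}"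
      by (rule finite_subset [OF _ fin1]) auto
    have "Sum_any (\<lambda>j. comp u (act M (F m) (tens V (LL j v) (em (n - 2 - j) p)))) = Pi_scale (k + 2) (D m n) + G m n"
      using v
      by (simp add: comp_act_F Sum_any.distrib [OF fin2 finG [unfolded c_def]] D_def G_def c_def
          Sum_any_pairs [OF LL_em_em_finite [OF v], symmetric] lin_Sum_any [OF Pi.linear_scale_self fin1])
    then show ?thesis
      unfolding comp_tlin_act_F [OF tlin_act_F v] using v by (simp add: comp_act_F H'_def c_def Pi.scale_right_distrib add_ac)
  qed
  have finw: "finite {s. Pi_scale (c s) (w s) \<noteq> 0}"
  proof -
    obtain N where N: "\<And>s. s < N \<Longrightarrow> w s = 0" using W_vanish [of "\<lambda>s i. of_int (2 * i - s)" m n p] unfolding w_def by blast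
    obtain N' where N': "\<And>s. s > N' \<Longrightarrow> LL s v = \<zero>\<^bsub>V\<^esub>" using smooth [OF v] by blast
    have "{s. Pi_scale (c s) (w s) \<noteq> 0} \<subseteq> {N..N'}"
    proof
      fix s assume s: "s \<in> {s. Pi_scale (c s) (w s) \<noteq> 0}"
      then have "\<not> s < N" "\<not> s > N'" using N [of s] N' [of s] by (auto simp: c_def coord_zero)
      then show "s \<in> {N..N'}" by simp
    qed
    then show ?thesis by (rule finite_subset) simp
  qed
  have DD: "D m n - D n m = Sum_any (\<lambda>s. Pi_scale (c s) (w s)) + Pi_scale (d_level k / 12 * coord u v) (W (\<lambda>i. of_int (i ^ 3 - i)) 0 m n p)"
  proof -
    have Dnm: "D n m = Sum_any (\<lambda>(j, i). Pi_scale (coord u (LL j (LL i v))) (em (m - 2 - i) (em (n - 2 - j) p)))"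
      unfolding D_def
      by (rule Sum_any.reindex_cong [where l = prod.swap]) (auto simp: em_em [of "n - 2 - _"])
    have fin2: "finite {x. (case x of (j, i) \<Rightarrow> Pi_scale (coord u (LL j (LL i v))) (em (m - 2 - i) (em (n - 2 - j) p))) \<noteq> 0}"
    proof -
      have "{x. (case x of (j, i) \<Rightarrow> Pi_scale (coord u (LL j (LL i v))) (em (m - 2 - i) (em (n - 2 - j) p))) \<noteq> 0}
        = prod.swap ` {x. (case x of (j, i) \<Rightarrow> Pi_scale (coord u (LL i (LL j v))) (em (n - 2 - i) (em (m - 2 - j) p))) \<noteq> 0}"
        by (auto simp: image_iff em_em [of "m - 2 - _"])
      then show ?thesis using LL_em_em_finite [OF v, of u n m p] by simp
    qed
    \<comment> \<open>The pairs (j, i) are sorted by their sum s; the central term of the Virasoro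
      bracket appears at s = 0 only.\<close>
    define h where "h s i = Pi_scale (of_int (2 * i - s) * c s + (if s = 0 then of_int (i ^ 3 - i) / 12 * (d_level k * coord u v) else 0))
        (em (m - 2 - i) (em (n - 2 - (s - i)) p))" for s i
    have pw: "(case x of (j, i) \<Rightarrow> Pi_scale (coord u (LL i (LL j v))) (em (m - 2 - i) (em (n - 2 - j) p)))
        - (case x of (j, i) \<Rightarrow> Pi_scale (coord u (LL j (LL i v))) (em (m - 2 - i) (em (n - 2 - j) p))) = h (fst x + snd x) (snd x)" for x
    proof -
      obtain j i where x: "x = (j, i)" by fastforce
      have "coord u (LL i (LL j v)) - coord u (LL j (LL i v)) = of_int (2 * i - (j + i)) * c (j + i) + (if j + i = 0 then of_int (i ^ 3 - i) / 12 * (d_level k * coord u v) else 0)"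
        using coord_LL_LL [OF v, of u i j] by (simp add: c_def add.commute)
      then show ?thesis by (simp add: x h_def flip: Pi.scale_left_diff_distrib)
    qed
    have finh: "finite {x. h (fst x + snd x) (snd x) \<noteq> 0}"
      unfolding pw [symmetric]
      by (rule finite_subset [OF _ finite_UnI [OF LL_em_em_finite [OF v, of u m n p] fin2]]) auto
    have bij: "bij (\<lambda>(s, i). (s - i, i) :: int \<times> int)"
      by (rule bij_betw_byWitness [where f' = "\<lambda>(j, i). (j + i, i)"]) auto
    have finh': "finite {x. (case x of (s, i) \<Rightarrow> h s i) \<noteq> 0}"
      using finite_vimageI [OF finh bij_is_inj [OF bij]] by (simp add: vimage_def case_prod_beta')
    have "D m n - D n m = Sum_any (\<lambda>x. h (fst x + snd x) (snd x))"
      unfolding Dnm pw [symmetric] unfolding D_def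
      by (rule Sum_any_diff [OF LL_em_em_finite [OF v] fin2, symmetric])
    also have "\<dots> = Sum_any (\<lambda>(s, i). h s i)"
      by (rule Sum_any.reindex_cong [OF bij]) auto
    also have "\<dots> = Sum_any (\<lambda>s. Sum_any (\<lambda>i. h s i))"
      by (rule Sum_any_pairs [OF finh', symmetric])
    also have "\<dots> = Sum_any (\<lambda>s. Pi_scale (c s) (w s) + (if s = 0 then Pi_scale (d_level k / 12 * coord u v) (W (\<lambda>i. of_int (i ^ 3 - i)) 0 m n p) else 0))"
    proof (rule Sum_any.cong)
      fix s :: int
      define y where "y = (if s = 0 then d_level k / 12 * coord u v else 0)"
      have hs: "h s = (\<lambda>i. Pi_scale (c s) (Pi_scale (of_int (2 * i - s)) (em (m - 2 - i) (em (n - 2 - (s - i)) p)))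
         + Pi_scale y (Pi_scale (of_int (i ^ 3 - i)) (em (m - 2 - i) (em (n - 2 - (s - i)) p))))"
        by (rule ext) (simp add: h_def y_def mult.commute mult.left_commute flip: Pi.scale_left_distrib)
      have fin: "finite {i. Pi_scale x (Pi_scale (\<kappa> i) (em (m - 2 - i) (em (n - 2 - (s - i)) p))) \<noteq> 0}" for x \<kappa>
        by (rule finite_subset [OF _ W_finite [of \<kappa> m n s p]]) auto
      have "Sum_any (h s) = Pi_scale (c s) (w s) + Pi_scale y (W (\<lambda>i. of_int (i ^ 3 - i)) s m n p)"
        unfolding hs Sum_any.distrib [OF fin fin] w_def W_eq lin_Sum_any [OF Pi.linear_scale_self W_finite] ..
      then show "Sum_any (h s) = Pi_scale (c s) (w s) + (if s = 0 then Pi_scale (d_level k / 12 * coord u v) (W (\<lambda>i. of_int (i ^ 3 - i)) 0 m n p) else 0)"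
        by (simp add: y_def)
    qed
    also have "\<dots> = Sum_any (\<lambda>s. Pi_scale (c s) (w s)) + Sum_any (\<lambda>s::int. if s = 0 then Pi_scale (d_level k / 12 * coord u v) (W (\<lambda>i. of_int (i ^ 3 - i)) 0 m n p) else 0)"
      by (rule Sum_any.distrib [OF finw]) simp
    finally show ?thesis by simp
  qed
  \<comment> \<open>Summand by summand in s, this is c(s) times
    \<open>em_gop_relation\<close>.\<close>
  have I: "Pi_scale (k + 2) (Sum_any (\<lambda>s. Pi_scale (c s) (w s))) + (G m n - G n m) + (H' m n - H' n m) = 0"
  proof -
    have fin1: "finite {s. Pi_scale (k + 2) (Pi_scale (c s) (w s)) \<noteq> 0}" by (rule finite_subset [OF _ finw]) auto
    have fin2: "finite {s. f s - g s \<noteq> (0 :: Pi_vec)}" if "finite {s. f s \<noteq> 0}" "finite {s. g s \<noteq> 0}" for f g :: "int \<Rightarrow> Pi_vec"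
      by (rule finite_subset [OF _ finite_UnI [OF that]]) auto
    have fin3: "finite {s. f s + g s \<noteq> (0 :: Pi_vec)}" if "finite {s. f s \<noteq> 0}" "finite {s. g s \<noteq> 0}" for f g :: "int \<Rightarrow> Pi_vec"
      by (rule finite_subset [OF _ finite_UnI [OF that]]) auto
    have "Pi_scale (k + 2) (Sum_any (\<lambda>s. Pi_scale (c s) (w s))) + (G m n - G n m) + (H' m n - H' n m)
      = Sum_any (\<lambda>s. Pi_scale (k + 2) (Pi_scale (c s) (w s)) + (Pi_scale (c s) (gop m (em (n - 2 - s) p)) - Pi_scale (c s) (gop n (em (m - 2 - s) p)))
         + (Pi_scale (c s) (em (m - 2 - s) (gop n p)) - Pi_scale (c s) (em (n - 2 - s) (gop m p))))"
      unfolding G_def H'_def lin_Sum_any [OF Pi.linear_scale_self finw] Sum_any_diff [OF finG finG, symmetric] Sum_any_diff [OF finH finH, symmetric]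
        Sum_any.distrib [OF fin1 fin2 [OF finG finG], symmetric] Sum_any.distrib [OF fin3 [OF fin1 fin2 [OF finG finG]] fin2 [OF finH finH], symmetric] ..
    also have "\<dots> = Sum_any (\<lambda>s :: int. 0)"
    proof (rule Sum_any.cong)
      fix s
      have "Pi_scale (k + 2) (Pi_scale (c s) (w s)) + (Pi_scale (c s) (gop m (em (n - 2 - s) p)) - Pi_scale (c s) (gop n (em (m - 2 - s) p)))
         + (Pi_scale (c s) (em (m - 2 - s) (gop n p)) - Pi_scale (c s) (em (n - 2 - s) (gop m p)))
        = Pi_scale (c s) (Pi_scale (k + 2) (w s) + (em (m - 2 - s) (gop n p) - gop n (em (m - 2 - s) p)) + (gop m (em (n - 2 - s) p) - em (n - 2 - s) (gop m p)))"
        by (simp add: Pi.scale_right_distrib Pi.scale_right_diff_distrib mult.commute)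
      also have "\<dots> = 0" unfolding w_def em_gop_relation by simp
      finally show "Pi_scale (k + 2) (Pi_scale (c s) (w s)) + (Pi_scale (c s) (gop m (em (n - 2 - s) p)) - Pi_scale (c s) (gop n (em (m - 2 - s) p)))
         + (Pi_scale (c s) (em (m - 2 - s) (gop n p)) - Pi_scale (c s) (em (n - 2 - s) (gop m p))) = 0" .
    qed
    finally show ?thesis by simp
  qed
  have "comp u (act M (F m) (act M (F n) (tens V v p))) - comp u (act M (F n) (act M (F m) (tens V v p)))
    = Pi_scale (k + 2) (Pi_scale (k + 2) (D m n - D n m) + (G m n - G n m) + (H' m n - H' n m)) + Pi_scale (coord u v) (gop m (gop n p) - gop n (gop m p))"
    unfolding FF by (simp add: Pi.scale_right_distrib Pi.scale_right_diff_distrib)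
  also have "\<dots> = Pi_scale (k + 2) (Pi_scale (k + 2) (Sum_any (\<lambda>s. Pi_scale (c s) (w s))) + (G m n - G n m) + (H' m n - H' n m))
     + Pi_scale (coord u v) (Pi_scale ((k + 2)\<^sup>2 * d_level k / 12) (W (\<lambda>i. of_int (i ^ 3 - i)) 0 m n p) + (gop m (gop n p) - gop n (gop m p)))"
    unfolding DD by (simp add: Pi.scale_right_distrib Pi.scale_right_diff_distrib power2_eq_square mult_ac)
  also have "\<dots> = 0" unfolding I gop_gop_relation [OF level] by simp
  finally show ?thesis .
qed

fun Pi_op :: "affine_sl2 \<Rightarrow> Pi_vec \<Rightarrow> Pi_vec" where
  "Pi_op (E n) = ep n"
| "Pi_op (H n) = hh n"
| "Pi_op K = Pi_scale k"
| "Pi_op (F n) = gop n"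

lemma act_tens: "v \<in> carrier V \<Longrightarrow> \<forall>n. x \<noteq> F n \<Longrightarrow> act M x (tens V v p) = tens V v (Pi_op x p)"
  by (cases x) (simp_all add: act_E_tens act_H_tens act_K_tens)

lemma affine_bracket_antisym: "affine_bracket y x = - affine_bracket x y"
  by (cases x; cases y) (auto simp: add.commute single_uminus add_eq_0_iff)

text \<open>A generator other than f acts on the \<open>Pi_vec\<close> factor alone, so the modes
  L(j) stay in place and the relation reduces to the commutators with \<open>em\<close> and
  \<open>gop\<close>: e commutes with the former, h shifts the index of both.\<close>

lemma comp_bracket_F:
  assumes v: "v \<in> carrier V" and x: "\<forall>n. x \<noteq> F n"
  shows "comp u (act M x (act M (F n) (tens V v p))) - comp u (act M (F n) (act M x (tens V v p)))
    = bracket_sum (\<lambda>z. comp u (act M z (tens V v p))) (affine_bracket x (F n))"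
proof -
  have xF: "comp u (act M x (act M (F n) (tens V v p)))
      = Pi_scale (k + 2) (Sum_any (\<lambda>j. Pi_scale (coord u (LL j v)) (Pi_op x (em (n - 2 - j) p)))) + Pi_scale (coord u v) (Pi_op x (gop n p))"
    unfolding comp_tlin_act_F [OF tlin_act v] using v by (simp add: act_tens [OF _ x] comp_tens)
  have Fx: "comp u (act M (F n) (act M x (tens V v p)))
      = Pi_scale (k + 2) (Sum_any (\<lambda>j. Pi_scale (coord u (LL j v)) (em (n - 2 - j) (Pi_op x p)))) + Pi_scale (coord u v) (gop n (Pi_op x p))"
    unfolding act_tens [OF v x] comp_act_F [OF v] ..
  show ?thesis
  proof (cases x)
    case (E m)
    show ?thesis
      unfolding xF Fx using v
      by (simp add: E ep_em ep_gop bracket_sum_add act_H_tens act_K_tens comp_tens Pi.scale_right_distrib add_eq_0_iff2)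
  next
    case (H m)
    have fin: "finite {j. Pi_scale (coord u (LL j v)) (em (n - 2 - j) (hh m p)) \<noteq> 0}"
      by (rule LL_sum_finite [OF v plin_ident])
    have fin': "finite {j. Pi_scale (coord u (LL j v)) (em (n - 2 - j + m) p) \<noteq> 0}"
      using LL_sum_finite [OF v plin_ident, of u "n - 2 + m" p] by (simp add: algebra_simps)
    have fin2: "finite {j. Pi_scale 2 (Pi_scale (coord u (LL j v)) (em (n - 2 - j + m) p)) \<noteq> 0}"
      by (rule finite_subset [OF _ fin']) auto
    have "Sum_any (\<lambda>j. Pi_scale (coord u (LL j v)) (hh m (em (n - 2 - j) p)))
       = Sum_any (\<lambda>j. Pi_scale (coord u (LL j v)) (em (n - 2 - j) (hh m p)) - Pi_scale 2 (Pi_scale (coord u (LL j v)) (em (n - 2 - j + m) p)))"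
      by (rule Sum_any.cong) (simp add: hh_em Pi.scale_right_diff_distrib mult.commute)
    also have "\<dots> = Sum_any (\<lambda>j. Pi_scale (coord u (LL j v)) (em (n - 2 - j) (hh m p)))
       - Pi_scale 2 (Sum_any (\<lambda>j. Pi_scale (coord u (LL j v)) (em (m + n - 2 - j) p)))"
      unfolding Sum_any_diff [OF fin fin2] lin_Sum_any [OF Pi.linear_scale_self fin', symmetric] by (simp add: algebra_simps)
    finally have eq: "Sum_any (\<lambda>j. Pi_scale (coord u (LL j v)) (hh m (em (n - 2 - j) p)))
       = Sum_any (\<lambda>j. Pi_scale (coord u (LL j v)) (em (n - 2 - j) (hh m p)))
       - Pi_scale 2 (Sum_any (\<lambda>j. Pi_scale (coord u (LL j v)) (em (m + n - 2 - j) p)))" .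
    show ?thesis
      unfolding xF Fx unfolding H Pi_op.simps eq using v
      by (simp add: hh_gop comp_act_F Pi.scale_right_distrib Pi.scale_right_diff_distrib add.commute [of n m])
        (simp add: mult.commute Pi.scale_left_distrib Pi.scale_left_diff_distrib)
  next
    case K
    have fin: "finite {j. Pi_scale (coord u (LL j v)) (em (n - 2 - j) p) \<noteq> 0}"
      by (rule LL_sum_finite [OF v plin_ident])
    have "Sum_any (\<lambda>j. Pi_scale (coord u (LL j v)) (Pi_scale k (em (n - 2 - j) p))) = Sum_any (\<lambda>j. Pi_scale (coord u (LL j v)) (em (n - 2 - j) (Pi_scale k p)))"
      by (simp add: ops_scale)
    then show ?thesis unfolding xF Fx by (simp add: K ops_scale)
  qed (use x in simp)
qed

lemma comp_bracket:
  assumes v: "v \<in> carrier V"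
  shows "comp u (act M x (act M y (tens V v p))) - comp u (act M y (act M x (tens V v p)))
    = bracket_sum (\<lambda>z. comp u (act M z (tens V v p))) (affine_bracket x y)"
proof (cases "\<exists>n. y = F n")
  case True
  then obtain n where y: "y = F n" ..
  show ?thesis
  proof (cases "\<exists>m. x = F m")
    case True
    then obtain m where x: "x = F m" ..
    show ?thesis using comp_F_F [OF v, of u m n p] by (simp add: x y)
  next
    case False
    then show ?thesis unfolding y by (intro comp_bracket_F v) simp
  qed
next
  case y: False
  show ?thesis
  proof (cases "\<exists>m. x = F m")
    case True
    then obtain m where x: "x = F m" ..
    have "comp u (act M y (act M (F m) (tens V v p))) - comp u (act M (F m) (act M y (tens V v p)))
      = bracket_sum (\<lambda>z. comp u (act M z (tens V v p))) (affine_bracket y (F m))"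
      using y by (intro comp_bracket_F v) simp
    then show ?thesis unfolding x affine_bracket_antisym [of "F m" y] bracket_sum_minus by (simp add: algebra_simps)
  next
    case x: False
    have "Pi_op x (Pi_op y p) - Pi_op y (Pi_op x p) = bracket_sum (\<lambda>z. Pi_op z p) (affine_bracket x y)"
    proof (cases x)
      case x': (E m)
      show ?thesis
      proof (cases y)
        case (E n) then show ?thesis using ep_ep [of m n p] by (simp add: x')
      next
        case (H n) then show ?thesis by (simp add: x' hh_ep)
      qed (use y in \<open>auto simp: x' ops_scale\<close>)
    next
      case x': (H m)
      show ?thesis
      proof (cases y)
        case (E n) then show ?thesis by (simp add: x' hh_ep add.commute)
      next
        case (H n) then show ?thesis by (simp add: x' hh_hh [of m n p] eq_neg_iff_add_eq_0 add.commute mult.commute)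
      qed (use y in \<open>auto simp: x' ops_scale\<close>)
    next
      case x': K
      show ?thesis by (cases y) (use y in \<open>auto simp: x' ops_scale\<close>)
    qed (use x in simp)
    moreover have "bracket_sum (\<lambda>z. comp u (act M z (tens V v p))) (affine_bracket x y) = Pi_scale (coord u v) (bracket_sum (\<lambda>z. Pi_op z p) (affine_bracket x y))"
    proof -
      have "comp u (act M z (tens V v p)) = Pi_scale (coord u v) (Pi_op z p)" if "z \<in> keys (affine_bracket x y)" for z
      proof -
        have "\<forall>n. z \<noteq> F n"
          using that x y keys_add by (cases x; cases y) (fastforce split: if_splits)+
        then show ?thesis using v by (simp add: act_tens comp_tens)
      qed
      then show ?thesis by (simp add: bracket_sum_def Pi.scale_sum_right mult.commute)
    qed
    ultimately show ?thesis
      using v x y by (simp add: act_tens comp_tens flip: Pi.scale_right_diff_distrib)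
  qed
qed

lemma cmodule_M: "cmodule M"
  by (rule epi_module [OF cmodule_T, of _ "\<lambda>t. t"]) (simp add: epi_def)

lemma lie_module_M: "lie_module affine_bracket M"
proof -
  interpret M: Module.module complex_ring M by (rule cmodule_M)
  have Mc: "act M x t \<in> carrier T" if "t \<in> carrier T" for x t using tlinD(1) [OF tlin_act that] .
  have fs: "comp u (\<Oplus>\<^bsub>M\<^esub>z\<in>S. f z) = (\<Sum>z\<in>S. comp u (f z)) \<and> (\<Oplus>\<^bsub>M\<^esub>z\<in>S. f z) \<in> carrier T" if "finite S" "f \<in> S \<rightarrow> carrier T"
    for S :: "affine_sl2 set" and f u
    using that by (induction S rule: finite_induct) (simp_all add: comp_add)
  have diff: "comp u (t \<ominus>\<^bsub>M\<^esub> t') = comp u t - comp u t'" "t \<ominus>\<^bsub>M\<^esub> t' \<in> carrier T" if "t \<in> carrier T" "t' \<in> carrier T" for t t' u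
  proof -
    show c: "t \<ominus>\<^bsub>M\<^esub> t' \<in> carrier T" using M.minus_closed [of t t'] that by simp
    have "t = (t \<ominus>\<^bsub>M\<^esub> t') \<oplus>\<^bsub>M\<^esub> t'" using that M.a_assoc [of t "\<ominus>\<^bsub>M\<^esub> t'" t'] M.l_neg [of t'] M.a_inv_closed [of t'] M.r_zero [of t]
      by (simp add: a_minus_def)
    then show "comp u (t \<ominus>\<^bsub>M\<^esub> t') = comp u t - comp u t'" using that c comp_add [of "t \<ominus>\<^bsub>M\<^esub> t'" t' u] by simp
  qed
  have bs: "bracket_sum (\<lambda>z. f z + g z) b = bracket_sum f b + bracket_sum g b" for f g and b :: "affine_sl2 \<Rightarrow>\<^sub>0 complex"
    by (simp add: bracket_sum_def Pi.scale_right_distrib sum.distrib)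
  have br: "comp u (act M x (act M y t)) - comp u (act M y (act M x t)) = bracket_sum (\<lambda>z. comp u (act M z t)) (affine_bracket x y)"
    if "t \<in> carrier T" for u x y t
    using that
  proof (induction t rule: T_induct)
    case (add t t')
    then show ?case
      by (simp add: tlinD(2) [OF tlin_act] Mc comp_add bs algebra_simps)
  qed (rule comp_bracket)
  show ?thesis
  proof
    fix v w and x y :: affine_sl2 and a
    assume "v \<in> carrier M"
    then have v: "v \<in> carrier T" by simp
    show "act M x v \<in> carrier M" using Mc [OF v] by simp
    show "act M x (a \<odot>\<^bsub>M\<^esub> v) = a \<odot>\<^bsub>M\<^esub> act M x v" using tlinD(3) [OF tlin_act v] by simp
    show "act M x (v \<oplus>\<^bsub>M\<^esub> w) = act M x v \<oplus>\<^bsub>M\<^esub> act M x w" if "w \<in> carrier M" using tlinD(2) [OF tlin_act v] that by simp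
    have f: "(\<lambda>z. lookup (affine_bracket x y) z \<odot>\<^bsub>M\<^esub> act M z v) \<in> keys (affine_bracket x y) \<rightarrow> carrier T"
      using Mc [OF v] by simp
    show "act M x (act M y v) \<ominus>\<^bsub>M\<^esub> act M y (act M x v)
      = (\<Oplus>\<^bsub>M\<^esub>z\<in>keys (affine_bracket x y). lookup (affine_bracket x y) z \<odot>\<^bsub>M\<^esub> act M z v)"
    proof (rule T_eqI)
      show "act M x (act M y v) \<ominus>\<^bsub>M\<^esub> act M y (act M x v) \<in> carrier T" by (intro diff Mc v)
      show "(\<Oplus>\<^bsub>M\<^esub>z\<in>keys (affine_bracket x y). lookup (affine_bracket x y) z \<odot>\<^bsub>M\<^esub> act M z v) \<in> carrier T"
        using fs [OF finite_keys f] by blast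
      fix u
      have "comp u (\<Oplus>\<^bsub>M\<^esub>z\<in>keys (affine_bracket x y). lookup (affine_bracket x y) z \<odot>\<^bsub>M\<^esub> act M z v)
         = bracket_sum (\<lambda>z. comp u (act M z v)) (affine_bracket x y)"
        using fs [OF finite_keys f, of u] Mc [OF v] by (simp add: bracket_sum_def comp_smult)
      then show "comp u (act M x (act M y v) \<ominus>\<^bsub>M\<^esub> act M y (act M x v))
        = comp u (\<Oplus>\<^bsub>M\<^esub>z\<in>keys (affine_bracket x y). lookup (affine_bracket x y) z \<odot>\<^bsub>M\<^esub> act M z v)"
        using br [OF v, of u x y] diff [OF Mc Mc, OF Mc [OF v] Mc [OF v]] Mc [OF Mc [OF v]] by (simp add: diff)
    qed
  qed
qed

end

section \<open>The Whittaker vector and simplicity of the tensor product\<close>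

context whittaker_parameters
begin

lemma gop_0_1: "gop 0 1 = Pi_scale (- 1 / lam) (nu 0 (nu 0 1) + Pi_scale 2 (nu 0 1) + 1) + Pi_scale ((k + 1) / lam) (nu 0 1 + 1)"
proof -
  have nem: "nem (- 1) 1 = Pi_scale (1 / lam) (nu 0 1 + 1)"
    using nem_1 [of "- 1"] by (simp add: em_nu_0_1 Pi.scale_right_distrib)
  have nem_nu: "nem (- 1) (nu 0 1) = nu 0 (nem (- 1) 1) + nem (- 1) 1"
    using nu_nem [of 0 "- 1" 1] by simp
  have "NO_term (\<lambda>_. 1) nu nem (- 1) 1 = (\<lambda>j. if j = 0 then nem (- 1) (nu 0 1) else 0)"
    by (intro ext) (auto simp: NO_term_def nu_1 nem_1_large ops_zero)
  then have "nnem 0 1 = nem (- 1) (nu 0 1)" by (simp add: nnem_def NO_def)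
  moreover have "Pi_scale 2 x = x + x" for x
    using Pi.scale_left_distrib [of 1 1 x] by simp
  ultimately have nn: "nnem 0 1 = Pi_scale (1 / lam) (nu 0 (nu 0 1) + Pi_scale 2 (nu 0 1) + 1)"
    by (simp only: nem_nu nem ops_lin Pi.scale_right_distrib add_ac)
  have dd: "dnem 0 1 = Pi_scale (- 1 / lam) (nu 0 1 + 1)"
    by (simp add: dnem_def NO_nu_em_1 dcoef_0 em_nu_0_1 Pi.scale_right_distrib)
  show ?thesis unfolding gop_def nn dd by simp
qed

lemma hh_0_eq: "hh 0 p = Pi_scale 2 (nu 0 p) - Pi_scale k p"
  by (simp add: hh_def nu_def Pi_c_simps Pi.scale_right_distrib algebra_simps flip: Pi.scale_left_distrib)

text \<open>The source of k/4. In terms of nu(0)^2 1, nu(0) 1 and 1, the first two coefficients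
  cancel, and the third is k + k^2/2 = 2 (k + 2) k/4.\<close>

lemma casimir_1:
  "Pi_scale lam (gop 0 1) + ep 0 (gop 0 1) + Pi_scale (1 / 2) (hh 0 (hh 0 1)) = Pi_scale (2 * (k + 2) * (k / 4)) 1"
proof -
  define A B where "A = nu 0 (nu 0 1)" and "B = nu 0 1"
  define c where "c x y z = Pi_scale x A + Pi_scale y B + Pi_scale z 1" for x y z
  have c_add: "c x y z + c x' y' z' = c (x + x') (y + y') (z + z')" for x y z x' y' z'
    by (simp only: c_def Pi.scale_left_distrib add_ac)
  have c_scale: "Pi_scale a (c x y z) = c (a * x) (a * y) (a * z)" for a x y z
    by (simp only: c_def Pi.scale_right_distrib Pi.scale_scale)
  have gop: "Pi_scale lam (gop 0 1) = c (- 1) (k - 1) k"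
  proof -
    have "Pi_scale lam (gop 0 1) = Pi_scale (- 1) (c 1 2 1) + Pi_scale (k + 1) (c 0 1 1)"
      unfolding gop_0_1 Pi.scale_right_distrib [of lam] A_def B_def c_def using lam by simp
    then show ?thesis unfolding c_scale c_add by simp
  qed
  have hh: "hh 0 1 = c 0 2 (- k)" by (simp add: hh_0_eq c_def A_def B_def)
  have hhh: "hh 0 (hh 0 1) = c 4 (- 4 * k) (k * k)"
  proof -
    have "hh 0 (hh 0 1) = Pi_scale 2 (c 2 (- k) 0) + Pi_scale (- k) (c 0 2 (- k))"
      unfolding hh unfolding c_def hh_0_eq A_def B_def by (simp add: ops_lin)
    then show ?thesis unfolding c_scale c_add by simp
  qed
  have ep: "ep 0 (gop 0 1) = c (- 1 + 0) (k - 1 + 2) (k + - k)"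
    using ep_gop [of 0 0 1] unfolding c_add [symmetric] gop [symmetric] hh [symmetric] by (simp add: ep_0_1 ops_scale)
  have "Pi_scale lam (gop 0 1) + ep 0 (gop 0 1) + Pi_scale (1 / 2) (hh 0 (hh 0 1)) = c 0 0 (2 * (k + 2) * (k / 4))"
  proof -
    have "- 1 + (- 1 + 0) + 1 / 2 * 4 = (0 :: complex)" "k - 1 + (k - 1 + 2) + 1 / 2 * (- 4 * k) = 0"
      "k + (k + - k) + 1 / 2 * (k * k) = 2 * (k + 2) * (k / 4)"
      by (simp_all add: field_simps)
    then show ?thesis unfolding hhh unfolding gop ep c_scale c_add by (simp only:)
  qed
  then show ?thesis by (simp add: c_def)
qed

end

context free_field_realization
begin

abbreviation wv where "wv \<equiv> tens V vh 1"

lemma wv_carrier: "wv \<in> carrier T"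
  by (simp add: vh)

lemma act_E_wv: "n \<ge> 0 \<Longrightarrow> act M (E n) wv = (if n = 0 then lam else 0) \<odot>\<^bsub>M\<^esub> wv"
  using vh by (cases "n = 0") (simp_all add: act_E_tens ep_0_1 ep_1 tens_smult_right)

lemma act_K_wv: "act M K wv = k \<odot>\<^bsub>M\<^esub> wv"
  by (simp add: act_K)

lemma comp_act_F_wv:
  assumes "n \<ge> 0"
  shows "comp u (act M (F n) wv) = Pi_scale (coord u vh) (if n = 0 then Pi_scale ((k + 2) * hw / lam) 1 + gop 0 1 else 0)"
proof -
  have "Pi_scale (coord u (LL j vh)) (em (n - 2 - j) 1) = (if j = 0 then if n = 0 then Pi_scale (coord u vh) (Pi_scale (hw / lam) 1) else 0 else 0)" for j
  proof (cases "j > 0")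
    case True
    then show ?thesis by (simp add: L_vh coord_zero)
  next
    case False
    then show ?thesis using assms vh by (cases "j = 0") (auto simp: L_vh coord_smult em_1 em_m2_1 mult.commute)
  qed
  then have "Sum_any (\<lambda>j. Pi_scale (coord u (LL j vh)) (em (n - 2 - j) 1)) = (if n = 0 then Pi_scale (coord u vh) (Pi_scale (hw / lam) 1) else 0)"
    by simp
  then show ?thesis
    using assms vh by (auto simp: comp_act_F rho_gop_pos Pi.scale_right_distrib mult.commute mult.left_commute)
qed

lemma act_F_wv: "n \<ge> 1 \<Longrightarrow> act M (F n) wv = \<zero>\<^bsub>M\<^esub>"
  by (rule T_eqI) (use tlinD(1) [OF tlin_act wv_carrier] comp_act_F_wv [of n] in auto)

lemma act_F_0_wv: "act M (F 0) wv = tens V vh (Pi_scale ((k + 2) * hw / lam) 1 + gop 0 1)"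
  by (rule T_eqI) (use tlinD(1) [OF tlin_act wv_carrier] comp_act_F_wv [of 0] vh in \<open>auto simp: comp_tens\<close>)

text \<open>omega enters through f(0) only, as (k + 2) hw / lam on \<open>wv\<close>, once in f(0)
  e(0) and once in e(0) f(0); the rest is \<open>casimir_1\<close>.\<close>

lemma casimir_wv:
  "act M (F 0) (act M (E 0) wv) \<oplus>\<^bsub>M\<^esub> act M (E 0) (act M (F 0) wv) \<oplus>\<^bsub>M\<^esub> (1 / 2) \<odot>\<^bsub>M\<^esub> act M (H 0) (act M (H 0) wv)
    = (2 * (k + 2) * (hw + k / 4)) \<odot>\<^bsub>M\<^esub> wv"
proof -
  have FE: "act M (F 0) (act M (E 0) wv) = lam \<odot>\<^bsub>T\<^esub> act M (F 0) wv"
    using act_E_wv [of 0] tlinD(3) [OF tlin_act wv_carrier] by simp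
  have "act M (F 0) (act M (E 0) wv) \<oplus>\<^bsub>M\<^esub> act M (E 0) (act M (F 0) wv) \<oplus>\<^bsub>M\<^esub> (1 / 2) \<odot>\<^bsub>M\<^esub> act M (H 0) (act M (H 0) wv)
    = tens V vh (Pi_scale (2 * (k + 2) * hw) 1 + (Pi_scale lam (gop 0 1) + ep 0 (gop 0 1) + Pi_scale (1 / 2) (hh 0 (hh 0 1))))"
  proof -
    have sum: "Pi_scale lam (Pi_scale (y / lam) 1 + gop 0 1) + ep 0 (Pi_scale (y / lam) 1 + gop 0 1) + z
      = Pi_scale (y + y) 1 + (Pi_scale lam (gop 0 1) + ep 0 (gop 0 1) + z)" for y z
    proof -
      have "lam * (y / lam) = y" "y / lam * lam = y" using lam by simp_all
      then show ?thesis
        by (simp only: ops_add ops_scale ep_0_1 Pi.scale_right_distrib Pi.scale_left_distrib Pi.scale_scale add_ac)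
    qed
    have "act M (F 0) (act M (E 0) wv) \<oplus>\<^bsub>M\<^esub> act M (E 0) (act M (F 0) wv) \<oplus>\<^bsub>M\<^esub> (1 / 2) \<odot>\<^bsub>M\<^esub> act M (H 0) (act M (H 0) wv)
      = tens V vh (Pi_scale lam (Pi_scale ((k + 2) * hw / lam) 1 + gop 0 1) + ep 0 (Pi_scale ((k + 2) * hw / lam) 1 + gop 0 1) + Pi_scale (1 / 2) (hh 0 (hh 0 1)))"
    proof -
      have "lam \<odot>\<^bsub>T\<^esub> tens V vh p \<oplus>\<^bsub>T\<^esub> act M (E 0) (tens V vh p) \<oplus>\<^bsub>T\<^esub> (1 / 2) \<odot>\<^bsub>T\<^esub> act M (H 0) (act M (H 0) wv)
        = tens V vh (Pi_scale lam p + ep 0 p + Pi_scale (1 / 2) (hh 0 (hh 0 1)))" for p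
        using vh by (simp add: act_E_tens act_H_tens tens_smult_right tens_add_right)
      then show ?thesis unfolding FE act_F_0_wv M_simps .
    qed
    moreover have "(k + 2) * hw + (k + 2) * hw = 2 * (k + 2) * hw" by simp
    ultimately show ?thesis unfolding sum by (simp only:)
  qed
  also have "\<dots> = tens V vh (Pi_scale (2 * (k + 2) * (hw + k / 4)) 1)"
    unfolding casimir_1 by (simp add: distrib_left flip: Pi.scale_left_distrib)
  finally show ?thesis using vh by (simp add: tens_smult_right)
qed

lemma wv_nonzero: "wv \<noteq> \<zero>\<^bsub>M\<^esub>"
proof
  assume "wv = \<zero>\<^bsub>M\<^esub>"
  then have "Pi_scale (coord u vh) 1 = 0" for u using comp_tens [OF vh(1), of u 1] by simp
  then have "sec vh = 0" by (intro poly_mapping_eqI) (simp add: coord_def)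
  then have "vh = q 0" using q_sec [OF vh(1)] by simp
  also have "\<dots> = \<zero>\<^bsub>V\<^esub>" using q_fscale [of 0 0] V.smult_l_null [of "q 0"] by simp
  finally show False using vh by simp
qed

lemma comp_finite_support: "t \<in> carrier T \<Longrightarrow> finite {u. comp u t \<noteq> 0}"
proof -
  assume "t \<in> carrier T"
  then obtain g where "\<forall>u. lookup g u = comp u t" using assemble_comp by blast
  then show ?thesis using finite_lookup [of g] by simp
qed

lemma comp_bound:
  assumes "t \<in> carrier T"
  shows "\<exists>r::nat. \<forall>u. bnd (int r) (comp u t)"
proof -
  let ?S = "{u. comp u t \<noteq> 0}"
  have "\<exists>R. \<forall>u. bnd (R u) (comp u t)" by (intro choice allI bnd_exists)
  then obtain R where R: "\<And>u. bnd (R u) (comp u t)" by blast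
  define r where "r = (\<Sum>u\<in>?S. nat (R u))"
  have "bnd (int r) (comp u t)" for u
  proof (cases "u \<in> ?S")
    case True
    then have "nat (R u) \<le> r" unfolding r_def using comp_finite_support [OF assms] by (intro member_le_sum) auto
    then show ?thesis using bnd_mono [OF R] by (simp add: nat_le_iff)
  qed simp
  then show ?thesis by blast
qed

lemma annihilated_vacuum:
  assumes "\<And>n. n > 0 \<Longrightarrow> ep n y = 0" "\<And>n. n > 0 \<Longrightarrow> hh n y = 0"
  shows "y = single 0 (lookup y 0)"
proof (rule vacuum_eq)
  fix j :: int assume j: "j > 0"
  show c: "Pi_c j y = 0" by (rule ep_annihilated [OF assms(1) j])
  show "Pi_d j y = 0" using assms(2) [OF j] by (simp add: hh_def c)
qed

lemma simple_M:
  assumes N: "subrep N M" "N \<noteq> {\<zero>\<^bsub>M\<^esub>}"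
  shows "N = carrier M"
proof -
  have sub: "N \<subseteq> carrier T" "\<zero>\<^bsub>T\<^esub> \<in> N" "\<And>t t'. t \<in> N \<Longrightarrow> t' \<in> N \<Longrightarrow> t \<oplus>\<^bsub>T\<^esub> t' \<in> N"
    "\<And>a t. t \<in> N \<Longrightarrow> a \<odot>\<^bsub>T\<^esub> t \<in> N" "\<And>x t. t \<in> N \<Longrightarrow> act M x t \<in> N"
    using N(1) by (auto simp: subrep_def submodule_iff [OF cmodule_M])
  obtain t0 where t0: "t0 \<in> N" "t0 \<noteq> \<zero>\<^bsub>T\<^esub>" using N(2) sub(2) by auto
  have comp_E: "comp u (act M (E n) t) = ep n (comp u t)" and comp_H: "comp u (act M (H n) t) = hh n (comp u t)" if "t \<in> carrier T" for u n t
    using that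
    by (induction t rule: T_induct)
      (simp_all add: act_E_tens act_H_tens comp_tens ops_lin tlinD(1,2) [OF tlin_act] comp_add)
  \<comment> \<open>The weight is bounded for all coordinates at once, because \<open>N\<close>
    gives no access to a single coordinate of its elements.\<close>
  define P where "P r t \<longleftrightarrow> t \<in> N \<and> t \<noteq> \<zero>\<^bsub>T\<^esub> \<and> (\<forall>u. bnd (int r) (comp u t))" for r t
  obtain r0 where "P r0 t0" using comp_bound [of t0] t0 sub(1) by (auto simp: P_def)
  define r where "r = (LEAST r. \<exists>t. P r t)"
  have "\<exists>t. P r t" unfolding r_def by (rule LeastI_ex) (use \<open>P r0 t0\<close> in blast)
  then obtain t1 where t1: "P r t1" ..
  have min: "t = \<zero>\<^bsub>T\<^esub>" if "t \<in> N" "\<And>u. bnd (int r - n) (comp u t)" "n > 0" for t n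
  proof (rule ccontr)
    assume t: "t \<noteq> \<zero>\<^bsub>T\<^esub>"
    show False
    proof (cases "int r - n < 0")
      case True
      then have "comp u t = 0" for u using bnd_negative [OF that(2)] by simp
      then show False using t T_eqI [of t "\<zero>\<^bsub>T\<^esub>"] that(1) sub(1) by auto
    next
      case False
      then have "P (nat (int r - n)) t" using that t by (simp add: P_def)
      then have "r \<le> nat (int r - n)" unfolding r_def by (intro Least_le) blast
      then show False using False \<open>n > 0\<close> by simp
    qed
  qed
  have vac: "comp u t = single 0 (lookup (comp u t) 0)" if t: "P r t" for t u
  proof (rule annihilated_vacuum)
    fix n :: int assume n: "n > 0"
    have tN: "t \<in> N" "t \<in> carrier T" and b: "\<And>u. bnd (int r) (comp u t)" using t sub(1) by (auto simp: P_def)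
    have "bnd (int r - n) (comp u (act M (E n) t))" "bnd (int r - n) (comp u (act M (H n) t))" for u
      using graded_bnd [OF fldD [OF fld_ep] b, of n u] graded_bnd [OF fldD [OF fld_hh] b, of n u] by (simp_all add: comp_E comp_H tN)
    then have "act M (E n) t = \<zero>\<^bsub>T\<^esub>" "act M (H n) t = \<zero>\<^bsub>T\<^esub>"
      using n tN sub(5) by (intro min [where n = n]; simp)+
    then show "ep n (comp u t) = 0" "hh n (comp u t) = 0"
      using comp_E [OF tN(2), of u n] comp_H [OF tN(2), of u n] by simp_all
  qed
  \<comment> \<open>Among the elements of minimal weight the degree in d is minimised next, again
    over all coordinates simultaneously.\<close>
  define Q where "Q s t \<longleftrightarrow> P r t \<and> (\<forall>u. degree (lookup (comp u t) 0) \<le> s)" for s t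
  have "\<exists>s. Q s t1"
  proof -
    let ?S = "{u. comp u t1 \<noteq> 0}"
    have "finite ?S" using t1 sub(1) by (intro comp_finite_support) (auto simp: P_def)
    then have "degree (lookup (comp u t1) 0) \<le> (\<Sum>u\<in>?S. degree (lookup (comp u t1) 0))" for u
      by (cases "u \<in> ?S") (auto intro: member_le_sum)
    then show ?thesis using t1 by (auto simp: Q_def)
  qed
  then have ex: "\<exists>s t. Q s t" by blast
  define s where "s = (LEAST s. \<exists>t. Q s t)"
  have "\<exists>t. Q s t" unfolding s_def by (rule LeastI_ex [OF ex])
  then obtain t where t: "Q s t" ..
  have tP: "P r t" and tN: "t \<in> N" "t \<in> carrier T" "t \<noteq> \<zero>\<^bsub>T\<^esub>" using t sub(1) by (auto simp: Q_def P_def)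
  define p where "p u = lookup (comp u t) 0" for u
  have comp_t: "comp u t = single 0 (p u)" for u using vac [OF tP] by (simp add: p_def)
  \<comment> \<open>In each coordinate this is lambda times a difference as in
    \<open>degree_shift_diff\<close>, so minimality of s forces it to vanish.\<close>
  let ?t' = "act M (E 0) t \<oplus>\<^bsub>T\<^esub> (- lam) \<odot>\<^bsub>T\<^esub> t"
  have t'N: "?t' \<in> N" by (intro sub(3) sub(4) sub(5) tN)
  have t': "?t' \<in> N" "?t' \<in> carrier T" by (rule t'N, rule subsetD [OF sub(1) t'N])
  have comp_t': "comp u ?t' = single 0 (Polynomial.smult lam (pcompose (p u) [:- 2, 1:] - p u))" for u
  proof -
    have "ep 0 (single 0 (p u)) = single 0 (Polynomial.smult lam (pcompose (p u) [:- 2, 1:]))"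
      using exp_single_0 [of 1 "p u"] by simp
    then show ?thesis
      using tN sub(5) [OF tN(1), of "E 0"] sub(1) by (subst comp_add) (auto simp: comp_smult comp_E comp_t smult_diff_right simp flip: single_add single_diff)
  qed
  have "?t' = \<zero>\<^bsub>T\<^esub>"
  proof (rule ccontr)
    assume nz: "?t' \<noteq> \<zero>\<^bsub>T\<^esub>"
    have bnd0: "bnd (int r) (comp u ?t')" for u
      unfolding comp_t' by (auto simp: bnd_def)
    then have P': "P r ?t'" using nz t' by (simp add: P_def)
    have deg: "degree (lookup (comp u ?t') 0) \<le> s - 1 \<and> (s = 0 \<longrightarrow> comp u ?t' = 0)" for u
    proof (cases "degree (p u) = 0")
      case True
      then obtain a where "p u = [:a:]" by (metis degree_eq_zeroE)
      then show ?thesis by (simp add: comp_t' pcompose_pCons)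
    next
      case False
      then have "degree (p u) > 0" by simp
      from degree_shift_diff [OF this, of "- 2"] have "degree (Polynomial.smult lam (pcompose (p u) [:- 2, 1:] - p u)) < degree (p u)"
        using lam by simp
      moreover have "degree (p u) \<le> s" using t by (simp add: Q_def p_def)
      ultimately show ?thesis using False by (auto simp: comp_t')
    qed
    show False
    proof (cases "s = 0")
      case True
      then show False using nz deg T_eqI [OF t'(2) T.zero_closed] by simp
    next
      case False
      have "Q (s - 1) ?t'" using P' deg by (simp add: Q_def)
      then have "s \<le> s - 1" unfolding s_def by (intro Least_le) blast
      then show False using False by simp
    qed
  qed
  then have "lookup (single (0 :: heis_var \<Rightarrow>\<^sub>0 nat) (Polynomial.smult lam (pcompose (p u) [:- 2, 1:] - p u))) 0 = 0" for u
    using comp_t' [of u] by simp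
  then have "pcompose (p u) [:- 2, 1:] = p u" for u
    using lam by simp
  then have const: "p u = [:poly (p u) 0:]" for u by (rule poly_periodic_const)
  obtain g where g: "t = assemble g" "\<And>u. lookup g u = comp u t" using assemble_comp [OF tN(2)] by auto
  \<comment> \<open>All coordinates are constants, so t is the pure tensor of q(y) and 1.\<close>
  define y where "y = Poly_Mapping.map (\<lambda>a. poly (lookup a 0) 0) g"
  have ly: "lookup y u = poly (p u) 0" for u by (simp add: y_def lookup_map g(2) p_def)
  have "g = Poly_Mapping.map (\<lambda>a. Pi_scale a 1) y"
  proof (rule poly_mapping_eqI)
    fix u
    have "Pi_scale (poly (p u) 0) 1 = single 0 [:poly (p u) 0:]"
      by (simp flip: single_one)
    then show "lookup g u = lookup (Poly_Mapping.map (\<lambda>a. Pi_scale a 1) y) u"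
      using const [of u] by (simp add: lookup_map ly g(2) comp_t)
  qed
  then have tq: "t = tens V (q y) 1" using g(1) assemble_tens by simp
  define U where "U = {v \<in> carrier V. tens V v 1 \<in> N}"
  have all: "tens V v p \<in> N" if "v \<in> U" for v p
  proof (rule Pi_cyclic)
    show "tens V v 1 \<in> N" using that by (simp add: U_def)
    have v: "v \<in> carrier V" using that by (simp add: U_def)
    fix p p' assume p: "tens V v p \<in> N"
    show "tens V v (p + p') \<in> N" if "tens V v p' \<in> N" using sub(3) [OF p that] v by (simp add: tens_add_right)
    show "tens V v (Pi_scale a p) \<in> N" for a using sub(4) [OF p] v by (simp add: tens_smult_right)
    show "tens V v (ep n p) \<in> N" "tens V v (hh n p) \<in> N" for n
      using sub(5) [OF p, of "E n"] sub(5) [OF p, of "H n"] v by (simp_all add: act_E_tens act_H_tens)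
  qed
  have sums: "(\<Oplus>\<^bsub>T\<^esub>i\<in>A. f i) \<in> N" if "finite A" "\<And>i. i \<in> A \<Longrightarrow> f i \<in> N" for A :: "int set" and f
    using that
  proof (induction A rule: finite_induct)
    case (insert i A)
    then have "f \<in> A \<rightarrow> carrier T" "f i \<in> carrier T" using sub(1) by auto
    then show ?case using insert sub(3) by simp
  qed (simp add: sub(2))
  \<comment> \<open>Descending induction on n. In f(n) applied to v tensor 1, em(n - 2 - j) kills 1
    for j < n, the term j = n is (k + 2)/lam times L(n) v tensor 1, and the terms with j > n already
    lie in \<open>N\<close>.\<close>
  have LU: "LL n v \<in> U" if v: "v \<in> U" for n v
  proof -
    have vV: "v \<in> carrier V" using v by (simp add: U_def)
    obtain B :: int where B: "\<And>n. n > B \<Longrightarrow> LL n v = \<zero>\<^bsub>V\<^esub>" using smooth [OF vV] by blast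
    have "LL n v \<in> U" for n
    proof (induction "nat (B - n)" arbitrary: n rule: less_induct)
      case less
      show ?case
      proof (cases "LL n v = \<zero>\<^bsub>V\<^esub>")
        case True
        then show ?thesis using sub(2) by (simp add: U_def)
      next
        case False
        then have n: "n \<le> B" using B [of n] by force
        let ?f = "\<lambda>j. tens V (LL j v) (em (n - 2 - j) 1)" and ?S = "{j. LL j v \<noteq> \<zero>\<^bsub>V\<^esub> \<and> em (n - 2 - j) 1 \<noteq> 0}"
        have S: "finite ?S" by (rule LL_em_finite [OF vV])
        have fc: "?f \<in> ?S - {n} \<rightarrow> carrier T" "?f n \<in> carrier T" using vV by auto
        have nS: "n \<in> ?S" using False lam by (simp add: em_m2_1)
        have rest: "(\<Oplus>\<^bsub>T\<^esub>j\<in>?S - {n}. ?f j) \<in> N"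
        proof (rule sums)
          fix j assume j: "j \<in> ?S - {n}"
          then have "j > n" using em_1 [of "n - 2 - j"] by force
          moreover have "j \<le> B" using j B [of j] by force
          ultimately have "LL j v \<in> U" by (intro less) simp
          then show "?f j \<in> N" by (rule all)
        qed (use S in simp)
        have X: "(k + 2) \<odot>\<^bsub>T\<^esub> (\<Oplus>\<^bsub>T\<^esub>j\<in>?S. ?f j) \<oplus>\<^bsub>T\<^esub> tens V v (gop n 1) \<in> N"
          using sub(5) [OF all [OF v], of "F n" 1] unfolding tens_LL_em(2) [OF vV] .
        have split: "(\<Oplus>\<^bsub>T\<^esub>j\<in>?S. ?f j) = ?f n \<oplus>\<^bsub>T\<^esub> (\<Oplus>\<^bsub>T\<^esub>j\<in>?S - {n}. ?f j)"
          using T.finsum_insert [of "?S - {n}" n ?f] S fc nS by (simp add: insert_absorb)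
        let ?g = "(k + 2) \<odot>\<^bsub>T\<^esub> (\<Oplus>\<^bsub>T\<^esub>j\<in>?S. ?f j) \<oplus>\<^bsub>T\<^esub> tens V v (gop n 1)
            \<oplus>\<^bsub>T\<^esub> (- 1) \<odot>\<^bsub>T\<^esub> tens V v (gop n 1) \<oplus>\<^bsub>T\<^esub> (- (k + 2)) \<odot>\<^bsub>T\<^esub> (\<Oplus>\<^bsub>T\<^esub>j\<in>?S - {n}. ?f j)"
        have gN: "?g \<in> N" by (intro sub(3) X sub(4) all v rest)
        have "?g = (k + 2) \<odot>\<^bsub>T\<^esub> ?f n"
        proof (rule T_eqI)
          show "?g \<in> carrier T" using gN sub(1) by blast
          fix u
          show "comp u ?g = comp u ((k + 2) \<odot>\<^bsub>T\<^esub> ?f n)"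
            unfolding split using fc vV rest sub(1) T.finsum_closed [OF fc(1)]
            by (simp add: comp_add comp_smult Pi.scale_right_distrib algebra_simps)
        qed (use fc in simp)
        then have "(lam / (k + 2)) \<odot>\<^bsub>T\<^esub> ((k + 2) \<odot>\<^bsub>T\<^esub> ?f n) \<in> N" using gN sub(4) by simp
        then have "tens V (LL n v) 1 \<in> N"
          using level lam vV by (simp add: em_m2_1 add_eq_0_iff2 flip: tens_smult_right)
        then show ?thesis using vV by (simp add: U_def)
      qed
    qed
    then show ?thesis .
  qed
  have "subrep U V"
    unfolding subrep_def submodule_iff [OF V.module_axioms]
  proof (intro conjI ballI allI)
    show "U \<subseteq> carrier V" "\<zero>\<^bsub>V\<^esub> \<in> U" using sub(2) by (auto simp: U_def)
    fix v assume v: "v \<in> U"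
    show "v \<oplus>\<^bsub>V\<^esub> v' \<in> U" if "v' \<in> U" for v' using v that sub(3) by (simp add: U_def tens_add_left)
    show sm: "a \<odot>\<^bsub>V\<^esub> v \<in> U" for a using v sub(4) by (simp add: U_def tens_smult_left)
    show "act V x v \<in> U" for x
      using LU [OF v] sm C [of v] v by (cases x) (auto simp: U_def)
  qed
  moreover have "U \<noteq> {\<zero>\<^bsub>V\<^esub>}"
  proof
    assume "U = {\<zero>\<^bsub>V\<^esub>}"
    moreover have "q y \<in> U" using tN(1) tq by (simp add: U_def)
    ultimately have "q y = \<zero>\<^bsub>V\<^esub>" by blast
    then show False using tq tN(3) by simp
  qed
  ultimately have UV: "U = carrier V" by (rule simple)
  have "t \<in> N" if "t \<in> carrier T" for t
    using that by (induction t rule: T_induct) (simp_all add: all UV sub(3))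
  then show ?thesis using sub(1) by auto
qed

end

section \<open>Complements and functionals\<close>

text \<open>A basis of \<open>J\<close> is extended to the whole space, and the projection sends the
  basis of \<open>J\<close> to zero and fixes the added vectors.\<close>

lemma projection_exists:
  fixes J :: "('a \<Rightarrow>\<^sub>0 complex) set"
  assumes J: "free.subspace J"
  shows "\<exists>P. lin fscale fscale P \<and> (\<forall>y\<in>J. P y = 0) \<and> (\<forall>y. y - P y \<in> J)"
proof -
  interpret vector_space_pair "fscale :: complex \<Rightarrow> ('a \<Rightarrow>\<^sub>0 complex) \<Rightarrow> _" "fscale :: complex \<Rightarrow> ('a \<Rightarrow>\<^sub>0 complex) \<Rightarrow> _" ..
  obtain B where B: "B \<subseteq> J" "free.independent B" "J \<subseteq> free.span B"
    using free.maximal_independent_subset [of J] by blast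
  let ?B' = "free.extend_basis B"
  have B': "B \<subseteq> ?B'" "free.independent ?B'" "free.span ?B' = UNIV"
    using free.extend_basis_superset [OF B(2)] free.independent_extend_basis [OF B(2)] free.span_extend_basis [OF B(2)] by auto
  obtain P where P: "lin fscale fscale P" "\<And>x. x \<in> ?B' \<Longrightarrow> P x = (if x \<in> B then 0 else x)"
    using linear_independent_extend [OF B'(2), of "\<lambda>x. if x \<in> B then 0 else x"] by blast
  have "free.subspace {y. P y = 0}"
    by (simp add: free.subspace_def lin_zero [OF P(1)] lin_add [OF P(1)] lin_scale [OF P(1)])
  then have "free.span B \<subseteq> {y. P y = 0}" using P(2) B'(1) by (intro free.span_minimal) auto
  moreover have "free.subspace {y. y - P y \<in> J}"
  proof -
    have "x + y - P (x + y) \<in> J" if "x - P x \<in> J" "y - P y \<in> J" for x y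
      using free_subspaceD(2) [OF J that] by (simp add: lin_add [OF P(1)] add_diff_add)
    moreover have "fscale a x - P (fscale a x) \<in> J" if "x - P x \<in> J" for a x
      using free_subspaceD(4) [OF J that] by (simp add: lin_scale [OF P(1)] free.scale_right_diff_distrib)
    ultimately show ?thesis
      using free_subspaceD(1) [OF J] by (simp add: free.subspace_def lin_zero [OF P(1)])
  qed
  then have "free.span ?B' \<subseteq> {y. y - P y \<in> J}"
    using P(2) B(1) free_subspaceD(1) [OF J] by (intro free.span_minimal) auto
  ultimately show ?thesis using P(1) B(3) B'(3) by blast
qed

lemma (in presented) sectioned_exists: "\<exists>s. sectioned M q s"
proof -
  obtain P where P: "lin fscale fscale P" "\<And>y. y \<in> ker \<Longrightarrow> P y = 0" "\<And>y. y - P y \<in> ker"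
    using projection_exists [OF lidealD(1) [OF lideal_ker]] by blast
  define s where "s v = P (SOME y. q y = v)" for v
  have s: "s (q y) = P y" for y
  proof -
    have "q (SOME z. q z = q y) = q y" by (rule someI [of _ y]) simp
    then have "P ((SOME z. q z = q y) - y) = 0" by (intro P(2)) (simp add: q_eq_iff)
    then show ?thesis by (simp add: s_def lin_diff [OF P(1)])
  qed
  have "q (P y) = q y" for y using P(3) [of y] q_eq_iff [of y "P y"] by simp
  then have "sectioned M q s"
    by unfold_locales
      (auto simp: q_add q_scale carrier_eq s lin_add [OF P(1)] lin_scale [OF P(1)] simp flip: q_add q_scale)
  then show ?thesis by blast
qed

lemma free_field_realization_exists:
  assumes "k \<noteq> - 2" "lam \<noteq> 0"
  shows "\<exists>vh q sec. free_field_realization lam k (virasoro_irreducible (d_level k) h) h vh (q :: (virasoro list \<Rightarrow>\<^sub>0 complex) \<Rightarrow> _) sec"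
proof -
  obtain vh where vh: "highest_weight (virasoro_irreducible (d_level k) h) (d_level k) h vh"
    using highest_weight_irreducible by blast
  obtain q where "presented (virasoro_irreducible (d_level k) h) q"
    using virasoro_irreducible_presented by blast
  then obtain s where "sectioned (virasoro_irreducible (d_level k) h) q s"
    using presented.sectioned_exists by blast
  then have "free_field_realization lam k (virasoro_irreducible (d_level k) h) h vh q s"
    using vh assms by (intro free_field_realization.intro whittaker_parameters.intro free_field_realization_axioms.intro)
  then show ?thesis by blast
qed

section \<open>The Sugawara operator\<close>

abbreviation app (infixr "\<bullet>" 75) where "x \<bullet> y \<equiv> push ((#) x) y"

text \<open>f(j) - g(j) is the cost of exchanging two modes, the same for every j; each mode that
  changes sides of the cut contributes it once.\<close>

lemma cut_sum:
  fixes f g :: "int \<Rightarrow> complex"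
  assumes diff: "\<And>j. f j - g j = \<kappa>" and fin: "\<And>c. finite {j. (if j < c then f j else g j) \<noteq> 0}"
  shows "Sum_any (\<lambda>j. if j < c then f j else g j) = Sum_any (\<lambda>j. if j < 0 then f j else g j) + of_int c * \<kappa>"
proof -
  have step: "Sum_any (\<lambda>j. if j < c + 1 then f j else g j) = Sum_any (\<lambda>j. if j < c then f j else g j) + \<kappa>" for c
  proof -
    have "(\<lambda>j. if j < c + 1 then f j else g j) = (\<lambda>j. (if j < c then f j else g j) + (if j = c then \<kappa> else 0))"
      using diff by (auto simp: fun_eq_iff algebra_simps)
    then have "Sum_any (\<lambda>j. if j < c + 1 then f j else g j) = Sum_any (\<lambda>j. (if j < c then f j else g j) + (if j = c then \<kappa> else 0))"
      by (simp only:)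
    also have "\<dots> = Sum_any (\<lambda>j. if j < c then f j else g j) + \<kappa>" by (subst Sum_any.distrib [OF fin]) simp_all
    finally show ?thesis .
  qed
  show ?thesis
  proof (induction c rule: int_induct [where k = 0])
    case (step1 i)
    then show ?case unfolding step by (simp add: algebra_simps)
  next
    case (step2 i)
    then show ?case using step [of "i - 1"] by (simp add: algebra_simps)
  qed simp
qed

fun affine_degree :: "affine_sl2 \<Rightarrow> int" where
  "affine_degree (E n) = - n"
| "affine_degree (F n) = - n"
| "affine_degree (H n) = - n"
| "affine_degree K = 0"

lemma affine_bracket_degree:
  "z \<in> keys (affine_bracket x y) \<Longrightarrow> affine_degree z = affine_degree x + affine_degree y"
  by (cases x; cases y) (auto dest!: keys_add [THEN subsetD] keys_diff [THEN subsetD] split: if_splits)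

text \<open>What is left of 2 (k + 2) L_sug(0) on a vector killed by all positive modes.\<close>

definition casimir :: "(affine_sl2 list \<Rightarrow>\<^sub>0 complex)" where
  "casimir = single [F 0, E 0] 1 + single [E 0, F 0] 1 + single [H 0, H 0] (1 / 2)"

lemma bract_diff: "bract (b - b') y = bract b y - bract b' y"
  using bract_add [of b "- b'"] by (simp add: bract_minus)

locale affine_ideal =
  fixes lam k a :: complex and I :: "(affine_sl2 list \<Rightarrow>\<^sub>0 complex) set"
  assumes lam: "lam \<noteq> 0" and level: "k \<noteq> - 2"
    and lideal: "lideal I" and enveloping: "enveloping_relations affine_bracket \<subseteq> I"
    and E_rel: "n \<ge> 0 \<Longrightarrow> single [E n] 1 - single [] (if n = 0 then lam else 0) \<in> I"
    and F_rel: "n \<ge> 1 \<Longrightarrow> single [F n] 1 \<in> I"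
    and K_rel: "single [K] 1 - single [] k \<in> I"
    and casimir_rel: "casimir - single [] (2 * (k + 2) * a) \<in> I"
begin

lemmas sub = free_subspaceD [OF lidealD(1) [OF lideal]]
lemmas push_I = lidealD(2) [OF lideal]

lemma bracket: "x \<bullet> y \<bullet> w - y \<bullet> x \<bullet> w - bract (affine_bracket x y) w \<in> I"
  by (rule bracket_mem [OF lidealD(1) [OF lideal] enveloping])

text \<open>L_sug(0) y is an infinite sum of words. A functional that vanishes on \<open>I\<close>
  kills almost all of its terms and turns it into a finite sum of numbers;
  \<open>perp_separates\<close> leads back to membership in \<open>I\<close>.\<close>

definition perp :: "((affine_sl2 list \<Rightarrow>\<^sub>0 complex) \<Rightarrow> complex) \<Rightarrow> bool" where
  "perp \<phi> \<longleftrightarrow> (\<forall>x y. \<phi> (x + y) = \<phi> x + \<phi> y) \<and> (\<forall>c x. \<phi> (fscale c x) = c * \<phi> x) \<and> (\<forall>y\<in>I. \<phi> y = 0)"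

lemma perpD:
  assumes "perp \<phi>"
  shows "\<phi> (x + y) = \<phi> x + \<phi> y" "\<phi> (fscale c x) = c * \<phi> x" "y \<in> I \<Longrightarrow> \<phi> y = 0" "\<phi> (x - y) = \<phi> x - \<phi> y" "\<phi> (- x) = - \<phi> x" "\<phi> 0 = 0"
proof -
  show add: "\<phi> (x + y) = \<phi> x + \<phi> y" for x y using assms by (simp add: perp_def)
  show scale: "\<phi> (fscale c x) = c * \<phi> x" for c x using assms by (simp add: perp_def)
  show "y \<in> I \<Longrightarrow> \<phi> y = 0" using assms by (simp add: perp_def)
  show zero: "\<phi> 0 = 0" using scale [of 0 0] by simp
  show diff: "\<phi> (x - y) = \<phi> x - \<phi> y" for x y using add [of "x - y" y] by simp
  show "\<phi> (- x) = - \<phi> x" using diff [of 0 x] zero by simp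
qed

lemma perp_push: "perp \<phi> \<Longrightarrow> perp (\<lambda>y. \<phi> (x \<bullet> y))"
  using push_I by (simp add: perp_def push_add push_fscale)

lemma perp_separates:
  assumes "\<And>\<phi>. perp \<phi> \<Longrightarrow> \<phi> y = 0"
  shows "y \<in> I"
proof -
  obtain P where P: "lin fscale fscale P" "\<And>y. y \<in> I \<Longrightarrow> P y = 0" "\<And>y. y - P y \<in> I"
    using projection_exists [OF lidealD(1) [OF lideal]] by blast
  have "perp (\<lambda>y. lookup (P y) u)" for u
    by (simp add: perp_def lin_add [OF P(1)] lin_scale [OF P(1)] P(2) lookup_add lookup_map)
  then have "lookup (P y) u = 0" for u by (rule assms)
  then have "P y = 0" by (intro poly_mapping_eqI) simp
  then show ?thesis using P(3) [of y] by simp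
qed

lemma K_act: "K \<bullet> y - fscale k y \<in> I"
proof (induction y rule: poly_mapping_single_induct)
  case zero
  then show ?case using sub(1) by simp
next
  case (add p q)
  then show ?case using sub(2) [OF add] by (simp add: push_add free.scale_right_distrib add_diff_add)
next
  case (single u c)
  have "single (K # u) 1 - single u k \<in> I"
  proof (induction u)
    case Nil
    then show ?case using K_rel by simp
  next
    case (Cons x u)
    let ?u = "single u 1"
    have "K \<bullet> x \<bullet> ?u - x \<bullet> K \<bullet> ?u \<in> I" using bracket [of K x ?u] by (cases x) simp_all
    from sub(2) [OF this push_I [OF Cons, of x]] show ?case by (simp add: lin_diff [OF lin_push])
  qed
  then have "fscale c (single (K # u) 1 - single u k) \<in> I" by (rule sub)
  then show ?case by (simp add: free.scale_right_diff_distrib mult.commute)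
qed

context
  fixes \<phi> assumes \<phi>: "perp \<phi>"
begin

lemma phi_K: "\<phi> (K \<bullet> y) = k * \<phi> y"
  using perpD(3) [OF \<phi> K_act [of y]] by (simp add: perpD [OF \<phi>])

lemma phi_bracket: "\<phi> (x \<bullet> y \<bullet> w) = \<phi> (y \<bullet> x \<bullet> w) + \<phi> (bract (affine_bracket x y) w)"
  using perpD(3) [OF \<phi> bracket [of x y w]] unfolding perpD(4) [OF \<phi>] by (simp add: algebra_simps)

lemma phi_HE: "\<phi> (H n \<bullet> E i \<bullet> w) = \<phi> (E i \<bullet> H n \<bullet> w) + 2 * \<phi> (E (i + n) \<bullet> w)"
  and phi_HF: "\<phi> (H n \<bullet> F i \<bullet> w) = \<phi> (F i \<bullet> H n \<bullet> w) - 2 * \<phi> (F (i + n) \<bullet> w)"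
  and phi_EE: "\<phi> (E n \<bullet> E i \<bullet> w) = \<phi> (E i \<bullet> E n \<bullet> w)" and phi_FF: "\<phi> (F n \<bullet> F i \<bullet> w) = \<phi> (F i \<bullet> F n \<bullet> w)"
  unfolding phi_bracket [of "H n" "E i"] phi_bracket [of "H n" "F i"] phi_bracket [of "E n" "E i"] phi_bracket [of "F n" "F i"]
  by (auto simp: bract_add bract_minus bract_diff perpD [OF \<phi>] phi_K add.commute)

lemma phi_FE: "\<phi> (F n \<bullet> E i \<bullet> w) = \<phi> (E i \<bullet> F n \<bullet> w) - \<phi> (H (i + n) \<bullet> w) + (if n = - i then - of_int i * k * \<phi> w else 0)"
proof (cases "n = - i")
  case True
  show ?thesis unfolding phi_bracket [of "F n" "E i"] unfolding True by (simp add: bract_add bract_minus bract_diff perpD [OF \<phi>] phi_K)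
next
  case False
  then have "n + i \<noteq> 0" by simp
  then show ?thesis unfolding phi_bracket [of "F n" "E i"] using False by (simp add: bract_add bract_minus bract_diff perpD [OF \<phi>] phi_K add.commute)
qed

end

text \<open>h(n) with n >= 1 is [e(n - 1), f(1)], and both orders of the product kill the generator;
  for n = 1 because e(0) acts on it as a scalar.\<close>

lemma ann: "affine_degree x < 0 \<Longrightarrow> single [x] 1 \<in> I"
proof (cases x)
  case (H n)
  assume "affine_degree x < 0"
  then have n: "n \<ge> 1" using H by simp
  let ?w = "single [] 1"
  have b: "E (n - 1) \<bullet> F 1 \<bullet> ?w - F 1 \<bullet> E (n - 1) \<bullet> ?w - H n \<bullet> ?w \<in> I"
    using bracket [of "E (n - 1)" "F 1" ?w] n by (simp add: bract_add)
  have 1: "E (n - 1) \<bullet> F 1 \<bullet> ?w \<in> I" using push_I [OF F_rel [of 1], of "E (n - 1)"] by simp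
  have "F 1 \<bullet> (single [E (n - 1)] 1 - single [] (if n - 1 = 0 then lam else 0)) \<in> I"
    by (rule push_I [OF E_rel]) (use n in simp)
  moreover have "fscale (if n - 1 = 0 then lam else 0) (single [F 1] 1) \<in> I"
    by (rule sub(4) [OF F_rel]) simp
  ultimately have "F 1 \<bullet> (single [E (n - 1)] 1 - single [] (if n - 1 = 0 then lam else 0))
      + fscale (if n - 1 = 0 then lam else 0) (single [F 1] 1) \<in> I" by (rule sub(2))
  then have 2: "F 1 \<bullet> E (n - 1) \<bullet> ?w \<in> I" by (simp add: lin_diff [OF lin_push])
  have "E (n - 1) \<bullet> F 1 \<bullet> ?w - F 1 \<bullet> E (n - 1) \<bullet> ?w - (E (n - 1) \<bullet> F 1 \<bullet> ?w - F 1 \<bullet> E (n - 1) \<bullet> ?w - H n \<bullet> ?w) \<in> I"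
    by (rule sub(3) [OF sub(3) [OF 1 2] b])
  then show ?thesis by (simp add: H)
next
  case (E n)
  assume "affine_degree x < 0"
  then show ?thesis using E_rel [of n] E by simp
qed (use F_rel in auto)

lemma smooth_I: "\<exists>N::nat. \<forall>n>int N. E n \<bullet> y \<in> I \<and> F n \<bullet> y \<in> I \<and> H n \<bullet> y \<in> I"
proof -
  obtain N where N: "\<And>x. affine_degree x < N \<Longrightarrow> x \<bullet> y \<in> I"
    using smooth [where deg = affine_degree and y = y, OF lideal enveloping affine_bracket_degree ann] by blast
  show ?thesis by (rule exI [of _ "nat (- N)"]) (auto intro!: N)
qed

lemma finite_cut:
  fixes X Y :: "int \<Rightarrow> affine_sl2"
  assumes \<phi>: "perp \<phi>" and a: "\<And>n. n > N \<Longrightarrow> X n \<bullet> y \<in> I" and b: "\<And>n. n > N' \<Longrightarrow> Y n \<bullet> y \<in> I"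
  shows "finite {j. (if j < c then \<phi> (X j \<bullet> Y (m - j) \<bullet> y) else \<phi> (Y (m - j) \<bullet> X j \<bullet> y)) \<noteq> 0}"
proof -
  have "{j. (if j < c then \<phi> (X j \<bullet> Y (m - j) \<bullet> y) else \<phi> (Y (m - j) \<bullet> X j \<bullet> y)) \<noteq> 0} \<subseteq> {min c (m - N')..max c N}"
  proof
    fix j assume j: "j \<in> {j. (if j < c then \<phi> (X j \<bullet> Y (m - j) \<bullet> y) else \<phi> (Y (m - j) \<bullet> X j \<bullet> y)) \<noteq> 0}"
    show "j \<in> {min c (m - N')..max c N}"
    proof (cases "j < c")
      case True
      then have "Y (m - j) \<bullet> y \<notin> I" using j perpD(3) [OF \<phi> push_I] by auto
      then have "\<not> m - j > N'" using b by blast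
      then show ?thesis using True by auto
    next
      case False
      then have "X j \<bullet> y \<notin> I" using j perpD(3) [OF \<phi> push_I] by auto
      then have "\<not> j > N" using a by blast
      then show ?thesis using False by auto
    qed
  qed
  then show ?thesis using finite_subset by blast
qed

text \<open>The value of \<open>\<phi>\<close> at \<open>2 (k + 2) L\<^sub>s\<^sub>u\<^sub>g(0) y\<close>. As \<open>\<phi>\<close> vanishes on \<open>I\<close>, only finitely many terms of the normally ordered sum
  contribute; \<open>e(j) f(-j)\<close> and \<open>f(j) e(-j)\<close> have been combined, which leaves the term \<open>h(0)\<close>.\<close>

definition sug_term where
  "sug_term \<phi> y j = 2 * (if j < 0 then \<phi> (E j \<bullet> F (- j) \<bullet> y) else \<phi> (F (- j) \<bullet> E j \<bullet> y))
    + (if j < 0 then \<phi> (H j \<bullet> H (- j) \<bullet> y) else \<phi> (H (- j) \<bullet> H j \<bullet> y)) / 2"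

definition sug where "sug \<phi> y = Sum_any (sug_term \<phi> y) + \<phi> (H 0 \<bullet> y)"

lemma sug_term_support:
  assumes "perp \<phi>" "\<And>n. n > int N \<Longrightarrow> E n \<bullet> y \<in> I \<and> F n \<bullet> y \<in> I \<and> H n \<bullet> y \<in> I"
  shows "{j. sug_term \<phi> y j \<noteq> 0} \<subseteq> {- int N..int N}"
proof
  fix j assume j: "j \<in> {j. sug_term \<phi> y j \<noteq> 0}"
  show "j \<in> {- int N..int N}"
  proof (rule ccontr)
    assume "j \<notin> {- int N..int N}"
    then consider "j < 0" "- j > int N" | "j > int N" by fastforce
    then show False
      using j assms(2) [of j] assms(2) [of "- j"] perpD(3) [OF assms(1) push_I]
      by cases (auto simp: sug_term_def)
  qed
qed

lemma finite_sug_term: "perp \<phi> \<Longrightarrow> finite {j. sug_term \<phi> y j \<noteq> 0}"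
  using smooth_I [of y] sug_term_support finite_subset finite_atLeastAtMost_int by metis

text \<open>[L_sug(0), e(m)] = -m e(m). The commutators with the summands are e-h sums cut at 0, m +
  1 and m; by \<open>cut_sum\<close> they contribute -4m - 2, the term h(0) contributes 2 and the
  level -2km, together -2 (k + 2) m.\<close>

lemma sug_E:
  assumes \<phi>: "perp \<phi>"
  shows "sug \<phi> (E m \<bullet> y) = sug (\<lambda>y. \<phi> (E m \<bullet> y)) y - 2 * (k + 2) * of_int m * \<phi> (E m \<bullet> y)"
proof -
  note \<phi>' = perp_push [OF \<phi>]
  define s where "s c i = (if i < c then \<phi> (E i \<bullet> H (m - i) \<bullet> y) else \<phi> (H (m - i) \<bullet> E i \<bullet> y))" for c i
  obtain N where N: "\<And>n. n > int N \<Longrightarrow> E n \<bullet> y \<in> I \<and> F n \<bullet> y \<in> I \<and> H n \<bullet> y \<in> I" using smooth_I [of y] by blast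
  have fin: "finite {i. s c i \<noteq> 0}" for c
    unfolding s_def using N by (intro finite_cut [OF \<phi>, where N = "int N" and N' = "int N"]) auto
  have cut: "Sum_any (s c) = Sum_any (s 0) + of_int c * (- 2 * \<phi> (E m \<bullet> y))" for c
    unfolding s_def by (rule cut_sum [OF _ fin [unfolded s_def]]) (simp add: phi_HE [OF \<phi>])
  have fin1: "finite {j. s c (m - j) \<noteq> 0}" and fin2: "finite {j. s c (m + j) \<noteq> 0}" for c
    using finite_vimageI [OF fin [of c], of "\<lambda>j. m - j"] finite_vimageI [OF fin [of c], of "\<lambda>j. m + j"]
    by (simp_all add: inj_on_def vimage_def)
  have refl: "Sum_any (\<lambda>j. s c (m - j)) = Sum_any (s c)" for c
    by (rule Sum_any.reindex_cong [where l = "\<lambda>j. m - j", symmetric]) (auto intro!: bij_betw_byWitness [where f' = "\<lambda>j. m - j"])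
  have pw: "sug_term \<phi> (E m \<bullet> y) j = sug_term (\<lambda>y. \<phi> (E m \<bullet> y)) y j - 2 * s 0 j + s (m + 1) (m - j) + s m (m + j)
     + (if j = m then - 2 * of_int m * k * \<phi> (E m \<bullet> y) else 0)" for j
  proof (cases "j < 0")
    case True
    have 1: "\<phi> (E j \<bullet> F (- j) \<bullet> E m \<bullet> y) = \<phi> (E m \<bullet> E j \<bullet> F (- j) \<bullet> y) - \<phi> (E j \<bullet> H (m - j) \<bullet> y) + (if j = m then - of_int m * k * \<phi> (E m \<bullet> y) else 0)"
      using phi_FE [OF \<phi>' [of "E j"], of "- j" m y] by (auto simp: phi_EE [OF \<phi>, of j])
    have 2: "\<phi> (H j \<bullet> H (- j) \<bullet> E m \<bullet> y) = \<phi> (E m \<bullet> H j \<bullet> H (- j) \<bullet> y) + 2 * \<phi> (E (m + j) \<bullet> H (- j) \<bullet> y) + 2 * \<phi> (H j \<bullet> E (m - j) \<bullet> y)"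
      using phi_HE [OF \<phi>' [of "H j"], of "- j" m y] by (simp add: phi_HE [OF \<phi>, of j m])
    show ?thesis using True by (simp add: sug_term_def 1 2 s_def)
  next
    case False
    have 1: "\<phi> (F (- j) \<bullet> E j \<bullet> E m \<bullet> y) = \<phi> (E m \<bullet> F (- j) \<bullet> E j \<bullet> y) - \<phi> (H (m - j) \<bullet> E j \<bullet> y) + (if j = m then - of_int m * k * \<phi> (E m \<bullet> y) else 0)"
      using phi_FE [OF \<phi>, of "- j" m "E j \<bullet> y"] phi_EE [OF \<phi>' [of "F (- j)"], of j m y] by auto
    have 2: "\<phi> (H (- j) \<bullet> H j \<bullet> E m \<bullet> y) = \<phi> (E m \<bullet> H (- j) \<bullet> H j \<bullet> y) + 2 * \<phi> (E (m - j) \<bullet> H j \<bullet> y) + 2 * \<phi> (H (- j) \<bullet> E (m + j) \<bullet> y)"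
      using phi_HE [OF \<phi>' [of "H (- j)"], of j m y] by (simp add: phi_HE [OF \<phi>, of "- j" m])
    show ?thesis using False by (simp add: sug_term_def 1 2 s_def)
  qed
  note fs = finite_sug_term [OF \<phi>' [of "E m"], of y]
  have f2: "finite {j. 2 * s 0 j \<noteq> 0}" using fin [of 0] by simp
  have fd: "finite {j. f j - g j \<noteq> 0}" "finite {j. f j + g j \<noteq> 0}" if "finite {j. f j \<noteq> 0}" "finite {j. g j \<noteq> 0}" for f g :: "int \<Rightarrow> complex"
    by (rule finite_subset [OF _ finite_UnI [OF that]], auto)+
  have "Sum_any (sug_term \<phi> (E m \<bullet> y)) = Sum_any (sug_term (\<lambda>y. \<phi> (E m \<bullet> y)) y) - Sum_any (\<lambda>j. 2 * s 0 j) + Sum_any (s (m + 1)) + Sum_any (s m)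
      + (- 2 * of_int m * k * \<phi> (E m \<bullet> y))"
    unfolding pw [abs_def] refl [of "m + 1", symmetric] Sum_any_shift [of "s m" m, symmetric]
    by (subst Sum_any.distrib, intro fd fs f2 fin1 fin2, simp, subst Sum_any.distrib, intro fd fs f2 fin1 fin2, intro fin2,
        subst Sum_any.distrib, intro fd fs f2 fin1, intro fin1, subst Sum_any_diff, intro fs, intro f2, simp)
  also have "Sum_any (\<lambda>j. 2 * s 0 j) = 2 * Sum_any (s 0)"
    by (rule Sum_any_right_distrib [symmetric]) (rule fin)
  finally show ?thesis
    unfolding sug_def cut [of "m + 1"] cut [of m] phi_HE [OF \<phi>] by (simp add: algebra_simps)
qed

end

lemma lookup_push_Cons: "lookup (x \<bullet> y) u = (case u of [] \<Rightarrow> 0 | z # v \<Rightarrow> if z = x then lookup y v else 0)"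
  by (induction y rule: poly_mapping_single_induct)
    (auto simp: lookup_single push_add lookup_add when_def split: list.split)

text \<open>The element q(h(0)); the range of this map serves as \<open>top\<close> for the affine
  ideal.\<close>

definition H0_poly :: "complex poly \<Rightarrow> (affine_sl2 list \<Rightarrow>\<^sub>0 complex)" where
  "H0_poly q = (\<Sum>i\<le>degree q. single (replicate i (H 0)) (coeff q i))"

lemma lookup_H0_poly: "lookup (H0_poly q) u = (if u = replicate (length u) (H 0) then coeff q (length u) else 0)"
proof -
  have "lookup (H0_poly q) u = (\<Sum>i\<le>degree q. if i = length u then if u = replicate (length u) (H 0) then coeff q (length u) else 0 else 0)"
    unfolding H0_poly_def lookup_sum by (rule sum.cong) (auto simp: lookup_single when_def)
  then show ?thesis by (auto simp: coeff_eq_0)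
qed

lemma H0_poly_add: "H0_poly (p + q) = H0_poly p + H0_poly q"
  and H0_poly_diff: "H0_poly (p - q) = H0_poly p - H0_poly q"
  and H0_poly_smult: "H0_poly (Polynomial.smult c q) = fscale c (H0_poly q)"
  by (auto intro!: poly_mapping_eqI simp: lookup_H0_poly lookup_add lookup_minus lookup_map)

lemma H0_poly_pCons: "H0_poly (pCons c q) = single [] c + H 0 \<bullet> H0_poly q"
proof (rule poly_mapping_eqI)
  fix u
  show "lookup (H0_poly (pCons c q)) u = lookup (single [] c + H 0 \<bullet> H0_poly q) u"
    by (cases u) (simp_all add: lookup_H0_poly lookup_add lookup_single lookup_push_Cons)
qed

lemma H0_poly_0 [simp]: "H0_poly 0 = 0"
  by (simp add: H0_poly_def)

context affine_ideal
begin

text \<open>The computation of \<open>sug_E\<close> with the opposite sign of the h-weight; the term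
  h(0) in \<open>sug\<close> is now balanced by the cut 1 in place of 0.\<close>

lemma sug_F:
  assumes \<phi>: "perp \<phi>"
  shows "sug \<phi> (F m \<bullet> y) = sug (\<lambda>y. \<phi> (F m \<bullet> y)) y - 2 * (k + 2) * of_int m * \<phi> (F m \<bullet> y)"
proof -
  note \<phi>' = perp_push [OF \<phi>]
  define s where "s c i = (if i < c then \<phi> (F i \<bullet> H (m - i) \<bullet> y) else \<phi> (H (m - i) \<bullet> F i \<bullet> y))" for c i
  obtain N where N: "\<And>n. n > int N \<Longrightarrow> E n \<bullet> y \<in> I \<and> F n \<bullet> y \<in> I \<and> H n \<bullet> y \<in> I" using smooth_I [of y] by blast
  have fin: "finite {i. s c i \<noteq> 0}" for c
    unfolding s_def using N by (intro finite_cut [OF \<phi>, where N = "int N" and N' = "int N"]) auto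
  have cut: "Sum_any (s c) = Sum_any (s 0) + of_int c * (2 * \<phi> (F m \<bullet> y))" for c
    unfolding s_def by (rule cut_sum [OF _ fin [unfolded s_def]]) (simp add: phi_HF [OF \<phi>])
  have fin1: "finite {j. s c (m - j) \<noteq> 0}" and fin2: "finite {j. s c (m + j) \<noteq> 0}" and fin3: "finite {j. s c (- j) \<noteq> 0}" for c
    using finite_vimageI [OF fin [of c], of "\<lambda>j. m - j"] finite_vimageI [OF fin [of c], of "\<lambda>j. m + j"] finite_vimageI [OF fin [of c], of "\<lambda>j. - j"]
    by (simp_all add: inj_on_def vimage_def)
  have refl: "Sum_any (\<lambda>j. s c (x - j)) = Sum_any (s c)" for c x
    by (rule Sum_any.reindex_cong [where l = "\<lambda>j. x - j", symmetric]) (auto intro!: bij_betw_byWitness [where f' = "\<lambda>j. x - j"])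
  have FE: "\<phi>' (E j \<bullet> F m \<bullet> w) = \<phi>' (F m \<bullet> E j \<bullet> w) + \<phi>' (H (m + j) \<bullet> w) + (if j = - m then - of_int m * k * \<phi>' w else 0)"
    if "perp \<phi>'" for \<phi>' j w
    using phi_FE [OF that, of m j w] by (auto simp: add.commute)
  have pw: "sug_term \<phi> (F m \<bullet> y) j = sug_term (\<lambda>y. \<phi> (F m \<bullet> y)) y j + 2 * s 1 (- j) - s (m + 1) (m - j) - s m (m + j)
     + (if j = - m then - 2 * of_int m * k * \<phi> (F m \<bullet> y) else 0)" for j
  proof (cases "j < 0")
    case True
    have 1: "\<phi> (E j \<bullet> F (- j) \<bullet> F m \<bullet> y) = \<phi> (F m \<bullet> E j \<bullet> F (- j) \<bullet> y) + \<phi> (H (m + j) \<bullet> F (- j) \<bullet> y) + (if j = - m then - of_int m * k * \<phi> (F m \<bullet> y) else 0)"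
      using FE [OF \<phi>, of j "F (- j) \<bullet> y"] phi_FF [OF \<phi>' [of "E j"], of "- j" m y] by auto
    have 2: "\<phi> (H j \<bullet> H (- j) \<bullet> F m \<bullet> y) = \<phi> (F m \<bullet> H j \<bullet> H (- j) \<bullet> y) - 2 * \<phi> (F (m + j) \<bullet> H (- j) \<bullet> y) - 2 * \<phi> (H j \<bullet> F (m - j) \<bullet> y)"
      using phi_HF [OF \<phi>' [of "H j"], of "- j" m y] by (simp add: phi_HF [OF \<phi>, of j m])
    show ?thesis using True by (simp add: sug_term_def 1 2 s_def)
  next
    case False
    have 1: "\<phi> (F (- j) \<bullet> E j \<bullet> F m \<bullet> y) = \<phi> (F m \<bullet> F (- j) \<bullet> E j \<bullet> y) + \<phi> (F (- j) \<bullet> H (m + j) \<bullet> y) + (if j = - m then - of_int m * k * \<phi> (F m \<bullet> y) else 0)"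
      using FE [OF \<phi>' [of "F (- j)"], of j y] phi_FF [OF \<phi>, of "- j" m "E j \<bullet> y"] by auto
    have 2: "\<phi> (H (- j) \<bullet> H j \<bullet> F m \<bullet> y) = \<phi> (F m \<bullet> H (- j) \<bullet> H j \<bullet> y) - 2 * \<phi> (F (m - j) \<bullet> H j \<bullet> y) - 2 * \<phi> (H (- j) \<bullet> F (m + j) \<bullet> y)"
      using phi_HF [OF \<phi>' [of "H (- j)"], of j m y] by (simp add: phi_HF [OF \<phi>, of "- j" m])
    show ?thesis using False by (simp add: sug_term_def 1 2 s_def)
  qed
  note fs = finite_sug_term [OF \<phi>' [of "F m"], of y]
  have f2: "finite {j. 2 * s 1 (- j) \<noteq> 0}" using fin3 [of 1] by simp
  have fd: "finite {j. f j - g j \<noteq> 0}" "finite {j. f j + g j \<noteq> 0}" if "finite {j. f j \<noteq> 0}" "finite {j. g j \<noteq> 0}" for f g :: "int \<Rightarrow> complex"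
    by (rule finite_subset [OF _ finite_UnI [OF that]], auto)+
  have refl0: "Sum_any (\<lambda>j. s c (- j)) = Sum_any (s c)" for c using refl [of c 0] by simp
  have "Sum_any (sug_term \<phi> (F m \<bullet> y)) = Sum_any (sug_term (\<lambda>y. \<phi> (F m \<bullet> y)) y) + Sum_any (\<lambda>j. 2 * s 1 (- j)) - Sum_any (s (m + 1)) - Sum_any (s m)
      + (- 2 * of_int m * k * \<phi> (F m \<bullet> y))"
    unfolding pw [abs_def] refl [of "m + 1" m, symmetric] Sum_any_shift [of "s m" m, symmetric]
    by (subst Sum_any.distrib, intro fd fs f2 fin1 fin2, simp, subst Sum_any_diff, intro fd fs f2 fin1 fin2, intro fin2,
        subst Sum_any_diff, intro fd fs f2 fin1, intro fin1, subst Sum_any.distrib, intro fs, intro f2, simp)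
  also have "Sum_any (\<lambda>j. 2 * s 1 (- j)) = 2 * Sum_any (s 1)"
    unfolding refl0 [of 1, symmetric] by (rule Sum_any_right_distrib [symmetric]) (rule fin3)
  finally show ?thesis
    unfolding sug_def cut [of "m + 1"] cut [of m] cut [of 1] phi_HF [OF \<phi>] by (simp add: algebra_simps)
qed

lemma sug_diff: "perp \<phi> \<Longrightarrow> sug \<phi> (x - y) = sug \<phi> x - sug \<phi> y"
proof -
  assume \<phi>: "perp \<phi>"
  have "sug_term \<phi> (x - y) = (\<lambda>j. sug_term \<phi> x j - sug_term \<phi> y j)"
    by (rule ext) (simp add: sug_term_def lin_diff [OF lin_push] perpD(4) [OF \<phi>] algebra_simps diff_divide_distrib)
  then show ?thesis
    by (simp add: sug_def lin_diff [OF lin_push] perpD(4) [OF \<phi>] Sum_any_diff [OF finite_sug_term [OF \<phi>] finite_sug_term [OF \<phi>]])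
qed

lemma sug_I: "perp \<phi> \<Longrightarrow> y \<in> I \<Longrightarrow> sug \<phi> y = 0"
  by (simp add: sug_def sug_term_def [abs_def] perpD(3) push_I cong: if_cong)

lemma sug_diff_left: "perp \<phi> \<Longrightarrow> perp \<psi> \<Longrightarrow> sug (\<lambda>y. \<phi> y - \<psi> y) y = sug \<phi> y - sug \<psi> y"
proof -
  assume \<phi>: "perp \<phi>" and \<psi>: "perp \<psi>"
  have "sug_term (\<lambda>y. \<phi> y - \<psi> y) y = (\<lambda>j. sug_term \<phi> y j - sug_term \<psi> y j)"
    by (rule ext) (simp add: sug_term_def algebra_simps diff_divide_distrib)
  then show ?thesis
    by (simp add: sug_def Sum_any_diff [OF finite_sug_term [OF \<phi>] finite_sug_term [OF \<psi>]])
qed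

text \<open>h(m) = [e(m), f(0)] inherits the relation from e and f, and K acts as a scalar.\<close>

lemma sug_act:
  assumes \<phi>: "perp \<phi>"
  shows "sug \<phi> (x \<bullet> y) = sug (\<lambda>y. \<phi> (x \<bullet> y)) y + 2 * (k + 2) * of_int (affine_degree x) * \<phi> (x \<bullet> y)"
proof (cases x)
  case (E m)
  then show ?thesis using sug_E [OF \<phi>, of m y] by simp
next
  case (F m)
  then show ?thesis using sug_F [OF \<phi>, of m y] by simp
next
  case (H m)
  note \<phi>' = perp_push [OF \<phi>]
  have br: "E m \<bullet> F 0 \<bullet> w - F 0 \<bullet> E m \<bullet> w - H m \<bullet> w \<in> I" for w
    using bracket [of "E m" "F 0" w] by (simp add: bract_add cong: if_cong split: if_splits)
  have phi: "(\<lambda>w. \<phi> (H m \<bullet> w)) = (\<lambda>w. \<phi> (E m \<bullet> F 0 \<bullet> w) - \<phi> (F 0 \<bullet> E m \<bullet> w))"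
    using perpD(3) [OF \<phi> br] unfolding perpD(4) [OF \<phi>] by (simp add: fun_eq_iff)
  have "0 = sug \<phi> (E m \<bullet> F 0 \<bullet> y - F 0 \<bullet> E m \<bullet> y - H m \<bullet> y)" using sug_I [OF \<phi> br] by simp
  then have "sug \<phi> (H m \<bullet> y) = sug \<phi> (E m \<bullet> F 0 \<bullet> y) - sug \<phi> (F 0 \<bullet> E m \<bullet> y)"
    unfolding sug_diff [OF \<phi>] by simp
  also have "\<dots> = sug (\<lambda>w. \<phi> (H m \<bullet> w)) y - 2 * (k + 2) * of_int m * \<phi> (H m \<bullet> y)"
    unfolding phi sug_diff_left [OF perp_push [OF \<phi>'] perp_push [OF \<phi>']] fun_cong [OF phi, of y]
      sug_E [OF \<phi>] sug_F [OF \<phi>] sug_E [OF \<phi>'] sug_F [OF \<phi>']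
    by (simp add: algebra_simps)
  finally show ?thesis by (simp add: H)
next
  case K
  have "sug_term \<phi> (K \<bullet> y) = (\<lambda>j. k * sug_term \<phi> y j)"
  proof (rule ext)
    fix j
    show "sug_term \<phi> (K \<bullet> y) j = k * sug_term \<phi> y j"
      using phi_K [OF perp_push [OF perp_push [OF \<phi>]]] by (simp add: sug_term_def algebra_simps)
  qed
  moreover have "sug_term (\<lambda>y. \<phi> (K \<bullet> y)) y = (\<lambda>j. k * sug_term \<phi> y j)"
    by (rule ext) (simp add: sug_term_def phi_K [OF \<phi>] algebra_simps)
  moreover have "\<phi> (H 0 \<bullet> K \<bullet> y) = \<phi> (K \<bullet> H 0 \<bullet> y)"
    using phi_K [OF perp_push [OF \<phi>, of "H 0"], of y] by (simp add: phi_K [OF \<phi>])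
  ultimately show ?thesis by (simp add: K sug_def)
qed

lemma phi_E0_1: "perp \<phi> \<Longrightarrow> \<phi> (single [E 0] 1) = lam * \<phi> (single [] 1)"
  using perpD(3) [OF _ E_rel [of 0], of \<phi>] perpD(2) [of \<phi> lam "single [] 1"] by (simp add: perpD(4))

lemma phi_casimir:
  assumes \<phi>: "perp \<phi>"
  shows "\<phi> (F 0 \<bullet> E 0 \<bullet> single [] 1) + \<phi> (E 0 \<bullet> F 0 \<bullet> single [] 1) + \<phi> (H 0 \<bullet> H 0 \<bullet> single [] 1) / 2
    = 2 * (k + 2) * a * \<phi> (single [] 1)"
proof -
  have c: "casimir - single [] (2 * (k + 2) * a) = F 0 \<bullet> E 0 \<bullet> single [] 1 + E 0 \<bullet> F 0 \<bullet> single [] 1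
     + fscale (1 / 2) (H 0 \<bullet> H 0 \<bullet> single [] 1) - fscale (2 * (k + 2) * a) (single [] 1)"
    by (simp add: casimir_def)
  show ?thesis
    using perpD(3) [OF \<phi> casimir_rel] unfolding c perpD(1,2,4) [OF \<phi>] by simp
qed

text \<open>On the generator only j = 0 contributes, which is the Casimir relation; each further
  letter adds its degree by \<open>sug_act\<close>.\<close>

lemma sug_word: "perp \<phi> \<Longrightarrow> sug \<phi> (single u 1)
    = 2 * (k + 2) * (a + of_int (wdeg affine_degree u)) * \<phi> (single u 1)"
proof (induction u arbitrary: \<phi>)
  case Nil
  note \<phi> = Nil
  let ?w = "single [] 1"
  have z: "E n \<bullet> ?w \<in> I" "F n \<bullet> ?w \<in> I" "H n \<bullet> ?w \<in> I" if "n > 0" for n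
    using that ann [of "E n"] ann [of "F n"] ann [of "H n"] by simp_all
  have "sug_term \<phi> ?w j = (if j = 0 then 2 * \<phi> (F 0 \<bullet> E 0 \<bullet> ?w) + \<phi> (H 0 \<bullet> H 0 \<bullet> ?w) / 2 else 0)" for j
  proof (cases j "0::int" rule: linorder_cases)
    case less
    then show ?thesis using perpD(3) [OF \<phi> push_I [OF z(2)]] perpD(3) [OF \<phi> push_I [OF z(3)]] by (simp add: sug_term_def del: push_single)
  next
    case greater
    then show ?thesis using perpD(3) [OF \<phi> push_I [OF z(1)]] perpD(3) [OF \<phi> push_I [OF z(3)]] by (simp add: sug_term_def del: push_single)
  qed (simp add: sug_term_def)
  then have "sug \<phi> ?w = 2 * \<phi> (F 0 \<bullet> E 0 \<bullet> ?w) + \<phi> (H 0 \<bullet> H 0 \<bullet> ?w) / 2 + \<phi> (H 0 \<bullet> ?w)"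
    by (simp add: sug_def del: push_single)
  then have "sug \<phi> ?w = \<phi> (F 0 \<bullet> E 0 \<bullet> ?w) + \<phi> (E 0 \<bullet> F 0 \<bullet> ?w) + \<phi> (H 0 \<bullet> H 0 \<bullet> ?w) / 2"
    using phi_FE [OF \<phi>, of 0 0 ?w] by (simp del: push_single)
  then show ?case unfolding phi_casimir [OF \<phi>] by (simp add: wdeg_def)
next
  case (Cons x u)
  show ?case
    using sug_act [OF Cons.prems, of x "single u 1"] Cons.IH [OF perp_push [OF Cons.prems, of x]]
    by (simp add: wdeg_def algebra_simps)
qed

definition sug_trunc :: "nat \<Rightarrow> (affine_sl2 list \<Rightarrow>\<^sub>0 complex) \<Rightarrow> (affine_sl2 list \<Rightarrow>\<^sub>0 complex)" where
  "sug_trunc N y = (\<Sum>j\<in>{- int N..int N}. fscale 2 (if j < 0 then E j \<bullet> F (- j) \<bullet> y else F (- j) \<bullet> E j \<bullet> y)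
      + fscale (1 / 2) (if j < 0 then H j \<bullet> H (- j) \<bullet> y else H (- j) \<bullet> H j \<bullet> y)) + H 0 \<bullet> y"

lemma lin_sug_trunc: "lin fscale fscale (sug_trunc N)"
proof -
  have add: "(if b then x + y else x' + y') = (if b then x else x') + (if b then y else y')" for b and x x' y y' :: "affine_sl2 list \<Rightarrow>\<^sub>0 complex"
    by simp
  have sc: "(if b then fscale c x else fscale c x') = fscale c (if b then x else x')" for b c and x x' :: "affine_sl2 list \<Rightarrow>\<^sub>0 complex"
    by simp
  show ?thesis
  proof (unfold_locales)
    show "sug_trunc N (x + y) = sug_trunc N x + sug_trunc N y" for x y
      unfolding sug_trunc_def push_add add free.scale_right_distrib sum.distrib by (simp add: add_ac)
    show "sug_trunc N (fscale c y) = fscale c (sug_trunc N y)" for c y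
      unfolding sug_trunc_def push_fscale sc free.scale_right_distrib free.scale_sum_right free.scale_left_commute [of c] ..
  qed
qed

lemma sug_trunc_ideal: "lideal J \<Longrightarrow> y \<in> J \<Longrightarrow> sug_trunc N y \<in> J"
  unfolding sug_trunc_def
  by (rule free_subspaceD(2) [OF lidealD(1)], assumption, rule free_subspaceD(6) [OF lidealD(1)], assumption,
      rule free_subspaceD(2) [OF lidealD(1)], assumption) (auto intro!: free_subspaceD(4) [OF lidealD(1)] lidealD(2))

lemma phi_sug_trunc:
  assumes \<phi>: "perp \<phi>" and N: "\<And>n. n > int N \<Longrightarrow> E n \<bullet> y \<in> I \<and> F n \<bullet> y \<in> I \<and> H n \<bullet> y \<in> I"
  shows "\<phi> (sug_trunc N y) = sug \<phi> y"
proof -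
  have sum: "\<phi> (sum f A) = (\<Sum>i\<in>A. \<phi> (f i))" if "finite A" for f and A :: "int set"
    using that by (induction A) (simp_all add: perpD [OF \<phi>])
  have "Sum_any (sug_term \<phi> y) = (\<Sum>j\<in>{- int N..int N}. sug_term \<phi> y j)"
    by (rule Sum_any.expand_superset [OF finite_atLeastAtMost_int sug_term_support [OF \<phi> N]])
  then show ?thesis
    unfolding sug_def sug_trunc_def perpD(1) [OF \<phi>] sum [OF finite_atLeastAtMost_int] perpD(2) [OF \<phi>]
    by (auto intro!: sum.cong simp: sug_term_def)
qed

text \<open>e(0) h(0) = (h(0) - 2) e(0), and e(0) is lambda on the generator.\<close>

lemma phi_E0_poly: "perp \<phi> \<Longrightarrow> \<phi> (E 0 \<bullet> H0_poly q) = lam * \<phi> (H0_poly (pcompose q [:- 2, 1:]))"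
proof (induction q arbitrary: \<phi>)
  case 0
  then show ?case by (simp add: perpD(6))
next
  case (pCons c q)
  note \<phi> = pCons.prems
  have c: "single [] c = fscale c (single [] 1)" by simp
  have "\<phi> (E 0 \<bullet> H 0 \<bullet> H0_poly q) = \<phi> (H 0 \<bullet> E 0 \<bullet> H0_poly q) - 2 * \<phi> (E 0 \<bullet> H0_poly q)"
    using phi_HE [OF \<phi>, of 0 0] by simp
  also have "\<phi> (H 0 \<bullet> E 0 \<bullet> H0_poly q) = lam * \<phi> (H 0 \<bullet> H0_poly (pcompose q [:- 2, 1:]))"
    by (rule pCons.IH [OF perp_push [OF \<phi>]])
  finally have 1: "\<phi> (E 0 \<bullet> H 0 \<bullet> H0_poly q) = lam * \<phi> (H 0 \<bullet> H0_poly (pcompose q [:- 2, 1:])) - 2 * (lam * \<phi> (H0_poly (pcompose q [:- 2, 1:])))"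
    unfolding pCons.IH [OF \<phi>] .
  have 2: "pcompose (pCons c q) [:- 2, 1:] = pCons c (pcompose q [:- 2, 1:]) + Polynomial.smult (- 2) (pcompose q [:- 2, 1:])"
    by (simp add: pcompose_pCons algebra_simps)
  show ?case
    unfolding 2 H0_poly_add H0_poly_smult H0_poly_pCons push_add c push_fscale perpD(1,2) [OF \<phi>] 1
    using phi_E0_1 [OF \<phi>] by (simp add: algebra_simps)
qed

text \<open>On the generator w the Casimir relation reads 2 lam f(0) w = (2 (k + 2) a - h(0) -
  h(0)^2/2) w, which is the polynomial \<open>?qf\<close>. Fixing the Sugawara eigenvalue thus
  closes the polynomials in h(0) under f(0).\<close>

lemma phi_F0_poly: "\<exists>q'. \<forall>\<phi>. perp \<phi> \<longrightarrow> \<phi> (F 0 \<bullet> H0_poly q) = \<phi> (H0_poly q')"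
proof -
  let ?w = "single [] 1" and ?qf = "Polynomial.smult (1 / (2 * lam)) [:2 * (k + 2) * a, - 1, - 1 / 2:]"
  have base: "\<phi> (F 0 \<bullet> ?w) = \<phi> (H0_poly ?qf)" if \<phi>: "perp \<phi>" for \<phi>
  proof -
    have c: "single [] c = fscale c ?w" for c by simp
    have "\<phi> (F 0 \<bullet> E 0 \<bullet> ?w) = lam * \<phi> (F 0 \<bullet> ?w)" using phi_E0_1 [OF perp_push [OF \<phi>, of "F 0"]] by simp
    then have "2 * lam * \<phi> (F 0 \<bullet> ?w) = 2 * (k + 2) * a * \<phi> ?w - \<phi> (H 0 \<bullet> ?w) - \<phi> (H 0 \<bullet> H 0 \<bullet> ?w) / 2"
      using phi_casimir [OF \<phi>] phi_FE [OF \<phi>, of 0 0 ?w] by (simp del: push_single add: algebra_simps)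
    also have "\<dots> = \<phi> (H0_poly [:2 * (k + 2) * a, - 1, - 1 / 2:])"
      unfolding H0_poly_pCons c [of "2 * (k + 2) * a"] c [of "- 1"] c [of "- 1 / 2"] push_add push_fscale perpD(1,2) [OF \<phi>] H0_poly_0 push_zero perpD(6) [OF \<phi>]
      by (simp del: push_single)
    finally show ?thesis unfolding H0_poly_smult perpD(2) [OF \<phi>] using lam by (simp del: push_single add: field_simps)
  qed
  show ?thesis
  proof (induction q)
    case 0
    show ?case by (rule exI [of _ 0]) simp
  next
    case (pCons c q)
    then obtain q' where q': "\<And>\<phi>. perp \<phi> \<Longrightarrow> \<phi> (F 0 \<bullet> H0_poly q) = \<phi> (H0_poly q')" by blast
    have "\<phi> (F 0 \<bullet> H0_poly (pCons c q)) = \<phi> (H0_poly (Polynomial.smult c ?qf + pCons 0 q' + Polynomial.smult 2 q'))" if \<phi>: "perp \<phi>" for \<phi>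
    proof -
      have c: "single [] c = fscale c ?w" by simp
      have "\<phi> (F 0 \<bullet> H 0 \<bullet> H0_poly q) = \<phi> (H 0 \<bullet> F 0 \<bullet> H0_poly q) + 2 * \<phi> (F 0 \<bullet> H0_poly q)"
        using phi_HF [OF \<phi>, of 0 0] by simp
      then have 1: "\<phi> (F 0 \<bullet> H 0 \<bullet> H0_poly q) = \<phi> (H 0 \<bullet> H0_poly q') + 2 * \<phi> (H0_poly q')"
        using q' [OF \<phi>] q' [OF perp_push [OF \<phi>, of "H 0"]] by simp
      have 2: "\<phi> (F 0 \<bullet> H0_poly (pCons c q)) = c * \<phi> (H0_poly ?qf) + (\<phi> (H 0 \<bullet> H0_poly q') + 2 * \<phi> (H0_poly q'))"
        unfolding H0_poly_pCons [of c q] push_add c push_fscale perpD(1,2) [OF \<phi>] base [OF \<phi>] 1 ..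
      have 3: "H0_poly (Polynomial.smult c ?qf + pCons 0 q' + Polynomial.smult 2 q') = fscale c (H0_poly ?qf) + H 0 \<bullet> H0_poly q' + fscale 2 (H0_poly q')"
        unfolding H0_poly_add H0_poly_smult [of c] H0_poly_smult [of 2] H0_poly_pCons [of 0] by simp
      show ?thesis unfolding 2 3 perpD(1,2) [OF \<phi>] by simp
    qed
    then show ?case by blast
  qed
qed

text \<open>The bracket of x with h(0) is a multiple of x, so annihilation of the generator carries
  over to all polynomials in h(0) applied to it.\<close>

lemma phi_lower_poly: "affine_degree x < 0 \<Longrightarrow> perp \<phi> \<Longrightarrow> \<phi> (x \<bullet> H0_poly q) = 0"
proof (induction q arbitrary: \<phi>)
  case 0
  then show ?case by (simp add: perpD(6))
next
  case (pCons c q)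
  note \<phi> = pCons.prems(2)
  have c: "single [] c = fscale c (single [] 1)" by simp
  have 1: "\<phi> (x \<bullet> single [] 1) = 0" using perpD(3) [OF \<phi> ann [OF pCons.prems(1)]] by simp
  have "\<phi> (x \<bullet> H 0 \<bullet> H0_poly q) = \<phi> (H 0 \<bullet> x \<bullet> H0_poly q) + \<phi> (bract (affine_bracket x (H 0)) (H0_poly q))"
    by (rule phi_bracket [OF \<phi>])
  also have "\<dots> = 0"
    using pCons.IH [OF pCons.prems(1) perp_push [OF \<phi>, of "H 0"]] pCons.IH [OF pCons.prems(1) \<phi>] pCons.prems(1)
    by (cases x) (simp_all add: perpD [OF \<phi>])
  finally show ?case
    unfolding H0_poly_pCons push_add c push_fscale perpD(1,2) [OF \<phi>] 1 by simp
qed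

lemma top_closed:
  assumes "affine_degree x \<le> 0"
  shows "\<exists>q'. x \<bullet> H0_poly q - H0_poly q' \<in> I"
proof -
  have mem: "y - y' \<in> I" if "\<And>\<phi>. perp \<phi> \<Longrightarrow> \<phi> y = \<phi> y'" for y y'
    by (rule perp_separates) (simp add: that perpD(4))
  consider "affine_degree x < 0" | "x = E 0" | "x = F 0" | "x = H 0" | "x = K"
    using assms by (cases x) force+
  then show ?thesis
  proof cases
    case 1
    have "x \<bullet> H0_poly q - H0_poly 0 \<in> I" by (rule mem) (simp add: phi_lower_poly [OF 1] perpD(6))
    then show ?thesis by blast
  next
    case 2
    have "x \<bullet> H0_poly q - H0_poly (Polynomial.smult lam (pcompose q [:- 2, 1:])) \<in> I"
      by (rule mem) (simp add: 2 phi_E0_poly H0_poly_smult perpD(2))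
    then show ?thesis by blast
  next
    case 3
    obtain q' where "\<And>\<phi>. perp \<phi> \<Longrightarrow> \<phi> (F 0 \<bullet> H0_poly q) = \<phi> (H0_poly q')" using phi_F0_poly by blast
    then have "x \<bullet> H0_poly q - H0_poly q' \<in> I" by (intro mem) (simp add: 3)
    then show ?thesis by blast
  next
    case 4
    have "x \<bullet> H0_poly q - H0_poly (pCons 0 q) \<in> I" by (rule mem) (simp add: 4 H0_poly_pCons)
    then show ?thesis by blast
  next
    case 5
    have "x \<bullet> H0_poly q - H0_poly (Polynomial.smult k q) \<in> I" by (rule mem) (simp add: 5 H0_poly_smult phi_K perpD(2))
    then show ?thesis by blast
  qed
qed

lemma top_simple:
  assumes J: "lideal J" "I \<subseteq> J"
  shows "q \<noteq> 0 \<Longrightarrow> H0_poly q \<in> J \<Longrightarrow> single [] 1 \<in> J"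
proof (induction "degree q" arbitrary: q rule: less_induct)
  case less
  note subJ = free_subspaceD [OF lidealD(1) [OF J(1)]]
  show ?case
  proof (cases "degree q = 0")
    case True
    then obtain c where c: "q = [:c:]" by (metis degree_eq_zeroE)
    then have "c \<noteq> 0" using less.prems by simp
    have "single [] c \<in> J" using less.prems(2) by (simp add: c H0_poly_pCons)
    from subJ(4) [OF this, of "1 / c"] show ?thesis using \<open>c \<noteq> 0\<close> by simp
  next
    case False
    let ?q' = "pcompose q [:- 2, 1:]"
    have nz: "?q' - q \<noteq> 0"
    proof
      assume "?q' - q = 0"
      then have "q = [:poly q 0:]" by (intro poly_periodic_const) simp
      then have "degree q = 0" by (metis degree_pCons_0)
      with False show False ..
    qed
    have "E 0 \<bullet> H0_poly q - fscale lam (H0_poly ?q') \<in> I"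
      by (rule perp_separates) (simp add: phi_E0_poly perpD(2,4))
    then have 1: "E 0 \<bullet> H0_poly q - fscale lam (H0_poly ?q') \<in> J" using J(2) by blast
    have 2: "E 0 \<bullet> H0_poly q - fscale lam (H0_poly q) \<in> J"
      by (rule subJ(3) [OF lidealD(2) [OF J(1) less.prems(2)] subJ(4) [OF less.prems(2)]])
    have "E 0 \<bullet> H0_poly q - fscale lam (H0_poly q) - (E 0 \<bullet> H0_poly q - fscale lam (H0_poly ?q')) \<in> J"
      by (rule subJ(3) [OF 2 1])
    then have "fscale lam (H0_poly (?q' - q)) \<in> J"
      by (simp add: H0_poly_diff free.scale_right_diff_distrib)
    from subJ(4) [OF this, of "1 / lam"] have "H0_poly (?q' - q) \<in> J" using lam by simp
    moreover have "degree (?q' - q) < degree q" by (rule degree_shift_diff) (use False in simp)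
    ultimately show ?thesis using less.hyps nz by blast
  qed
qed

text \<open>The factor 2 (k + 2) is the normalisation of \<open>sug\<close>; it is invertible away
  from the critical level.\<close>

lemma graded_cyclic_affine:
  assumes "single [] 1 \<notin> I"
  shows "graded_cyclic affine_bracket affine_degree I a (2 * (k + 2)) (range H0_poly)"
proof
  show "lideal I" "enveloping_relations affine_bracket \<subseteq> I" "single [] 1 \<notin> I" by (rule lideal enveloping assms)+
  have "k + 2 \<noteq> 0" using level by (simp add: eq_neg_iff_add_eq_0)
  then show "2 * (k + 2) \<noteq> 0" by (metis mult_eq_0_iff zero_neq_numeral)
  show "\<exists>T. lin fscale fscale T \<and> (\<forall>J. lideal J \<longrightarrow> T ` J \<subseteq> J) \<and>
      (\<forall>u\<in>U. T (single u 1) - fscale (2 * (k + 2) * (a + of_int (wdeg affine_degree u))) (single u 1) \<in> I)"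
    if U: "finite U" for U
  proof -
    have "\<exists>N. \<forall>u. \<forall>n>int (N u). E n \<bullet> single u 1 \<in> I \<and> F n \<bullet> single u 1 \<in> I \<and> H n \<bullet> single u 1 \<in> I"
      by (intro choice allI smooth_I)
    then obtain N where N: "\<And>u n. n > int (N u) \<Longrightarrow> E n \<bullet> single u 1 \<in> I \<and> F n \<bullet> single u 1 \<in> I \<and> H n \<bullet> single u 1 \<in> I"
      by blast
    \<comment> \<open>A common truncation bound for the finitely many words in
      \<open>U\<close>.\<close>
    define B where "B = (\<Sum>u\<in>U. N u)"
    have "sug_trunc B (single u 1) - fscale (2 * (k + 2) * (a + of_int (wdeg affine_degree u))) (single u 1) \<in> I" if "u \<in> U" for u
    proof (rule perp_separates)
      fix \<phi> assume \<phi>: "perp \<phi>"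
      have "N u \<le> B" unfolding B_def using U that by (intro member_le_sum) auto
      then have "\<phi> (sug_trunc B (single u 1)) = sug \<phi> (single u 1)"
        by (intro phi_sug_trunc [OF \<phi>] N) linarith
      then show "\<phi> (sug_trunc B (single u 1) - fscale (2 * (k + 2) * (a + of_int (wdeg affine_degree u))) (single u 1)) = 0"
        unfolding perpD(2,4) [OF \<phi>] sug_word [OF \<phi>] by simp
    qed
    then show ?thesis using lin_sug_trunc sug_trunc_ideal by blast
  qed
  show "free.subspace (range H0_poly)"
    unfolding free.subspace_def
  proof (intro conjI ballI allI)
    show "0 \<in> range H0_poly" by (rule range_eqI [where x = 0]) simp
    show "x + y \<in> range H0_poly" if "x \<in> range H0_poly" "y \<in> range H0_poly" for x y
      using that by (auto simp flip: H0_poly_add)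
    show "fscale c x \<in> range H0_poly" if "x \<in> range H0_poly" for c x
      using that by (auto simp flip: H0_poly_smult)
  qed
  have "H0_poly 1 = single [] 1" by (simp add: one_pCons H0_poly_pCons)
  then show "single [] 1 \<in> range H0_poly" by (metis rangeI)
  show "wdeg affine_degree u = 0" if p: "p \<in> range H0_poly" and u: "u \<in> keys p" for p u
  proof -
    have "u = replicate (length u) (H 0)" using p u by (auto simp: in_keys_iff lookup_H0_poly split: if_splits)
    then have "wdeg affine_degree u = sum_list (replicate (length u) (affine_degree (H 0)))" by (metis map_replicate wdeg_def)
    then show ?thesis by (simp add: sum_list_replicate)
  qed
  show "\<exists>p'\<in>range H0_poly. push ((#) x) p - p' \<in> I" if "p \<in> range H0_poly" "affine_degree x \<le> 0" for p x
    using that top_closed by blast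
  show "single [] 1 \<in> J" if J: "lideal J" "I \<subseteq> J" and p: "p \<in> range H0_poly" "p \<in> J" "p \<notin> I" for J p
  proof -
    obtain q where q: "p = H0_poly q" using p(1) by blast
    then have "q \<noteq> 0" using p(3) sub(1) by auto
    then show ?thesis using top_simple [OF J] p(2) q by blast
  qed
qed

end

section \<open>The Whittaker module\<close>

text \<open>At index 1 the summands are X(-1 - i) Y(1 + i) and Y(-i) X(i). Only Y(0) X(0) is left on
  w, with the sign -(-1)^(-1) = 1.\<close>

lemma (in lie_module) nth_product_normal:
  assumes w: "w \<in> carrier M"
    and X: "\<And>n. n \<ge> 1 \<Longrightarrow> act M (X n) w = \<zero>\<^bsub>M\<^esub>" and Y: "\<And>n. n \<ge> 1 \<Longrightarrow> act M (Y n) w = \<zero>\<^bsub>M\<^esub>"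
  shows "nth_product M (- 1) (\<lambda>n. act M (X n)) (\<lambda>n. act M (Y n)) 1 w = act M (Y 0) (act M (X 0) w)"
proof -
  define t where "t i = ((- 1) ^ i * (of_int (- 1) gchoose i)) \<odot>\<^bsub>M\<^esub> (act M (X (- 1 - int i)) (act M (Y (1 + int i)) w)
      \<ominus>\<^bsub>M\<^esub> ((- 1) powi (- 1)) \<odot>\<^bsub>M\<^esub> act M (Y (- 1 + 1 - int i)) (act M (X (int i)) w))" for i
  let ?v = "act M (Y 0) (act M (X 0) w)"
  have v: "?v \<in> carrier M" by (intro act_closed w)
  have neg0: "\<ominus>\<^bsub>M\<^esub> \<zero>\<^bsub>M\<^esub> = \<zero>\<^bsub>M\<^esub>" by (rule minus_equality) simp_all
  have neg: "\<zero>\<^bsub>M\<^esub> \<ominus>\<^bsub>M\<^esub> (- 1) \<odot>\<^bsub>M\<^esub> v = v" if "v \<in> carrier M" for v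
  proof -
    have "v \<oplus>\<^bsub>M\<^esub> (- 1) \<odot>\<^bsub>M\<^esub> v = \<zero>\<^bsub>M\<^esub>" using smult_distribs(1) [of v 1 "- 1"] that by (simp add: smult_distribs)
    then have "\<ominus>\<^bsub>M\<^esub> ((- 1) \<odot>\<^bsub>M\<^esub> v) = v" using that by (intro minus_equality) simp_all
    then show ?thesis using that by (simp add: a_minus_def)
  qed
  have t: "t i = (if i = 0 then ?v else \<zero>\<^bsub>M\<^esub>)" for i
  proof (cases "i = 0")
    case True
    then show ?thesis using Y [of 1] v by (simp add: t_def neg smult_distribs)
  next
    case False
    then show ?thesis using X [of "int i"] Y [of "1 + int i"] by (simp add: t_def a_minus_def smult_distribs neg0)
  qed
  have "nth_product M (- 1) (\<lambda>n. act M (X n)) (\<lambda>n. act M (Y n)) 1 w = (\<Oplus>\<^bsub>M\<^esub>i\<in>{i. t i \<noteq> \<zero>\<^bsub>M\<^esub>}. t i)"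
    by (simp only: nth_product_def Let_def t_def)
  also have "\<dots> = (\<Oplus>\<^bsub>M\<^esub>i\<in>{0}. t i)"
    by (rule add.finprod_mono_neutral_cong_left) (use v in \<open>auto simp: t\<close>)
  also have "\<dots> = ?v" using v by (simp add: t)
  finally show ?thesis .
qed

text \<open>L_sug(0) is the mode of index 1, so \<open>nth_product_normal\<close> applies to each of
  its three products once h(n) w = 0 for n >= 1 has been derived from [e(n - 1), f(1)].\<close>

lemma L_sug_whittaker:
  assumes "lie_module affine_bracket M" and w: "w \<in> carrier M"
    and E: "\<And>n. n \<ge> 0 \<Longrightarrow> act M (E n) w = (if n = 0 then lam else 0) \<odot>\<^bsub>M\<^esub> w"
    and F: "\<And>n. n \<ge> 1 \<Longrightarrow> act M (F n) w = \<zero>\<^bsub>M\<^esub>"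
  shows "L_sug k M 0 w = evalw M w (fscale (1 / (2 * (k + 2))) casimir)"
proof -
  interpret lie_module affine_bracket M by fact
  have E1: "act M (E n) w = \<zero>\<^bsub>M\<^esub>" if "n \<ge> 1" for n
    using E [of n] that w by (simp add: smult_distribs)
  have H1: "act M (H n) w = \<zero>\<^bsub>M\<^esub>" if n: "n \<ge> 1" for n
  proof -
    have "act M (F 1) (act M (E (n - 1)) w) = \<zero>\<^bsub>M\<^esub>"
      using E [of "n - 1"] F [of 1] n w by (simp add: act_smult smult_distribs)
    then have "act M (E (n - 1)) (act M (F 1) w) \<ominus>\<^bsub>M\<^esub> act M (F 1) (act M (E (n - 1)) w) = \<zero>\<^bsub>M\<^esub>"
      using F [of 1] by (simp add: a_minus_def)
    moreover have "affine_bracket (E (n - 1)) (F 1) = single (H n) 1" using n by simp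
    ultimately show ?thesis
      using act_bracket [OF w, of "E (n - 1)" "F 1"] act_closed [OF w] by (simp add: smult_distribs)
  qed
  show ?thesis
    unfolding L_sug_def sugawara_field_def Let_def field_add_def field_scale_def
    using nth_product_normal [OF w, of E F] nth_product_normal [OF w, of F E] nth_product_normal [OF w, of H H] E1 F H1 act_closed w
    by (simp add: casimir_def evalw_fscale evalw_add evalw_single smult_distribs a_comm)
qed

lemma (in presented) evalw_q:
  assumes "lie_module br M"
  shows "evalw M (q (single [] 1)) y = q y"
proof -
  interpret L: lie_module br M by fact
  have word: "foldr (act M) u (q (single [] 1)) = q (single u 1)" for u
    by (induction u) (simp_all flip: q_act)
  show ?thesis
  proof (induction y rule: poly_mapping_single_induct)
    case zero
    then show ?case by (simp add: L.evalw_zero q_0)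
  next
    case (single u a)
    then show ?case by (simp add: L.evalw_single word flip: q_scale)
  next
    case (add x y)
    then show ?case by (simp add: L.evalw_add q_add)
  qed
qed

lemma lgen_lgen: "lgen (lgen S \<union> S') = lgen (S \<union> S')"
proof (rule antisym)
  have "S \<subseteq> lgen (S \<union> S')" "S' \<subseteq> lgen (S \<union> S')" using lgen_superset [of "S \<union> S'"] by simp_all
  then show "lgen (lgen S \<union> S') \<subseteq> lgen (S \<union> S')"
    by (intro lgen_minimal lideal_lgen Un_least)
  have *: "lgen S \<subseteq> lgen (lgen S \<union> S')" "S' \<subseteq> lgen (lgen S \<union> S')"
    using lgen_superset [of "lgen S \<union> S'"] by simp_all
  have "S \<subseteq> lgen (lgen S \<union> S')" by (rule subset_trans [OF lgen_superset *(1)])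
  note * = this *(2)
  then show "lgen (S \<union> S') \<subseteq> lgen (lgen S \<union> S')" by (intro lgen_minimal lideal_lgen Un_least *)
qed

definition sugawara_relation :: "complex \<Rightarrow> complex \<Rightarrow> (affine_sl2 list \<Rightarrow>\<^sub>0 complex)" where
  "sugawara_relation k a = fscale (1 / (2 * (k + 2))) casimir - single [] a"

definition whittaker_ideal :: "complex \<Rightarrow> complex \<Rightarrow> complex \<Rightarrow> (affine_sl2 list \<Rightarrow>\<^sub>0 complex) set" where
  "whittaker_ideal lam k a = lgen (enveloping_relations affine_bracket \<union> (whittaker_relations lam 0 k \<union> {sugawara_relation k a}))"

text \<open>The quotient of a quotient is flattened into one left ideal. This is possible because
  L_sug(0) acts on the generator as a finite element, a multiple of \<open>casimir\<close>.\<close>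

lemma whittaker_M_presented: "\<exists>q. presented (whittaker_M lam k a) q \<and> presented.ker (whittaker_M lam k a) q = whittaker_ideal lam k a"
proof -
  let ?W = "universal_whittaker lam 0 k" and ?S = "whittaker_relations lam 0 k"
  define q where "q y = cyclic_null affine_bracket ?S +>\<^bsub>tensor_algebra\<^esub> y" for y
  have W: "presented ?W q" and ker: "presented.ker ?W q = lgen (enveloping_relations affine_bracket \<union> ?S)"
    using presented_universal_cyclic [of affine_bracket ?S] by (simp_all add: universal_whittaker_def q_def [abs_def])
  interpret W: presented ?W q by (rule W)
  have sup: "enveloping_relations affine_bracket \<subseteq> W.ker" "?S \<subseteq> W.ker"
    unfolding ker using lgen_superset [of "enveloping_relations affine_bracket \<union> ?S"] by simp_all
  have lie: "lie_module affine_bracket ?W" by (rule W.lie_module [OF sup(1)])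
  interpret L: lie_module affine_bracket ?W by (rule lie)
  let ?w = "q (single [] 1)"
  have w: "whittaker_vector lam 0 k = ?w" by (simp add: whittaker_vector_def cyclic_vector_def q_def)
  have rel: "act ?W x ?w = s \<odot>\<^bsub>?W\<^esub> ?w" if "eigen_relation x s \<in> ?S" for x s
    using that sup(2) L.evalw_eigen_relation [of ?w x s] W.evalw_q [OF lie] by (auto simp: W.ker_def)
  have E: "act ?W (E n) ?w = (if n = 0 then lam else 0) \<odot>\<^bsub>?W\<^esub> ?w" if "n \<ge> 0" for n
    by (rule rel) (use that in \<open>auto simp: whittaker_relations_def\<close>)
  have F: "act ?W (F n) ?w = \<zero>\<^bsub>?W\<^esub>" if "n \<ge> 1" for n
  proof -
    have "act ?W (F n) ?w = 0 \<odot>\<^bsub>?W\<^esub> ?w"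
      by (rule rel) (use that in \<open>auto simp: whittaker_relations_def\<close>)
    then show ?thesis by (simp add: L.smult_distribs)
  qed
  have L_sug: "L_sug k ?W 0 ?w = evalw ?W ?w (fscale (1 / (2 * (k + 2))) casimir)"
    by (rule L_sug_whittaker [OF lie W.q_closed E F])
  have "a \<odot>\<^bsub>?W\<^esub> ?w = q (single [] a)" by (simp flip: W.q_scale)
  then have "L_sug k ?W 0 ?w \<ominus>\<^bsub>?W\<^esub> a \<odot>\<^bsub>?W\<^esub> ?w = q (sugawara_relation k a)"
    unfolding L_sug W.evalw_q [OF lie] sugawara_relation_def W.q_diff by simp
  then have M: "whittaker_M lam k a = quot_rep ?W (gen_subrep ?W (q ` {sugawara_relation k a}))"
    by (simp add: whittaker_M_def Let_def w)
  have sub: "subrep (gen_subrep ?W (q ` {sugawara_relation k a})) ?W" by (rule W.subrep_gen) auto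
  have "{y. q y \<in> gen_subrep ?W (q ` {sugawara_relation k a})} = whittaker_ideal lam k a"
    unfolding W.gen_subrep_preimage ker lgen_lgen by (simp add: whittaker_ideal_def Un_assoc)
  then show ?thesis
    unfolding M using W.presented_quot [OF sub] W.ker_quot [OF sub] by blast
qed

lemma affine_ideal_whittaker:
  assumes "k \<noteq> - 2" "lam \<noteq> 0"
  shows "affine_ideal lam k a (whittaker_ideal lam k a)"
proof
  let ?I = "whittaker_ideal lam k a"
  show "k \<noteq> - 2" "lam \<noteq> 0" by (rule assms)+
  show I: "lideal ?I" unfolding whittaker_ideal_def by (rule lideal_lgen)
  have sup: "enveloping_relations affine_bracket \<subseteq> ?I" "whittaker_relations lam 0 k \<subseteq> ?I" "sugawara_relation k a \<in> ?I"
    using lgen_superset [of "enveloping_relations affine_bracket \<union> (whittaker_relations lam 0 k \<union> {sugawara_relation k a})"]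
    by (simp_all add: whittaker_ideal_def)
  show "enveloping_relations affine_bracket \<subseteq> ?I" by (rule sup)
  show "single [E n] 1 - single [] (if n = 0 then lam else 0) \<in> ?I" if "n \<ge> 0" for n
    by (rule sup(2) [THEN subsetD]) (use that in \<open>auto simp: whittaker_relations_def eigen_relation_def\<close>)
  show "single [F n] 1 \<in> ?I" if "n \<ge> 1" for n
  proof -
    have "eigen_relation (F n) (if n = 1 then 0 else 0) \<in> ?I"
      by (rule sup(2) [THEN subsetD]) (use that in \<open>auto simp: whittaker_relations_def\<close>)
    then show ?thesis by (simp add: eigen_relation_def)
  qed
  show "single [K] 1 - single [] k \<in> ?I"
    by (rule sup(2) [THEN subsetD]) (auto simp: whittaker_relations_def eigen_relation_def)
  have "k + 2 \<noteq> 0" using assms(1) by (simp add: eq_neg_iff_add_eq_0)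
  then have c: "2 * (k + 2) \<noteq> 0" by (metis mult_eq_0_iff zero_neq_numeral)
  have "fscale (2 * (k + 2)) (sugawara_relation k a) \<in> ?I"
    by (rule free_subspaceD(4) [OF lidealD(1) [OF I] sup(3)])
  moreover have "fscale (2 * (k + 2)) (sugawara_relation k a) = casimir - single [] (2 * (k + 2) * a)"
    unfolding sugawara_relation_def free.scale_right_diff_distrib free.scale_scale using c by simp
  ultimately show "casimir - single [] (2 * (k + 2) * a) \<in> ?I" by simp
qed

lemma (in presented) ker_maximal:
  assumes simple: "\<And>N. subrep N M \<Longrightarrow> N \<noteq> {\<zero>\<^bsub>M\<^esub>} \<Longrightarrow> N = carrier M"
    and J: "lideal J" "ker \<subseteq> J"
  shows "J = ker \<or> J = UNIV"
proof (cases "q ` J = {\<zero>\<^bsub>M\<^esub>}")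
  case True
  then have "J \<subseteq> ker" by (auto simp: ker_def)
  then show ?thesis using J(2) by blast
next
  case False
  then have "q ` J = carrier M" using simple [OF subrep_image [OF J(1)]] by blast
  then show ?thesis using mem_image_iff [OF J] q_closed by blast
qed

theorem theorem8p1:
  fixes k h lam :: complex
  assumes "k \<noteq> - 2" and "lam \<noteq> 0"
  shows "lie_isomorphic affine_bracket
           (whittaker_Wh lam k (h + k / 4))
           (affine_tensor k lam (virasoro_irreducible (d_level k) h))"
proof -
  let ?V = "virasoro_irreducible (d_level k) h"
  let ?M = "affine_tensor k lam ?V" and ?I = "whittaker_ideal lam k (h + k / 4)"
  obtain vh and q :: "(virasoro list \<Rightarrow>\<^sub>0 complex) \<Rightarrow> _" and sec where ffr: "free_field_realization lam k ?V h vh q sec"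
    using free_field_realization_exists [OF assms] by blast
  interpret R: free_field_realization lam k ?V h vh q sec by (rule ffr)
  interpret L: lie_module affine_bracket ?M by (rule R.lie_module_M)
  have wv: "R.wv \<in> carrier ?M" using R.wv_carrier by simp
  let ?ev = "evalw ?M R.wv"
  interpret P: presented ?M ?ev by (rule L.presented_evalw [OF wv R.simple_M R.wv_nonzero])
  have "?ev (sugawara_relation k (h + k / 4)) = \<zero>\<^bsub>?M\<^esub>"
  proof -
    have "k + 2 \<noteq> 0" using assms(1) by (simp add: eq_neg_iff_add_eq_0)
    then have "2 * (k + 2) \<noteq> 0" by (metis mult_eq_0_iff zero_neq_numeral)
    then have k: "1 / (2 * (k + 2)) * (2 * (k + 2) * x) = x" for x
      by (simp only: mult.assoc [symmetric] divide_self_if nonzero_divide_mult_cancel_right times_divide_eq_left if_False mult_1)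
    have "?ev casimir = (2 * (k + 2) * (h + k / 4)) \<odot>\<^bsub>?M\<^esub> R.wv"
      using R.casimir_wv wv by (simp add: casimir_def L.evalw_add [OF wv] L.evalw_single [OF wv] L.smult_distribs L.act_closed del: R.M_simps)
    then have "?ev (fscale (1 / (2 * (k + 2))) casimir) = (1 / (2 * (k + 2)) * (2 * (k + 2) * (h + k / 4))) \<odot>\<^bsub>?M\<^esub> R.wv"
      by (simp only: L.evalw_fscale [OF wv] L.smult_distribs(3) [OF wv])
    also have "1 / (2 * (k + 2)) * (2 * (k + 2) * (h + k / 4)) = h + k / 4" by (rule k)
    finally show ?thesis
      unfolding sugawara_relation_def L.evalw_diff [OF wv] L.evalw_Nil [OF wv]
      using L.smult_closed' [OF wv, of "h + k / 4"] by (simp only: a_minus_def L.r_neg)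
  qed
  moreover have "whittaker_relations lam 0 k \<subseteq> {y. ?ev y = \<zero>\<^bsub>?M\<^esub>}"
  proof -
    have "?ev (eigen_relation (F n) (if n = 1 then 0 else 0)) = \<zero>\<^bsub>?M\<^esub>" if "n \<ge> 1" for n
      unfolding L.evalw_eigen_relation [OF wv] R.act_F_wv [OF that] using L.smult_distribs(5) [OF wv] by simp
    moreover have "?ev (eigen_relation (E n) (if n = 0 then lam else 0)) = \<zero>\<^bsub>?M\<^esub>" if "n \<ge> 0" for n
      unfolding L.evalw_eigen_relation [OF wv] by (rule R.act_E_wv [OF that])
    moreover have "?ev (eigen_relation K k) = \<zero>\<^bsub>?M\<^esub>"
      unfolding L.evalw_eigen_relation [OF wv] by (rule R.act_K_wv)
    ultimately show ?thesis unfolding whittaker_relations_def by blast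
  qed
  ultimately have I: "?I \<subseteq> P.ker"
    unfolding whittaker_ideal_def P.ker_def by (intro L.lgen_evalw [OF wv]) auto
  \<comment> \<open>As \<open>?I\<close> lies in \<open>P.ker\<close>, this also shows that the
    abstract module is nonzero, which \<open>graded_cyclic\<close> requires.\<close>
  have nontrivial: "single [] 1 \<notin> P.ker"
    using R.wv_nonzero wv by (simp add: P.ker_def L.evalw_Nil [OF wv] L.smult_distribs del: R.M_simps)
  interpret A: affine_ideal lam k "h + k / 4" ?I by (rule affine_ideal_whittaker [OF assms])
  interpret G: graded_cyclic affine_bracket affine_degree ?I "h + k / 4" "2 * (k + 2)" "range H0_poly"
    using A.graded_cyclic_affine I nontrivial by blast
  have max: "G.maximal_ideal = P.ker"
    using nontrivial by (intro G.maximal_ideal_eq P.lideal_ker I P.ker_maximal R.simple_M) auto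
  obtain q' where "presented (whittaker_M lam k (h + k / 4)) q'" "presented.ker (whittaker_M lam k (h + k / 4)) q' = ?I"
    using whittaker_M_presented by blast
  then obtain q'' where q'': "presented (whittaker_Wh lam k (h + k / 4)) q''" "presented.ker (whittaker_Wh lam k (h + k / 4)) q'' = P.ker"
    using G.presented_simple_quotient unfolding whittaker_Wh_def max by blast
  show ?thesis
  proof (rule lie_isomorphicI [OF q''(1) P.presented_axioms q''(2)])
    show "enveloping_relations affine_bracket \<subseteq> presented.ker (whittaker_Wh lam k (h + k / 4)) q''"
      unfolding q''(2) using I A.enveloping by blast
  qed
qed

end
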